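(* Let $A$ be a split quasi-hereditary algebra over a commutative Noetherian ring $R$ with split heredity chain $0=J_{t+1}\subset J_t\subset\cdots\subset J_1=A$. If $\operatorname{gldim}A<+\infty$, then $\operatorname{gldim}R<+\infty$. Moreover, $R$ is a regular ring with finite Krull dimension.
   Context: $\operatorname{gldim}$ is the global dimension. A local commutative Noetherian ring is regular if it has finite global dimension; a commutative Noetherian ring $R$ is regular if $R_\mathfrak{p}$ is regular for every prime ideal $\mathfrak{p}$. **Split heredity chains.** Let $A$ be an $R$-algebra which is finitely generated and projective as an $R$-module. A two-sided ideal $J$ of $A$ is a split heredity ideal if: (i) $A/J$ is projective over $R$; (ii) $J$ is projective as a left $A$-module; (iii) $J^2=J$; (iv) the $R$-algebra $\operatorname{End}_A({}_AJ)^{op}$ is Morita equivalent to $R$. A chain of ideals $0=J_{t+1}\subset J_t\subset\cdots\subset J_1=A$ is a split heredity chain if $J_i/J_{i+1}$ is a split heredity ideal of $A/J_{i+1}$ for $1\leq i\leq t$; $A$ is split quasi-hereditary if it has a split heredity chain. *)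

theory Defs
  imports
    "HOL-Library.Extended_Nat"
    "HOL-Library.Equipollence"
    "HOL-Algebra.Algebra"
begin

text \<open>
  The library locale \<^locale>\<open>module\<close> is restricted to commutative rings of scalars.
  The fields \<^const>\<open>monoid.mult\<close> and \<^const>\<open>monoid.one\<close> of the record representing
  a module are ignored.
\<close>

locale left_module = A?: ring A + M?: abelian_group M
  for A :: "('a, 'x) ring_scheme" (structure) and M :: "('a, 'm) module" (structure) +
  assumes smult_closed:
      "\<lbrakk>a \<in> carrier A; x \<in> carrier M\<rbrakk> \<Longrightarrow> a \<odot>\<^bsub>M\<^esub> x \<in> carrier M"
    and smult_l_distr:
      "\<lbrakk>a \<in> carrier A; b \<in> carrier A; x \<in> carrier M\<rbrakk> \<Longrightarrow>
        (a \<oplus> b) \<odot>\<^bsub>M\<^esub> x = a \<odot>\<^bsub>M\<^esub> x \<oplus>\<^bsub>M\<^esub> b \<odot>\<^bsub>M\<^esub> x"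
    and smult_r_distr:
      "\<lbrakk>a \<in> carrier A; x \<in> carrier M; y \<in> carrier M\<rbrakk> \<Longrightarrow>
        a \<odot>\<^bsub>M\<^esub> (x \<oplus>\<^bsub>M\<^esub> y) = a \<odot>\<^bsub>M\<^esub> x \<oplus>\<^bsub>M\<^esub> a \<odot>\<^bsub>M\<^esub> y"
    and smult_assoc:
      "\<lbrakk>a \<in> carrier A; b \<in> carrier A; x \<in> carrier M\<rbrakk> \<Longrightarrow>
        (a \<otimes> b) \<odot>\<^bsub>M\<^esub> x = a \<odot>\<^bsub>M\<^esub> (b \<odot>\<^bsub>M\<^esub> x)"
    and smult_one:
      "x \<in> carrier M \<Longrightarrow> \<one> \<odot>\<^bsub>M\<^esub> x = x"

lemma left_module_iff_module:
  assumes "cring R"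
  shows "left_module R M \<longleftrightarrow> module R M"
  using assms
  by (auto simp: left_module_def left_module_axioms_def module_def module_axioms_def
      dest: cring.axioms(1))

text \<open>Homomorphisms are extensional, so that equality of homomorphisms is equality of functions.\<close>

definition mod_hom ::
    "('a, 'x) ring_scheme \<Rightarrow> ('a, 'm) module \<Rightarrow> ('a, 'n) module \<Rightarrow> ('m \<Rightarrow> 'n) set" where
  "mod_hom A M N = {f \<in> carrier M \<rightarrow>\<^sub>E carrier N.
     (\<forall>x\<in>carrier M. \<forall>y\<in>carrier M. f (x \<oplus>\<^bsub>M\<^esub> y) = f x \<oplus>\<^bsub>N\<^esub> f y) \<and>
     (\<forall>a\<in>carrier A. \<forall>x\<in>carrier M. f (a \<odot>\<^bsub>M\<^esub> x) = a \<odot>\<^bsub>N\<^esub> f x)}"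

definition mod_iso ::
    "('a, 'x) ring_scheme \<Rightarrow> ('a, 'm) module \<Rightarrow> ('a, 'n) module \<Rightarrow> ('m \<Rightarrow> 'n) set" where
  "mod_iso A M N = {f \<in> mod_hom A M N. bij_betw f (carrier M) (carrier N)}"

definition finitely_generated :: "('a, 'x) ring_scheme \<Rightarrow> ('a, 'm) module \<Rightarrow> bool" where
  "finitely_generated A M \<longleftrightarrow> left_module A M \<and>
     (\<exists>S. finite S \<and> S \<subseteq> carrier M \<and>
       carrier M = {finsum M (\<lambda>s. c s \<odot>\<^bsub>M\<^esub> s) S |c. c \<in> S \<rightarrow> carrier A})"


text \<open>
  A quantifier over all modules cannot range over all types. As with universe levels, notions that
  involve the whole module category take a type \<^typ>\<open>'m\<close> as a parameter and refer to the modules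
  whose carrier is a subset of that type. A type is large enough for a ring if it is infinite and
  the ring embeds into it. Every module embedding into such a type is a quotient of a free module
  that embeds into it as well, so no lifting problem and no projective resolution is lost.
\<close>

definition large_universe :: "'m itself \<Rightarrow> ('a, 'x) ring_scheme \<Rightarrow> bool" where
  "large_universe U A \<longleftrightarrow> infinite (UNIV :: 'm set) \<and> carrier A \<lesssim> (UNIV :: 'm set)"

definition projective_module ::
    "'m itself \<Rightarrow> ('a, 'x) ring_scheme \<Rightarrow> ('a, 'p) module \<Rightarrow> bool" where
  "projective_module U A P \<longleftrightarrow> left_module A P \<and>
     (\<forall>(M :: ('a, 'm) module) (N :: ('a, 'm) module) g f.
        left_module A M \<longrightarrow> left_module A N \<longrightarrow>
        g \<in> mod_hom A M N \<longrightarrow> g ` carrier M = carrier N \<longrightarrow> f \<in> mod_hom A P N \<longrightarrow>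
        (\<exists>h \<in> mod_hom A P M. \<forall>x\<in>carrier P. g (h x) = f x))"

definition projective_resolution ::
    "('a, 'x) ring_scheme \<Rightarrow> ('a, 'm) module \<Rightarrow> nat \<Rightarrow>
     (nat \<Rightarrow> ('a, 'm) module) \<Rightarrow> (nat \<Rightarrow> 'm \<Rightarrow> 'm) \<Rightarrow> bool" where
  "projective_resolution A M n P d \<longleftrightarrow>
     (\<forall>i. projective_module TYPE('m) A (P i)) \<and>
     (\<forall>i>n. carrier (P i) = {\<zero>\<^bsub>P i\<^esub>}) \<and>
     d 0 \<in> mod_hom A (P 0) M \<and> d 0 ` carrier (P 0) = carrier M \<and>
     d 1 ` carrier (P 1) = {x \<in> carrier (P 0). d 0 x = \<zero>\<^bsub>M\<^esub>} \<and>
     (\<forall>i. d (Suc i) \<in> mod_hom A (P (Suc i)) (P i)) \<and>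
     (\<forall>i. d (Suc (Suc i)) ` carrier (P (Suc (Suc i))) =
        {x \<in> carrier (P (Suc i)). d (Suc i) x = \<zero>\<^bsub>P i\<^esub>})"

definition projdim :: "('a, 'x) ring_scheme \<Rightarrow> ('a, 'm) module \<Rightarrow> enat" where
  "projdim A M = Inf {enat n |n. \<exists>P d. projective_resolution A M n P d}"

definition gldim :: "'m itself \<Rightarrow> ('a, 'x) ring_scheme \<Rightarrow> enat" where
  "gldim U A = Sup {projdim A M |M :: ('a, 'm) module. left_module A M}"


locale assoc_algebra = module R A + ring A
  for R :: "('r, 'x) ring_scheme" (structure) and A :: "('r, 'a) module" (structure) +
  assumes smult_mult_left:
      "\<lbrakk>r \<in> carrier R; x \<in> carrier A; y \<in> carrier A\<rbrakk> \<Longrightarrow>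
        (r \<odot>\<^bsub>A\<^esub> x) \<otimes>\<^bsub>A\<^esub> y = r \<odot>\<^bsub>A\<^esub> (x \<otimes>\<^bsub>A\<^esub> y)"
    and smult_mult_right:
      "\<lbrakk>r \<in> carrier R; x \<in> carrier A; y \<in> carrier A\<rbrakk> \<Longrightarrow>
        x \<otimes>\<^bsub>A\<^esub> (r \<odot>\<^bsub>A\<^esub> y) = r \<odot>\<^bsub>A\<^esub> (x \<otimes>\<^bsub>A\<^esub> y)"

definition fg_projective_algebra ::
    "'m itself \<Rightarrow> ('r, 'x) ring_scheme \<Rightarrow> ('r, 'a) module \<Rightarrow> bool" where
  "fg_projective_algebra U R A \<longleftrightarrow>
     assoc_algebra R A \<and> finitely_generated R A \<and> projective_module U R A"

text \<open>A left ideal as a left module over the ring; the whole carrier gives the regular module.\<close>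

definition ideal_module :: "('a, 'x) ring_scheme \<Rightarrow> 'a set \<Rightarrow> ('a, 'a) module" where
  "ideal_module A J =
     \<lparr>carrier = J, monoid.mult = (\<otimes>\<^bsub>A\<^esub>), one = \<one>\<^bsub>A\<^esub>,
      ring.zero = \<zero>\<^bsub>A\<^esub>, add = (\<oplus>\<^bsub>A\<^esub>), smult = (\<otimes>\<^bsub>A\<^esub>)\<rparr>"

abbreviation self_algebra :: "('r, 'x) ring_scheme \<Rightarrow> ('r, 'r) module" where
  "self_algebra R \<equiv> ideal_module R (carrier R)"

definition quotient_algebra :: "('r, 'a) module \<Rightarrow> 'a set \<Rightarrow> ('r, 'a set) module" where
  "quotient_algebra A J =
     \<lparr>carrier = carrier (A Quot J), monoid.mult = (\<otimes>\<^bsub>A Quot J\<^esub>), one = \<one>\<^bsub>A Quot J\<^esub>,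
      ring.zero = \<zero>\<^bsub>A Quot J\<^esub>, add = (\<oplus>\<^bsub>A Quot J\<^esub>),
      smult = (\<lambda>r C. \<Union>x\<in>C. J +>\<^bsub>A\<^esub> (r \<odot>\<^bsub>A\<^esub> x))\<rparr>"

definition End_op ::
    "('r, 'a) module \<Rightarrow> ('a, 'b) module \<Rightarrow> ('r, 'b \<Rightarrow> 'b) module" where
  "End_op A M =
     \<lparr>carrier = mod_hom A M M,
      monoid.mult = (\<lambda>f g. compose (carrier M) g f),
      one = (\<lambda>x\<in>carrier M. x),
      ring.zero = (\<lambda>x\<in>carrier M. \<zero>\<^bsub>M\<^esub>),
      add = (\<lambda>f g. \<lambda>x\<in>carrier M. f x \<oplus>\<^bsub>M\<^esub> g x),
      smult = (\<lambda>r f. \<lambda>x\<in>carrier M. (r \<odot>\<^bsub>A\<^esub> \<one>\<^bsub>A\<^esub>) \<odot>\<^bsub>M\<^esub> f x)\<rparr>"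


text \<open>
  Morita equivalence of \<^term>\<open>R\<close>-algebras: an \<^term>\<open>R\<close>-linear equivalence between the categories
  of left modules. A functor is a pair of its action on objects and its action on morphisms.
\<close>

type_synonym ('b, 'c, 'm) mod_functor =
  "(('b, 'm) module \<Rightarrow> ('c, 'm) module) \<times>
   (('b, 'm) module \<Rightarrow> ('b, 'm) module \<Rightarrow> ('m \<Rightarrow> 'm) \<Rightarrow> 'm \<Rightarrow> 'm)"

definition is_functor ::
    "('b, 'x) ring_scheme \<Rightarrow> ('c, 'y) ring_scheme \<Rightarrow> ('b, 'c, 'm) mod_functor \<Rightarrow> bool" where
  "is_functor B C F \<longleftrightarrow>
     (\<forall>M. left_module B M \<longrightarrow> left_module C (fst F M)) \<and>
     (\<forall>M N f. left_module B M \<longrightarrow> left_module B N \<longrightarrow> f \<in> mod_hom B M N \<longrightarrow>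
        snd F M N f \<in> mod_hom C (fst F M) (fst F N)) \<and>
     (\<forall>M. left_module B M \<longrightarrow>
        snd F M M (\<lambda>x\<in>carrier M. x) = (\<lambda>x\<in>carrier (fst F M). x)) \<and>
     (\<forall>L M N f g. left_module B L \<longrightarrow> left_module B M \<longrightarrow> left_module B N \<longrightarrow>
        f \<in> mod_hom B L M \<longrightarrow> g \<in> mod_hom B M N \<longrightarrow>
        snd F L N (compose (carrier L) g f) =
          compose (carrier (fst F L)) (snd F M N g) (snd F L M f))"

definition linear_functor ::
    "('r, 'x) ring_scheme \<Rightarrow> ('r, 'b) module \<Rightarrow> ('r, 'c) module \<Rightarrow>
     ('b, 'c, 'm) mod_functor \<Rightarrow> bool" where
  "linear_functor R B C F \<longleftrightarrow> is_functor B C F \<and>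
     (\<forall>M N f g. left_module B M \<longrightarrow> left_module B N \<longrightarrow>
        f \<in> mod_hom B M N \<longrightarrow> g \<in> mod_hom B M N \<longrightarrow>
        snd F M N (\<lambda>x\<in>carrier M. f x \<oplus>\<^bsub>N\<^esub> g x) =
          (\<lambda>x\<in>carrier (fst F M). snd F M N f x \<oplus>\<^bsub>fst F N\<^esub> snd F M N g x)) \<and>
     (\<forall>M N f r. left_module B M \<longrightarrow> left_module B N \<longrightarrow>
        f \<in> mod_hom B M N \<longrightarrow> r \<in> carrier R \<longrightarrow>
        snd F M N (\<lambda>x\<in>carrier M. (r \<odot>\<^bsub>B\<^esub> \<one>\<^bsub>B\<^esub>) \<odot>\<^bsub>N\<^esub> f x) =
          (\<lambda>x\<in>carrier (fst F M). (r \<odot>\<^bsub>C\<^esub> \<one>\<^bsub>C\<^esub>) \<odot>\<^bsub>fst F N\<^esub> snd F M N f x))"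

definition id_functor :: "('b, 'b, 'm) mod_functor" where
  "id_functor = (\<lambda>M. M, \<lambda>M N f. f)"

definition comp_functor ::
    "('c, 'd, 'm) mod_functor \<Rightarrow> ('b, 'c, 'm) mod_functor \<Rightarrow> ('b, 'd, 'm) mod_functor" where
  "comp_functor G F =
     (\<lambda>M. fst G (fst F M), \<lambda>M N f. snd G (fst F M) (fst F N) (snd F M N f))"

definition naturally_isomorphic ::
    "('b, 'x) ring_scheme \<Rightarrow> ('c, 'y) ring_scheme \<Rightarrow>
     ('b, 'c, 'm) mod_functor \<Rightarrow> ('b, 'c, 'm) mod_functor \<Rightarrow> bool" where
  "naturally_isomorphic B C F G \<longleftrightarrow>
     (\<exists>\<eta>. (\<forall>M. left_module B M \<longrightarrow> \<eta> M \<in> mod_iso C (fst F M) (fst G M)) \<and>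
          (\<forall>M N f. left_module B M \<longrightarrow> left_module B N \<longrightarrow> f \<in> mod_hom B M N \<longrightarrow>
             compose (carrier (fst F M)) (\<eta> N) (snd F M N f) =
             compose (carrier (fst F M)) (snd G M N f) (\<eta> M)))"

definition morita_equivalent ::
    "'m itself \<Rightarrow> ('r, 'x) ring_scheme \<Rightarrow> ('r, 'b) module \<Rightarrow> ('r, 'c) module \<Rightarrow> bool" where
  "morita_equivalent U R B C \<longleftrightarrow>
     (\<exists>(F :: ('b, 'c, 'm) mod_functor) (G :: ('c, 'b, 'm) mod_functor).
        linear_functor R B C F \<and> linear_functor R C B G \<and>
        naturally_isomorphic B B (comp_functor G F) id_functor \<and>
        naturally_isomorphic C C (comp_functor F G) id_functor)"


definition split_heredity_ideal ::
    "'m itself \<Rightarrow> ('r, 'x) ring_scheme \<Rightarrow> ('r, 'a) module \<Rightarrow> 'a set \<Rightarrow> bool" where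
  "split_heredity_ideal U R A J \<longleftrightarrow>
     fg_projective_algebra U R A \<and> ideal J A \<and>
     projective_module U R (quotient_algebra A J) \<and>
     projective_module U A (ideal_module A J) \<and>
     J \<cdot>\<^bsub>A\<^esub> J = J \<and>
     morita_equivalent U R (End_op A (ideal_module A J)) (self_algebra R)"

text \<open>
  The zero algebra is not allowed an empty chain, hence \<open>1 \<le> t\<close>. In the last clause
  the image of \<open>J i\<close> is the ideal \<open>J i / J (i + 1)\<close> of \<open>A / J (i + 1)\<close>.
\<close>

definition split_heredity_chain ::
    "'m itself \<Rightarrow> ('r, 'x) ring_scheme \<Rightarrow> ('r, 'a) module \<Rightarrow> nat \<Rightarrow> (nat \<Rightarrow> 'a set) \<Rightarrow> bool" where
  "split_heredity_chain U R A t J \<longleftrightarrow>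
     fg_projective_algebra U R A \<and> 1 \<le> t \<and>
     J (t + 1) = {\<zero>\<^bsub>A\<^esub>} \<and> J 1 = carrier A \<and>
     (\<forall>i\<in>{1..t+1}. ideal (J i) A) \<and>
     (\<forall>i\<in>{1..t}. J (i + 1) \<subseteq> J i) \<and>
     (\<forall>i\<in>{1..t}. split_heredity_ideal U R (quotient_algebra A (J (i + 1)))
        ((\<lambda>x. J (i + 1) +>\<^bsub>A\<^esub> x) ` J i))"


text \<open>
  Fractions \<open>a / s\<close> with \<open>s \<notin> P\<close>, represented by pairs; \<open>a / s = b / t\<close> iff \<open>u (a t) = u (b s)\<close>
  for some \<open>u \<notin> P\<close>.
\<close>

definition frac_rel :: "('r, 'x) ring_scheme \<Rightarrow> 'r set \<Rightarrow> (('r \<times> 'r) \<times> ('r \<times> 'r)) set" where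
  "frac_rel R P = {((a, s), (b, t)). a \<in> carrier R \<and> s \<in> carrier R - P \<and>
     b \<in> carrier R \<and> t \<in> carrier R - P \<and>
     (\<exists>u\<in>carrier R - P. u \<otimes>\<^bsub>R\<^esub> (a \<otimes>\<^bsub>R\<^esub> t) = u \<otimes>\<^bsub>R\<^esub> (b \<otimes>\<^bsub>R\<^esub> s))}"

definition localization :: "('r, 'x) ring_scheme \<Rightarrow> 'r set \<Rightarrow> ('r \<times> 'r) set ring" where
  "localization R P =
     \<lparr>carrier = (carrier R \<times> (carrier R - P)) // frac_rel R P,
      monoid.mult = (\<lambda>C D. \<Union>(a, s)\<in>C. \<Union>(b, t)\<in>D. frac_rel R P `` {(a \<otimes>\<^bsub>R\<^esub> b, s \<otimes>\<^bsub>R\<^esub> t)}),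
      one = frac_rel R P `` {(\<one>\<^bsub>R\<^esub>, \<one>\<^bsub>R\<^esub>)},
      ring.zero = frac_rel R P `` {(\<zero>\<^bsub>R\<^esub>, \<one>\<^bsub>R\<^esub>)},
      add = (\<lambda>C D. \<Union>(a, s)\<in>C. \<Union>(b, t)\<in>D.
        frac_rel R P `` {(a \<otimes>\<^bsub>R\<^esub> t \<oplus>\<^bsub>R\<^esub> b \<otimes>\<^bsub>R\<^esub> s, s \<otimes>\<^bsub>R\<^esub> t)})\<rparr>"

definition regular_local_ring :: "'m itself \<Rightarrow> ('r, 'x) ring_scheme \<Rightarrow> bool" where
  "regular_local_ring U R \<longleftrightarrow>
     cring R \<and> noetherian_ring R \<and> (\<exists>!m. maximalideal m R) \<and> gldim U R < \<infinity>"

definition regular_ring :: "'m itself \<Rightarrow> ('r, 'x) ring_scheme \<Rightarrow> bool" where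
  "regular_ring U R \<longleftrightarrow>
     cring R \<and> noetherian_ring R \<and>
     (\<forall>P. primeideal P R \<longrightarrow> regular_local_ring U (localization R P))"

definition krull_dim :: "('r, 'x) ring_scheme \<Rightarrow> enat" where
  "krull_dim R = Sup {enat n |n. \<exists>P :: nat \<Rightarrow> 'r set.
     (\<forall>i\<le>n. primeideal (P i) R) \<and> (\<forall>i<n. P i \<subset> P (Suc i))}"

end

theory Submission
  imports Defs
begin

text \<open>
  The last ideal \<open>J = J t\<close> of the chain is a split heredity ideal of \<open>A\<close> itself. Let
  \<open>E = End\<^sub>A(J)\<close>, with the opposite multiplication. Right multiplication is a ring homomorphism
  \<open>A \<rightarrow> E\<close>, and \<open>Hom\<^sub>A(J, A) = E\<close> because \<open>J\<^sup>2 = J\<close>. Hence the exact functor \<open>Hom\<^sub>A(J, -)\<close> is left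
  adjoint to restriction of scalars along \<open>A \<rightarrow> E\<close>, so it preserves projectives, and by the dual
  basis of \<open>J\<close> it maps the restriction of an \<open>E\<close>-module \<open>M\<close> back to \<open>M\<close>. It therefore turns a projective
  resolution of \<open>M\<close> over \<open>A\<close> into one over \<open>E\<close> of the same length, and the Morita equivalence carries
  the bound from \<open>E\<close> to \<open>R\<close>. Localization at a prime ideal is exact, preserves projectives
  and reaches every module over the localized ring as well, which gives regularity.

  For the Krull dimension let \<open>p \<subset> q\<close> be prime ideals and \<open>x \<in> q - p\<close>. If all finitely generated
  modules have projective dimension at most \<open>n + 1\<close> at \<open>q\<close>, and \<open>x\<close> is regular on \<open>M\<close>, then the bound for
  \<open>M / x M\<close> and Nakayama's lemma give projective dimension at most \<open>n\<close> for \<open>M\<close> at \<open>q\<close>; at \<open>p\<close> the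
  \<open>x\<close>-torsion does not matter, so there all finitely generated modules have projective dimension at
  most \<open>n\<close>. Descending a chain of primes longer than the global dimension, one reaches \<open>p \<subset> q\<close>
  with every finitely generated module projective at \<open>q\<close>; this is absurd for a nonzero \<open>M / x M\<close>.
\<close>

section \<open>Modules and linear maps\<close>

text \<open>Projectivity and global dimension speak only of modules carried by the type
  \<open>'m\<close>, so no construction may simply leave that type. Sums, Hom modules and modules of
  fractions are built on richer types and then copied into \<open>'m\<close> along an injection;
  \<open>large_universe\<close> and the finite generation of the heredity ideal supply the
  injections. Since the copies involve choices, Hom and localization appear as relations between a
  module and a possible value. The functors of a Morita equivalence see no elements, so elements of
  their values are recovered as maps out of one fixed module, the counterpart of the free module of
  rank one.

  In the dimension argument neither Ext nor a localized module occurs: with \<open>R\<close>-modules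
  and denominators outside a prime, two primes can be compared on the same module. A bound on
  projective dimension only provides some cover; a weak form of Schanuel's lemma, phrased by
  retracts up to projectives, allows changing it. Nakayama's lemma is applied to the endomorphisms
  of a first syzygy, and the Noetherian hypothesis makes these a finitely generated module.\<close>

definition mod_lin ::
    "('a, 'x) ring_scheme \<Rightarrow> ('a, 'm) module \<Rightarrow> ('a, 'n) module \<Rightarrow> ('m \<Rightarrow> 'n) \<Rightarrow> bool" where
  "mod_lin A M N f \<longleftrightarrow> (\<forall>x\<in>carrier M. f x \<in> carrier N) \<and>
     (\<forall>x\<in>carrier M. \<forall>y\<in>carrier M. f (x \<oplus>\<^bsub>M\<^esub> y) = f x \<oplus>\<^bsub>N\<^esub> f y) \<and>
     (\<forall>a\<in>carrier A. \<forall>x\<in>carrier M. f (a \<odot>\<^bsub>M\<^esub> x) = a \<odot>\<^bsub>N\<^esub> f x)"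

definition mk_module ::
    "'m set \<Rightarrow> 'm \<Rightarrow> ('m \<Rightarrow> 'm \<Rightarrow> 'm) \<Rightarrow> ('a \<Rightarrow> 'm \<Rightarrow> 'm) \<Rightarrow> ('a, 'm) module" where
  "mk_module C z p s = \<lparr>carrier = C, monoid.mult = undefined, one = undefined,
     ring.zero = z, add = p, smult = s\<rparr>"

lemma mk_module_simps [simp]:
  "carrier (mk_module C z p s) = C" "\<zero>\<^bsub>mk_module C z p s\<^esub> = z"
  "add (mk_module C z p s) = p" "smult (mk_module C z p s) = s"
  by (simp_all add: mk_module_def)

lemma mod_linI:
  assumes "\<And>x. x \<in> carrier M \<Longrightarrow> f x \<in> carrier N"
    and "\<And>x y. \<lbrakk>x \<in> carrier M; y \<in> carrier M\<rbrakk> \<Longrightarrow> f (x \<oplus>\<^bsub>M\<^esub> y) = f x \<oplus>\<^bsub>N\<^esub> f y"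
    and "\<And>a x. \<lbrakk>a \<in> carrier A; x \<in> carrier M\<rbrakk> \<Longrightarrow> f (a \<odot>\<^bsub>M\<^esub> x) = a \<odot>\<^bsub>N\<^esub> f x"
  shows "mod_lin A M N f"
  using assms by (simp add: mod_lin_def)

lemma mod_linD:
  assumes "mod_lin A M N f"
  shows "x \<in> carrier M \<Longrightarrow> f x \<in> carrier N"
    and "\<lbrakk>x \<in> carrier M; y \<in> carrier M\<rbrakk> \<Longrightarrow> f (x \<oplus>\<^bsub>M\<^esub> y) = f x \<oplus>\<^bsub>N\<^esub> f y"
    and "\<lbrakk>a \<in> carrier A; x \<in> carrier M\<rbrakk> \<Longrightarrow> f (a \<odot>\<^bsub>M\<^esub> x) = a \<odot>\<^bsub>N\<^esub> f x"
  using assms by (simp_all add: mod_lin_def)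

text \<open>The existence of additive inverses is replaced by an equation for the scalar -1, which
  is easier to check on explicit operations and does not require naming the inverse.\<close>

lemma left_moduleI:
  assumes "ring A"
    and "\<And>x y. \<lbrakk>x \<in> carrier M; y \<in> carrier M\<rbrakk> \<Longrightarrow> x \<oplus>\<^bsub>M\<^esub> y \<in> carrier M"
    and "\<zero>\<^bsub>M\<^esub> \<in> carrier M"
    and "\<And>x y z. \<lbrakk>x \<in> carrier M; y \<in> carrier M; z \<in> carrier M\<rbrakk> \<Longrightarrow>
      (x \<oplus>\<^bsub>M\<^esub> y) \<oplus>\<^bsub>M\<^esub> z = x \<oplus>\<^bsub>M\<^esub> (y \<oplus>\<^bsub>M\<^esub> z)"
    and "\<And>x y. \<lbrakk>x \<in> carrier M; y \<in> carrier M\<rbrakk> \<Longrightarrow> x \<oplus>\<^bsub>M\<^esub> y = y \<oplus>\<^bsub>M\<^esub> x"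
    and "\<And>x. x \<in> carrier M \<Longrightarrow> \<zero>\<^bsub>M\<^esub> \<oplus>\<^bsub>M\<^esub> x = x"
    and "\<And>x. x \<in> carrier M \<Longrightarrow> (\<ominus>\<^bsub>A\<^esub> \<one>\<^bsub>A\<^esub>) \<odot>\<^bsub>M\<^esub> x \<oplus>\<^bsub>M\<^esub> x = \<zero>\<^bsub>M\<^esub>"
    and "\<And>a x. \<lbrakk>a \<in> carrier A; x \<in> carrier M\<rbrakk> \<Longrightarrow> a \<odot>\<^bsub>M\<^esub> x \<in> carrier M"
    and "\<And>a b x. \<lbrakk>a \<in> carrier A; b \<in> carrier A; x \<in> carrier M\<rbrakk> \<Longrightarrow>
      (a \<oplus>\<^bsub>A\<^esub> b) \<odot>\<^bsub>M\<^esub> x = a \<odot>\<^bsub>M\<^esub> x \<oplus>\<^bsub>M\<^esub> b \<odot>\<^bsub>M\<^esub> x"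
    and "\<And>a x y. \<lbrakk>a \<in> carrier A; x \<in> carrier M; y \<in> carrier M\<rbrakk> \<Longrightarrow>
      a \<odot>\<^bsub>M\<^esub> (x \<oplus>\<^bsub>M\<^esub> y) = a \<odot>\<^bsub>M\<^esub> x \<oplus>\<^bsub>M\<^esub> a \<odot>\<^bsub>M\<^esub> y"
    and "\<And>a b x. \<lbrakk>a \<in> carrier A; b \<in> carrier A; x \<in> carrier M\<rbrakk> \<Longrightarrow>
      (a \<otimes>\<^bsub>A\<^esub> b) \<odot>\<^bsub>M\<^esub> x = a \<odot>\<^bsub>M\<^esub> (b \<odot>\<^bsub>M\<^esub> x)"
    and "\<And>x. x \<in> carrier M \<Longrightarrow> \<one>\<^bsub>A\<^esub> \<odot>\<^bsub>M\<^esub> x = x"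
  shows "left_module A M"
proof -
  interpret A: ring A by fact
  have "abelian_group M"
  proof (rule abelian_groupI)
    fix x assume "x \<in> carrier M"
    then show "\<exists>y\<in>carrier M. y \<oplus>\<^bsub>M\<^esub> x = \<zero>\<^bsub>M\<^esub>"
      using assms(7,8) A.a_inv_closed[OF A.one_closed] by blast
  qed (fact assms)+
  with assms show ?thesis
    by (simp add: left_module_def left_module_axioms_def)
qed

context left_module
begin

lemma smult_zero_right: "a \<in> carrier A \<Longrightarrow> a \<odot>\<^bsub>M\<^esub> \<zero>\<^bsub>M\<^esub> = \<zero>\<^bsub>M\<^esub>"
  by (metis M.add.r_cancel_one' M.r_zero M.zero_closed smult_closed smult_r_distr)

lemma smult_zero_left: "x \<in> carrier M \<Longrightarrow> \<zero> \<odot>\<^bsub>M\<^esub> x = \<zero>\<^bsub>M\<^esub>"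
  by (metis A.r_zero A.zero_closed M.add.r_cancel_one' smult_closed smult_l_distr)

lemma smult_minus_one: "x \<in> carrier M \<Longrightarrow> (\<ominus> \<one>) \<odot>\<^bsub>M\<^esub> x = \<ominus>\<^bsub>M\<^esub> x"
  by (metis A.a_inv_closed A.l_neg A.one_closed M.minus_equality smult_closed smult_l_distr
      smult_one smult_zero_left)

lemma smult_minus: "\<lbrakk>a \<in> carrier A; x \<in> carrier M\<rbrakk> \<Longrightarrow> a \<odot>\<^bsub>M\<^esub> (\<ominus>\<^bsub>M\<^esub> x) = \<ominus>\<^bsub>M\<^esub> (a \<odot>\<^bsub>M\<^esub> x)"
  by (metis M.add.inv_closed M.l_neg M.minus_equality smult_closed smult_r_distr smult_zero_right)

lemma smult_diff: "\<lbrakk>a \<in> carrier A; x \<in> carrier M; y \<in> carrier M\<rbrakk> \<Longrightarrow>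
    a \<odot>\<^bsub>M\<^esub> (x \<ominus>\<^bsub>M\<^esub> y) = a \<odot>\<^bsub>M\<^esub> x \<ominus>\<^bsub>M\<^esub> a \<odot>\<^bsub>M\<^esub> y"
  by (simp add: M.minus_eq smult_r_distr smult_minus)

lemma minus_smult: "\<lbrakk>a \<in> carrier A; x \<in> carrier M\<rbrakk> \<Longrightarrow> (\<ominus> a) \<odot>\<^bsub>M\<^esub> x = \<ominus>\<^bsub>M\<^esub> (a \<odot>\<^bsub>M\<^esub> x)"
  by (metis A.a_inv_closed A.l_neg M.minus_equality smult_closed smult_l_distr smult_zero_left)

lemma diff_smult: "\<lbrakk>a \<in> carrier A; b \<in> carrier A; x \<in> carrier M\<rbrakk> \<Longrightarrow>
    (a \<ominus> b) \<odot>\<^bsub>M\<^esub> x = a \<odot>\<^bsub>M\<^esub> x \<ominus>\<^bsub>M\<^esub> b \<odot>\<^bsub>M\<^esub> x"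
  by (simp add: M.minus_eq A.minus_eq smult_l_distr minus_smult)

lemma diff_zero_iff: "\<lbrakk>x \<in> carrier M; y \<in> carrier M\<rbrakk> \<Longrightarrow> x \<ominus>\<^bsub>M\<^esub> y = \<zero>\<^bsub>M\<^esub> \<longleftrightarrow> x = y"
  by (simp add: M.minus_eq M.add.inv_solve_right')

end

lemma mod_lin_zero:
  assumes "left_module A M" "left_module A N" "mod_lin A M N f"
  shows "f \<zero>\<^bsub>M\<^esub> = \<zero>\<^bsub>N\<^esub>"
proof -
  interpret M: left_module A M by fact
  interpret N: left_module A N by fact
  have "f (\<zero>\<^bsub>A\<^esub> \<odot>\<^bsub>M\<^esub> \<zero>\<^bsub>M\<^esub>) = \<zero>\<^bsub>A\<^esub> \<odot>\<^bsub>N\<^esub> f \<zero>\<^bsub>M\<^esub>"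
    by (rule mod_linD(3)[OF assms(3)]) auto
  then show ?thesis
    by (simp add: M.smult_zero_left N.smult_zero_left mod_linD(1)[OF assms(3)])
qed

lemma mod_lin_diff:
  assumes "left_module A M" "left_module A N" "mod_lin A M N f" "x \<in> carrier M" "y \<in> carrier M"
  shows "f (x \<ominus>\<^bsub>M\<^esub> y) = f x \<ominus>\<^bsub>N\<^esub> f y"
proof -
  interpret M: left_module A M by fact
  interpret N: left_module A N by fact
  note l = mod_linD[OF assms(3)]
  have "f (\<ominus>\<^bsub>M\<^esub> y) = \<ominus>\<^bsub>N\<^esub> f y"
    using l(3)[of "\<ominus>\<^bsub>A\<^esub> \<one>\<^bsub>A\<^esub>" y] assms l(1)
    by (simp add: M.smult_minus_one N.smult_minus_one)
  then show ?thesis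
    using assms l by (simp add: M.minus_eq N.minus_eq)
qed

lemma mod_lin_comp:
  assumes "mod_lin A L M f" "mod_lin A M N g"
  shows "mod_lin A L N (\<lambda>x. g (f x))"
  using assms by (simp add: mod_lin_def)

lemma mod_lin_id: "mod_lin A M M (\<lambda>x. x)"
  by (simp add: mod_lin_def)

lemma mod_lin_add:
  assumes "left_module A M" "left_module A N" "mod_lin A M N f" "mod_lin A M N g"
  shows "mod_lin A M N (\<lambda>x. f x \<oplus>\<^bsub>N\<^esub> g x)"
proof -
  interpret M: left_module A M by fact
  interpret N: left_module A N by fact
  show ?thesis
    using mod_linD[OF assms(3)] mod_linD[OF assms(4)]
    by (intro mod_linI) (simp_all add: N.a_ac N.smult_r_distr)
qed

lemma mod_lin_zero_map: "left_module A N \<Longrightarrow> mod_lin A M N (\<lambda>x. \<zero>\<^bsub>N\<^esub>)"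
  using left_module.smult_zero_right[of A N]
  by (intro mod_linI) (auto simp: left_module_def abelian_group_def abelian_monoid.zero_closed
      abelian_monoid.l_zero)

lemma mod_lin_smult:
  assumes "cring A" "left_module A M" "left_module A N" "mod_lin A M N f" "a \<in> carrier A"
  shows "mod_lin A M N (\<lambda>x. a \<odot>\<^bsub>N\<^esub> f x)"
proof -
  interpret A: cring A by fact
  interpret M: left_module A M by fact
  interpret N: left_module A N by fact
  show ?thesis
    using mod_linD[OF assms(4)] assms(5)
    by (intro mod_linI) (simp_all add: N.smult_r_distr N.smult_closed flip: N.smult_assoc,
      simp add: A.m_comm)
qed

lemma mod_lin_diff_map:
  assumes "left_module A M" "left_module A N" "mod_lin A M N f" "mod_lin A M N g"
  shows "mod_lin A M N (\<lambda>x. f x \<ominus>\<^bsub>N\<^esub> g x)"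
proof -
  interpret M: left_module A M by fact
  interpret N: left_module A N by fact
  show ?thesis
    using mod_linD[OF assms(3)] mod_linD[OF assms(4)]
    by (intro mod_linI)
      (simp_all add: N.a_ac N.smult_r_distr N.minus_eq N.minus_add N.smult_minus)
qed

lemma mod_lin_cong:
  assumes "mod_lin A M N f" "left_module A M" "\<And>x. x \<in> carrier M \<Longrightarrow> g x = f x"
  shows "mod_lin A M N g"
proof -
  interpret M: left_module A M by fact
  show ?thesis
    using assms(1,3) by (simp add: mod_lin_def M.smult_closed)
qed

text \<open>The two notions differ only in extensionality. Linear maps compose as plain lambda
  terms, so they are used for calculation; restriction to the carrier happens only where equality of
  functions matters, as for elements of Hom modules and arguments of functors.\<close>

lemma mod_hom_iff: "f \<in> mod_hom A M N \<longleftrightarrow> mod_lin A M N f \<and> f \<in> extensional (carrier M)"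
  by (auto simp: mod_hom_def mod_lin_def PiE_def)

lemma mod_hom_restrict:
  assumes "left_module A M" "mod_lin A M N f"
  shows "(\<lambda>x\<in>carrier M. f x) \<in> mod_hom A M N"
  using assms(2) mod_lin_cong[OF assms(2,1), of "\<lambda>x\<in>carrier M. f x"]
  by (auto simp: mod_hom_iff)

lemma mod_hom_lin: "f \<in> mod_hom A M N \<Longrightarrow> mod_lin A M N f"
  by (simp add: mod_hom_iff)

lemma mod_hom_eqI:
  assumes "f \<in> mod_hom A M N" "g \<in> mod_hom A M N" "\<And>x. x \<in> carrier M \<Longrightarrow> f x = g x"
  shows "f = g"
  using assms by (auto simp: mod_hom_iff intro: extensionalityI)

text \<open>All axioms are equations, so they pass to any structure that is the image of a module
  under a map respecting the operations. This yields both copies and quotients.\<close>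

lemma left_module_image:
  assumes "left_module A M" "carrier N = f ` carrier M" "f \<zero>\<^bsub>M\<^esub> = \<zero>\<^bsub>N\<^esub>"
    and "\<And>x y. \<lbrakk>x \<in> carrier M; y \<in> carrier M\<rbrakk> \<Longrightarrow> f (x \<oplus>\<^bsub>M\<^esub> y) = f x \<oplus>\<^bsub>N\<^esub> f y"
    and "\<And>a x. \<lbrakk>a \<in> carrier A; x \<in> carrier M\<rbrakk> \<Longrightarrow> f (a \<odot>\<^bsub>M\<^esub> x) = a \<odot>\<^bsub>N\<^esub> f x"
  shows "left_module A N"
proof -
  interpret M: left_module A M by fact
  note s = assms(3-5)[symmetric]
  show ?thesis
    by (intro left_moduleI)
      (auto simp: assms(2) s M.a_ac M.r_neg M.smult_closed M.smult_assoc M.smult_one M.ring_axioms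
        M.smult_l_distr M.smult_r_distr M.a_comm M.smult_minus_one M.l_neg)
qed

section \<open>Isomorphisms, copies in another type, and quotients\<close>

definition lin_iso where
  "lin_iso A M N f g \<longleftrightarrow> mod_lin A M N f \<and> mod_lin A N M g \<and>
     (\<forall>x\<in>carrier M. g (f x) = x) \<and> (\<forall>y\<in>carrier N. f (g y) = y)"

lemma lin_isoD:
  assumes "lin_iso A M N f g"
  shows "mod_lin A M N f" "mod_lin A N M g" "x \<in> carrier M \<Longrightarrow> g (f x) = x"
    "y \<in> carrier N \<Longrightarrow> f (g y) = y" "x \<in> carrier M \<Longrightarrow> f x \<in> carrier N"
    "y \<in> carrier N \<Longrightarrow> g y \<in> carrier M"
  using assms by (auto simp: lin_iso_def mod_lin_def)

lemma lin_iso_sym: "lin_iso A M N f g \<Longrightarrow> lin_iso A N M g f"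
  by (auto simp: lin_iso_def)

lemma lin_iso_id: "lin_iso A M M (\<lambda>x. x) (\<lambda>x. x)"
  by (simp add: lin_iso_def mod_lin_id)

lemma lin_iso_of_bij:
  assumes "left_module A M" "mod_lin A M N f" "bij_betw f (carrier M) (carrier N)"
  shows "lin_iso A M N f (inv_into (carrier M) f)"
proof -
  interpret M: left_module A M by fact
  let ?g = "inv_into (carrier M) f"
  note l = mod_linD[OF assms(2)]
  have g: "?g y \<in> carrier M" "f (?g y) = y" if "y \<in> carrier N" for y
    using that assms(3) by (auto simp: bij_betw_def inv_into_into f_inv_into_f)
  have gf: "?g (f x) = x" if "x \<in> carrier M" for x
    using that assms(3) by (auto simp: bij_betw_def)
  have "mod_lin A N M ?g"
  proof (rule mod_linI)
    fix x y assume "x \<in> carrier N" "y \<in> carrier N"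
    then show "?g (x \<oplus>\<^bsub>N\<^esub> y) = ?g x \<oplus>\<^bsub>M\<^esub> ?g y"
      using gf[of "?g x \<oplus>\<^bsub>M\<^esub> ?g y"] g l(2) by simp
  next
    fix a x assume "a \<in> carrier A" "x \<in> carrier N"
    then show "?g (a \<odot>\<^bsub>N\<^esub> x) = a \<odot>\<^bsub>M\<^esub> ?g x"
      using gf[of "a \<odot>\<^bsub>M\<^esub> ?g x"] g l(3) M.smult_closed by simp
  qed (use g in auto)
  then show ?thesis
    using assms(2) g gf by (simp add: lin_iso_def)
qed

lemma lin_iso_bij: "lin_iso A M N f g \<Longrightarrow> bij_betw f (carrier M) (carrier N)"
  by (rule bij_betwI[of _ _ _ g]) (auto dest: lin_isoD)

text \<open>Lifting properties are tested only on modules in \<open>'m\<close>. A module built on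
  another type enters them through a copy along an injection of its carrier into
  \<open>'m\<close>.\<close>

lemma ex_transport:
  fixes M :: "('a, 'b) module"
  assumes "left_module A M" "lepoll (carrier M) (UNIV :: 'm set)"
  obtains M' :: "('a, 'm) module" and f g where "left_module A M'" "lin_iso A M M' f g"
proof -
  interpret M: left_module A M by fact
  obtain f :: "'b \<Rightarrow> 'm" where f: "inj_on f (carrier M)"
    using assms(2) by (auto simp: lepoll_def)
  define g where "g = inv_into (carrier M) f"
  have gf: "g (f x) = x" if "x \<in> carrier M" for x
    using that f by (simp add: g_def)
  define M' :: "('a, 'm) module" where
    "M' = mk_module (f ` carrier M) (f \<zero>\<^bsub>M\<^esub>) (\<lambda>x y. f (g x \<oplus>\<^bsub>M\<^esub> g y)) (\<lambda>a x. f (a \<odot>\<^bsub>M\<^esub> g x))"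
  have lm: "left_module A M'"
    by (rule left_module_image[OF assms(1), of _ f]) (simp_all add: M'_def gf)
  have "lin_iso A M M' f (inv_into (carrier M) f)"
    by (rule lin_iso_of_bij[OF assms(1)])
      (auto intro!: mod_linI simp: M'_def gf bij_betw_def f)
  with lm that show thesis by blast
qed

text \<open>The quotient of \<open>M\<close> by \<open>H\<close> is realized on chosen
  representatives instead of cosets, so that it stays in the type of \<open>M\<close>.\<close>

lemma ex_kernel_quotient:
  fixes M :: "('a, 'm) module"
  assumes "left_module A M" and "H \<subseteq> carrier M" "\<zero>\<^bsub>M\<^esub> \<in> H"
    and "\<And>x y. \<lbrakk>x \<in> H; y \<in> H\<rbrakk> \<Longrightarrow> x \<oplus>\<^bsub>M\<^esub> y \<in> H"
    and "\<And>a x. \<lbrakk>a \<in> carrier A; x \<in> H\<rbrakk> \<Longrightarrow> a \<odot>\<^bsub>M\<^esub> x \<in> H"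
  obtains N :: "('a, 'm) module" and f where "left_module A N" "mod_lin A M N f"
    "f ` carrier M = carrier N" "\<And>x. x \<in> carrier M \<Longrightarrow> f x = \<zero>\<^bsub>N\<^esub> \<longleftrightarrow> x \<in> H"
proof -
  interpret M: left_module A M by fact
  have neg: "\<ominus>\<^bsub>M\<^esub> x \<in> H" if "x \<in> H" for x
    using assms(5)[of "\<ominus>\<^bsub>A\<^esub> \<one>\<^bsub>A\<^esub>" x] that assms(2) by (auto simp: M.smult_minus_one)
  define r where "r x = (SOME y. y \<in> carrier M \<and> x \<ominus>\<^bsub>M\<^esub> y \<in> H)" for x
  have r: "r x \<in> carrier M \<and> x \<ominus>\<^bsub>M\<^esub> r x \<in> H" if "x \<in> carrier M" for x
    unfolding r_def
  proof (rule someI_ex, intro exI conjI)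
    show "x \<ominus>\<^bsub>M\<^esub> x \<in> H" using that assms(3) by (simp add: M.minus_eq M.r_neg)
  qed (fact that)
  have diffH: "x \<ominus>\<^bsub>M\<^esub> z \<in> H" if "x \<ominus>\<^bsub>M\<^esub> y \<in> H" "y \<ominus>\<^bsub>M\<^esub> z \<in> H" "x \<in> carrier M" "y \<in> carrier M"
    "z \<in> carrier M" for x y z
  proof -
    have "x \<ominus>\<^bsub>M\<^esub> z = (x \<ominus>\<^bsub>M\<^esub> y) \<oplus>\<^bsub>M\<^esub> (y \<ominus>\<^bsub>M\<^esub> z)"
      using that by (simp add: M.minus_eq M.a_assoc M.r_neg1)
    with assms(4) that show ?thesis by simp
  qed
  have symH: "y \<ominus>\<^bsub>M\<^esub> x \<in> H" if "x \<ominus>\<^bsub>M\<^esub> y \<in> H" "x \<in> carrier M" "y \<in> carrier M" for x y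
    using neg[OF that(1)] that by (simp add: M.minus_eq M.minus_add M.a_comm)
  \<comment> \<open>Congruent elements satisfy the same defining predicate, hence the choice
    operator returns the same representative for both.\<close>
  have rcong: "r x = r y" if "x \<in> carrier M" "y \<in> carrier M" "x \<ominus>\<^bsub>M\<^esub> y \<in> H" for x y
    unfolding r_def using that diffH symH by (intro arg_cong[where f = Eps] ext) blast
  have req: "r x = r y \<longleftrightarrow> x \<ominus>\<^bsub>M\<^esub> y \<in> H" if "x \<in> carrier M" "y \<in> carrier M" for x y
    using that r[of x] r[of y] rcong[of x y] diffH[of x "r y" y] symH[of y "r y"] by auto
  define N :: "('a, 'm) module" where
    "N = mk_module (r ` carrier M) (r \<zero>\<^bsub>M\<^esub>) (\<lambda>x y. r (x \<oplus>\<^bsub>M\<^esub> y)) (\<lambda>a x. r (a \<odot>\<^bsub>M\<^esub> x))"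
  have add: "r (x \<oplus>\<^bsub>M\<^esub> y) = r x \<oplus>\<^bsub>N\<^esub> r y" if "x \<in> carrier M" "y \<in> carrier M" for x y
  proof -
    have "(x \<oplus>\<^bsub>M\<^esub> y) \<ominus>\<^bsub>M\<^esub> (r x \<oplus>\<^bsub>M\<^esub> r y) = (x \<ominus>\<^bsub>M\<^esub> r x) \<oplus>\<^bsub>M\<^esub> (y \<ominus>\<^bsub>M\<^esub> r y)"
      using that r by (simp add: M.minus_eq M.minus_add M.a_ac)
    then show ?thesis
      using that r assms(4) by (simp add: N_def req)
  qed
  have smult: "r (a \<odot>\<^bsub>M\<^esub> x) = a \<odot>\<^bsub>N\<^esub> r x" if "a \<in> carrier A" "x \<in> carrier M" for a x
    using that r assms(5) by (simp add: N_def req M.smult_closed flip: M.smult_diff)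
  have lm: "left_module A N"
    by (rule left_module_image[OF assms(1) _ _ add smult]) (auto simp: N_def)
  show thesis
  proof (rule that[OF lm])
    show "mod_lin A M N r"
      by (intro mod_linI add smult) (auto simp: N_def)
    show "r ` carrier M = carrier N" by (simp add: N_def)
    have "x \<ominus>\<^bsub>M\<^esub> \<zero>\<^bsub>M\<^esub> = x" if "x \<in> carrier M" for x
      using that M.minus_equality[of "\<zero>\<^bsub>M\<^esub>" "\<zero>\<^bsub>M\<^esub>"] by (simp add: M.minus_eq)
    then show "r x = \<zero>\<^bsub>N\<^esub> \<longleftrightarrow> x \<in> H" if "x \<in> carrier M" for x
      using that by (simp add: N_def req)
  qed
qed

subsection \<open>Submodules\<close>

definition submod where
  "submod A M H \<longleftrightarrow> H \<subseteq> carrier M \<and> \<zero>\<^bsub>M\<^esub> \<in> H \<and> (\<forall>x\<in>H. \<forall>y\<in>H. x \<oplus>\<^bsub>M\<^esub> y \<in> H) \<and>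
     (\<forall>a\<in>carrier A. \<forall>x\<in>H. a \<odot>\<^bsub>M\<^esub> x \<in> H)"

lemma submodD:
  assumes "submod A M H"
  shows "x \<in> H \<Longrightarrow> x \<in> carrier M" "\<zero>\<^bsub>M\<^esub> \<in> H" "\<lbrakk>x \<in> H; y \<in> H\<rbrakk> \<Longrightarrow> x \<oplus>\<^bsub>M\<^esub> y \<in> H"
    "\<lbrakk>a \<in> carrier A; x \<in> H\<rbrakk> \<Longrightarrow> a \<odot>\<^bsub>M\<^esub> x \<in> H"
  using assms by (auto simp: submod_def)

lemma submod_left_module:
  assumes "left_module A M" "submod A M H"
  shows "left_module A (M\<lparr>carrier := H\<rparr>)"
proof -
  interpret M: left_module A M by fact
  note H = submodD[OF assms(2)]
  show ?thesis
    by (intro left_moduleI) (auto simp: H M.a_ac M.r_neg M.smult_closed M.smult_assoc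
        M.smult_one M.ring_axioms M.smult_l_distr M.smult_r_distr M.smult_minus_one M.l_neg)
qed

lemma submod_diff:
  assumes "left_module A M" "submod A M H" "x \<in> H" "y \<in> H"
  shows "x \<ominus>\<^bsub>M\<^esub> y \<in> H"
proof -
  interpret M: left_module A M by fact
  show ?thesis
    using assms submodD[OF assms(2)] submodD(4)[OF assms(2), of "\<ominus>\<^bsub>A\<^esub> \<one>\<^bsub>A\<^esub>" y]
    by (simp add: M.minus_eq M.smult_minus_one)
qed

lemma mod_lin_incl: "submod A M H \<Longrightarrow> mod_lin A (M\<lparr>carrier := H\<rparr>) M (\<lambda>x. x)"
  by (auto simp: mod_lin_def dest: submodD(1))

lemma mod_lin_restrict_dom: "submod A M H \<Longrightarrow> mod_lin A M N f \<Longrightarrow> mod_lin A (M\<lparr>carrier := H\<rparr>) N f"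
  using submodD(1)[of A M H] by (simp add: mod_lin_def)

lemma mod_lin_restrict_cod:
  "mod_lin A M N f \<Longrightarrow> f ` carrier M \<subseteq> H \<Longrightarrow> mod_lin A M (N\<lparr>carrier := H\<rparr>) f"
  by (auto simp: mod_lin_def)

lemma mod_lin_extend_cod: "submod A N H \<Longrightarrow> mod_lin A M (N\<lparr>carrier := H\<rparr>) f \<Longrightarrow> mod_lin A M N f"
  by (auto simp: mod_lin_def submod_def)

definition ker_set where
  "ker_set M N f = {x \<in> carrier M. f x = \<zero>\<^bsub>N\<^esub>}"

abbreviation ker_mod where
  "ker_mod M N f \<equiv> M\<lparr>carrier := ker_set M N f\<rparr>"

lemma submod_vimage:
  assumes "left_module A M" "left_module A N" "mod_lin A M N f" "submod A N H"
  shows "submod A M {x \<in> carrier M. f x \<in> H}"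
proof -
  interpret M: left_module A M by fact
  interpret N: left_module A N by fact
  show ?thesis
    using mod_linD[OF assms(3)] mod_lin_zero[OF assms(1-3)] submodD[OF assms(4)]
    by (auto simp: submod_def M.smult_closed)
qed

lemma submod_zero: "left_module A M \<Longrightarrow> submod A M {\<zero>\<^bsub>M\<^esub>}"
  using left_module.smult_zero_right[of A M]
  by (auto simp: submod_def left_module_def abelian_group_def abelian_monoid.zero_closed
      abelian_monoid.l_zero)

lemma submod_ker:
  assumes "left_module A M" "left_module A N" "mod_lin A M N f"
  shows "submod A M (ker_set M N f)"
  using submod_vimage[OF assms submod_zero[OF assms(2)]] by (simp add: ker_set_def)

lemmas left_module_ker = submod_left_module[OF _ submod_ker]

lemma submod_image:
  assumes "left_module A M" "left_module A N" "mod_lin A M N f" "submod A M H"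
  shows "submod A N (f ` H)"
proof -
  note l = mod_linD[OF assms(3)] and H = submodD[OF assms(4)]
  show ?thesis
    unfolding submod_def
  proof (intro conjI ballI)
    show "\<zero>\<^bsub>N\<^esub> \<in> f ` H"
      using mod_lin_zero[OF assms(1-3)] H(2) by (metis imageI)
  next
    fix x y assume "x \<in> f ` H" "y \<in> f ` H"
    then obtain u v where "x = f u" "y = f v" "u \<in> H" "v \<in> H" by blast
    then show "x \<oplus>\<^bsub>N\<^esub> y \<in> f ` H" using H l(2)[of u v] by (auto intro!: image_eqI[of _ _ "u \<oplus>\<^bsub>M\<^esub> v"])
  next
    fix a x assume "a \<in> carrier A" "x \<in> f ` H"
    then obtain u where "x = f u" "u \<in> H" by blast
    then show "a \<odot>\<^bsub>N\<^esub> x \<in> f ` H" using H l(3)[of a u] \<open>a \<in> carrier A\<close>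
      by (auto intro!: image_eqI[of _ _ "a \<odot>\<^bsub>M\<^esub> u"])
  qed (use H l in auto)
qed

lemma submod_carrier: "left_module A M \<Longrightarrow> submod A M (carrier M)"
  by (auto simp: submod_def left_module_def left_module_axioms_def abelian_group_def
      abelian_monoid.zero_closed abelian_monoid.a_closed)

lemma image_carrier_submod:
  assumes "left_module A M" "left_module A N" "mod_lin A M N f"
  shows "submod A N (f ` carrier M)"
  by (rule submod_image[OF assms submod_carrier[OF assms(1)]])

lemma mod_lin_inj_iff:
  assumes "left_module A M" "left_module A N" "mod_lin A M N f"
  shows "inj_on f (carrier M) \<longleftrightarrow> (\<forall>x\<in>carrier M. f x = \<zero>\<^bsub>N\<^esub> \<longrightarrow> x = \<zero>\<^bsub>M\<^esub>)"
proof -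
  interpret M: left_module A M by fact
  interpret N: left_module A N by fact
  show ?thesis (is "?l = ?r")
  proof
    assume ?l then show ?r
      using mod_lin_zero[OF assms] by (metis M.zero_closed inj_onD)
  next
    assume r: ?r
    show ?l
    proof (rule inj_onI)
      fix x y assume "x \<in> carrier M" "y \<in> carrier M" "f x = f y"
      moreover from this have "f (x \<ominus>\<^bsub>M\<^esub> y) = \<zero>\<^bsub>N\<^esub>"
        using mod_linD(1)[OF assms(3)] by (simp add: mod_lin_diff[OF assms] N.diff_zero_iff)
      ultimately show "x = y" using r M.diff_zero_iff[of x y] M.minus_closed[of x y] by metis
    qed
  qed
qed

subsection \<open>Direct sums\<close>

text \<open>An infinite set is equinumerous with its square; this is the reason for demanding an
  infinite universe.\<close>

lemma prod_lepoll_infinite: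
  assumes "infinite (UNIV :: 'm set)" "lepoll A (UNIV :: 'm set)" "lepoll B (UNIV :: 'm set)"
  shows "lepoll (A \<times> B) (UNIV :: 'm set)"
proof -
  have "lepoll ((UNIV :: 'm set) \<times> (UNIV :: 'm set)) (UNIV :: 'm set)"
    using card_of_Times_same_infinite[OF assms(1)] ordIso_imp_ordLeq
    by (force simp: lepoll_def simp flip: card_of_ordLeq)
  then show ?thesis
    using times_lepoll_mono[OF assms(2,3)] lepoll_trans by blast
qed

lemma ex_direct_sum:
  fixes M :: "('a, 'b) module" and N :: "('a, 'c) module"
  assumes "left_module A M" "left_module A N"
    and "infinite (UNIV :: 'm set)" "lepoll (carrier M) (UNIV :: 'm set)" "lepoll (carrier N) (UNIV :: 'm set)"
  obtains D :: "('a, 'm) module" and p q j where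
    "left_module A D" "mod_lin A D M p" "mod_lin A D N q"
    "\<And>x y. \<lbrakk>x \<in> carrier M; y \<in> carrier N\<rbrakk> \<Longrightarrow> j x y \<in> carrier D \<and> p (j x y) = x \<and> q (j x y) = y"
    "\<And>d. d \<in> carrier D \<Longrightarrow> j (p d) (q d) = d"
proof -
  interpret M: left_module A M by fact
  interpret N: left_module A N by fact
  define D0 :: "('a, 'b \<times> 'c) module" where
    "D0 = mk_module (carrier M \<times> carrier N) (\<zero>\<^bsub>M\<^esub>, \<zero>\<^bsub>N\<^esub>)
       (\<lambda>x y. (fst x \<oplus>\<^bsub>M\<^esub> fst y, snd x \<oplus>\<^bsub>N\<^esub> snd y)) (\<lambda>a x. (a \<odot>\<^bsub>M\<^esub> fst x, a \<odot>\<^bsub>N\<^esub> snd x))"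
  have lm: "left_module A D0"
    by (intro left_moduleI) (auto simp: D0_def M.a_assoc M.a_comm M.smult_closed M.smult_assoc
        M.smult_one M.ring_axioms M.smult_l_distr M.smult_r_distr M.smult_minus_one M.l_neg
        M.r_neg N.r_neg M.a_lcomm N.a_lcomm N.a_assoc N.a_comm N.smult_closed N.smult_assoc
        N.smult_one N.smult_l_distr N.smult_r_distr N.smult_minus_one N.l_neg)
  have "lepoll (carrier D0) (UNIV :: 'm set)"
    by (simp add: D0_def prod_lepoll_infinite assms)
  from ex_transport[OF lm this]
  obtain D :: "('a, 'm) module" and f g where D: "left_module A D" "lin_iso A D0 D f g" by blast
  note i = lin_isoD[OF D(2)]
  have "mod_lin A D0 M fst" "mod_lin A D0 N snd"
    by (auto simp: D0_def mod_lin_def)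
  then have "mod_lin A D M (\<lambda>x. fst (g x))" "mod_lin A D N (\<lambda>x. snd (g x))"
    using i(2) by (auto intro: mod_lin_comp)
  then show thesis
    by (rule that[OF D(1), where j = "\<lambda>x y. f (x, y)"]) (use i in \<open>auto simp: D0_def\<close>)
qed

section \<open>Projective modules and projective dimension\<close>

lemma surj_onE: "g ` V = W \<Longrightarrow> y \<in> W \<Longrightarrow> (\<And>x. x \<in> V \<Longrightarrow> g x = y \<Longrightarrow> thesis) \<Longrightarrow> thesis"
  by blast

text \<open>Lifting against modules of other types, provided that the source of the surjection fits
  into \<open>'m\<close>: both modules are replaced by copies in \<open>'m\<close>.\<close>

lemma projective_lift:
  fixes P :: "('a, 'p) module" and M :: "('a, 'b) module" and N :: "('a, 'c) module"
  assumes P: "projective_module TYPE('m) A P" and M: "left_module A M" and N: "left_module A N"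
    and le: "lepoll (carrier M) (UNIV :: 'm set)"
    and g: "mod_lin A M N g" "g ` carrier M = carrier N" and f: "mod_lin A P N f"
  obtains h where "mod_lin A P M h" "\<And>x. x \<in> carrier P \<Longrightarrow> g (h x) = f x"
proof -
  \<comment> \<open>The target of a surjection is no larger than its source, so only
    \<open>M\<close> needs a size hypothesis.\<close>
  have le': "lepoll (carrier N) (UNIV :: 'm set)"
    using le g(2) image_lepoll lepoll_trans by metis
  obtain M' :: "('a, 'm) module" and i i' where M': "left_module A M'" "lin_iso A M M' i i'"
    using ex_transport[OF M le] by blast
  obtain N' :: "('a, 'm) module" and j j' where N': "left_module A N'" "lin_iso A N N' j j'"
    using ex_transport[OF N le'] by blast
  note i = lin_isoD[OF M'(2)] and j = lin_isoD[OF N'(2)]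
  have lP: "left_module A P" using P by (simp add: projective_module_def)
  let ?g = "\<lambda>x\<in>carrier M'. j (g (i' x))" and ?f = "\<lambda>x\<in>carrier P. j (f x)"
  have g': "?g \<in> mod_hom A M' N'"
    by (intro mod_hom_restrict M' mod_lin_comp[OF mod_lin_comp[OF i(2) g(1)] j(1)])
  have f': "?f \<in> mod_hom A P N'"
    by (intro mod_hom_restrict lP mod_lin_comp[OF f j(1)])
  have "?g ` carrier M' = carrier N'"
  proof (intro equalityI subsetI)
    fix y assume y: "y \<in> carrier N'"
    then have "j' y \<in> g ` carrier M" by (simp add: g(2) j(6))
    then obtain x where x: "x \<in> carrier M" "g x = j' y" by auto
    then have "?g (i x) = y" using y by (simp add: i(3,5) j(4))
    then show "y \<in> ?g ` carrier M'" using i(5)[OF x(1)] by blast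
  next
    fix y assume "y \<in> ?g ` carrier M'"
    then obtain x where "x \<in> carrier M'" "y = j (g (i' x))" by auto
    then show "y \<in> carrier N'" by (simp add: j(5) i(6) mod_linD(1)[OF g(1)])
  qed
  with P M' N' g' f' obtain h where h: "h \<in> mod_hom A P M'" "\<forall>x\<in>carrier P. ?g (h x) = ?f x"
    unfolding projective_module_def by metis
  note hl = mod_hom_lin[OF h(1)]
  show thesis
  proof (rule that[OF mod_lin_comp[OF hl i(2)]])
    fix x assume x: "x \<in> carrier P"
    then have "j (g (i' (h x))) = j (f x)"
      using h(2) by (simp add: mod_linD(1)[OF hl])
    then have "j' (j (g (i' (h x)))) = j' (j (f x))" by simp
    then show "g (i' (h x)) = f x"
      using x by (simp add: j(3) mod_linD(1)[OF f] mod_linD(1)[OF g(1)] mod_linD(1)[OF hl] i(6))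
  qed
qed

text \<open>
  Projectivity up to \<open>S\<close>, and below projective dimension up to \<open>S\<close>: with \<open>S = {1}\<close> these are the
  usual notions. With \<open>S\<close> the complement of a prime ideal \<open>q\<close> they describe, for finitely generated
  modules, the situation after localization at \<open>q\<close>, without any localized module.
\<close>

definition sproj ::
    "'m itself \<Rightarrow> 'a set \<Rightarrow> ('a, 'x) ring_scheme \<Rightarrow> ('a, 'p) module \<Rightarrow> bool" where
  "sproj U S A P \<longleftrightarrow> left_module A P \<and>
     (\<forall>(M :: ('a, 'm) module) (N :: ('a, 'm) module) g f.
        left_module A M \<longrightarrow> left_module A N \<longrightarrow>
        mod_lin A M N g \<longrightarrow> g ` carrier M = carrier N \<longrightarrow> mod_lin A P N f \<longrightarrow>
        (\<exists>s\<in>S. \<exists>h. mod_lin A P M h \<and> (\<forall>x\<in>carrier P. g (h x) = s \<odot>\<^bsub>N\<^esub> f x)))"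

lemma projective_imp_left_module: "projective_module U A P \<Longrightarrow> left_module A P"
  by (simp add: projective_module_def)

lemma projective_lift_same:
  fixes P :: "('a, 'p) module" and M :: "('a, 'm) module" and N :: "('a, 'c) module"
  assumes "projective_module TYPE('m) A P" "left_module A M" "left_module A N"
    and "mod_lin A M N g" "g ` carrier M = carrier N" "mod_lin A P N f"
  obtains h where "mod_lin A P M h" "\<And>x. x \<in> carrier P \<Longrightarrow> g (h x) = f x"
  using projective_lift[OF assms(1-3) subset_imp_lepoll[OF subset_UNIV] assms(4-6)] by blast

lemma projectiveI:
  assumes "left_module A P"
    and "\<And>(M :: ('a, 'm) module) (N :: ('a, 'm) module) g f.
      \<lbrakk>left_module A M; left_module A N; mod_lin A M N g; g ` carrier M = carrier N;
       mod_lin A P N f\<rbrakk> \<Longrightarrow> \<exists>h. mod_lin A P M h \<and> (\<forall>x\<in>carrier P. g (h x) = f x)"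
  shows "projective_module TYPE('m) A (P :: ('a, 'p) module)"
  unfolding projective_module_def
proof (intro conjI assms(1) allI impI)
  fix M N :: "('a, 'm) module" and g f
  assume *: "left_module A M" "left_module A N" "g \<in> mod_hom A M N" "g ` carrier M = carrier N"
    "f \<in> mod_hom A P N"
  with assms(2) obtain h where h: "mod_lin A P M h" "\<forall>x\<in>carrier P. g (h x) = f x"
    by (metis mod_hom_lin)
  then show "\<exists>h\<in>mod_hom A P M. \<forall>x\<in>carrier P. g (h x) = f x"
    by (intro bexI[of _ "restrict h (carrier P)"] mod_hom_restrict[OF assms(1) h(1)]) auto
qed

lemma sproj_one_iff: "sproj TYPE('m) {\<one>\<^bsub>A\<^esub>} A P \<longleftrightarrow> projective_module TYPE('m) A P"
proof
  assume p: "projective_module TYPE('m) A P"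
  show "sproj TYPE('m) {\<one>\<^bsub>A\<^esub>} A P"
    unfolding sproj_def
  proof (intro conjI allI impI bexI[of _ "\<one>\<^bsub>A\<^esub>"])
    fix M N :: "('a, 'm) module" and g f
    assume *: "left_module A M" "left_module A N" "mod_lin A M N g" "g ` carrier M = carrier N"
      "mod_lin A P N f"
    obtain h where "mod_lin A P M h" "\<And>x. x \<in> carrier P \<Longrightarrow> g (h x) = f x"
      using projective_lift_same[OF p *] by blast
    then show "\<exists>h. mod_lin A P M h \<and> (\<forall>x\<in>carrier P. g (h x) = \<one>\<^bsub>A\<^esub> \<odot>\<^bsub>N\<^esub> f x)"
      using left_module.smult_one[OF *(2)] mod_linD(1)[OF *(5)] by auto
  qed (use p projective_imp_left_module in auto)
next
  assume p: "sproj TYPE('m) {\<one>\<^bsub>A\<^esub>} A P"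
  show "projective_module TYPE('m) A P"
  proof (rule projectiveI)
    fix M N :: "('a, 'm) module" and g f
    assume *: "left_module A M" "left_module A N" "mod_lin A M N g" "g ` carrier M = carrier N"
      "mod_lin A P N f"
    then obtain h where "mod_lin A P M h" "\<forall>x\<in>carrier P. g (h x) = \<one>\<^bsub>A\<^esub> \<odot>\<^bsub>N\<^esub> f x"
      using p unfolding sproj_def by blast
    then show "\<exists>h. mod_lin A P M h \<and> (\<forall>x\<in>carrier P. g (h x) = f x)"
      using left_module.smult_one[OF *(2)] mod_linD(1)[OF *(5)] by auto
  qed (use p in \<open>auto simp: sproj_def\<close>)
qed

text \<open>Denominators from \<open>S\<close> are permitted only in the last syzygy. The earlier
  terms are honestly projective, so lifting along them costs no denominator.\<close>

primrec pd_le ::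
    "'a set \<Rightarrow> ('a, 'x) ring_scheme \<Rightarrow> nat \<Rightarrow> ('a, 'm) module \<Rightarrow> bool" where
  "pd_le S A 0 = sproj TYPE('m) S A"
| "pd_le S A (Suc n) = (\<lambda>M. left_module A M \<and> (\<exists>P \<pi>. projective_module TYPE('m) A P \<and>
     mod_lin A P M \<pi> \<and> \<pi> ` carrier P = carrier M \<and> pd_le S A n (ker_mod P M \<pi>)))"

lemma sproj_iso:
  assumes "sproj TYPE('m) S A P" "left_module A P'" "lin_iso A P P' i i'"
  shows "sproj TYPE('m) S A P'"
  unfolding sproj_def
proof (intro conjI assms(2) allI impI)
  fix M N :: "('a, 'm) module" and g f
  assume *: "left_module A M" "left_module A N" "mod_lin A M N g" "g ` carrier M = carrier N"
    "mod_lin A P' N f"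
  note i = lin_isoD[OF assms(3)]
  obtain s h where h: "s \<in> S" "mod_lin A P M h" "\<And>x. x \<in> carrier P \<Longrightarrow> g (h x) = s \<odot>\<^bsub>N\<^esub> f (i x)"
    using assms(1) *(1-4) mod_lin_comp[OF i(1) *(5)] unfolding sproj_def by blast
  show "\<exists>s\<in>S. \<exists>h. mod_lin A P' M h \<and> (\<forall>x\<in>carrier P'. g (h x) = s \<odot>\<^bsub>N\<^esub> f x)"
    using h i mod_lin_comp[OF i(2) h(2)] by (intro bexI[of _ s] exI[of _ "\<lambda>x. h (i' x)"]) auto
qed

lemma projective_iso:
  assumes "projective_module TYPE('m) A P" "left_module A P'" "lin_iso A P P' i i'"
  shows "projective_module TYPE('m) A P'"
  using sproj_iso[of "{\<one>\<^bsub>A\<^esub>}"] assms by (metis sproj_one_iff)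

lemma projective_zero:
  assumes "left_module A P" "carrier P = {\<zero>\<^bsub>P\<^esub>}"
  shows "projective_module TYPE('m) A P"
proof (rule projectiveI[OF assms(1)])
  fix M N :: "('a, 'm) module" and g f
  assume *: "left_module A M" "left_module A N" "mod_lin A M N g" "mod_lin A P N f"
  show "\<exists>h. mod_lin A P M h \<and> (\<forall>x\<in>carrier P. g (h x) = f x)"
    using mod_lin_zero_map[OF *(1), of P] mod_lin_zero[OF *(1-3)] mod_lin_zero[OF assms(1) *(2,4)]
      assms(2) by (intro exI[of _ "\<lambda>x. \<zero>\<^bsub>M\<^esub>"]) auto
qed

text \<open>A map out of the sum is the sum of its restrictions to the two summands, and these are
  lifted separately.\<close>

lemma projective_direct_sum:
  assumes "projective_module TYPE('m) A M" "projective_module TYPE('m) A N"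
    and "left_module A D" "mod_lin A D M p" "mod_lin A D N q"
    "\<And>x y. \<lbrakk>x \<in> carrier M; y \<in> carrier N\<rbrakk> \<Longrightarrow> j x y \<in> carrier D \<and> p (j x y) = x \<and> q (j x y) = y"
    "\<And>d. d \<in> carrier D \<Longrightarrow> j (p d) (q d) = d"
  shows "projective_module TYPE('m) A D"
proof (rule projectiveI[OF assms(3)])
  fix V Y :: "('a, 'm) module" and g f
  assume *: "left_module A V" "left_module A Y" "mod_lin A V Y g" "g ` carrier V = carrier Y"
    "mod_lin A D Y f"
  have lM: "left_module A M" and lN: "left_module A N"
    using projective_imp_left_module[OF assms(1)] projective_imp_left_module[OF assms(2)] by auto
  interpret M: left_module A M by fact
  interpret N: left_module A N by fact
  interpret D: left_module A D by fact
  interpret Y: left_module A Y by fact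
  note p = mod_linD[OF assms(4)] and q = mod_linD[OF assms(5)] and j = assms(6) assms(7)
  have eqD: "d = d'" if "d \<in> carrier D" "d' \<in> carrier D" "p d = p d'" "q d = q d'" for d d'
    using that j(2) by metis
  have ja: "j (x \<oplus>\<^bsub>M\<^esub> x') (y \<oplus>\<^bsub>N\<^esub> y') = j x y \<oplus>\<^bsub>D\<^esub> j x' y'"
    if "x \<in> carrier M" "x' \<in> carrier M" "y \<in> carrier N" "y' \<in> carrier N" for x x' y y'
    by (rule eqD) (use that j(1) p q in auto)
  have js: "j (a \<odot>\<^bsub>M\<^esub> x) (a \<odot>\<^bsub>N\<^esub> y) = a \<odot>\<^bsub>D\<^esub> j x y"
    if "a \<in> carrier A" "x \<in> carrier M" "y \<in> carrier N" for a x y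
    by (rule eqD) (use that j(1) p q M.smult_closed N.smult_closed D.smult_closed in auto)
  have "mod_lin A M D (\<lambda>x. j x \<zero>\<^bsub>N\<^esub>)"
    using j(1) ja[of _ _ "\<zero>\<^bsub>N\<^esub>" "\<zero>\<^bsub>N\<^esub>"] js[of _ _ "\<zero>\<^bsub>N\<^esub>"]
    by (intro mod_linI) (auto simp: N.smult_zero_right)
  then have 1: "mod_lin A M Y (\<lambda>x. f (j x \<zero>\<^bsub>N\<^esub>))" using *(5) mod_lin_comp by blast
  have "mod_lin A N D (\<lambda>x. j \<zero>\<^bsub>M\<^esub> x)"
    using j(1) ja[of "\<zero>\<^bsub>M\<^esub>" "\<zero>\<^bsub>M\<^esub>"] js[of _ "\<zero>\<^bsub>M\<^esub>"]
    by (intro mod_linI) (auto simp: M.smult_zero_right)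
  then have 2: "mod_lin A N Y (\<lambda>x. f (j \<zero>\<^bsub>M\<^esub> x))" using *(5) mod_lin_comp by blast
  obtain h1 where h1: "mod_lin A M V h1" "\<And>x. x \<in> carrier M \<Longrightarrow> g (h1 x) = f (j x \<zero>\<^bsub>N\<^esub>)"
    using projective_lift_same[OF assms(1) *(1-4) 1] by metis
  obtain h2 where h2: "mod_lin A N V h2" "\<And>x. x \<in> carrier N \<Longrightarrow> g (h2 x) = f (j \<zero>\<^bsub>M\<^esub> x)"
    using projective_lift_same[OF assms(2) *(1-4) 2] by metis
  have "f d = f (j (p d) \<zero>\<^bsub>N\<^esub>) \<oplus>\<^bsub>Y\<^esub> f (j \<zero>\<^bsub>M\<^esub> (q d))" if "d \<in> carrier D" for d
  proof -
    have "j (p d) \<zero>\<^bsub>N\<^esub> \<oplus>\<^bsub>D\<^esub> j \<zero>\<^bsub>M\<^esub> (q d) = d"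
      using ja[of "p d" "\<zero>\<^bsub>M\<^esub>" "\<zero>\<^bsub>N\<^esub>" "q d"] that by (simp add: j(2) p(1) q(1))
    then show ?thesis
      using mod_linD(2)[OF *(5), of "j (p d) \<zero>\<^bsub>N\<^esub>" "j \<zero>\<^bsub>M\<^esub> (q d)"] that
      by (simp add: j(1) p(1) q(1))
  qed
  then show "\<exists>h. mod_lin A D V h \<and> (\<forall>x\<in>carrier D. g (h x) = f x)"
    using mod_lin_add[OF assms(3) *(1) mod_lin_comp[OF assms(4) h1(1)] mod_lin_comp[OF assms(5) h2(1)]]
      h1 h2 p(1) q(1) mod_linD[OF *(3)] mod_linD(1)[OF h1(1)] mod_linD(1)[OF h2(1)]
    by (intro exI[of _ "\<lambda>x. h1 (p x) \<oplus>\<^bsub>V\<^esub> h2 (q x)"]) auto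
qed

lemma ideal_module_simps [simp]:
  "carrier (ideal_module A J) = J" "\<zero>\<^bsub>ideal_module A J\<^esub> = \<zero>\<^bsub>A\<^esub>"
  "add (ideal_module A J) = add A" "smult (ideal_module A J) = monoid.mult A"
  "monoid.mult (ideal_module A J) = monoid.mult A" "one (ideal_module A J) = one A"
  by (simp_all add: ideal_module_def)

lemma left_module_regular: "ring A \<Longrightarrow> left_module A (ideal_module A (carrier A))"
proof -
  assume "ring A"
  then interpret ring A .
  show ?thesis
    by (intro left_moduleI) (auto simp: ring_axioms a_ac m_assoc l_distr r_distr l_minus l_neg r_neg)
qed

lemma projective_regular:
  assumes "ring A"
  shows "projective_module TYPE('m) A (ideal_module A (carrier A))"
proof (rule projectiveI[OF left_module_regular[OF assms]])
  interpret ring A by fact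
  fix M N :: "('a, 'm) module" and g f
  assume *: "left_module A M" "left_module A N" "mod_lin A M N g" "g ` carrier M = carrier N"
    "mod_lin A (ideal_module A (carrier A)) N f"
  interpret M: left_module A M by fact
  note f = mod_linD[OF *(5), simplified]
  obtain x where x: "x \<in> carrier M" "g x = f \<one>\<^bsub>A\<^esub>"
    using surj_onE[OF *(4) f(1)[OF one_closed]] by metis
  have "g (a \<odot>\<^bsub>M\<^esub> x) = f a" if "a \<in> carrier A" for a
    using f(3)[of a "\<one>\<^bsub>A\<^esub>"] x that mod_linD(3)[OF *(3)] by simp
  then show "\<exists>h. mod_lin A (ideal_module A (carrier A)) M h \<and>
      (\<forall>x\<in>carrier (ideal_module A (carrier A)). g (h x) = f x)"
    using x by (intro exI[of _ "\<lambda>a. a \<odot>\<^bsub>M\<^esub> x"])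
      (auto intro!: mod_linI simp: M.smult_closed M.smult_l_distr M.smult_assoc)
qed

subsection \<open>Projective resolutions\<close>

lemma projective_resolutionD:
  fixes M :: "('a, 'm) module"
  assumes "projective_resolution A M n P d"
  shows "projective_module TYPE('m) A (P i)" "n < i \<Longrightarrow> carrier (P i) = {\<zero>\<^bsub>P i\<^esub>}"
    "d 0 \<in> mod_hom A (P 0) M" "d 0 ` carrier (P 0) = carrier M"
    "d (Suc 0) ` carrier (P (Suc 0)) = {x \<in> carrier (P 0). d 0 x = \<zero>\<^bsub>M\<^esub>}"
    "d (Suc i) \<in> mod_hom A (P (Suc i)) (P i)"
    "d (Suc (Suc i)) ` carrier (P (Suc (Suc i))) =
        {x \<in> carrier (P (Suc i)). d (Suc i) x = \<zero>\<^bsub>P i\<^esub>}"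
  using assms by (simp_all add: projective_resolution_def)

text \<open>Dropping the first term of a resolution of \<open>M\<close> leaves a resolution of the
  kernel of \<open>d 0\<close>. In length 0 the term \<open>P 1\<close> vanishes, so
  \<open>d 0\<close> is an isomorphism from a projective module to \<open>M\<close>.\<close>

lemma projective_resolution_imp_pd_le:
  fixes M :: "('a, 'm) module"
  assumes "projective_resolution A M n P d" "left_module A M"
  shows "pd_le {\<one>\<^bsub>A\<^esub>} A n M"
  using assms
proof (induction n arbitrary: M P d)
  case (0 M P d)
  note r = projective_resolutionD[OF 0(1)]
  have lP: "left_module A (P i)" for i by (rule projective_imp_left_module[OF r(1)])
  note d0 = mod_hom_lin[OF r(3)] and d1 = mod_hom_lin[OF r(6)[of 0]]
  have "{x \<in> carrier (P 0). d 0 x = \<zero>\<^bsub>M\<^esub>} = {\<zero>\<^bsub>P 0\<^esub>}"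
    using r(5) r(2)[of 1] mod_lin_zero[OF lP lP d1] by simp
  then have "inj_on (d 0) (carrier (P 0))"
    unfolding mod_lin_inj_iff[OF lP 0(2) d0] by blast
  then have "lin_iso A (P 0) M (d 0) (inv_into (carrier (P 0)) (d 0))"
    by (intro lin_iso_of_bij lP d0) (simp add: bij_betw_def r(4))
  then have "projective_module TYPE('m) A M"
    by (rule projective_iso[OF r(1) 0(2)])
  then show ?case by (simp add: sproj_one_iff)
next
  case (Suc n M P d)
  note r = projective_resolutionD[OF Suc(2)]
  have lP: "left_module A (P i)" for i by (rule projective_imp_left_module[OF r(1)])
  note d0 = mod_hom_lin[OF r(3)]
  let ?K = "ker_mod (P 0) M (d 0)"
  have K: "left_module A ?K" by (rule left_module_ker[OF lP lP Suc(3) d0])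
  note d1 = r(6)[of 0]
  have im: "d (Suc 0) ` carrier (P (Suc 0)) = carrier ?K" by (simp add: ker_set_def r(5))
  have d1': "d (Suc 0) \<in> mod_hom A (P (Suc 0)) ?K"
    using d1 mod_lin_restrict_cod[OF mod_hom_lin[OF d1], of "ker_set (P 0) M (d 0)"] im
    by (simp add: mod_hom_iff)
  have "projective_resolution A ?K n (\<lambda>i. P (Suc i)) (\<lambda>i. d (Suc i))"
    unfolding projective_resolution_def using d1' im by (simp add: r(1,2,6,7))
  from Suc(1)[OF this K] show ?case
    unfolding pd_le.simps using Suc(3) r(1) d0 r(4) by blast
qed

lemma pd_le_imp_projective_resolution:
  fixes M :: "('a, 'm) module"
  assumes "pd_le {\<one>\<^bsub>A\<^esub>} A n M"
  shows "\<exists>P d. projective_resolution A M n P d"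
  using assms
proof (induction n arbitrary: M)
  case (0 M)
  then have p: "projective_module TYPE('m) A M" by (simp add: sproj_one_iff)
  then have l: "left_module A M" by (rule projective_imp_left_module)
  \<comment> \<open>Resolutions are indexed by all natural numbers; the zero submodule fills the
    positions beyond the length.\<close>
  let ?Z = "M\<lparr>carrier := {\<zero>\<^bsub>M\<^esub>}\<rparr>"
  have Z: "left_module A ?Z" by (rule submod_left_module[OF l submod_zero[OF l]])
  have pZ: "projective_module TYPE('m) A ?Z" by (rule projective_zero[OF Z]) simp
  have zM: "\<zero>\<^bsub>M\<^esub> \<in> carrier M" using submod_zero[OF l] by (simp add: submod_def)
  define P where "P i = (if i = 0 then M else ?Z)" for i :: nat
  define d where "d i = (if i = 0 then (\<lambda>x\<in>carrier M. x) else (\<lambda>x\<in>{\<zero>\<^bsub>M\<^esub>}. x))" for i :: nat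
  have 1: "(\<lambda>x\<in>carrier M. x) \<in> mod_hom A M M" by (rule mod_hom_restrict[OF l mod_lin_id])
  have 2: "(\<lambda>x\<in>{\<zero>\<^bsub>M\<^esub>}. x) \<in> mod_hom A ?Z M"
    using mod_hom_restrict[OF Z mod_lin_incl[OF submod_zero[OF l]]] by simp
  have 3: "(\<lambda>x\<in>{\<zero>\<^bsub>M\<^esub>}. x) \<in> mod_hom A ?Z ?Z"
    using mod_hom_restrict[OF Z mod_lin_id] by simp
  have "projective_resolution A M 0 P d"
    unfolding projective_resolution_def
    using p pZ zM 1 2 3 by (auto simp: P_def d_def)
  then show ?case by blast
next
  case (Suc n M)
  then obtain P0 :: "('a, 'm) module" and \<pi> where P0: "projective_module TYPE('m) A P0" "mod_lin A P0 M \<pi>"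
    "\<pi> ` carrier P0 = carrier M" "pd_le {\<one>\<^bsub>A\<^esub>} A n (ker_mod P0 M \<pi>)" "left_module A M"
    unfolding pd_le.simps by blast
  have l0: "left_module A P0" by (rule projective_imp_left_module[OF P0(1)])
  have sub: "submod A P0 (ker_set P0 M \<pi>)" by (rule submod_ker[OF l0 P0(5,2)])
  obtain P d where r: "projective_resolution A (ker_mod P0 M \<pi>) n P d"
    using Suc(1)[OF P0(4)] by blast
  note r = projective_resolutionD[OF r]
  define P' where "P' = case_nat P0 P"
  define d' where "d' = case_nat (\<lambda>x\<in>carrier P0. \<pi> x) d"
  have e0: "(\<lambda>x\<in>carrier P0. \<pi> x) \<in> mod_hom A P0 M" by (rule mod_hom_restrict[OF l0 P0(2)])
  have e1: "d 0 \<in> mod_hom A (P 0) P0"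
    using r(3) by (auto simp: mod_hom_iff intro: mod_lin_extend_cod[OF sub])
  have "carrier (P' i) = {\<zero>\<^bsub>P' i\<^esub>}" if "Suc n < i" for i
    using that r(2) by (cases i) (simp_all add: P'_def)
  moreover have "projective_module TYPE('m) A (P' i)" for i
    using r(1) P0(1) by (cases i) (simp_all add: P'_def)
  moreover have "d' (Suc i) \<in> mod_hom A (P' (Suc i)) (P' i)" for i
    using r(6) e1 by (cases i) (simp_all add: P'_def d'_def)
  moreover have "d' (Suc (Suc i)) ` carrier (P' (Suc (Suc i))) =
        {x \<in> carrier (P' (Suc i)). d' (Suc i) x = \<zero>\<^bsub>P' i\<^esub>}" for i
    using r(5,7) by (cases i) (simp_all add: P'_def d'_def)
  moreover have "d 0 ` carrier (P 0) = {x \<in> carrier P0. (\<lambda>x\<in>carrier P0. \<pi> x) x = \<zero>\<^bsub>M\<^esub>}"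
    using r(4) by (auto simp: ker_set_def)
  ultimately have "projective_resolution A M (Suc n) P' d'"
    unfolding projective_resolution_def using P0(3) e0 by (simp add: P'_def d'_def)
  then show ?case by blast
qed

lemma projective_resolution_mono:
  "projective_resolution A M n P d \<Longrightarrow> n \<le> m \<Longrightarrow> projective_resolution A M m P d"
  by (auto simp: projective_resolution_def)

text \<open>A finite supremum is a common bound, and a resolution of length at most \<open>n\<close>
  also counts as one of length \<open>n\<close>. The right-hand side is the form in which finiteness
  is carried from one ring to another.\<close>

lemma gldim_finite_iff:
  "gldim TYPE('m) A < \<infinity> \<longleftrightarrow>
     (\<exists>n. \<forall>M :: ('a, 'm) module. left_module A M \<longrightarrow> pd_le {\<one>\<^bsub>A\<^esub>} A n M)"
proof
  assume "gldim TYPE('m) A < \<infinity>"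
  then obtain k where k: "gldim TYPE('m) A = enat k" by (cases "gldim TYPE('m) A") auto
  have "pd_le {\<one>\<^bsub>A\<^esub>} A k M" if M: "left_module A M" for M :: "('a, 'm) module"
  proof -
    have le: "projdim A M \<le> enat k"
      unfolding k[symmetric] gldim_def using M by (intro Sup_upper) blast
    have "\<exists>n\<le>k. \<exists>P d. projective_resolution A M n P d"
    proof (rule ccontr)
      assume "\<not> ?thesis"
      \<comment> \<open>If no resolution has length at most \<open>k\<close>, all lengths that occur
        are at least \<open>k + 1\<close>, and so is their infimum; this includes the case of the
        empty set.\<close>
      then have "enat (Suc k) \<le> projdim A M"
        unfolding projdim_def by (intro Inf_greatest) (auto simp: not_less_eq_eq)
      with le have "enat (Suc k) \<le> enat k" by (rule order_trans[rotated])
      then show False by simp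
    qed
    then show ?thesis
      using projective_resolution_mono projective_resolution_imp_pd_le[OF _ M] by blast
  qed
  then show "\<exists>n. \<forall>M :: ('a, 'm) module. left_module A M \<longrightarrow> pd_le {\<one>\<^bsub>A\<^esub>} A n M" by blast
next
  assume "\<exists>n. \<forall>M :: ('a, 'm) module. left_module A M \<longrightarrow> pd_le {\<one>\<^bsub>A\<^esub>} A n M"
  then obtain n where n: "\<And>M :: ('a, 'm) module. left_module A M \<Longrightarrow> pd_le {\<one>\<^bsub>A\<^esub>} A n M" by blast
  have "projdim A M \<le> enat n" if "left_module A M" for M :: "('a, 'm) module"
    unfolding projdim_def using pd_le_imp_projective_resolution[OF n[OF that]]
    by (intro Inf_lower) blast
  then have "gldim TYPE('m) A \<le> enat n"
    unfolding gldim_def by (intro Sup_least) blast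
  also have "enat n < \<infinity>" by simp
  finally show "gldim TYPE('m) A < \<infinity>" .
qed

text \<open>Instantiated below with \<open>Rel N N'\<close> saying that \<open>N'\<close> is the value at \<open>N\<close> of some exact functor.\<close>

lemma pd_le_transfer:
  fixes Rel :: "('a, 'm) module \<Rightarrow> ('b, 'm) module \<Rightarrow> bool"
  assumes mod: "\<And>N N'. Rel N N' \<Longrightarrow> left_module B N'"
    and proj: "\<And>P P'. \<lbrakk>Rel P P'; projective_module TYPE('m) A P\<rbrakk> \<Longrightarrow> projective_module TYPE('m) B P'"
    and ses: "\<And>P N N' \<pi>. \<lbrakk>Rel N N'; left_module A N; projective_module TYPE('m) A P;
        mod_lin A P N \<pi>; \<pi> ` carrier P = carrier N\<rbrakk> \<Longrightarrow>
      \<exists>P' \<pi>'. Rel P P' \<and> mod_lin B P' N' \<pi>' \<and> \<pi>' ` carrier P' = carrier N' \<and>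
        Rel (ker_mod P N \<pi>) (ker_mod P' N' \<pi>')"
    and "Rel N N'" "pd_le {\<one>\<^bsub>A\<^esub>} A n N"
  shows "pd_le {\<one>\<^bsub>B\<^esub>} B n N'"
  using assms(4,5)
proof (induction n arbitrary: N N')
  case 0
  then show ?case using proj by (simp add: sproj_one_iff)
next
  case (Suc n)
  then obtain P :: "('a, 'm) module" and \<pi> where P: "projective_module TYPE('m) A P" "mod_lin A P N \<pi>"
    "\<pi> ` carrier P = carrier N" "pd_le {\<one>\<^bsub>A\<^esub>} A n (ker_mod P N \<pi>)" "left_module A N"
    unfolding pd_le.simps by blast
  obtain P' :: "('b, 'm) module" and \<pi>' where "Rel P P'" "mod_lin B P' N' \<pi>'" "\<pi>' ` carrier P' = carrier N'"
    "Rel (ker_mod P N \<pi>) (ker_mod P' N' \<pi>')"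
    using ses[OF Suc(2) P(5,1-3)] by blast
  then show ?case
    using Suc(1)[OF _ P(4)] proj[OF _ P(1)] mod[OF Suc(2)] unfolding pd_le.simps by blast
qed

section \<open>Noetherian modules\<close>

definition gen :: "('a, 'x) ring_scheme \<Rightarrow> ('a, 'm) module \<Rightarrow> 'm set \<Rightarrow> 'm set" where
  "gen A M S = \<Inter>{H. submod A M H \<and> S \<subseteq> H}"

text \<open>Generation takes place inside the ambient module, so submodules of \<open>M\<close> can
  be treated as sets without forming smaller modules.\<close>

definition fgen :: "('a, 'x) ring_scheme \<Rightarrow> ('a, 'm) module \<Rightarrow> 'm set \<Rightarrow> bool" where
  "fgen A M H \<longleftrightarrow> (\<exists>S. finite S \<and> S \<subseteq> carrier M \<and> gen A M S = H)"

definition noeth :: "('a, 'x) ring_scheme \<Rightarrow> ('a, 'm) module \<Rightarrow> bool" where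
  "noeth A M \<longleftrightarrow> left_module A M \<and> (\<forall>H. submod A M H \<longrightarrow> fgen A M H)"

lemma gen_submod:
  assumes "left_module A M" "S \<subseteq> carrier M"
  shows "submod A M (gen A M S)"
proof -
  have "gen A M S \<subseteq> carrier M"
    unfolding gen_def using assms(2) submod_carrier[OF assms(1)] by blast
  then show ?thesis
    unfolding submod_def gen_def by (auto simp: subset_iff)
qed

lemma gen_incl: "S \<subseteq> gen A M S"
  by (auto simp: gen_def)

lemma gen_least: "submod A M H \<Longrightarrow> S \<subseteq> H \<Longrightarrow> gen A M S \<subseteq> H"
  by (auto simp: gen_def)

lemma gen_self: "submod A M H \<Longrightarrow> gen A M H = H"
  by (intro equalityI gen_least gen_incl subset_refl)

lemma gen_image:
  assumes "left_module A M" "left_module A N" "mod_lin A M N f" "S \<subseteq> carrier M"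
  shows "f ` gen A M S = gen A N (f ` S)"
proof (rule equalityI)
  have sub: "f ` S \<subseteq> carrier N" using assms(4) mod_linD(1)[OF assms(3)] by auto
  have "gen A M S \<subseteq> {x \<in> carrier M. f x \<in> gen A N (f ` S)}"
    using gen_incl[of "f ` S" A N] assms(4)
    by (intro gen_least submod_vimage[OF assms(1-3)] gen_submod[OF assms(2) sub]) auto
  then show "f ` gen A M S \<subseteq> gen A N (f ` S)" by blast
  show "gen A N (f ` S) \<subseteq> f ` gen A M S"
    by (intro gen_least submod_image[OF assms(1-3)] gen_submod assms image_mono gen_incl)
qed

lemma fgen_image:
  assumes "left_module A M" "left_module A N" "mod_lin A M N f" "fgen A M H"
  shows "fgen A N (f ` H)"
proof -
  obtain S where S: "finite S" "S \<subseteq> carrier M" "gen A M S = H"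
    using assms(4) by (auto simp: fgen_def)
  then show ?thesis
    unfolding fgen_def using gen_image[OF assms(1-3) S(2)] mod_linD(1)[OF assms(3)]
    by (intro exI[of _ "f ` S"]) auto
qed

lemma submod_sub_iff:
  "submod A M H \<Longrightarrow> submod A (M\<lparr>carrier := H\<rparr>) H' \<longleftrightarrow> submod A M H' \<and> H' \<subseteq> H"
  by (auto simp: submod_def)

lemma gen_sub:
  assumes "left_module A M" "submod A M H" "S \<subseteq> H"
  shows "gen A (M\<lparr>carrier := H\<rparr>) S = gen A M S"
proof (rule equalityI)
  have S: "S \<subseteq> carrier M" using assms by (auto simp: submod_def)
  show "gen A (M\<lparr>carrier := H\<rparr>) S \<subseteq> gen A M S"
    using gen_submod[OF assms(1) S] gen_incl[of S A M] gen_least[OF assms(2,3)]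
    by (intro gen_least) (auto simp: submod_sub_iff[OF assms(2)])
  have "submod A (M\<lparr>carrier := H\<rparr>) (gen A (M\<lparr>carrier := H\<rparr>) S)"
    by (rule gen_submod) (use assms submod_left_module in auto)
  then show "gen A M S \<subseteq> gen A (M\<lparr>carrier := H\<rparr>) S"
    by (intro gen_least gen_incl) (simp add: submod_sub_iff[OF assms(2)])
qed

lemma fgen_sub_iff:
  assumes "left_module A M" "submod A M H" "H' \<subseteq> H"
  shows "fgen A (M\<lparr>carrier := H\<rparr>) H' \<longleftrightarrow> fgen A M H'"
proof
  assume "fgen A (M\<lparr>carrier := H\<rparr>) H'"
  then show "fgen A M H'"
    using gen_sub[OF assms(1,2)] assms(2) unfolding fgen_def submod_def by fastforce
next
  assume "fgen A M H'"
  then obtain S where S: "finite S" "S \<subseteq> carrier M" "gen A M S = H'" by (auto simp: fgen_def)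
  then have "S \<subseteq> H" using assms(3) gen_incl[of S A M] by auto
  then show "fgen A (M\<lparr>carrier := H\<rparr>) H'"
    unfolding fgen_def using gen_sub[OF assms(1,2)] S by (intro exI[of _ S]) simp
qed

lemma noeth_left_module: "noeth A M \<Longrightarrow> left_module A M"
  by (simp add: noeth_def)

lemma noeth_sub: "noeth A M \<Longrightarrow> submod A M H \<Longrightarrow> noeth A (M\<lparr>carrier := H\<rparr>)"
  using submod_left_module[of A M H] fgen_sub_iff[of A M H]
  by (auto simp: noeth_def submod_sub_iff)

lemma noeth_surj_image:
  assumes "noeth A M" "left_module A N" "mod_lin A M N f" "f ` carrier M = carrier N"
  shows "noeth A N"
  unfolding noeth_def
proof (intro conjI allI impI assms(2))
  fix H assume H: "submod A N H"
  let ?V = "{x \<in> carrier M. f x \<in> H}"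
  have lM: "left_module A M" using assms(1) noeth_left_module by blast
  have "f ` ?V = H"
  proof
    show "H \<subseteq> f ` ?V"
    proof
      fix y assume y: "y \<in> H"
      with H have "y \<in> carrier N" by (rule submodD(1))
      then obtain x where "x \<in> carrier M" "f x = y" using surj_onE[OF assms(4)] by metis
      with y show "y \<in> f ` ?V" by blast
    qed
  qed auto
  moreover have "fgen A M ?V"
    using assms(1) submod_vimage[OF lM assms(2,3) H] by (simp add: noeth_def)
  ultimately show "fgen A N H"
    using fgen_image[OF lM assms(2,3), of ?V] by simp
qed

text \<open>Preimages of generators of the image, together with generators of the part killed by
  \<open>f\<close>, generate \<open>H\<close>: an element of \<open>H\<close> differs from a
  combination of the preimages by something in the kernel.\<close>

lemma fgen_extension:
  assumes lM: "left_module A M" and lN: "left_module A N" and f: "mod_lin A M N f"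
    and H: "submod A M H" and 1: "fgen A N (f ` H)" and 2: "fgen A M {x \<in> H. f x = \<zero>\<^bsub>N\<^esub>}"
  shows "fgen A M H"
proof -
  interpret M: left_module A M by fact
  interpret N: left_module A N by fact
  obtain T where T: "finite T" "T \<subseteq> carrier N" "gen A N T = f ` H" using 1 by (auto simp: fgen_def)
  have "T \<subseteq> f ` H" using T(3) gen_incl by metis
  then obtain T' where T': "finite T'" "T' \<subseteq> H" "T = f ` T'"
    using finite_subset_image[OF T(1)] by metis
  obtain S where S: "finite S" "S \<subseteq> carrier M" "gen A M S = {x \<in> H. f x = \<zero>\<^bsub>N\<^esub>}"
    using 2 by (auto simp: fgen_def)
  have SH: "S \<subseteq> H" using gen_incl[of S A M] S(3) by auto
  let ?G = "gen A M (S \<union> T')"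
  have sub: "S \<union> T' \<subseteq> carrier M" using S T' H by (auto simp: submod_def)
  have G: "submod A M ?G" by (rule gen_submod[OF lM sub])
  have "?G = H"
  proof
    show "?G \<subseteq> H" by (rule gen_least[OF H]) (use SH T' in auto)
    show "H \<subseteq> ?G"
    proof
      fix h assume h: "h \<in> H"
      have sT': "T' \<subseteq> carrier M" using sub by auto
      have "f h \<in> f ` gen A M T'"
        using h T(3) gen_image[OF lM lN f sT'] T'(3) by auto
      then obtain h' where h': "h' \<in> gen A M T'" "f h = f h'" by auto
      have h'G: "h' \<in> ?G" using h'(1) gen_least[OF G, of T'] gen_incl[of "S \<union> T'" A M] by auto
      have h'H: "h' \<in> H" using h'(1) gen_least[OF H T'(2)] by auto
      have c: "h \<in> carrier M" "h' \<in> carrier M" using h h'H submodD(1)[OF H] by auto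
      have "f (h \<ominus>\<^bsub>M\<^esub> h') = \<zero>\<^bsub>N\<^esub>"
        using mod_lin_diff[OF lM lN f c] h'(2) c mod_linD(1)[OF f] N.diff_zero_iff by auto
      then have "h \<ominus>\<^bsub>M\<^esub> h' \<in> gen A M S"
        using S(3) submod_diff[OF lM H h h'H] by simp
      also have "\<dots> \<subseteq> ?G" using gen_least[OF G, of S] gen_incl[of "S \<union> T'" A M] by auto
      finally have "(h \<ominus>\<^bsub>M\<^esub> h') \<oplus>\<^bsub>M\<^esub> h' \<in> ?G" using h'G submodD(3)[OF G] by simp
      moreover have "(h \<ominus>\<^bsub>M\<^esub> h') \<oplus>\<^bsub>M\<^esub> h' = h"
        using c by (simp add: M.minus_eq M.a_assoc M.l_neg)
      ultimately show "h \<in> ?G" by simp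
    qed
  qed
  then show ?thesis unfolding fgen_def using S(1) T'(1) sub by blast
qed

lemma noeth_carrier: "noeth A M \<Longrightarrow> fgen A M (carrier M)"
  by (simp add: noeth_def submod_carrier)

text \<open>A submodule of the sum is an extension of its image under \<open>q\<close> by its
  intersection with the kernel of \<open>q\<close>, and that kernel is a copy of
  \<open>M\<close>.\<close>

lemma noeth_direct_sum:
  assumes M: "noeth A M" and N: "noeth A N"
    and D: "left_module A D" and p: "mod_lin A D M p" and q: "mod_lin A D N q"
    and j: "\<And>x y. \<lbrakk>x \<in> carrier M; y \<in> carrier N\<rbrakk> \<Longrightarrow> j x y \<in> carrier D \<and> p (j x y) = x \<and> q (j x y) = y"
    "\<And>d. d \<in> carrier D \<Longrightarrow> j (p d) (q d) = d"
  shows "noeth A D"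
  unfolding noeth_def
proof (intro conjI allI impI D)
  fix H assume H: "submod A D H"
  have lM: "left_module A M" and lN: "left_module A N" using M N noeth_left_module by auto
  interpret M: left_module A M by fact
  interpret N: left_module A N by fact
  interpret D: left_module A D by fact
  let ?i = "\<lambda>x. j x \<zero>\<^bsub>N\<^esub>"
  have eqD: "d = d'" if "d \<in> carrier D" "d' \<in> carrier D" "p d = p d'" "q d = q d'" for d d'
    using that j(2) by metis
  have i: "mod_lin A M D ?i"
  proof (rule mod_linI)
    fix x y assume "x \<in> carrier M" "y \<in> carrier M"
    then show "?i (x \<oplus>\<^bsub>M\<^esub> y) = ?i x \<oplus>\<^bsub>D\<^esub> ?i y"
      by (intro eqD) (simp_all add: j(1) mod_linD(2)[OF p] mod_linD(2)[OF q])
  next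
    fix a x assume "a \<in> carrier A" "x \<in> carrier M"
    then show "?i (a \<odot>\<^bsub>M\<^esub> x) = a \<odot>\<^bsub>D\<^esub> ?i x"
      by (intro eqD) (simp_all add: j(1) mod_linD(3)[OF p] mod_linD(3)[OF q] M.smult_closed
          D.smult_closed N.smult_zero_right)
  qed (simp add: j(1))
  show "fgen A D H"
  proof (rule fgen_extension[OF D lN q H])
    show "fgen A N (q ` H)" using N submod_image[OF D lN q H] by (simp add: noeth_def)
    have "?i ` {x \<in> carrier M. ?i x \<in> H} = {x \<in> H. q x = \<zero>\<^bsub>N\<^esub>}"
    proof (intro equalityI subsetI)
      fix d assume d: "d \<in> {x \<in> H. q x = \<zero>\<^bsub>N\<^esub>}"
      then have "d \<in> carrier D" using submodD(1)[OF H] by auto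
      with d have "?i (p d) = d" "p d \<in> carrier M" using j(2)[of d] mod_linD(1)[OF p] by auto
      with d show "d \<in> ?i ` {x \<in> carrier M. ?i x \<in> H}" by (intro image_eqI[of _ _ "p d"]) auto
    qed (auto simp: j(1))
    moreover have "fgen A M {x \<in> carrier M. ?i x \<in> H}"
      using M submod_vimage[OF lM D i H] by (simp add: noeth_def)
    ultimately show "fgen A D {x \<in> H. q x = \<zero>\<^bsub>N\<^esub>}" using fgen_image[OF lM D i] by metis
  qed
qed

lemma noeth_zero_module:
  assumes "left_module A M" "carrier M = {\<zero>\<^bsub>M\<^esub>}"
  shows "noeth A M"
proof -
  have "gen A M {} = H" if H: "submod A M H" for H
  proof -
    have "H \<subseteq> {\<zero>\<^bsub>M\<^esub>}" using H unfolding submod_def assms(2) by blast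
    moreover have "\<zero>\<^bsub>M\<^esub> \<in> gen A M {}"
      by (rule submodD(2)[OF gen_submod[OF assms(1)]]) simp
    ultimately show ?thesis using gen_least[OF H, of "{}"] by blast
  qed
  then show ?thesis unfolding noeth_def fgen_def using assms(1) by blast
qed

lemma submod_regular_iff:
  assumes "cring R"
  shows "submod R (ideal_module R (carrier R)) I \<longleftrightarrow> ideal I R"
proof
  interpret cring R by fact
  assume "ideal I R"
  then interpret ideal I R .
  show "submod R (ideal_module R (carrier R)) I"
    using a_subset by (auto simp: submod_def I_l_closed)
next
  interpret cring R by fact
  assume s: "submod R (ideal_module R (carrier R)) I"
  note s' = submodD[OF s, simplified]
  have n: "\<ominus>\<^bsub>R\<^esub> x \<in> I" if "x \<in> I" for x
    using s'(4)[of "\<ominus>\<^bsub>R\<^esub> \<one>\<^bsub>R\<^esub>" x] s'(1)[OF that] that by (simp add: l_minus)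
  show "ideal I R"
  proof (rule idealI[OF ring_axioms])
    show "subgroup I (add_monoid R)"
      using s' n by (intro subgroup.intro) (auto simp: a_inv_def)
    show "\<And>a x. a \<in> I \<Longrightarrow> x \<in> carrier R \<Longrightarrow> x \<otimes>\<^bsub>R\<^esub> a \<in> I" using s'(4) by blast
    show "\<And>a x. a \<in> I \<Longrightarrow> x \<in> carrier R \<Longrightarrow> a \<otimes>\<^bsub>R\<^esub> x \<in> I" using s'(1,4) m_comm by metis
  qed
qed

lemma noeth_regular:
  assumes "cring R" "noetherian_ring R"
  shows "noeth R (ideal_module R (carrier R))"
proof -
  interpret cring R by fact
  interpret noetherian_ring R by fact
  have "fgen R (ideal_module R (carrier R)) I" if I: "ideal I R" for I
  proof -
    obtain S where "S \<subseteq> carrier R" "finite S" "I = Idl\<^bsub>R\<^esub> S"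
      using finetely_gen[OF I] by blast
    then show ?thesis
      unfolding fgen_def gen_def submod_regular_iff[OF assms(1)] genideal_def ideal_module_simps
      by blast
  qed
  then show ?thesis
    by (simp add: noeth_def submod_regular_iff[OF assms(1)] left_module_regular ring_axioms)
qed

subsection \<open>Finite free covers\<close>

text \<open>These are the finite sums of maps \<open>x \<mapsto> f x y\<close> with \<open>f\<close>
  a functional on \<open>J\<close>, that is, the image of the natural map from the tensor product of
  the dual of \<open>J\<close> with \<open>M\<close> into Hom(J, M). That the identity of
  \<open>J\<close> belongs to it, for \<open>M = J\<close>, is the statement that \<open>J\<close>
  has a finite dual basis. The inductive form avoids indexed families.\<close>

inductive_set dual_sums ::
    "('a, 'x) ring_scheme \<Rightarrow> ('a, 'c) module \<Rightarrow> ('a, 'b) module \<Rightarrow> ('c \<Rightarrow> 'b) set"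
  for A J M where
  base: "\<lbrakk>mod_lin A J (ideal_module A (carrier A)) f; y \<in> carrier M\<rbrakk> \<Longrightarrow>
    (\<lambda>x\<in>carrier J. f x \<odot>\<^bsub>M\<^esub> y) \<in> dual_sums A J M"
| add: "\<lbrakk>f \<in> dual_sums A J M; g \<in> dual_sums A J M\<rbrakk> \<Longrightarrow>
    (\<lambda>x\<in>carrier J. f x \<oplus>\<^bsub>M\<^esub> g x) \<in> dual_sums A J M"

text \<open>One copy of the ring is added for each element of \<open>S\<close>. The last clause
  records that a map \<open>J \<rightarrow> F\<close> has functionals as coordinates, so that its
  composite with \<open>\<pi>\<close> is a sum of functionals times elements of \<open>S\<close>;
  this is the source of the dual basis.\<close>

lemma ex_finite_free_cover:
  fixes M :: "('a, 'b) module" and J :: "('a, 'c) module"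
  assumes "large_universe TYPE('m) A" "left_module A M" "finite S" "S \<subseteq> carrier M"
    "left_module A J"
  shows "\<exists>(F :: ('a, 'm) module) \<pi>. projective_module TYPE('m) A F \<and> mod_lin A F M \<pi> \<and>
    S \<subseteq> \<pi> ` carrier F \<and> (noeth A (ideal_module A (carrier A)) \<longrightarrow> noeth A F) \<and>
    (\<forall>\<sigma>. mod_lin A J F \<sigma> \<longrightarrow> (\<lambda>x\<in>carrier J. \<pi> (\<sigma> x)) \<in> dual_sums A J M)"
  using assms(3,4)
proof (induction S)
  case empty
  interpret M: left_module A M by fact
  let ?F = "mk_module {undefined} undefined (\<lambda>_ _. undefined) (\<lambda>_ _. undefined) :: ('a, 'm) module"
  have F: "left_module A ?F" by (rule left_moduleI) (simp_all add: M.ring_axioms)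
  \<comment> \<open>\<open>dual_sums\<close> has no empty sum; the zero map enters as the zero
    functional times the zero element.\<close>
  have "(\<lambda>x\<in>carrier J. \<zero>\<^bsub>A\<^esub> \<odot>\<^bsub>M\<^esub> \<zero>\<^bsub>M\<^esub>) \<in> dual_sums A J M"
    using mod_lin_zero_map[OF left_module_regular[OF M.ring_axioms], of J]
    by (intro dual_sums.base) auto
  then have "(\<lambda>x\<in>carrier J. \<zero>\<^bsub>M\<^esub>) \<in> dual_sums A J M"
    by (simp add: M.smult_zero_left restrict_def)
  then show ?case
    by (intro exI[of _ ?F] exI[of _ "\<lambda>_. \<zero>\<^bsub>M\<^esub>"] conjI projective_zero noeth_zero_module impI allI
        mod_lin_zero_map F assms(2)) (simp_all add: restrict_def)
next
  case (insert s S)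
  interpret M: left_module A M by fact
  let ?A = "ideal_module A (carrier A)"
  have lA: "left_module A ?A" by (rule left_module_regular[OF M.ring_axioms])
  have s: "s \<in> carrier M" using insert by auto
  obtain F :: "('a, 'm) module" and \<pi> where F: "projective_module TYPE('m) A F" "mod_lin A F M \<pi>"
    "S \<subseteq> \<pi> ` carrier F" "noeth A ?A \<Longrightarrow> noeth A F"
    "\<And>\<sigma>. mod_lin A J F \<sigma> \<Longrightarrow> (\<lambda>x\<in>carrier J. \<pi> (\<sigma> x)) \<in> dual_sums A J M"
    using insert by blast
  have lF: "left_module A F" by (rule projective_imp_left_module[OF F(1)])
  interpret F: left_module A F by fact
  have "lepoll (carrier ?A) (UNIV :: 'm set)" "infinite (UNIV :: 'm set)"
    using assms(1) by (auto simp: large_universe_def)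
  then obtain D :: "('a, 'm) module" and p q j where D: "left_module A D" "mod_lin A D F p"
    "mod_lin A D ?A q"
    "\<And>x y. \<lbrakk>x \<in> carrier F; y \<in> carrier ?A\<rbrakk> \<Longrightarrow> j x y \<in> carrier D \<and> p (j x y) = x \<and> q (j x y) = y"
    "\<And>d. d \<in> carrier D \<Longrightarrow> j (p d) (q d) = d"
    using ex_direct_sum[OF lF lA _ subset_imp_lepoll[OF subset_UNIV]] by metis
  define \<psi> where "\<psi> d = \<pi> (p d) \<oplus>\<^bsub>M\<^esub> q d \<odot>\<^bsub>M\<^esub> s" for d
  have qs: "mod_lin A ?A M (\<lambda>a. a \<odot>\<^bsub>M\<^esub> s)"
    using s by (auto intro!: mod_linI simp: M.smult_closed M.smult_l_distr M.smult_assoc)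
  have \<psi>: "mod_lin A D M \<psi>"
    unfolding \<psi>_def
    by (rule mod_lin_add[OF D(1) assms(2) mod_lin_comp[OF D(2) F(2)] mod_lin_comp[OF D(3) qs]])
  have \<pi>0: "\<pi> \<zero>\<^bsub>F\<^esub> = \<zero>\<^bsub>M\<^esub>" by (rule mod_lin_zero[OF lF assms(2) F(2)])
  have "insert s S \<subseteq> \<psi> ` carrier D"
  proof (rule insert_subsetI)
    have "\<psi> (j \<zero>\<^bsub>F\<^esub> \<one>\<^bsub>A\<^esub>) = s" using s \<pi>0 by (simp add: \<psi>_def D(4) M.smult_one)
    then show "s \<in> \<psi> ` carrier D" using D(4)[of "\<zero>\<^bsub>F\<^esub>" "\<one>\<^bsub>A\<^esub>"] by force
    show "S \<subseteq> \<psi> ` carrier D"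
    proof
      fix x assume "x \<in> S"
      then obtain y where y: "y \<in> carrier F" "x = \<pi> y" using F(3) by auto
      then have "\<psi> (j y \<zero>\<^bsub>A\<^esub>) = x"
        using s mod_linD(1)[OF F(2)] by (simp add: \<psi>_def D(4) M.smult_zero_left)
      then show "x \<in> \<psi> ` carrier D" using D(4)[of y "\<zero>\<^bsub>A\<^esub>"] y by force
    qed
  qed
  moreover have "(\<lambda>x\<in>carrier J. \<psi> (\<sigma> x)) \<in> dual_sums A J M" if \<sigma>: "mod_lin A J D \<sigma>" for \<sigma>
  proof -
    have "(\<lambda>x\<in>carrier J. (\<lambda>x\<in>carrier J. \<pi> (p (\<sigma> x))) x \<oplus>\<^bsub>M\<^esub>
        (\<lambda>x\<in>carrier J. q (\<sigma> x) \<odot>\<^bsub>M\<^esub> s) x) \<in> dual_sums A J M"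
      by (intro dual_sums.intros F(5) mod_lin_comp[OF \<sigma>] D s)
    moreover have "(\<lambda>x\<in>carrier J. (\<lambda>x\<in>carrier J. \<pi> (p (\<sigma> x))) x \<oplus>\<^bsub>M\<^esub>
        (\<lambda>x\<in>carrier J. q (\<sigma> x) \<odot>\<^bsub>M\<^esub> s) x) = (\<lambda>x\<in>carrier J. \<psi> (\<sigma> x))"
      by (rule ext) (simp add: \<psi>_def)
    ultimately show ?thesis by simp
  qed
  moreover have "projective_module TYPE('m) A D"
    by (rule projective_direct_sum[OF F(1) projective_regular[OF M.ring_axioms] D])
  moreover have "noeth A D" if "noeth A ?A"
    by (rule noeth_direct_sum[OF F(4)[OF that] that D])
  ultimately show ?case using \<psi> by blast
qed

lemma gen_subset_image:
  assumes "left_module A M" "left_module A N" "mod_lin A M N f" "gen A N S = carrier N"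
    "S \<subseteq> f ` carrier M"
  shows "f ` carrier M = carrier N"
  using gen_least[OF image_carrier_submod[OF assms(1-3)] assms(5)] assms(4) mod_linD(1)[OF assms(3)]
  by auto

text \<open>A cover that is itself Noetherian has a Noetherian kernel, so the construction can be
  repeated on syzygies.\<close>

lemma ex_noeth_cover:
  fixes M :: "('a, 'b) module"
  assumes "cring R" "noetherian_ring R" "large_universe TYPE('m) R" "noeth R M"
  obtains F :: "('a, 'm) module" and \<pi> where "projective_module TYPE('m) R F" "noeth R F"
    "mod_lin R F M \<pi>" "\<pi> ` carrier F = carrier M"
proof -
  obtain S where S: "finite S" "S \<subseteq> carrier M" "gen R M S = carrier M"
    using noeth_carrier[OF assms(4)] by (auto simp: fgen_def)
  have lM: "left_module R M" using assms(4) noeth_left_module by blast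
  obtain F :: "('a, 'm) module" and \<pi> where F: "projective_module TYPE('m) R F" "mod_lin R F M \<pi>"
    "S \<subseteq> \<pi> ` carrier F" "noeth R F"
    using ex_finite_free_cover[OF assms(3) lM S(1,2) lM] noeth_regular[OF assms(1,2)] by blast
  show thesis
    by (rule that[OF F(1,4,2)])
      (rule gen_subset_image[OF projective_imp_left_module[OF F(1)] lM F(2) S(3) F(3)])
qed

text \<open>Links generation by explicit linear combinations to generation as the smallest
  submodule.\<close>

lemma finitely_generated_fgen:
  assumes "finitely_generated A M"
  shows "fgen A M (carrier M)"
proof -
  obtain S where S: "finite S" "S \<subseteq> carrier M" and
    car: "carrier M = {finsum M (\<lambda>s. c s \<odot>\<^bsub>M\<^esub> s) S |c. c \<in> S \<rightarrow> carrier A}"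
    and lM: "left_module A M"
    using assms by (auto simp: finitely_generated_def)
  interpret M: left_module A M by fact
  have G: "submod A M (gen A M S)" by (rule gen_submod[OF lM S(2)])
  have "finsum M (\<lambda>s. c s \<odot>\<^bsub>M\<^esub> s) T \<in> gen A M S" if "c \<in> S \<rightarrow> carrier A" "T \<subseteq> S" for c T
    using finite_subset[OF that(2) S(1)] that(2)
  proof (induction T)
    case empty
    then show ?case using submodD(2)[OF G] by (simp)
  next
    case (insert s T)
    have "(\<lambda>s. c s \<odot>\<^bsub>M\<^esub> s) \<in> T \<rightarrow> carrier M" "c s \<odot>\<^bsub>M\<^esub> s \<in> carrier M"
      using insert that(1) S(2) by (auto intro!: M.smult_closed)
    moreover have "c s \<odot>\<^bsub>M\<^esub> s \<in> gen A M S"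
      using insert that(1) gen_incl[of S A M] by (intro submodD(4)[OF G]) auto
    ultimately show ?case using insert submodD(3)[OF G] by (simp add: M.finsum_insert)
  qed
  then have "carrier M \<subseteq> gen A M S" unfolding car by auto
  then have "gen A M S = carrier M" using G by (auto simp: submod_def)
  then show ?thesis using S by (auto simp: fgen_def)
qed

section \<open>Restriction of scalars\<close>

definition restr :: "('a \<Rightarrow> 'b) \<Rightarrow> ('b, 'm) module \<Rightarrow> ('a, 'm) module" where
  "restr \<phi> N = mk_module (carrier N) \<zero>\<^bsub>N\<^esub> (add N) (\<lambda>a x. \<phi> a \<odot>\<^bsub>N\<^esub> x)"

lemma restr_simps [simp]:
  "carrier (restr \<phi> N) = carrier N" "\<zero>\<^bsub>restr \<phi> N\<^esub> = \<zero>\<^bsub>N\<^esub>" "add (restr \<phi> N) = add N"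
  "a \<odot>\<^bsub>restr \<phi> N\<^esub> x = \<phi> a \<odot>\<^bsub>N\<^esub> x"
  by (simp_all add: restr_def)

lemma left_module_restr:
  assumes "ring A" "\<phi> \<in> ring_hom A B" "left_module B N"
  shows "left_module A (restr \<phi> N)"
proof -
  interpret A: ring A by fact
  interpret N: left_module B N by fact
  note h = ring_hom_closed[OF assms(2)] ring_hom_mult[OF assms(2)] ring_hom_add[OF assms(2)]
    ring_hom_one[OF assms(2)]
  have z: "\<phi> \<zero>\<^bsub>A\<^esub> = \<zero>\<^bsub>B\<^esub>"
    using h(3)[of "\<zero>\<^bsub>A\<^esub>" "\<zero>\<^bsub>A\<^esub>"] h(1)[of "\<zero>\<^bsub>A\<^esub>"] by simp
  have "\<phi> (\<ominus>\<^bsub>A\<^esub> \<one>\<^bsub>A\<^esub>) \<odot>\<^bsub>N\<^esub> x \<oplus>\<^bsub>N\<^esub> x = \<zero>\<^bsub>N\<^esub>" if x: "x \<in> carrier N" for x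
  proof -
    have "\<phi> (\<ominus>\<^bsub>A\<^esub> \<one>\<^bsub>A\<^esub> \<oplus>\<^bsub>A\<^esub> \<one>\<^bsub>A\<^esub>) \<odot>\<^bsub>N\<^esub> x = \<phi> (\<ominus>\<^bsub>A\<^esub> \<one>\<^bsub>A\<^esub>) \<odot>\<^bsub>N\<^esub> x \<oplus>\<^bsub>N\<^esub> \<phi> \<one>\<^bsub>A\<^esub> \<odot>\<^bsub>N\<^esub> x"
      using x by (subst h(3)) (simp_all add: h(1) N.smult_l_distr)
    then show ?thesis using x by (simp add: A.l_neg z h(4) N.smult_zero_left N.smult_one)
  qed
  then show ?thesis
    by (intro left_moduleI)
      (simp_all add: A.ring_axioms h N.a_ac N.smult_closed N.smult_l_distr
        N.smult_r_distr N.smult_assoc N.smult_one)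
qed

lemma mod_lin_restr:
  assumes "\<phi> \<in> ring_hom A B" "mod_lin B M N f"
  shows "mod_lin A (restr \<phi> M) (restr \<phi> N) f"
  using mod_linD[OF assms(2)] ring_hom_closed[OF assms(1)] by (intro mod_linI) simp_all

section \<open>Split heredity ideals\<close>

lemma End_op_simps [simp]:
  "carrier (End_op A M) = mod_hom A M M" "\<zero>\<^bsub>End_op A M\<^esub> = (\<lambda>x\<in>carrier M. \<zero>\<^bsub>M\<^esub>)"
  "f \<otimes>\<^bsub>End_op A M\<^esub> g = compose (carrier M) g f" "\<one>\<^bsub>End_op A M\<^esub> = (\<lambda>x\<in>carrier M. x)"
  "f \<oplus>\<^bsub>End_op A M\<^esub> g = (\<lambda>x\<in>carrier M. f x \<oplus>\<^bsub>M\<^esub> g x)"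
  by (simp_all add: End_op_def)

text \<open>\<open>dual\<close> expresses by a dual basis that \<open>J\<close> is finitely
  generated and projective. That \<open>E\<close> is a ring is an assumption here; the alternative
  is dealt with where the locale is interpreted, since a structure that is not a ring has no modules
  at all.\<close>

locale heredity =
  fixes A :: "('r, 'a) module" and J :: "'a set" and E :: "('r, 'a \<Rightarrow> 'a) module"
  assumes ring_A: "ring A" and ideal_J: "ideal J A" and idem: "J \<cdot>\<^bsub>A\<^esub> J = J"
    and E_def: "E = End_op A (ideal_module A J)" and ring_E: "ring E"
    and dual: "(\<lambda>x\<in>J. x) \<in> dual_sums A (ideal_module A J) (ideal_module A J)"
begin

interpretation A: ring A by (rule ring_A)
interpretation J: ideal J A by (rule ideal_J)

abbreviation Jm where "Jm \<equiv> ideal_module A J"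

lemma J_carrier: "x \<in> J \<Longrightarrow> x \<in> carrier A"
  using J.a_subset by auto

lemma left_module_J: "left_module A Jm"
  using J_carrier J.I_l_closed
  by (intro left_moduleI) (auto simp: A.ring_axioms A.a_ac A.m_assoc A.l_distr
      A.r_distr A.l_minus A.l_neg A.r_neg)

text \<open>Since \<open>J\<^sup>2 = J\<close>, this identifies \<open>Hom\<^sub>A(J, A)\<close> with \<open>E\<close>.\<close>

lemma hom_into_J:
  assumes f: "mod_lin A Jm (ideal_module A (carrier A)) f" and x: "x \<in> J"
  shows "f x \<in> J"
proof -
  have "x \<in> J \<cdot>\<^bsub>A\<^esub> J" using x idem by simp
  then show ?thesis
  proof (induction rule: ideal_prod.induct)
    case (prod i j)
    then show ?case
      using mod_linD(3)[OF f, of i j] mod_linD(1)[OF f, of j] J_carrier[of i] J.I_r_closed by simp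
  next
    case (sum s1 s2)
    then show ?case using mod_linD(2)[OF f, of s1 s2] idem by simp
  qed
qed

section \<open>Right multiplication, and elements of \<open>E\<close>-modules as maps out of
  \<open>J\<close>\<close>

definition rho where "rho a = (\<lambda>x\<in>J. x \<otimes>\<^bsub>A\<^esub> a)"

lemma rho_apply: "x \<in> J \<Longrightarrow> rho a x = x \<otimes>\<^bsub>A\<^esub> a"
  by (simp add: rho_def)

lemma E_simps:
  "carrier E = mod_hom A Jm Jm" "\<zero>\<^bsub>E\<^esub> = (\<lambda>x\<in>J. \<zero>\<^bsub>A\<^esub>)"
  "f \<otimes>\<^bsub>E\<^esub> g = compose J g f" "\<one>\<^bsub>E\<^esub> = (\<lambda>x\<in>J. x)" "f \<oplus>\<^bsub>E\<^esub> g = (\<lambda>x\<in>J. f x \<oplus>\<^bsub>A\<^esub> g x)"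
  by (simp_all add: E_def)

lemma E_lin: "e \<in> carrier E \<Longrightarrow> mod_lin A Jm Jm e"
  by (simp add: E_simps mod_hom_lin)

lemma E_closed: "e \<in> carrier E \<Longrightarrow> x \<in> J \<Longrightarrow> e x \<in> J"
  using mod_linD(1)[OF E_lin] by simp

lemma rho_closed: "a \<in> carrier A \<Longrightarrow> rho a \<in> carrier E"
proof -
  assume a: "a \<in> carrier A"
  then have "mod_lin A Jm Jm (\<lambda>x. x \<otimes>\<^bsub>A\<^esub> a)"
    using J_carrier J.I_r_closed by (intro mod_linI) (simp_all add: A.l_distr A.m_assoc)
  from mod_hom_restrict[OF left_module_J this] show ?thesis
    by (simp add: E_simps rho_def)
qed

lemma rho_hom: "rho \<in> ring_hom A E"
proof (rule ring_hom_memI)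
  fix a b assume ab: "a \<in> carrier A" "b \<in> carrier A"
  show "rho (a \<otimes>\<^bsub>A\<^esub> b) = rho a \<otimes>\<^bsub>E\<^esub> rho b"
    unfolding E_simps rho_def compose_def using ab J_carrier J.I_r_closed
    by (intro ext) (simp add: A.m_assoc)
  show "rho (a \<oplus>\<^bsub>A\<^esub> b) = rho a \<oplus>\<^bsub>E\<^esub> rho b"
    unfolding E_simps rho_def using ab J_carrier by (intro ext) (simp add: A.r_distr)
next
  show "rho \<one>\<^bsub>A\<^esub> = \<one>\<^bsub>E\<^esub>"
    unfolding E_simps rho_def using J_carrier by (intro ext) simp
qed (rule rho_closed)

text \<open>By left linearity \<open>e (y x) = y (e x)\<close>. Thus right multiplications by
  elements of \<open>J\<close> absorb \<open>E\<close> from the right, which lets the action of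
  \<open>E\<close> on a module be computed from the action of \<open>A\<close>.\<close>

lemma rho_mult: "e \<in> carrier E \<Longrightarrow> x \<in> J \<Longrightarrow> rho x \<otimes>\<^bsub>E\<^esub> e = rho (e x)"
  unfolding E_simps(3) rho_def compose_def
  using mod_linD(3)[OF E_lin, of e _ x] J_carrier J.I_r_closed by (intro ext) simp

lemma rho_smult:
  assumes "left_module E M" "e \<in> carrier E" "x \<in> J" "m \<in> carrier M"
  shows "rho x \<odot>\<^bsub>M\<^esub> (e \<odot>\<^bsub>M\<^esub> m) = rho (e x) \<odot>\<^bsub>M\<^esub> m"
  using left_module.smult_assoc[OF assms(1) rho_closed[OF J_carrier[OF assms(3)]] assms(2,4)]
    rho_mult[OF assms(2,3)] by simp

lemma restrict_hom_in_E:
  assumes "mod_lin A Jm (ideal_module A (carrier A)) f"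
  shows "(\<lambda>x\<in>J. f x) \<in> carrier E"
proof -
  have "mod_lin A Jm Jm f"
    using mod_linD[OF assms] hom_into_J[OF assms] by (intro mod_linI) simp_all
  from mod_hom_restrict[OF left_module_J this] show ?thesis by (simp add: E_simps)
qed

text \<open>The rank-one maps of the dual basis are products in \<open>E\<close> of a functional and
  a right multiplication. Hence the unit of \<open>E\<close> lies in the left ideal generated by the
  image of \<open>J\<close> under \<open>rho\<close>.\<close>

lemma dual_base_eq:
  assumes "mod_lin A Jm (ideal_module A (carrier A)) f" "y \<in> J"
  shows "(\<lambda>x\<in>J. f x \<otimes>\<^bsub>A\<^esub> y) = (\<lambda>x\<in>J. f x) \<otimes>\<^bsub>E\<^esub> rho y"
  unfolding E_simps(3) rho_def compose_def using hom_into_J[OF assms(1)]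
  by (intro ext) simp

lemma dual_sums_cancel:
  assumes M: "left_module E M" and d: "d \<in> dual_sums A Jm Jm"
    and m: "m \<in> carrier M" "\<And>x. x \<in> J \<Longrightarrow> rho x \<odot>\<^bsub>M\<^esub> m = \<zero>\<^bsub>M\<^esub>"
  shows "d \<in> carrier E \<and> d \<odot>\<^bsub>M\<^esub> m = \<zero>\<^bsub>M\<^esub>"
proof -
  interpret M: left_module E M by fact
  show ?thesis
    using d
  proof (induction rule: dual_sums.induct)
    case (base f y)
    then have y: "y \<in> J" by simp
    note f = restrict_hom_in_E[OF base(1)] and r = rho_closed[OF J_carrier[OF y]]
    show ?case
      using M.smult_assoc[OF f r m(1)] m(2)[OF y] M.smult_zero_right[OF f] M.m_closed[OF f r]
      by (simp add: dual_base_eq[OF base(1) y])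
  next
    case (add f g)
    then have "(\<lambda>x\<in>J. f x \<oplus>\<^bsub>A\<^esub> g x) = f \<oplus>\<^bsub>E\<^esub> g" by (simp add: E_simps)
    then show ?case using add m(1) by (simp add: M.smult_l_distr)
  qed
qed

text \<open>If all \<open>rho x\<close> kill the difference of \<open>m\<close> and
  \<open>m'\<close>, so does the left ideal they generate, and this ideal contains the unit.
  Identities in \<open>E\<close>-modules are from now on checked after applying
  \<open>rho x\<close>.\<close>

lemma rho_cancel:
  assumes M: "left_module E M" and m: "m \<in> carrier M" "m' \<in> carrier M"
    and eq: "\<And>x. x \<in> J \<Longrightarrow> rho x \<odot>\<^bsub>M\<^esub> m = rho x \<odot>\<^bsub>M\<^esub> m'"
  shows "m = m'"
proof -
  interpret M: left_module E M by fact
  have "rho x \<odot>\<^bsub>M\<^esub> (m \<ominus>\<^bsub>M\<^esub> m') = \<zero>\<^bsub>M\<^esub>" if "x \<in> J" for x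
    using that eq[OF that] m rho_closed[OF J_carrier[OF that]]
    by (simp add: M.smult_diff M.diff_zero_iff M.smult_closed)
  then have "\<one>\<^bsub>E\<^esub> \<odot>\<^bsub>M\<^esub> (m \<ominus>\<^bsub>M\<^esub> m') = \<zero>\<^bsub>M\<^esub>"
    using dual_sums_cancel[OF M dual M.minus_closed[OF m]] by (simp add: E_simps(4))
  then show ?thesis
    using m by (simp add: M.smult_one M.diff_zero_iff)
qed

text \<open>If \<open>d\<close> is the sum of the maps \<open>x \<mapsto> g x y\<close> for finitely
  many \<open>g\<close> and \<open>y\<close>, the representing element is the sum of the
  \<open>g\<close> applied to \<open>f y\<close>; the induction on \<open>d\<close> builds it term
  by term.\<close>

lemma dual_sums_represent:
  assumes M: "left_module E M" and f: "mod_lin A Jm (restr rho M) f" and d: "d \<in> dual_sums A Jm Jm"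
  shows "(\<forall>x\<in>J. d x \<in> J) \<and> (\<exists>m\<in>carrier M. \<forall>x\<in>J. rho x \<odot>\<^bsub>M\<^esub> m = f (d x))"
  using d
proof (induction rule: dual_sums.induct)
  case (base g y)
  interpret M: left_module E M by fact
  have y: "y \<in> J" "f y \<in> carrier M" using base mod_linD(1)[OF f] by auto
  note g = restrict_hom_in_E[OF base(1)] and gJ = hom_into_J[OF base(1)]
  \<comment> \<open>\<open>rho x\<close> absorbs \<open>g\<close> and becomes
    \<open>rho (g x)\<close>; linearity of \<open>f\<close> then moves the factor
    \<open>g x\<close>, which lies in \<open>J\<close>, inside.\<close>
  have "rho x \<odot>\<^bsub>M\<^esub> ((\<lambda>x\<in>J. g x) \<odot>\<^bsub>M\<^esub> f y) = f (g x \<otimes>\<^bsub>A\<^esub> y)" if "x \<in> J" for x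
    using rho_smult[OF M g that y(2)] mod_linD(3)[OF f, of "g x" y] that y gJ[OF that] J_carrier
    by simp
  then show ?case
    using y g gJ J.I_r_closed J_carrier
    by (auto intro!: bexI[of _ "(\<lambda>x\<in>J. g x) \<odot>\<^bsub>M\<^esub> f y"] M.smult_closed)
next
  case (add d1 d2)
  interpret M: left_module E M by fact
  obtain m1 m2 where m: "m1 \<in> carrier M" "m2 \<in> carrier M"
    "\<forall>x\<in>J. rho x \<odot>\<^bsub>M\<^esub> m1 = f (d1 x)" "\<forall>x\<in>J. rho x \<odot>\<^bsub>M\<^esub> m2 = f (d2 x)"
    using add by blast
  have "rho x \<odot>\<^bsub>M\<^esub> (m1 \<oplus>\<^bsub>M\<^esub> m2) = f (d1 x \<oplus>\<^bsub>A\<^esub> d2 x)" if "x \<in> J" for x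
    using that m add rho_closed[OF J_carrier[OF that]] mod_linD(2)[OF f, of "d1 x" "d2 x"]
    by (simp add: M.smult_r_distr)
  then show ?case
    using m add by (auto intro!: bexI[of _ "m1 \<oplus>\<^bsub>M\<^esub> m2"])
qed

text \<open>Taken with \<open>rho_cancel\<close>, which gives uniqueness, this identifies
  \<open>M\<close> with Hom(J, M) over \<open>A\<close>: passing to \<open>A\<close> and applying
  Hom gives \<open>M\<close> back.\<close>

lemma rho_represent:
  assumes "left_module E M" "mod_lin A Jm (restr rho M) f"
  obtains m where "m \<in> carrier M" "\<And>x. x \<in> J \<Longrightarrow> rho x \<odot>\<^bsub>M\<^esub> m = f x"
  using dual_sums_represent[OF assms dual] by auto

text \<open>\<open>ev\<close> identifies \<open>N'\<close> with \<open>Hom\<^sub>A(J, N)\<close>.\<close>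

definition hom_rel where
  "hom_rel N N' ev \<longleftrightarrow> left_module A N \<and> left_module E N' \<and>
     bij_betw ev (carrier N') (mod_hom A Jm N) \<and>
     (\<forall>y\<in>carrier N'. \<forall>y'\<in>carrier N'. \<forall>x\<in>J. ev (y \<oplus>\<^bsub>N'\<^esub> y') x = ev y x \<oplus>\<^bsub>N\<^esub> ev y' x) \<and>
     (\<forall>e\<in>carrier E. \<forall>y\<in>carrier N'. \<forall>x\<in>J. ev (e \<odot>\<^bsub>N'\<^esub> y) x = ev y (e x))"

lemma hom_relD:
  assumes "hom_rel N N' ev"
  shows "left_module A N" "left_module E N'"
    "y \<in> carrier N' \<Longrightarrow> ev y \<in> mod_hom A Jm N" "y \<in> carrier N' \<Longrightarrow> mod_lin A Jm N (ev y)"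
    "\<lbrakk>y \<in> carrier N'; y' \<in> carrier N'; x \<in> J\<rbrakk> \<Longrightarrow> ev (y \<oplus>\<^bsub>N'\<^esub> y') x = ev y x \<oplus>\<^bsub>N\<^esub> ev y' x"
    "\<lbrakk>e \<in> carrier E; y \<in> carrier N'; x \<in> J\<rbrakk> \<Longrightarrow> ev (e \<odot>\<^bsub>N'\<^esub> y) x = ev y (e x)"
    "\<lbrakk>y \<in> carrier N'; y' \<in> carrier N'; \<And>x. x \<in> J \<Longrightarrow> ev y x = ev y' x\<rbrakk> \<Longrightarrow> y = y'"
proof -
  show *: "ev y \<in> mod_hom A Jm N" if "y \<in> carrier N'" for y
    using assms that by (auto simp: hom_rel_def bij_betw_def)
  then show "y \<in> carrier N' \<Longrightarrow> mod_lin A Jm N (ev y)" by (simp add: mod_hom_lin)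
  assume "y \<in> carrier N'" "y' \<in> carrier N'" "\<And>x. x \<in> J \<Longrightarrow> ev y x = ev y' x"
  moreover from this have "ev y = ev y'" by (intro mod_hom_eqI[OF * *]) auto
  ultimately show "y = y'" using assms by (auto simp: hom_rel_def bij_betw_def inj_on_def)
qed (use assms in \<open>auto simp: hom_rel_def\<close>)

lemma hom_rel_represent:
  assumes "hom_rel N N' ev" "mod_lin A Jm N f"
  obtains y where "y \<in> carrier N'" "\<And>x. x \<in> J \<Longrightarrow> ev y x = f x"
proof -
  have "(\<lambda>x\<in>J. f x) \<in> mod_hom A Jm N"
    using mod_hom_restrict[OF left_module_J assms(2)] by simp
  then have "(\<lambda>x\<in>J. f x) \<in> ev ` carrier N'"
    using assms(1) by (simp add: hom_rel_def bij_betw_def)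
  then obtain y where "y \<in> carrier N'" "ev y = (\<lambda>x\<in>J. f x)" by (metis imageE)
  then show thesis using that by simp
qed

lemma hom_rel_restr:
  assumes M: "left_module E M"
  shows "hom_rel (restr rho M) M (\<lambda>m. \<lambda>x\<in>J. rho x \<odot>\<^bsub>M\<^esub> m)"
proof -
  interpret M: left_module E M by fact
  have lin: "mod_lin A Jm (restr rho M) (\<lambda>x. rho x \<odot>\<^bsub>M\<^esub> m)" if "m \<in> carrier M" for m
    using that J_carrier rho_closed
    by (intro mod_linI) (simp_all add: M.smult_closed M.smult_l_distr M.smult_assoc
        ring_hom_mult[OF rho_hom] ring_hom_add[OF rho_hom])
  have "bij_betw (\<lambda>m. \<lambda>x\<in>J. rho x \<odot>\<^bsub>M\<^esub> m) (carrier M) (mod_hom A Jm (restr rho M))"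
    unfolding bij_betw_def
  proof (intro conjI inj_onI equalityI subsetI)
    fix m m' assume m: "m \<in> carrier M" "m' \<in> carrier M"
      and eq: "(\<lambda>x\<in>J. rho x \<odot>\<^bsub>M\<^esub> m) = (\<lambda>x\<in>J. rho x \<odot>\<^bsub>M\<^esub> m')"
    have "rho x \<odot>\<^bsub>M\<^esub> m = rho x \<odot>\<^bsub>M\<^esub> m'" if "x \<in> J" for x
      using that fun_cong[OF eq, of x] by simp
    then show "m = m'" by (rule rho_cancel[OF M m])
  next
    fix f assume "f \<in> (\<lambda>m. \<lambda>x\<in>J. rho x \<odot>\<^bsub>M\<^esub> m) ` carrier M"
    then obtain m where "m \<in> carrier M" "f = (\<lambda>x\<in>J. rho x \<odot>\<^bsub>M\<^esub> m)" by blast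
    then show "f \<in> mod_hom A Jm (restr rho M)"
      using mod_hom_restrict[OF left_module_J lin] by simp
  next
    fix f assume f: "f \<in> mod_hom A Jm (restr rho M)"
    obtain m where m: "m \<in> carrier M" "\<And>x. x \<in> J \<Longrightarrow> rho x \<odot>\<^bsub>M\<^esub> m = f x"
      using rho_represent[OF M mod_hom_lin[OF f]] by blast
    have "f = (\<lambda>x\<in>J. rho x \<odot>\<^bsub>M\<^esub> m)"
      using f m(2) by (intro extensionalityI[of f J]) (auto simp: mod_hom_iff)
    then show "f \<in> (\<lambda>m. \<lambda>x\<in>J. rho x \<odot>\<^bsub>M\<^esub> m) ` carrier M" using m(1) by blast
  qed
  then show ?thesis
    using left_module_restr[OF ring_A rho_hom M] M rho_smult[OF M] E_closed rho_closed J_carrier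
    by (simp add: hom_rel_def M.smult_r_distr)
qed

text \<open>This is the adjunction between Hom(J, -) and restriction, written out. A lifting problem
  over \<open>E\<close> is composed with the unit \<open>u\<close>, solved over \<open>A\<close> by
  \<open>l\<close>, and the solution is carried back by representing the maps
  \<open>x \<mapsto> l (ev y x)\<close> by elements of \<open>U\<close>.\<close>

lemma hom_rel_projective:
  fixes P :: "('a, 'm) module" and P' :: "('a \<Rightarrow> 'a, 'm) module"
  assumes rel: "hom_rel P P' ev" and proj: "projective_module TYPE('m) A P"
  shows "projective_module TYPE('m) E P'"
proof (rule projectiveI)
  note r = hom_relD[OF rel]
  show "left_module E P'" by (rule r(2))
  fix U V :: "('a \<Rightarrow> 'a, 'm) module" and g f
  assume U: "left_module E U" and V: "left_module E V" and g: "mod_lin E U V g"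
    and gs: "g ` carrier U = carrier V" and f: "mod_lin E P' V f"
  interpret P: left_module A P by (rule r(1))
  interpret P': left_module E P' by (rule r(2))
  interpret U: left_module E U by fact
  interpret V: left_module E V by fact
  \<comment> \<open>The unit of the adjunction sends \<open>p\<close> to the map
    \<open>x \<mapsto> x p\<close> on \<open>J\<close>.\<close>
  have "\<exists>y\<in>carrier P'. \<forall>x\<in>J. ev y x = x \<odot>\<^bsub>P\<^esub> p" if "p \<in> carrier P" for p
  proof -
    have "mod_lin A Jm P (\<lambda>x. x \<odot>\<^bsub>P\<^esub> p)"
      using that J_carrier by (intro mod_linI) (simp_all add: P.smult_closed P.smult_l_distr P.smult_assoc)
    from hom_rel_represent[OF rel this] show ?thesis by metis
  qed
  then obtain u where u: "\<And>p. p \<in> carrier P \<Longrightarrow> u p \<in> carrier P'"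
    "\<And>p x. p \<in> carrier P \<Longrightarrow> x \<in> J \<Longrightarrow> ev (u p) x = x \<odot>\<^bsub>P\<^esub> p" by metis
  have u_lin: "mod_lin A P (restr rho P') u"
  proof (rule mod_linI)
    fix p q assume "p \<in> carrier P" "q \<in> carrier P"
    then show "u (p \<oplus>\<^bsub>P\<^esub> q) = u p \<oplus>\<^bsub>restr rho P'\<^esub> u q"
      using J_carrier by - (rule r(7), simp_all add: u r(5) P.smult_r_distr)
  next
    fix a p assume "a \<in> carrier A" "p \<in> carrier P"
    then show "u (a \<odot>\<^bsub>P\<^esub> p) = a \<odot>\<^bsub>restr rho P'\<^esub> u p"
      using J_carrier J.I_r_closed rho_closed
      by - (rule r(7), simp_all add: u r(6) P.smult_closed P'.smult_closed rho_apply P.smult_assoc)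
  qed (simp add: u)
  have fu: "mod_lin A P (restr rho V) (\<lambda>p. f (u p))"
    by (rule mod_lin_comp[OF u_lin mod_lin_restr[OF rho_hom f]])
  obtain l where l: "mod_lin A P (restr rho U) l" "\<And>p. p \<in> carrier P \<Longrightarrow> g (l p) = f (u p)"
    using projective_lift_same[OF proj left_module_restr[OF ring_A rho_hom U]
        left_module_restr[OF ring_A rho_hom V] mod_lin_restr[OF rho_hom g] _ fu] gs by auto
  have "\<exists>m\<in>carrier U. \<forall>x\<in>J. rho x \<odot>\<^bsub>U\<^esub> m = l (ev y x)" if "y \<in> carrier P'" for y
    using rho_represent[OF U mod_lin_comp[OF r(4)[OF that] l(1)]] by metis
  then obtain h where h: "\<And>y. y \<in> carrier P' \<Longrightarrow> h y \<in> carrier U"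
    "\<And>y x. y \<in> carrier P' \<Longrightarrow> x \<in> J \<Longrightarrow> rho x \<odot>\<^bsub>U\<^esub> h y = l (ev y x)" by metis
  have evc: "ev y x \<in> carrier P" if "y \<in> carrier P'" "x \<in> J" for x y
    using mod_linD(1)[OF r(4)] that by simp
  have "mod_lin E P' U h"
  proof (rule mod_linI)
    fix y z assume yz: "y \<in> carrier P'" "z \<in> carrier P'"
    show "h (y \<oplus>\<^bsub>P'\<^esub> z) = h y \<oplus>\<^bsub>U\<^esub> h z"
    proof (rule rho_cancel[OF U])
      fix x assume "x \<in> J"
      then show "rho x \<odot>\<^bsub>U\<^esub> h (y \<oplus>\<^bsub>P'\<^esub> z) = rho x \<odot>\<^bsub>U\<^esub> (h y \<oplus>\<^bsub>U\<^esub> h z)"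
        using yz mod_linD(2)[OF l(1)]
        by (simp add: h r(5) U.smult_r_distr rho_closed J_carrier evc)
    qed (use yz h in auto)
  next
    fix e y assume ey: "e \<in> carrier E" "y \<in> carrier P'"
    show "h (e \<odot>\<^bsub>P'\<^esub> y) = e \<odot>\<^bsub>U\<^esub> h y"
    proof (rule rho_cancel[OF U])
      fix x assume "x \<in> J"
      then show "rho x \<odot>\<^bsub>U\<^esub> h (e \<odot>\<^bsub>P'\<^esub> y) = rho x \<odot>\<^bsub>U\<^esub> (e \<odot>\<^bsub>U\<^esub> h y)"
        using ey by (simp add: h r(6) rho_smult[OF U] P'.smult_closed E_closed)
    qed (use ey h in \<open>auto simp: U.smult_closed P'.smult_closed\<close>)
  qed (rule h)
  moreover have "g (h y) = f y" if y: "y \<in> carrier P'" for y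
  proof (rule rho_cancel[OF V])
    fix x assume x: "x \<in> J"
    have "rho x \<odot>\<^bsub>V\<^esub> g (h y) = f (u (ev y x))"
      using x y mod_linD(3)[OF g, of "rho x" "h y"] h l(2)[OF evc[OF y x]] rho_closed J_carrier by simp
    \<comment> \<open>Both sides, as maps on \<open>J\<close>, send \<open>z\<close> to
      \<open>ev y (z x)\<close>, because \<open>ev y\<close> is linear over
      \<open>A\<close>.\<close>
    also have "u (ev y x) = rho x \<odot>\<^bsub>P'\<^esub> y"
    proof (rule r(7))
      fix z assume "z \<in> J"
      then show "ev (u (ev y x)) z = ev (rho x \<odot>\<^bsub>P'\<^esub> y) z"
        using x y mod_linD(3)[OF r(4)[OF y], of z x] J_carrier
        by (simp add: u evc r(6) rho_closed rho_apply)
    qed (use x y in \<open>simp_all add: u evc P'.smult_closed rho_closed J_carrier\<close>)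
    also have "f (rho x \<odot>\<^bsub>P'\<^esub> y) = rho x \<odot>\<^bsub>V\<^esub> f y"
      using mod_linD(3)[OF f] x y rho_closed J_carrier by simp
    finally show "rho x \<odot>\<^bsub>V\<^esub> g (h y) = rho x \<odot>\<^bsub>V\<^esub> f y" .
  qed (use y h(1) mod_linD(1)[OF g] mod_linD(1)[OF f] in auto)
  ultimately show "\<exists>h. mod_lin E P' U h \<and> (\<forall>x\<in>carrier P'. g (h x) = f x)" by blast
qed

section \<open>The module Hom(J, N), its size, and exactness\<close>

definition hom_module :: "('a, 'm) module \<Rightarrow> ('a \<Rightarrow> 'a, 'a \<Rightarrow> 'm) module" where
  "hom_module N = mk_module (mod_hom A Jm N) (\<lambda>x\<in>J. \<zero>\<^bsub>N\<^esub>) (\<lambda>f g. \<lambda>x\<in>J. f x \<oplus>\<^bsub>N\<^esub> g x)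
     (\<lambda>e f. \<lambda>x\<in>J. f (e x))"

lemma hom_rel_hom_module:
  assumes N: "left_module A N"
  shows "hom_rel N (hom_module N) (\<lambda>f. f)"
proof -
  interpret N: left_module A N by fact
  interpret E: ring E by (rule ring_E)
  let ?H = "hom_module N"
  have lin: "mod_lin A Jm N f" if "f \<in> carrier ?H" for f using that by (simp add: hom_module_def mod_hom_lin)
  have c: "f x \<in> carrier N" if "f \<in> carrier ?H" "x \<in> J" for f x using mod_linD(1)[OF lin] that by simp
  have eqI: "f = g" if "f \<in> carrier ?H" "g \<in> carrier ?H" "\<And>x. x \<in> J \<Longrightarrow> f x = g x" for f g
    using that unfolding hom_module_def by (intro mod_hom_eqI[of f A Jm N g]) simp_all
  have inH: "(\<lambda>x\<in>J. f x) \<in> carrier ?H" if "mod_lin A Jm N f" for f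
    using mod_hom_restrict[OF left_module_J that] by (simp add: hom_module_def)
  have add: "f \<oplus>\<^bsub>?H\<^esub> g \<in> carrier ?H" if "f \<in> carrier ?H" "g \<in> carrier ?H" for f g
    using inH[OF mod_lin_add[OF left_module_J N lin[OF that(1)] lin[OF that(2)]]]
    by (simp add: hom_module_def)
  have smult: "e \<odot>\<^bsub>?H\<^esub> f \<in> carrier ?H" if "e \<in> carrier E" "f \<in> carrier ?H" for e f
    using inH[OF mod_lin_comp[OF E_lin[OF that(1)] lin[OF that(2)]]] by (simp add: hom_module_def)
  have zero: "\<zero>\<^bsub>?H\<^esub> \<in> carrier ?H"
    using inH[OF mod_lin_zero_map[OF N]] by (simp add: hom_module_def)
  have ap: "(f \<oplus>\<^bsub>?H\<^esub> g) x = f x \<oplus>\<^bsub>N\<^esub> g x" "(e \<odot>\<^bsub>?H\<^esub> f) x = f (e x)" "\<zero>\<^bsub>?H\<^esub> x = \<zero>\<^bsub>N\<^esub>" if "x \<in> J" for f g e x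
    using that by (simp_all add: hom_module_def)
  \<comment> \<open>The inverse in \<open>E\<close> is only given abstractly by the additive group;
    evaluating the equation for minus one plus one at \<open>x\<close> shows what it does.\<close>
  have m1: "(\<ominus>\<^bsub>E\<^esub> \<one>\<^bsub>E\<^esub>) x = \<ominus>\<^bsub>A\<^esub> x" if "x \<in> J" for x
  proof -
    have "(\<ominus>\<^bsub>E\<^esub> \<one>\<^bsub>E\<^esub> \<oplus>\<^bsub>E\<^esub> \<one>\<^bsub>E\<^esub>) x = \<zero>\<^bsub>E\<^esub> x" by (simp only: E.l_neg[OF E.one_closed])
    then have "(\<ominus>\<^bsub>E\<^esub> \<one>\<^bsub>E\<^esub>) x \<oplus>\<^bsub>A\<^esub> x = \<zero>\<^bsub>A\<^esub>" using that by (simp add: E_simps)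
    then show ?thesis
      using A.minus_equality J_carrier that E_closed[OF E.a_inv_closed[OF E.one_closed] that] by metis
  qed
  have "left_module E ?H"
  proof (rule left_moduleI)
    show "ring E" by (rule ring_E)
    fix f assume f: "f \<in> carrier ?H"
    show "(\<ominus>\<^bsub>E\<^esub> \<one>\<^bsub>E\<^esub>) \<odot>\<^bsub>?H\<^esub> f \<oplus>\<^bsub>?H\<^esub> f = \<zero>\<^bsub>?H\<^esub>"
    proof (rule eqI)
      fix x assume x: "x \<in> J"
      have "f (\<ominus>\<^bsub>A\<^esub> x) = \<ominus>\<^bsub>N\<^esub> f x"
        using mod_linD(3)[OF lin[OF f], of "\<ominus>\<^bsub>A\<^esub> \<one>\<^bsub>A\<^esub>" x] x J_carrier[OF x] c[OF f x]
        by (simp add: A.l_minus N.smult_minus_one)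
      then show "((\<ominus>\<^bsub>E\<^esub> \<one>\<^bsub>E\<^esub>) \<odot>\<^bsub>?H\<^esub> f \<oplus>\<^bsub>?H\<^esub> f) x = \<zero>\<^bsub>?H\<^esub> x"
        using x c[OF f x] by (simp add: ap m1 N.l_neg)
    qed (use f add smult zero in auto)
    show "\<one>\<^bsub>E\<^esub> \<odot>\<^bsub>?H\<^esub> f = f"
      by (rule eqI) (use f smult in \<open>simp_all add: ap E_simps(4)[symmetric]\<close>, simp add: ap E_simps)
    show "\<zero>\<^bsub>?H\<^esub> \<oplus>\<^bsub>?H\<^esub> f = f"
      by (rule eqI) (use f add zero c in \<open>simp_all add: ap\<close>)
    fix g assume g: "g \<in> carrier ?H"
    show "f \<oplus>\<^bsub>?H\<^esub> g = g \<oplus>\<^bsub>?H\<^esub> f"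
      by (rule eqI) (use f g add c in \<open>simp_all add: ap N.a_comm\<close>)
    fix h assume h: "h \<in> carrier ?H"
    show "f \<oplus>\<^bsub>?H\<^esub> g \<oplus>\<^bsub>?H\<^esub> h = f \<oplus>\<^bsub>?H\<^esub> (g \<oplus>\<^bsub>?H\<^esub> h)"
      by (rule eqI) (use f g h add c in \<open>simp_all add: ap N.a_assoc\<close>)
  next
    fix e f g assume *: "e \<in> carrier E" "f \<in> carrier ?H" "g \<in> carrier ?H"
    show "e \<odot>\<^bsub>?H\<^esub> (f \<oplus>\<^bsub>?H\<^esub> g) = e \<odot>\<^bsub>?H\<^esub> f \<oplus>\<^bsub>?H\<^esub> e \<odot>\<^bsub>?H\<^esub> g"
      by (rule eqI) (use * add smult c E_closed in \<open>simp_all add: ap\<close>)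
  next
    fix e e' f assume *: "e \<in> carrier E" "e' \<in> carrier E" "f \<in> carrier ?H"
    show "(e \<oplus>\<^bsub>E\<^esub> e') \<odot>\<^bsub>?H\<^esub> f = e \<odot>\<^bsub>?H\<^esub> f \<oplus>\<^bsub>?H\<^esub> e' \<odot>\<^bsub>?H\<^esub> f"
    proof (rule eqI)
      fix x assume x: "x \<in> J"
      then show "((e \<oplus>\<^bsub>E\<^esub> e') \<odot>\<^bsub>?H\<^esub> f) x = (e \<odot>\<^bsub>?H\<^esub> f \<oplus>\<^bsub>?H\<^esub> e' \<odot>\<^bsub>?H\<^esub> f) x"
        using mod_linD(2)[OF lin[OF *(3)], of "e x" "e' x"] * E_closed by (simp add: ap E_simps(5))
    qed (use * add smult E.a_closed in auto)
    \<comment> \<open>Precomposition is a left action because multiplication in \<open>E\<close> is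
      composition in the opposite order.\<close>
    show "(e \<otimes>\<^bsub>E\<^esub> e') \<odot>\<^bsub>?H\<^esub> f = e \<odot>\<^bsub>?H\<^esub> (e' \<odot>\<^bsub>?H\<^esub> f)"
    proof (rule eqI)
      fix x assume x: "x \<in> J"
      then show "((e \<otimes>\<^bsub>E\<^esub> e') \<odot>\<^bsub>?H\<^esub> f) x = (e \<odot>\<^bsub>?H\<^esub> (e' \<odot>\<^bsub>?H\<^esub> f)) x"
        using * E_closed by (simp add: ap E_simps(3) compose_def)
    qed (use * add smult E.m_closed in auto)
  qed (use add zero smult in auto)
  then show ?thesis
    using N bij_betw_id[unfolded id_def] by (simp add: hom_rel_def ap) (simp add: hom_module_def)
qed

lemma hom_rel_iso:
  assumes "hom_rel N N' ev" "left_module E N''" "lin_iso E N' N'' i i'"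
  shows "hom_rel N N'' (\<lambda>y. ev (i' y))"
proof -
  note i = lin_isoD[OF assms(3)]
  have "bij_betw (\<lambda>y. ev (i' y)) (carrier N'') (mod_hom A Jm N)"
    using bij_betw_trans[OF lin_iso_bij[OF lin_iso_sym[OF assms(3)]], of ev "mod_hom A Jm N"] assms(1)
    by (simp add: hom_rel_def comp_def)
  then show ?thesis
    using assms mod_linD[OF i(2)] unfolding hom_rel_def by simp
qed

text \<open>A linear map is determined by its values on a finite generating set of \<open>J\<close>,
  and a finite power of an infinite type embeds into that type. Thus Hom(J, N) has a copy in
  \<open>'m\<close>.\<close>

lemma hom_lepoll:
  fixes N :: "('a, 'm) module"
  assumes inf: "infinite (UNIV :: 'm set)" and N: "left_module A N" and fg: "fgen A Jm J"
  shows "lepoll (mod_hom A Jm N) (UNIV :: 'm set)"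
proof -
  obtain S where S: "finite S" "S \<subseteq> J" "gen A Jm S = J" using fg by (auto simp: fgen_def)
  have fin: "lepoll (T \<rightarrow>\<^sub>E (UNIV :: 'm set)) (UNIV :: 'm set)" if "finite T" for T :: "'a set"
    using that
  proof (induction T)
    case empty
    have "{\<lambda>x::'a. undefined :: 'm} = (\<lambda>_ _. undefined) ` {undefined :: 'm}" by auto
    then show ?case using image_lepoll[of "\<lambda>_ _. undefined" "{undefined :: 'm}"]
        subset_imp_lepoll[of "{undefined :: 'm}" UNIV] lepoll_trans by (metis PiE_empty_domain subset_UNIV)
  next
    case (insert t T)
    have "lepoll (insert t T \<rightarrow>\<^sub>E (UNIV :: 'm set)) ((UNIV :: 'm set) \<times> (T \<rightarrow>\<^sub>E (UNIV :: 'm set)))"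
      unfolding PiE_insert_eq by (rule image_lepoll)
    then show ?case
      using prod_lepoll_infinite[OF inf subset_imp_lepoll[OF subset_UNIV] insert(3)] lepoll_trans by blast
  qed
  have "inj_on (\<lambda>f. restrict f S) (mod_hom A Jm N)"
  proof (rule inj_onI)
    fix f g assume fg: "f \<in> mod_hom A Jm N" "g \<in> mod_hom A Jm N" "restrict f S = restrict g S"
    interpret N: left_module A N by fact
    let ?K = "ker_set Jm N (\<lambda>x. f x \<ominus>\<^bsub>N\<^esub> g x)"
    note lf = mod_hom_lin[OF fg(1)] mod_hom_lin[OF fg(2)]
    note c = mod_linD(1)[OF lf(1)] mod_linD(1)[OF lf(2)]
    have "S \<subseteq> ?K"
    proof
      fix x assume x: "x \<in> S"
      then have "f x = g x" using fun_cong[OF fg(3), of x] by simp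
      then show "x \<in> ?K" using x S(2) c[of x] by (auto simp: ker_set_def N.diff_zero_iff)
    qed
    then have "gen A Jm S \<subseteq> ?K"
      by (rule gen_least[OF submod_ker[OF left_module_J N mod_lin_diff_map[OF left_module_J N lf]]])
    then have JK: "J \<subseteq> ?K" by (simp only: S(3))
    have "f x = g x" if x: "x \<in> J" for x
    proof -
      have "f x \<ominus>\<^bsub>N\<^esub> g x = \<zero>\<^bsub>N\<^esub>" using subsetD[OF JK x] by (simp add: ker_set_def)
      then show ?thesis using N.diff_zero_iff[of "f x" "g x"] c[of x] x by simp
    qed
    then show "f = g" by (intro mod_hom_eqI[OF fg(1,2)]) simp
  qed
  moreover have "(\<lambda>f. restrict f S) ` mod_hom A Jm N \<subseteq> S \<rightarrow>\<^sub>E UNIV" by auto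
  ultimately have "lepoll (mod_hom A Jm N) (S \<rightarrow>\<^sub>E (UNIV :: 'm set))"
    unfolding lepoll_def by blast
  then show ?thesis using fin[OF S(1)] lepoll_trans by blast
qed

text \<open>Exactness of Hom(J, -): surjectivity of the induced map is projectivity of
  \<open>J\<close>, and its kernel consists of the maps with values in the kernel of
  \<open>\<pi>\<close>.\<close>

lemma hom_rel_kernel:
  fixes P N :: "('a, 'm) module" and N' :: "('a \<Rightarrow> 'a, 'm) module"
  assumes inf: "infinite (UNIV :: 'm set)" and fg: "fgen A Jm J"
    and projJ: "projective_module TYPE('m) A Jm"
    and rel: "hom_rel N N' ev" and P: "left_module A P"
    and \<pi>: "mod_lin A P N \<pi>" and surj: "\<pi> ` carrier P = carrier N"
  shows "\<exists>(P' :: ('a \<Rightarrow> 'a, 'm) module) \<pi>'. (\<exists>ev. hom_rel P P' ev) \<and> mod_lin E P' N' \<pi>' \<and> \<pi>' ` carrier P' = carrier N' \<and>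
    (\<exists>ev. hom_rel (ker_mod P N \<pi>) (ker_mod P' N' \<pi>') ev)"
proof -
  note r = hom_relD[OF rel]
  have hm: "hom_rel P (hom_module P) (\<lambda>f. f)" by (rule hom_rel_hom_module[OF P])
  have "lepoll (carrier (hom_module P)) (UNIV :: 'm set)"
    using hom_lepoll[OF inf P fg] by (simp add: hom_module_def)
  then obtain P' :: "('a \<Rightarrow> 'a, 'm) module" and i i' where
    P': "left_module E P'" "lin_iso E (hom_module P) P' i i'"
    using ex_transport[OF hom_relD(2)[OF hm]] by blast
  obtain evP where relP: "hom_rel P P' evP" using hom_rel_iso[OF hm P'] by blast
  note rP = hom_relD[OF relP]
  have evc: "evP y x \<in> carrier P" if "y \<in> carrier P'" "x \<in> J" for x y
    using mod_linD(1)[OF rP(4)] that by simp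
  interpret N: left_module A N by (rule r(1))
  interpret N': left_module E N' by (rule r(2))
  interpret P': left_module E P' by fact
  have "\<exists>z\<in>carrier N'. \<forall>x\<in>J. ev z x = \<pi> (evP y x)" if "y \<in> carrier P'" for y
    using hom_rel_represent[OF rel mod_lin_comp[OF rP(4)[OF that] \<pi>]] by metis
  then obtain \<pi>' where \<pi>': "\<And>y. y \<in> carrier P' \<Longrightarrow> \<pi>' y \<in> carrier N'"
    "\<And>y x. \<lbrakk>y \<in> carrier P'; x \<in> J\<rbrakk> \<Longrightarrow> ev (\<pi>' y) x = \<pi> (evP y x)" by metis
  have lin: "mod_lin E P' N' \<pi>'"
  proof (rule mod_linI)
    fix y z assume "y \<in> carrier P'" "z \<in> carrier P'"
    then show "\<pi>' (y \<oplus>\<^bsub>P'\<^esub> z) = \<pi>' y \<oplus>\<^bsub>N'\<^esub> \<pi>' z"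
      using mod_linD(2)[OF \<pi>] by - (rule r(7), simp_all add: \<pi>' r(5) rP(5) evc)
  next
    fix e y assume "e \<in> carrier E" "y \<in> carrier P'"
    then show "\<pi>' (e \<odot>\<^bsub>P'\<^esub> y) = e \<odot>\<^bsub>N'\<^esub> \<pi>' y"
      by - (rule r(7), simp_all add: \<pi>' r(6) rP(6) P'.smult_closed N'.smult_closed E_closed)
  qed (rule \<pi>')
  have "carrier N' \<subseteq> \<pi>' ` carrier P'"
  proof
    fix z assume z: "z \<in> carrier N'"
    obtain h where h: "mod_lin A Jm P h" "\<And>x. x \<in> J \<Longrightarrow> \<pi> (h x) = ev z x"
      using projective_lift_same[OF projJ P r(1) \<pi> surj r(4)[OF z]] by auto
    obtain y where y: "y \<in> carrier P'" "\<And>x. x \<in> J \<Longrightarrow> evP y x = h x"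
      using hom_rel_represent[OF relP h(1)] by blast
    have "\<pi>' y = z" by - (rule r(7), simp_all add: y h z \<pi>')
    then show "z \<in> \<pi>' ` carrier P'" using y(1) by blast
  qed
  then have surj': "\<pi>' ` carrier P' = carrier N'" using \<pi>'(1) by auto
  let ?K = "ker_mod P N \<pi>" and ?K' = "ker_mod P' N' \<pi>'"
  have K: "left_module A ?K" by (rule left_module_ker[OF P P r(1) \<pi>])
  have K': "left_module E ?K'" by (rule left_module_ker[OF P'(1) P'(1) r(2) lin])
  have ev0: "ev \<zero>\<^bsub>N'\<^esub> x = \<zero>\<^bsub>N\<^esub>" if "x \<in> J" for x
  proof -
    have "ev \<zero>\<^bsub>N'\<^esub> x \<oplus>\<^bsub>N\<^esub> ev \<zero>\<^bsub>N'\<^esub> x = ev \<zero>\<^bsub>N'\<^esub> x" "ev \<zero>\<^bsub>N'\<^esub> x \<in> carrier N"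
      using r(5)[of "\<zero>\<^bsub>N'\<^esub>" "\<zero>\<^bsub>N'\<^esub>" x] that mod_linD(1)[OF r(4)] by auto
    then show ?thesis by simp
  qed
  have kiff: "y \<in> carrier ?K' \<longleftrightarrow> y \<in> carrier P' \<and> (\<forall>x\<in>J. evP y x \<in> carrier ?K)" for y
    using r(7)[of "\<pi>' y" "\<zero>\<^bsub>N'\<^esub>"] \<pi>' ev0 evc[of y]
    by (auto simp: ker_set_def) (metis \<pi>'(2) ev0)
  have "bij_betw evP (carrier ?K') (mod_hom A Jm ?K)"
    unfolding bij_betw_def
  proof (intro conjI inj_onI equalityI subsetI)
    fix y z assume "y \<in> carrier ?K'" "z \<in> carrier ?K'" "evP y = evP z"
    then show "y = z" using rP(7)[of y z] kiff by auto
  next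
    fix f assume "f \<in> evP ` carrier ?K'"
    then obtain y where y: "y \<in> carrier ?K'" "f = evP y" by blast
    then have "mod_lin A Jm ?K f"
      using mod_lin_restrict_cod[OF rP(4)[of y], of "ker_set P N \<pi>"] kiff[of y] by auto
    then show "f \<in> mod_hom A Jm ?K"
      using y rP(3)[of y] kiff[of y] by (simp add: mod_hom_iff)
  next
    fix f assume f: "f \<in> mod_hom A Jm ?K"
    then have lf: "mod_lin A Jm P f"
      using mod_lin_extend_cod[OF submod_ker[OF P r(1) \<pi>]] mod_hom_lin by blast
    then have "f \<in> mod_hom A Jm P" using f by (simp add: mod_hom_iff)
    then obtain y where y: "y \<in> carrier P'" "f = evP y"
      using relP unfolding hom_rel_def bij_betw_def by blast
    then have "y \<in> carrier ?K'"
      using kiff[of y] mod_linD(1)[OF mod_hom_lin[OF f]] by auto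
    then show "f \<in> evP ` carrier ?K'" using y by blast
  qed
  then have "hom_rel ?K ?K' evP"
    using K K' rP(5,6) unfolding hom_rel_def by (auto simp: ker_set_def)
  then show ?thesis
    using relP lin surj' by blast
qed

lemma gldim_finite_End:
  assumes "infinite (UNIV :: 'm set)" "fgen A Jm J" "projective_module TYPE('m) A Jm"
    and "gldim TYPE('m) A < \<infinity>"
  shows "gldim TYPE('m) E < \<infinity>"
proof -
  obtain n where n: "\<And>M :: ('a, 'm) module. left_module A M \<Longrightarrow> pd_le {\<one>\<^bsub>A\<^esub>} A n M"
    using assms(4) gldim_finite_iff by metis
  have "pd_le {\<one>\<^bsub>E\<^esub>} E n M" if M: "left_module E M" for M :: "('a \<Rightarrow> 'a, 'm) module"
  proof (rule pd_le_transfer[where Rel = "\<lambda>N N'. \<exists>ev. hom_rel N N' ev"])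
    show "\<exists>ev. hom_rel (restr rho M) M ev" using hom_rel_restr[OF M] by blast
    show "pd_le {\<one>\<^bsub>A\<^esub>} A n (restr rho M)" by (rule n[OF left_module_restr[OF ring_A rho_hom M]])
  next
    fix P N :: "('a, 'm) module" and N' :: "('a \<Rightarrow> 'a, 'm) module" and \<pi>
    assume *: "\<exists>ev. hom_rel N N' ev" "projective_module TYPE('m) A P"
      "mod_lin A P N \<pi>" "\<pi> ` carrier P = carrier N"
    then show "\<exists>(P' :: ('a \<Rightarrow> 'a, 'm) module) \<pi>'. (\<exists>ev. hom_rel P P' ev) \<and> mod_lin E P' N' \<pi>' \<and> \<pi>' ` carrier P' = carrier N' \<and>
      (\<exists>ev. hom_rel (ker_mod P N \<pi>) (ker_mod P' N' \<pi>') ev)"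
      using hom_rel_kernel[OF assms(1-3) _ projective_imp_left_module[OF *(2)] *(3,4)]
      by blast
  qed (use hom_relD(2) hom_rel_projective in blast)+
  then show ?thesis using gldim_finite_iff by blast
qed

end

section \<open>Morita equivalence\<close>

lemma is_functorD:
  assumes "is_functor B C F"
  shows "left_module B M \<Longrightarrow> left_module C (fst F M)"
    "\<lbrakk>left_module B M; left_module B N; f \<in> mod_hom B M N\<rbrakk> \<Longrightarrow>
       snd F M N f \<in> mod_hom C (fst F M) (fst F N)"
    "left_module B M \<Longrightarrow> snd F M M (\<lambda>x\<in>carrier M. x) = (\<lambda>x\<in>carrier (fst F M). x)"
    "\<lbrakk>left_module B L; left_module B M; left_module B N; f \<in> mod_hom B L M; g \<in> mod_hom B M N\<rbrakk> \<Longrightarrow>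
       snd F L N (compose (carrier L) g f) = compose (carrier (fst F L)) (snd F M N g) (snd F L M f)"
  using assms unfolding is_functor_def by blast+

lemma comp_functor_isoE:
  fixes F :: "('b, 'c, 'm) mod_functor" and G :: "('c, 'b, 'm) mod_functor"
  assumes "naturally_isomorphic B B (comp_functor G F) id_functor"
  obtains \<eta> where
    "\<And>M. left_module B M \<Longrightarrow> \<eta> M \<in> mod_hom B (fst G (fst F M)) M"
    "\<And>M. left_module B M \<Longrightarrow> bij_betw (\<eta> M) (carrier (fst G (fst F M))) (carrier M)"
    "\<And>M N f y. \<lbrakk>left_module B M; left_module B N; f \<in> mod_hom B M N; y \<in> carrier (fst G (fst F M))\<rbrakk> \<Longrightarrow>
       f (\<eta> M y) = \<eta> N (snd G (fst F M) (fst F N) (snd F M N f) y)"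
proof -
  obtain \<eta> where \<eta>: "\<And>M. left_module B M \<Longrightarrow> \<eta> M \<in> mod_iso B (fst G (fst F M)) M"
    "\<And>M N f. \<lbrakk>left_module B M; left_module B N; f \<in> mod_hom B M N\<rbrakk> \<Longrightarrow>
       compose (carrier (fst G (fst F M))) (\<eta> N) (snd G (fst F M) (fst F N) (snd F M N f)) =
       compose (carrier (fst G (fst F M))) f (\<eta> M)"
    using assms unfolding naturally_isomorphic_def comp_functor_def id_functor_def fst_conv snd_conv
    by blast
  show thesis
  proof (rule that[of \<eta>])
    fix M N :: "('b, 'm) module" and f y
    assume *: "left_module B M" "left_module B N" "f \<in> mod_hom B M N"
      "y \<in> carrier (fst G (fst F M))"
    show "f (\<eta> M y) = \<eta> N (snd G (fst F M) (fst F N) (snd F M N f) y)"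
      using fun_cong[OF \<eta>(2)[OF *(1-3)], of y] *(4) by (simp add: compose_def)
  qed (use \<eta>(1) in \<open>auto simp: mod_iso_def\<close>)
qed

text \<open>By naturality the composite of \<open>f\<close> with \<open>\<eta> M\<close> depends
  only on the image of \<open>f\<close> under \<open>F\<close>, and \<open>\<eta> M\<close> is
  onto.\<close>

lemma functor_faithful:
  fixes F :: "('b, 'c, 'm) mod_functor" and G :: "('c, 'b, 'm) mod_functor"
  assumes iso: "naturally_isomorphic B B (comp_functor G F) id_functor"
    and M: "left_module B M" and N: "left_module B N"
    and f: "f \<in> mod_hom B M N" and g: "g \<in> mod_hom B M N" and eq: "snd F M N f = snd F M N g"
  shows "f = g"
proof -
  obtain \<eta> where \<eta>:
    "\<And>M. left_module B M \<Longrightarrow> bij_betw (\<eta> M) (carrier (fst G (fst F M))) (carrier M)"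
    "\<And>M N f y. \<lbrakk>left_module B M; left_module B N; f \<in> mod_hom B M N; y \<in> carrier (fst G (fst F M))\<rbrakk> \<Longrightarrow>
       f (\<eta> M y) = \<eta> N (snd G (fst F M) (fst F N) (snd F M N f) y)"
    using comp_functor_isoE[OF iso] by metis
  show ?thesis
  proof (rule mod_hom_eqI[OF f g])
    fix x assume x: "x \<in> carrier M"
    then obtain y where "y \<in> carrier (fst G (fst F M))" "\<eta> M y = x"
      using \<eta>(1)[OF M] surj_onE[of "\<eta> M"] unfolding bij_betw_def by metis
    then show "f x = g x" using \<eta>(2)[OF M N f] \<eta>(2)[OF M N g] eq by auto
  qed
qed

lemma mod_hom_compose:
  assumes "left_module B L" "f \<in> mod_hom B L M" "g \<in> mod_hom B M N"
  shows "compose (carrier L) g f \<in> mod_hom B L N"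
  using mod_hom_restrict[OF assms(1) mod_lin_comp[OF mod_hom_lin[OF assms(2)] mod_hom_lin[OF assms(3)]]]
  by (simp add: compose_def)

text \<open>The preimage of \<open>k\<close> is obtained by conjugating its image under
  \<open>G\<close> with the natural isomorphism.\<close>

lemma functor_full:
  fixes F :: "('b, 'c, 'm) mod_functor" and G :: "('c, 'b, 'm) mod_functor"
  assumes F: "is_functor B C F" and G: "is_functor C B G"
    and iso: "naturally_isomorphic B B (comp_functor G F) id_functor"
    and iso': "naturally_isomorphic C C (comp_functor F G) id_functor"
    and M: "left_module B M" and N: "left_module B N"
    and k: "k \<in> mod_hom C (fst F M) (fst F N)"
  obtains f where "f \<in> mod_hom B M N" "snd F M N f = k"
proof -
  obtain \<eta> where \<eta>: "\<And>M. left_module B M \<Longrightarrow> \<eta> M \<in> mod_hom B (fst G (fst F M)) M"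
    "\<And>M. left_module B M \<Longrightarrow> bij_betw (\<eta> M) (carrier (fst G (fst F M))) (carrier M)"
    "\<And>M N f y. \<lbrakk>left_module B M; left_module B N; f \<in> mod_hom B M N; y \<in> carrier (fst G (fst F M))\<rbrakk> \<Longrightarrow>
       f (\<eta> M y) = \<eta> N (snd G (fst F M) (fst F N) (snd F M N f) y)"
    using comp_functor_isoE[OF iso] by metis
  note FM = is_functorD(1)[OF F M] and FN = is_functorD(1)[OF F N]
  note GM = is_functorD(1)[OF G FM] and GN = is_functorD(1)[OF G FN]
  let ?i = "inv_into (carrier (fst G (fst F M))) (\<eta> M)"
  have i: "lin_iso B (fst G (fst F M)) M (\<eta> M) ?i"
    by (rule lin_iso_of_bij[OF GM mod_hom_lin[OF \<eta>(1)[OF M]] \<eta>(2)[OF M]])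
  note Gk = is_functorD(2)[OF G FM FN k]
  let ?f = "\<lambda>x\<in>carrier M. \<eta> N (snd G (fst F M) (fst F N) k (?i x))"
  have f: "?f \<in> mod_hom B M N"
    by (intro mod_hom_restrict M mod_lin_comp[OF mod_lin_comp[OF lin_isoD(2)[OF i] mod_hom_lin[OF Gk]]
          mod_hom_lin[OF \<eta>(1)[OF N]]])
  note Ff = is_functorD(2)[OF F M N f]
  note GFf = is_functorD(2)[OF G FM FN Ff]
  have "snd G (fst F M) (fst F N) (snd F M N ?f) = snd G (fst F M) (fst F N) k"
  proof (rule mod_hom_eqI[OF GFf Gk])
    fix y assume y: "y \<in> carrier (fst G (fst F M))"
    have "\<eta> N (snd G (fst F M) (fst F N) (snd F M N ?f) y) = ?f (\<eta> M y)"
      by (rule \<eta>(3)[OF M N f y, symmetric])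
    also have "\<dots> = \<eta> N (snd G (fst F M) (fst F N) k y)"
      using lin_isoD(3)[OF i y] lin_isoD(5)[OF i y] by simp
    finally show "snd G (fst F M) (fst F N) (snd F M N ?f) y = snd G (fst F M) (fst F N) k y"
      using \<eta>(2)[OF N] mod_linD(1)[OF mod_hom_lin[OF GFf] y] mod_linD(1)[OF mod_hom_lin[OF Gk] y]
      by (auto simp: bij_betw_def inj_on_def)
  qed
  \<comment> \<open>Here faithfulness is that of \<open>G\<close>, obtained by exchanging the two
    functors and using the second natural isomorphism.\<close>
  then have "snd F M N ?f = k" by (rule functor_faithful[OF iso' FM FN Ff k])
  with f that show thesis by blast
qed

text \<open>A copy of the regular module inside \<open>'m\<close>: maps out of it correspond to
  elements of the target by evaluation at \<open>c\<close>. It lets elements be expressed by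
  morphisms.\<close>

lemma ex_free_module:
  assumes "ring C" "lepoll (carrier C) (UNIV :: 'm set)"
  obtains C' :: "('c, 'm) module" and c where "left_module C C'" "c \<in> carrier C'"
    "\<And>(N :: ('c, 'n) module) y. \<lbrakk>left_module C N; y \<in> carrier N\<rbrakk> \<Longrightarrow> \<exists>f\<in>mod_hom C C' N. f c = y"
    "\<And>(N :: ('c, 'n) module) f g. \<lbrakk>f \<in> mod_hom C C' N; g \<in> mod_hom C C' N; f c = g c\<rbrakk> \<Longrightarrow> f = g"
proof -
  interpret C: ring C by fact
  let ?C = "ideal_module C (carrier C)"
  obtain C' :: "('c, 'm) module" and i i' where C': "left_module C C'" "lin_iso C ?C C' i i'"
    using ex_transport[OF left_module_regular[OF assms(1)]] assms(2) by (metis ideal_module_simps(1))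
  note i = lin_isoD[OF C'(2), simplified]
  have eq: "x = i' x \<odot>\<^bsub>C'\<^esub> i \<one>\<^bsub>C\<^esub>" if "x \<in> carrier C'" for x
    using mod_linD(3)[OF i(1), of "i' x" "\<one>\<^bsub>C\<^esub>"] i(4,6) that by simp
  show thesis
  proof (rule that[OF C'(1), of "i \<one>\<^bsub>C\<^esub>"])
    show "i \<one>\<^bsub>C\<^esub> \<in> carrier C'" using i(5) by simp
  next
    fix N :: "('c, 'n) module" and y assume N: "left_module C N" and y: "y \<in> carrier N"
    interpret N: left_module C N by fact
    have "mod_lin C ?C N (\<lambda>a. a \<odot>\<^bsub>N\<^esub> y)"
      using y by (intro mod_linI) (simp_all add: N.smult_closed N.smult_l_distr N.smult_assoc)
    from mod_hom_restrict[OF C'(1) mod_lin_comp[OF i(2) this]]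
    show "\<exists>f\<in>mod_hom C C' N. f (i \<one>\<^bsub>C\<^esub>) = y"
      by (rule bexI[rotated]) (simp add: i(3,5) y N.smult_one)
  next
    fix N :: "('c, 'n) module" and f g
    assume f: "f \<in> mod_hom C C' N" and g: "g \<in> mod_hom C C' N" and fg: "f (i \<one>\<^bsub>C\<^esub>) = g (i \<one>\<^bsub>C\<^esub>)"
    show "f = g"
    proof (rule mod_hom_eqI[OF f g])
      fix x assume x: "x \<in> carrier C'"
      show "f x = g x"
        using mod_linD(3)[OF mod_hom_lin[OF f], of "i' x" "i \<one>\<^bsub>C\<^esub>"]
          mod_linD(3)[OF mod_hom_lin[OF g], of "i' x" "i \<one>\<^bsub>C\<^esub>"] fg i(5,6) x eq[OF x] by simp
    qed
  qed
qed

text \<open>\<open>F_zero\<close> makes a composite that vanishes stay zero under \<open>F\<close>,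
  as is needed for kernels; \<open>lepoll_C\<close> places the free module of rank one among the
  modules on which the functors act.\<close>

locale module_equivalence =
  fixes B :: "('b, 'x) ring_scheme" and C :: "('c, 'y) ring_scheme"
    and F :: "('b, 'c, 'm) mod_functor" and G :: "('c, 'b, 'm) mod_functor"
  assumes F: "is_functor B C F" and G: "is_functor C B G"
    and GF: "naturally_isomorphic B B (comp_functor G F) id_functor"
    and FG: "naturally_isomorphic C C (comp_functor F G) id_functor"
    and F_zero: "\<lbrakk>left_module B M; left_module B N\<rbrakk> \<Longrightarrow>
      snd F M N (\<lambda>x\<in>carrier M. \<zero>\<^bsub>N\<^esub>) = (\<lambda>x\<in>carrier (fst F M). \<zero>\<^bsub>fst F N\<^esub>)"
    and ring_C: "ring C" and lepoll_C: "lepoll (carrier C) (UNIV :: 'm set)"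
begin

section \<open>Elements as maps out of a generator; injections, surjections and kernels under an
  equivalence\<close>

lemmas F_obj = is_functorD(1)[OF F]
lemmas F_hom = is_functorD(2)[OF F]
lemmas F_comp = is_functorD(4)[OF F]
lemmas faithful = functor_faithful[OF GF]
lemmas full = functor_full[OF F G GF FG]

lemma F_comp_apply:
  assumes "left_module B L" "left_module B M" "left_module B N" "f \<in> mod_hom B L M" "g \<in> mod_hom B M N"
    "x \<in> carrier (fst F L)"
  shows "snd F L N (compose (carrier L) g f) x = snd F M N g (snd F L M f x)"
  using F_comp[OF assms(1-5)] assms(6) by (simp add: compose_def)

lemma ess_surj:
  assumes "left_module C N"
  obtains i i' where "lin_iso C (fst F (fst G N)) N i i'" "left_module B (fst G N)"
proof -
  obtain e where "\<And>M. left_module C M \<Longrightarrow> e M \<in> mod_hom C (fst F (fst G M)) M"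
    "\<And>M. left_module C M \<Longrightarrow> bij_betw (e M) (carrier (fst F (fst G M))) (carrier M)"
    using comp_functor_isoE[OF FG] by metis
  then show thesis
    using that lin_iso_of_bij[OF F_obj[OF is_functorD(1)[OF G assms]] mod_hom_lin] assms
      is_functorD(1)[OF G assms] by metis
qed

text \<open>\<open>Q\<close> is the value of \<open>G\<close> at the free module of rank one.
  Fullness and faithfulness turn elements of the value of \<open>F\<close> at \<open>V\<close> into
  maps \<open>Q \<rightarrow> V\<close>, the universal element being \<open>q\<close>.\<close>

lemma ex_generator:
  obtains Q q where "left_module B Q" "q \<in> carrier (fst F Q)"
    "\<And>V y. \<lbrakk>left_module B V; y \<in> carrier (fst F V)\<rbrakk> \<Longrightarrow> \<exists>h\<in>mod_hom B Q V. snd F Q V h q = y"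
    "\<And>V h h'. \<lbrakk>left_module B V; h \<in> mod_hom B Q V; h' \<in> mod_hom B Q V;
       snd F Q V h q = snd F Q V h' q\<rbrakk> \<Longrightarrow> h = h'"
proof -
  obtain C' :: "('c, 'm) module" and c where C': "left_module C C'" and c: "c \<in> carrier C'"
    and ex: "\<And>(N :: ('c, 'm) module) y. \<lbrakk>left_module C N; y \<in> carrier N\<rbrakk> \<Longrightarrow> \<exists>f\<in>mod_hom C C' N. f c = y"
    and un: "\<And>(N :: ('c, 'm) module) f g. \<lbrakk>f \<in> mod_hom C C' N; g \<in> mod_hom C C' N; f c = g c\<rbrakk> \<Longrightarrow> f = g"
    using ex_free_module[OF ring_C lepoll_C] by blast
  let ?Q = "fst G C'"
  obtain i i' where iso: "lin_iso C (fst F ?Q) C' i i'" and Q: "left_module B ?Q"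
    using ess_surj[OF C'] by blast
  note i = lin_isoD[OF iso] and FQ = F_obj[OF Q]
  show thesis
  proof (rule that[OF Q])
    show "i' c \<in> carrier (fst F ?Q)" by (rule i(6)[OF c])
  next
    fix V y assume V: "left_module B V" and y: "y \<in> carrier (fst F V)"
    obtain f where f: "f \<in> mod_hom C C' (fst F V)" "f c = y" using ex[OF F_obj[OF V] y] by blast
    have "(\<lambda>x\<in>carrier (fst F ?Q). f (i x)) \<in> mod_hom C (fst F ?Q) (fst F V)"
      by (rule mod_hom_restrict[OF FQ mod_lin_comp[OF i(1) mod_hom_lin[OF f(1)]]])
    then obtain h where "h \<in> mod_hom B ?Q V" "snd F ?Q V h = (\<lambda>x\<in>carrier (fst F ?Q). f (i x))"
      using full[OF Q V] by blast
    then show "\<exists>h\<in>mod_hom B ?Q V. snd F ?Q V h (i' c) = y"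
      using f(2) c by (intro bexI[of _ h]) (simp_all add: i(4,6))
  next
    fix V h h' assume V: "left_module B V" and h: "h \<in> mod_hom B ?Q V" and h': "h' \<in> mod_hom B ?Q V"
      and eq: "snd F ?Q V h (i' c) = snd F ?Q V h' (i' c)"
    note Fh = mod_hom_lin[OF F_hom[OF Q V h]] and Fh' = mod_hom_lin[OF F_hom[OF Q V h']]
    have hh: "(\<lambda>x\<in>carrier C'. snd F ?Q V h (i' x)) = (\<lambda>x\<in>carrier C'. snd F ?Q V h' (i' x))"
      by (rule un[OF mod_hom_restrict[OF C' mod_lin_comp[OF i(2) Fh]]
            mod_hom_restrict[OF C' mod_lin_comp[OF i(2) Fh']]]) (simp add: c eq)
    have *: "snd F ?Q V h (i' x) = snd F ?Q V h' (i' x)" if "x \<in> carrier C'" for x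
      using that fun_cong[OF hh, of x] by simp
    have "snd F ?Q V h = snd F ?Q V h'"
    proof (rule mod_hom_eqI[OF F_hom[OF Q V h] F_hom[OF Q V h']])
      fix x assume "x \<in> carrier (fst F ?Q)"
      then show "snd F ?Q V h x = snd F ?Q V h' x" using *[OF i(5)] i(3) by simp
    qed
    then show "h = h'" by (rule faithful[OF Q V h h'])
  qed
qed

text \<open>Elements with the same image correspond to maps \<open>h\<close> and \<open>h'\<close>
  out of \<open>Q\<close> with equal composites with \<open>j\<close>; since \<open>j\<close> is
  injective, \<open>h = h'\<close>.\<close>

lemma F_inj:
  assumes V: "left_module B V" and W: "left_module B W" and j: "j \<in> mod_hom B V W"
    and inj: "inj_on j (carrier V)"
  shows "inj_on (snd F V W j) (carrier (fst F V))"
proof -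
  obtain Q q where Q: "left_module B Q" "q \<in> carrier (fst F Q)"
    and ex: "\<And>V y. \<lbrakk>left_module B V; y \<in> carrier (fst F V)\<rbrakk> \<Longrightarrow> \<exists>h\<in>mod_hom B Q V. snd F Q V h q = y"
    and un: "\<And>V h h'. \<lbrakk>left_module B V; h \<in> mod_hom B Q V; h' \<in> mod_hom B Q V;
       snd F Q V h q = snd F Q V h' q\<rbrakk> \<Longrightarrow> h = h'"
    using ex_generator by blast
  show ?thesis
  proof (rule inj_onI)
    fix y y' assume y: "y \<in> carrier (fst F V)" "y' \<in> carrier (fst F V)" "snd F V W j y = snd F V W j y'"
    obtain h where h: "h \<in> mod_hom B Q V" "snd F Q V h q = y" using ex[OF V y(1)] by blast
    obtain h' where h': "h' \<in> mod_hom B Q V" "snd F Q V h' q = y'" using ex[OF V y(2)] by blast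
    have jh: "compose (carrier Q) j h = compose (carrier Q) j h'"
      by (rule un[OF W mod_hom_compose[OF Q(1) h(1) j] mod_hom_compose[OF Q(1) h'(1) j]])
        (simp add: F_comp_apply[OF Q(1) V W _ j Q(2)] h h' y(3))
    have *: "j (h x) = j (h' x)" if "x \<in> carrier Q" for x
      using that fun_cong[OF jh, of x] by (simp add: compose_def)
    have "h = h'"
    proof (rule mod_hom_eqI[OF h(1) h'(1)])
      fix x assume x: "x \<in> carrier Q"
      show "h x = h' x"
        using inj_onD[OF inj *[OF x]] mod_linD(1)[OF mod_hom_lin[OF h(1)] x]
          mod_linD(1)[OF mod_hom_lin[OF h'(1)] x] by simp
    qed
    then show "y = y'" using h h' by simp
  qed
qed

text \<open>\<open>F\<close> maps \<open>j\<close> to a bijection. Its inverse comes from some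
  \<open>k\<close> by fullness, and faithfulness shows that \<open>j\<close> after \<open>k\<close>
  is the identity.\<close>

lemma F_bij_reflect:
  assumes V: "left_module B V" and W: "left_module B W" and j: "j \<in> mod_hom B V W"
    and inj: "inj_on j (carrier V)" and surj: "snd F V W j ` carrier (fst F V) = carrier (fst F W)"
  shows "j ` carrier V = carrier W"
proof -
  note Fj = F_hom[OF V W j]
  have bij: "bij_betw (snd F V W j) (carrier (fst F V)) (carrier (fst F W))"
    using F_inj[OF V W j inj] surj by (simp add: bij_betw_def)
  let ?k = "inv_into (carrier (fst F V)) (snd F V W j)"
  have iso: "lin_iso C (fst F V) (fst F W) (snd F V W j) ?k"
    by (rule lin_iso_of_bij[OF F_obj[OF V] mod_hom_lin[OF Fj] bij])
  have "(\<lambda>x\<in>carrier (fst F W). ?k x) \<in> mod_hom C (fst F W) (fst F V)"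
    by (rule mod_hom_restrict[OF F_obj[OF W] lin_isoD(2)[OF iso]])
  then obtain k where k: "k \<in> mod_hom B W V" "snd F W V k = (\<lambda>x\<in>carrier (fst F W). ?k x)"
    using full[OF W V] by blast
  have id: "(\<lambda>x\<in>carrier W. x) \<in> mod_hom B W W" by (rule mod_hom_restrict[OF W mod_lin_id])
  note jk = mod_hom_compose[OF W k(1) j]
  have jk_id: "compose (carrier W) j k = (\<lambda>x\<in>carrier W. x)"
  proof (rule faithful[OF W W jk id], rule mod_hom_eqI[OF F_hom[OF W W jk] F_hom[OF W W id]])
    fix x assume x: "x \<in> carrier (fst F W)"
    then show "snd F W W (compose (carrier W) j k) x = snd F W W (\<lambda>x\<in>carrier W. x) x"
      by (simp add: F_comp_apply[OF W V W k(1) j] is_functorD(3)[OF F W] k(2) lin_isoD(4)[OF iso])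
  qed
  have jk: "j (k x) = x" if "x \<in> carrier W" for x
    using that fun_cong[OF jk_id, of x] by (simp add: compose_def)
  show ?thesis
  proof (intro equalityI subsetI)
    fix x assume x: "x \<in> carrier W"
    show "x \<in> j ` carrier V"
      using jk[OF x] mod_linD(1)[OF mod_hom_lin[OF k(1)] x] by (metis imageI)
  qed (use mod_linD(1)[OF mod_hom_lin[OF j]] in auto)
qed

lemma F_bij:
  assumes V: "left_module B V" and W: "left_module B W" and j: "j \<in> mod_hom B V W"
    and bij: "bij_betw j (carrier V) (carrier W)"
  shows "snd F V W j ` carrier (fst F V) = carrier (fst F W)"
proof -
  let ?k = "\<lambda>x\<in>carrier W. inv_into (carrier V) j x"
  have iso: "lin_iso B V W j (inv_into (carrier V) j)"
    by (rule lin_iso_of_bij[OF V mod_hom_lin[OF j] bij])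
  have k: "?k \<in> mod_hom B W V" by (rule mod_hom_restrict[OF W lin_isoD(2)[OF iso]])
  have "compose (carrier W) j ?k = (\<lambda>x\<in>carrier W. x)"
    by (rule ext) (simp add: compose_def lin_isoD(4)[OF iso])
  then have jk: "snd F V W j (snd F W V ?k x) = x" if "x \<in> carrier (fst F W)" for x
    using F_comp_apply[OF W V W k j that] is_functorD(3)[OF F W] that by simp
  show ?thesis
  proof (intro equalityI subsetI)
    fix x assume x: "x \<in> carrier (fst F W)"
    show "x \<in> snd F V W j ` carrier (fst F V)"
      using jk[OF x] mod_linD(1)[OF mod_hom_lin[OF F_hom[OF W V k]] x] by (metis imageI)
  qed (use mod_linD(1)[OF mod_hom_lin[OF F_hom[OF V W j]]] in auto)
qed

text \<open>
  Surjectivity is expressed by images, which are submodules, so no quotient is needed: a map is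
  surjective iff every injection through which it factors is bijective.
\<close>

lemma F_surj:
  assumes V: "left_module B V" and W: "left_module B W" and g: "g \<in> mod_hom B V W"
    and surj: "g ` carrier V = carrier W"
  shows "snd F V W g ` carrier (fst F V) = carrier (fst F W)"
proof -
  note FV = F_obj[OF V] and FW = F_obj[OF W] and Fg = F_hom[OF V W g]
  let ?H = "snd F V W g ` carrier (fst F V)"
  have H: "submod C (fst F W) ?H" by (rule image_carrier_submod[OF FV FW mod_hom_lin[OF Fg]])
  \<comment> \<open>The image of the transformed map is, up to isomorphism, the value of
    \<open>F\<close> at \<open>U\<close>, and by fullness its inclusion comes from a map
    \<open>j\<close> from \<open>U\<close> to \<open>W\<close> through which \<open>g\<close>
    factors.\<close>
  define Z where "Z = (fst F W)\<lparr>carrier := ?H\<rparr>"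
  have Z: "left_module C Z" unfolding Z_def by (rule submod_left_module[OF FW H])
  obtain i i' where iso: "lin_iso C (fst F (fst G Z)) Z i i'" and U: "left_module B (fst G Z)"
    using ess_surj[OF Z] by blast
  note i = lin_isoD[OF iso] and FU = F_obj[OF U]
  let ?U = "fst G Z"
  have "mod_lin C (fst F ?U) (fst F W) i"
    using mod_lin_extend_cod[OF H] i(1) by (simp add: Z_def)
  then have "(\<lambda>x\<in>carrier (fst F ?U). i x) \<in> mod_hom C (fst F ?U) (fst F W)"
    by (rule mod_hom_restrict[OF FU])
  then obtain j where j: "j \<in> mod_hom B ?U W" "snd F ?U W j = (\<lambda>x\<in>carrier (fst F ?U). i x)"
    using full[OF U W] by blast
  have "mod_lin C (fst F V) Z (snd F V W g)"
    unfolding Z_def by (rule mod_lin_restrict_cod[OF mod_hom_lin[OF Fg]]) simp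
  then have "(\<lambda>x\<in>carrier (fst F V). i' (snd F V W g x)) \<in> mod_hom C (fst F V) (fst F ?U)"
    by (intro mod_hom_restrict[OF FV] mod_lin_comp[OF _ i(2)])
  then obtain w where w: "w \<in> mod_hom B V ?U"
    "snd F V ?U w = (\<lambda>x\<in>carrier (fst F V). i' (snd F V W g x))"
    using full[OF V U] by blast
  note jw = mod_hom_compose[OF V w(1) j(1)]
  have Zc: "snd F V W g x \<in> carrier Z" if "x \<in> carrier (fst F V)" for x
    using that by (simp add: Z_def)
  have jwg: "compose (carrier V) j w = g"
  proof (rule faithful[OF V W jw g], rule mod_hom_eqI[OF F_hom[OF V W jw] Fg])
    fix x assume x: "x \<in> carrier (fst F V)"
    then show "snd F V W (compose (carrier V) j w) x = snd F V W g x"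
      using i(4,6)[OF Zc[OF x]] by (simp add: F_comp_apply[OF V U W w(1) j(1)] j(2) w(2))
  qed
  have jw: "j (w x) = g x" if "x \<in> carrier V" for x
    using that fun_cong[OF jwg, of x] by (simp add: compose_def)
  \<comment> \<open>The inclusion of the kernel of \<open>j\<close> and the zero map have the same
    composite with \<open>j\<close>. As \<open>F\<close> sends \<open>j\<close> to an injection,
    both have the same value under \<open>F\<close>, hence are equal, and the kernel is
    zero.\<close>
  have "inj_on j (carrier ?U)"
    unfolding mod_lin_inj_iff[OF U W mod_hom_lin[OF j(1)]]
  proof (intro ballI impI)
    fix x assume x: "x \<in> carrier ?U" "j x = \<zero>\<^bsub>W\<^esub>"
    let ?K = "ker_mod ?U W j"
    note sub = submod_ker[OF U W mod_hom_lin[OF j(1)]]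
    have K: "left_module B ?K" by (rule submod_left_module[OF U sub])
    have u: "(\<lambda>x\<in>carrier ?K. x) \<in> mod_hom B ?K ?U"
      by (rule mod_hom_restrict[OF K mod_lin_incl[OF sub]])
    have z: "(\<lambda>x\<in>carrier ?K. \<zero>\<^bsub>?U\<^esub>) \<in> mod_hom B ?K ?U"
      by (rule mod_hom_restrict[OF K mod_lin_zero_map[OF U]])
    have eq: "compose (carrier ?K) j (\<lambda>x\<in>carrier ?K. x) = compose (carrier ?K) j (\<lambda>x\<in>carrier ?K. \<zero>\<^bsub>?U\<^esub>)"
      using mod_lin_zero[OF U W mod_hom_lin[OF j(1)]]
      by (intro ext) (simp add: compose_def ker_set_def)
    have "snd F ?K ?U (\<lambda>x\<in>carrier ?K. x) = snd F ?K ?U (\<lambda>x\<in>carrier ?K. \<zero>\<^bsub>?U\<^esub>)"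
    proof (rule mod_hom_eqI[OF F_hom[OF K U u] F_hom[OF K U z]])
      fix y assume y: "y \<in> carrier (fst F ?K)"
      let ?a = "snd F ?K ?U (\<lambda>x\<in>carrier ?K. x) y" and ?b = "snd F ?K ?U (\<lambda>x\<in>carrier ?K. \<zero>\<^bsub>?U\<^esub>) y"
      have c: "?a \<in> carrier (fst F ?U)" "?b \<in> carrier (fst F ?U)"
        using mod_linD(1)[OF mod_hom_lin[OF F_hom[OF K U u]] y]
          mod_linD(1)[OF mod_hom_lin[OF F_hom[OF K U z]] y] by auto
      have "snd F ?U W j ?a = snd F ?U W j ?b"
        using F_comp_apply[OF K U W u j(1) y] F_comp_apply[OF K U W z j(1) y] eq by simp
      then have "i ?a = i ?b" using c by (simp add: j(2))
      then show "?a = ?b" using i(3)[OF c(1)] i(3)[OF c(2)] by simp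
    qed
    then have "(\<lambda>x\<in>carrier ?K. x) = (\<lambda>x\<in>carrier ?K. \<zero>\<^bsub>?U\<^esub>)" by (rule faithful[OF K U u z])
    from fun_cong[OF this, of x] show "x = \<zero>\<^bsub>?U\<^esub>" using x by (simp add: ker_set_def)
  qed
  moreover have "j ` carrier ?U = carrier W"
  proof (intro equalityI subsetI)
    fix y assume "y \<in> carrier W"
    then obtain x where "x \<in> carrier V" "g x = y" using surj_onE[OF surj] by metis
    then show "y \<in> j ` carrier ?U" using jw[of x] mod_linD(1)[OF mod_hom_lin[OF w(1)], of x] by (metis imageI)
  qed (use mod_linD(1)[OF mod_hom_lin[OF j(1)]] in auto)
  ultimately have "snd F ?U W j ` carrier (fst F ?U) = carrier (fst F W)"
    by (intro F_bij[OF U W j(1)]) (simp add: bij_betw_def)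
  \<comment> \<open>The map that \<open>F\<close> assigns to \<open>j\<close> takes values in the
    image \<open>Z\<close>, so its surjectivity makes \<open>Z\<close> everything.\<close>
  moreover have "snd F ?U W j ` carrier (fst F ?U) \<subseteq> carrier Z"
    using i(5) by (auto simp: j(2))
  then have "snd F ?U W j ` carrier (fst F ?U) \<subseteq> ?H" by (simp add: Z_def)
  ultimately show ?thesis using mod_linD(1)[OF mod_hom_lin[OF Fg]] by auto
qed

text \<open>\<open>g\<close> factors through the inclusion of its image; \<open>F\<close> sends this
  inclusion to a surjection, so the inclusion is bijective by \<open>F_bij_reflect\<close>.\<close>

lemma F_surj_reflect:
  assumes V: "left_module B V" and W: "left_module B W" and g: "g \<in> mod_hom B V W"
    and surj: "snd F V W g ` carrier (fst F V) = carrier (fst F W)"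
  shows "g ` carrier V = carrier W"
proof -
  have H: "submod B W (g ` carrier V)" by (rule image_carrier_submod[OF V W mod_hom_lin[OF g]])
  let ?Z = "W\<lparr>carrier := g ` carrier V\<rparr>"
  have Z: "left_module B ?Z" by (rule submod_left_module[OF W H])
  let ?j = "\<lambda>x\<in>carrier ?Z. x"
  have j: "?j \<in> mod_hom B ?Z W" by (rule mod_hom_restrict[OF Z mod_lin_incl[OF H]])
  have g': "g \<in> mod_hom B V ?Z"
    using g mod_lin_restrict_cod[OF mod_hom_lin[OF g], of "g ` carrier V"] by (simp add: mod_hom_iff)
  have "compose (carrier V) ?j g = g"
    using g by (intro mod_hom_eqI[OF mod_hom_compose[OF V g' j] g]) (simp add: compose_def)
  then have gj: "snd F V W g x = snd F ?Z W ?j (snd F V ?Z g x)" if "x \<in> carrier (fst F V)" for x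
    using F_comp_apply[OF V Z W g' j that] by simp
  have "snd F ?Z W ?j ` carrier (fst F ?Z) = carrier (fst F W)"
  proof (intro equalityI subsetI)
    fix y assume "y \<in> carrier (fst F W)"
    then obtain x where "x \<in> carrier (fst F V)" "snd F V W g x = y" using surj_onE[OF surj] by metis
    then show "y \<in> snd F ?Z W ?j ` carrier (fst F ?Z)"
      using gj[of x] mod_linD(1)[OF mod_hom_lin[OF F_hom[OF V Z g']], of x] by (metis imageI)
  qed (use mod_linD(1)[OF mod_hom_lin[OF F_hom[OF Z W j]]] in auto)
  then have "?j ` carrier ?Z = carrier W"
    by (intro F_bij_reflect[OF Z W j]) (auto simp: inj_on_def)
  then show ?thesis by simp
qed

definition F_rel where
  "F_rel V N \<longleftrightarrow> left_module B V \<and> left_module C N \<and> (\<exists>i i'. lin_iso C (fst F V) N i i')"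

text \<open>A lifting problem over \<open>C\<close> is translated to \<open>B\<close>: the modules
  by essential surjectivity, the maps by fullness, and surjectivity of the given map by
  \<open>F_surj_reflect\<close>. The lift found over \<open>B\<close> is sent back by
  \<open>F\<close>.\<close>

lemma F_rel_projective:
  assumes rel: "F_rel P P'" and proj: "projective_module TYPE('m) B P"
  shows "projective_module TYPE('m) C P'"
proof -
  have P: "left_module B P" and P': "left_module C P'" using rel by (auto simp: F_rel_def)
  obtain e e' where e: "lin_iso C (fst F P) P' e e'" using rel by (auto simp: F_rel_def)
  have "projective_module TYPE('m) C (fst F P)"
  proof (rule projectiveI[OF F_obj[OF P]])
    fix U V :: "('c, 'm) module" and g f
    assume U: "left_module C U" and V: "left_module C V" and g: "mod_lin C U V g"
      and gs: "g ` carrier U = carrier V" and f: "mod_lin C (fst F P) V f"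
    obtain i i' where iso: "lin_iso C (fst F (fst G U)) U i i'" and U': "left_module B (fst G U)"
      using ess_surj[OF U] by blast
    obtain k k' where kiso: "lin_iso C (fst F (fst G V)) V k k'" and V': "left_module B (fst G V)"
      using ess_surj[OF V] by blast
    note i = lin_isoD[OF iso] and k = lin_isoD[OF kiso]
    have "(\<lambda>x\<in>carrier (fst F (fst G U)). k' (g (i x))) \<in> mod_hom C (fst F (fst G U)) (fst F (fst G V))"
      by (rule mod_hom_restrict[OF F_obj[OF U'] mod_lin_comp[OF mod_lin_comp[OF i(1) g] k(2)]])
    then obtain g' where g': "g' \<in> mod_hom B (fst G U) (fst G V)"
      "snd F (fst G U) (fst G V) g' = (\<lambda>x\<in>carrier (fst F (fst G U)). k' (g (i x)))"
      using full[OF U' V'] by blast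
    have "(\<lambda>x\<in>carrier (fst F P). k' (f x)) \<in> mod_hom C (fst F P) (fst F (fst G V))"
      by (rule mod_hom_restrict[OF F_obj[OF P] mod_lin_comp[OF f k(2)]])
    then obtain f' where f': "f' \<in> mod_hom B P (fst G V)"
      "snd F P (fst G V) f' = (\<lambda>x\<in>carrier (fst F P). k' (f x))"
      using full[OF P V'] by blast
    have "snd F (fst G U) (fst G V) g' ` carrier (fst F (fst G U)) = carrier (fst F (fst G V))"
    proof (intro equalityI subsetI)
      fix y assume y: "y \<in> carrier (fst F (fst G V))"
      obtain x where x: "x \<in> carrier U" "g x = k y" using surj_onE[OF gs k(5)[OF y]] by metis
      have "snd F (fst G U) (fst G V) g' (i' x) = y"
        using x y by (simp add: g'(2) i(4,6) k(3))
      then show "y \<in> snd F (fst G U) (fst G V) g' ` carrier (fst F (fst G U))"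
        using i(6)[OF x(1)] by (metis imageI)
    qed (use mod_linD(1)[OF mod_hom_lin[OF F_hom[OF U' V' g'(1)]]] in auto)
    note g's = F_surj_reflect[OF U' V' g'(1) this]
    obtain h where h: "mod_lin B P (fst G U) h" "\<And>x. x \<in> carrier P \<Longrightarrow> g' (h x) = f' x"
      using projective_lift_same[OF proj U' V' mod_hom_lin[OF g'(1)] g's mod_hom_lin[OF f'(1)]] by blast
    let ?h = "\<lambda>x\<in>carrier P. h x"
    have h': "?h \<in> mod_hom B P (fst G U)" by (rule mod_hom_restrict[OF P h(1)])
    have gh: "compose (carrier P) g' ?h = f'"
      by (rule mod_hom_eqI[OF mod_hom_compose[OF P h' g'(1)] f'(1)]) (simp add: compose_def h(2))
    note Fh = mod_hom_lin[OF F_hom[OF P U' h']]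
    have "g (i (snd F P (fst G U) ?h x)) = f x" if x: "x \<in> carrier (fst F P)" for x
    proof -
      have "k' (g (i (snd F P (fst G U) ?h x))) = k' (f x)"
        using F_comp_apply[OF P U' V' h' g'(1) x] mod_linD(1)[OF Fh x] x by (simp add: gh f'(2) g'(2))
      then show ?thesis
        using k(4) mod_linD(1)[OF g] i(5) mod_linD(1)[OF Fh x] mod_linD(1)[OF f x] by metis
    qed
    then show "\<exists>h. mod_lin C (fst F P) U h \<and> (\<forall>x\<in>carrier (fst F P). g (h x) = f x)"
      using mod_lin_comp[OF Fh i(1)] by blast
  qed
  then show ?thesis by (rule projective_iso[OF _ P' e])
qed

text \<open>The value of \<open>F\<close> at the kernel of \<open>\<pi>\<close> embeds into its
  value at \<open>P\<close>; what has to be shown is that its image is the whole kernel of the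
  transformed map.\<close>

lemma F_rel_kernel:
  assumes rel: "F_rel V N" and P: "left_module B P"
    and \<pi>: "mod_lin B P V \<pi>" and surj: "\<pi> ` carrier P = carrier V"
  shows "\<exists>(P' :: ('c, 'm) module) \<pi>'. F_rel P P' \<and> mod_lin C P' N \<pi>' \<and> \<pi>' ` carrier P' = carrier N \<and>
    F_rel (ker_mod P V \<pi>) (ker_mod P' N \<pi>')"
proof -
  have V: "left_module B V" and N: "left_module C N" using rel by (auto simp: F_rel_def)
  obtain e e' where iso: "lin_iso C (fst F V) N e e'" using rel by (auto simp: F_rel_def)
  note e = lin_isoD[OF iso] and FP = F_obj[OF P] and FV = F_obj[OF V]
  let ?p = "\<lambda>x\<in>carrier P. \<pi> x"
  have p: "?p \<in> mod_hom B P V" by (rule mod_hom_restrict[OF P \<pi>])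
  have ps: "?p ` carrier P = carrier V" using surj by simp
  let ?\<pi>' = "\<lambda>y. e (snd F P V ?p y)"
  note Fp = mod_hom_lin[OF F_hom[OF P V p]]
  have lin: "mod_lin C (fst F P) N ?\<pi>'" by (rule mod_lin_comp[OF Fp e(1)])
  have "?\<pi>' ` carrier (fst F P) = e ` carrier (fst F V)"
    by (simp flip: F_surj[OF P V p ps] add: image_image)
  also have "\<dots> = carrier N" using lin_iso_bij[OF iso] by (simp add: bij_betw_def)
  finally have surj': "?\<pi>' ` carrier (fst F P) = carrier N" .
  let ?K = "ker_mod P V \<pi>" and ?K' = "ker_mod (fst F P) N ?\<pi>'"
  note sub = submod_ker[OF P V \<pi>]
  have K: "left_module B ?K" by (rule submod_left_module[OF P sub])
  have K': "left_module C ?K'" by (rule left_module_ker[OF FP FP N lin])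
  let ?\<kappa> = "\<lambda>x\<in>carrier ?K. x"
  have \<kappa>: "?\<kappa> \<in> mod_hom B ?K P" by (rule mod_hom_restrict[OF K mod_lin_incl[OF sub]])
  note F\<kappa> = mod_hom_lin[OF F_hom[OF K P \<kappa>]]
  have e0: "e y = \<zero>\<^bsub>N\<^esub> \<longleftrightarrow> y = \<zero>\<^bsub>fst F V\<^esub>" if "y \<in> carrier (fst F V)" for y
    using mod_lin_zero[OF FV N e(1)] mod_lin_zero[OF N FV e(2)] e(3)[OF that] by metis
  have k1: "snd F ?K P ?\<kappa> y \<in> carrier ?K'" if y: "y \<in> carrier (fst F ?K)" for y
  proof -
    have "compose (carrier ?K) ?p ?\<kappa> = (\<lambda>x\<in>carrier ?K. \<zero>\<^bsub>V\<^esub>)"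
      by (rule ext) (simp add: compose_def ker_set_def)
    then have "snd F P V ?p (snd F ?K P ?\<kappa> y) = \<zero>\<^bsub>fst F V\<^esub>"
      using F_comp_apply[OF K P V \<kappa> p y] F_zero[OF K V] y by simp
    then show ?thesis
      using mod_linD(1)[OF F\<kappa> y] mod_lin_zero[OF FV N e(1)] by (simp add: ker_set_def)
  qed
  obtain Q q where Q: "left_module B Q" "q \<in> carrier (fst F Q)"
    and ex: "\<And>V y. \<lbrakk>left_module B V; y \<in> carrier (fst F V)\<rbrakk> \<Longrightarrow> \<exists>h\<in>mod_hom B Q V. snd F Q V h q = y"
    and un: "\<And>V h h'. \<lbrakk>left_module B V; h \<in> mod_hom B Q V; h' \<in> mod_hom B Q V;
       snd F Q V h q = snd F Q V h' q\<rbrakk> \<Longrightarrow> h = h'"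
    using ex_generator by blast
  \<comment> \<open>\<open>y\<close> corresponds to a map \<open>h\<close> from \<open>Q\<close> to
    \<open>P\<close>. Its composite with \<open>\<pi>\<close> corresponds to zero, so it is zero,
    and \<open>h\<close> has values in the kernel.\<close>
  have k2: "y \<in> snd F ?K P ?\<kappa> ` carrier (fst F ?K)" if y: "y \<in> carrier ?K'" for y
  proof -
    have yP: "y \<in> carrier (fst F P)" "snd F P V ?p y = \<zero>\<^bsub>fst F V\<^esub>"
      using y e0 mod_linD(1)[OF Fp] by (auto simp: ker_set_def)
    obtain h where h: "h \<in> mod_hom B Q P" "snd F Q P h q = y" using ex[OF P yP(1)] by blast
    have z: "(\<lambda>x\<in>carrier Q. \<zero>\<^bsub>V\<^esub>) \<in> mod_hom B Q V"
      by (rule mod_hom_restrict[OF Q(1) mod_lin_zero_map[OF V]])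
    have ph: "compose (carrier Q) ?p h = (\<lambda>x\<in>carrier Q. \<zero>\<^bsub>V\<^esub>)"
      by (rule un[OF V mod_hom_compose[OF Q(1) h(1) p] z])
        (simp add: F_comp_apply[OF Q(1) P V h(1) p Q(2)] h(2) yP F_zero[OF Q(1) V] Q(2))
    have "\<pi> (h x) = \<zero>\<^bsub>V\<^esub>" if "x \<in> carrier Q" for x
      using fun_cong[OF ph, of x] that mod_linD(1)[OF mod_hom_lin[OF h(1)] that]
      by (simp add: compose_def)
    then have "h ` carrier Q \<subseteq> carrier ?K"
      using mod_linD(1)[OF mod_hom_lin[OF h(1)]] by (auto simp: ker_set_def)
    then have h': "h \<in> mod_hom B Q ?K"
      using h(1) mod_lin_restrict_cod[OF mod_hom_lin[OF h(1)], of "ker_set P V \<pi>"]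
      by (simp add: mod_hom_iff)
    have "compose (carrier Q) ?\<kappa> h = h"
      using mod_linD(1)[OF mod_hom_lin[OF h']]
      by (intro mod_hom_eqI[OF mod_hom_compose[OF Q(1) h' \<kappa>] h(1)]) (simp add: compose_def)
    then have "snd F ?K P ?\<kappa> (snd F Q ?K h q) = y"
      using F_comp_apply[OF Q(1) K P h' \<kappa> Q(2)] h(2) by simp
    then show ?thesis using mod_linD(1)[OF mod_hom_lin[OF F_hom[OF Q(1) K h']] Q(2)] by (metis imageI)
  qed
  have "mod_lin C (fst F ?K) ?K' (snd F ?K P ?\<kappa>)"
    using mod_lin_restrict_cod[OF F\<kappa>, of "carrier ?K'"] k1 by auto
  moreover have "bij_betw (snd F ?K P ?\<kappa>) (carrier (fst F ?K)) (carrier ?K')"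
    unfolding bij_betw_def using k1 k2 by (intro conjI F_inj[OF K P \<kappa>]) (auto simp: inj_on_def)
  ultimately have "lin_iso C (fst F ?K) ?K' (snd F ?K P ?\<kappa>)
      (inv_into (carrier (fst F ?K)) (snd F ?K P ?\<kappa>))"
    by (rule lin_iso_of_bij[OF F_obj[OF K]])
  then have "F_rel ?K ?K'" unfolding F_rel_def using K K' by blast
  moreover have "F_rel P (fst F P)" unfolding F_rel_def using P FP lin_iso_id by blast
  ultimately show ?thesis using lin surj' by blast
qed

lemma gldim_finite_equivalence:
  assumes "gldim TYPE('m) B < \<infinity>"
  shows "gldim TYPE('m) C < \<infinity>"
proof -
  obtain n where n: "\<And>M :: ('b, 'm) module. left_module B M \<Longrightarrow> pd_le {\<one>\<^bsub>B\<^esub>} B n M"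
    using assms gldim_finite_iff by metis
  have "pd_le {\<one>\<^bsub>C\<^esub>} C n M" if M: "left_module C M" for M :: "('c, 'm) module"
  proof (rule pd_le_transfer[where Rel = F_rel])
    obtain i i' where "lin_iso C (fst F (fst G M)) M i i'" "left_module B (fst G M)"
      using ess_surj[OF M] by blast
    then show "F_rel (fst G M) M" "pd_le {\<one>\<^bsub>B\<^esub>} B n (fst G M)"
      unfolding F_rel_def using M n by blast+
  next
    fix P N :: "('b, 'm) module" and N' :: "('c, 'm) module" and \<pi>
    assume *: "F_rel N N'" "projective_module TYPE('m) B P" "mod_lin B P N \<pi>" "\<pi> ` carrier P = carrier N"
    show "\<exists>(P' :: ('c, 'm) module) \<pi>'. F_rel P P' \<and> mod_lin C P' N' \<pi>' \<and> \<pi>' ` carrier P' = carrier N' \<and>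
      F_rel (ker_mod P N \<pi>) (ker_mod P' N' \<pi>')"
      by (rule F_rel_kernel[OF *(1) projective_imp_left_module[OF *(2)] *(3,4)])
  next
    show "\<And>N N'. F_rel N N' \<Longrightarrow> left_module C N'" by (simp add: F_rel_def)
  qed (rule F_rel_projective)
  then show ?thesis using gldim_finite_iff by blast
qed

end

lemma linear_functor_add:
  assumes "linear_functor R B C F"
  shows "\<lbrakk>left_module B M; left_module B N; f \<in> mod_hom B M N; g \<in> mod_hom B M N\<rbrakk> \<Longrightarrow>
    snd F M N (\<lambda>x\<in>carrier M. f x \<oplus>\<^bsub>N\<^esub> g x) =
      (\<lambda>x\<in>carrier (fst F M). snd F M N f x \<oplus>\<^bsub>fst F N\<^esub> snd F M N g x)"
  by (rule assms[unfolded linear_functor_def, THEN conjunct2, THEN conjunct1, rule_format])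

lemma gldim_finite_morita:
  fixes B :: "('r, 'b) module" and C :: "('r, 'c) module"
  assumes "morita_equivalent TYPE('m) R B C" "ring C" "lepoll (carrier C) (UNIV :: 'm set)"
    and "gldim TYPE('m) B < \<infinity>"
  shows "gldim TYPE('m) C < \<infinity>"
proof -
  obtain F :: "('b, 'c, 'm) mod_functor" and G :: "('c, 'b, 'm) mod_functor" where
    F: "linear_functor R B C F" and G: "linear_functor R C B G"
    and iso: "naturally_isomorphic B B (comp_functor G F) id_functor"
      "naturally_isomorphic C C (comp_functor F G) id_functor"
    using assms(1) unfolding morita_equivalent_def by blast
  have fF: "is_functor B C F" and fG: "is_functor C B G"
    using F G by (simp_all add: linear_functor_def)
  interpret module_equivalence B C F G
  proof (rule module_equivalence.intro)
    fix M N :: "('b, 'm) module" assume M: "left_module B M" and N: "left_module B N"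
    let ?z = "\<lambda>x\<in>carrier M. \<zero>\<^bsub>N\<^esub>"
    interpret N: left_module B N by fact
    interpret FN: left_module C "fst F N" by (rule is_functorD(1)[OF fF N])
    have z: "?z \<in> mod_hom B M N" by (rule mod_hom_restrict[OF M mod_lin_zero_map[OF N]])
    \<comment> \<open>The zero map equals its own double, so by additivity the same holds for its
      image under \<open>F\<close>, which is therefore zero.\<close>
    have zz: "(\<lambda>x\<in>carrier M. ?z x \<oplus>\<^bsub>N\<^esub> ?z x) = ?z" by (rule ext) simp
    have *: "snd F M N ?z = (\<lambda>x\<in>carrier (fst F M). snd F M N ?z x \<oplus>\<^bsub>fst F N\<^esub> snd F M N ?z x)"
      by (rule linear_functor_add[OF F M N z z, unfolded zz])
    note Fz = is_functorD(2)[OF fF M N z]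
    show "snd F M N ?z = (\<lambda>x\<in>carrier (fst F M). \<zero>\<^bsub>fst F N\<^esub>)"
    proof (rule mod_hom_eqI[OF Fz mod_hom_restrict[OF is_functorD(1)[OF fF M] mod_lin_zero_map]])
      fix x assume x: "x \<in> carrier (fst F M)"
      have "snd F M N ?z x = snd F M N ?z x \<oplus>\<^bsub>fst F N\<^esub> snd F M N ?z x"
        using fun_cong[OF *, of x] x by simp
      then show "snd F M N ?z x = (\<lambda>x\<in>carrier (fst F M). \<zero>\<^bsub>fst F N\<^esub>) x"
        using mod_linD(1)[OF mod_hom_lin[OF Fz] x] x by simp
    qed (rule FN.left_module_axioms)
  qed (fact fF fG iso assms(2,3))+
  show ?thesis by (rule gldim_finite_equivalence[OF assms(4)])
qed

section \<open>Localization\<close>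

text \<open>An axiomatic description of \<open>B\<close> as the ring of fractions of
  \<open>A\<close> with central denominators in \<open>S\<close>; \<open>A\<close> may be
  noncommutative. With \<open>S = {1}\<close> it describes a ring isomorphism, so invariance under
  isomorphism and passage to a localization are covered by one argument.\<close>

locale ring_loc =
  fixes A :: "('a, 'x) ring_scheme" and B :: "('b, 'y) ring_scheme"
    and \<phi> :: "'a \<Rightarrow> 'b" and S :: "'a set"
  assumes ring_A: "ring A" and ring_B: "ring B" and hom: "\<phi> \<in> ring_hom A B"
    and S_carrier: "s \<in> S \<Longrightarrow> s \<in> carrier A" and S_one: "\<one>\<^bsub>A\<^esub> \<in> S"
    and S_mult: "\<lbrakk>s \<in> S; t \<in> S\<rbrakk> \<Longrightarrow> s \<otimes>\<^bsub>A\<^esub> t \<in> S"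
    and S_central: "\<lbrakk>s \<in> S; a \<in> carrier A\<rbrakk> \<Longrightarrow> s \<otimes>\<^bsub>A\<^esub> a = a \<otimes>\<^bsub>A\<^esub> s"
    and S_unit: "s \<in> S \<Longrightarrow> \<exists>b\<in>carrier B. b \<otimes>\<^bsub>B\<^esub> \<phi> s = \<one>\<^bsub>B\<^esub> \<and> \<phi> s \<otimes>\<^bsub>B\<^esub> b = \<one>\<^bsub>B\<^esub>"
    and fraction: "b \<in> carrier B \<Longrightarrow> \<exists>s\<in>S. \<exists>a\<in>carrier A. \<phi> s \<otimes>\<^bsub>B\<^esub> b = \<phi> a"
    and kernel: "\<lbrakk>a \<in> carrier A; \<phi> a = \<zero>\<^bsub>B\<^esub>\<rbrakk> \<Longrightarrow> \<exists>s\<in>S. s \<otimes>\<^bsub>A\<^esub> a = \<zero>\<^bsub>A\<^esub>"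
begin

interpretation A: ring A by (rule ring_A)
interpretation B: ring B by (rule ring_B)

lemmas phi_closed = ring_hom_closed[OF hom]
lemmas phi_mult = ring_hom_mult[OF hom]
lemmas phi_add = ring_hom_add[OF hom]
lemmas phi_one = ring_hom_one[OF hom]

lemma phi_neg: "a \<in> carrier A \<Longrightarrow> \<phi> (\<ominus>\<^bsub>A\<^esub> a) = \<ominus>\<^bsub>B\<^esub> \<phi> a"
proof -
  interpret h: ring_hom_ring A B \<phi> by (rule ring_hom_ringI2[OF ring_A ring_B hom])
  show "a \<in> carrier A \<Longrightarrow> \<phi> (\<ominus>\<^bsub>A\<^esub> a) = \<ominus>\<^bsub>B\<^esub> \<phi> a" by simp
qed

lemma S_smult_commute:
  assumes "left_module A N" "s \<in> S" "a \<in> carrier A" "x \<in> carrier N"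
  shows "s \<odot>\<^bsub>N\<^esub> (a \<odot>\<^bsub>N\<^esub> x) = a \<odot>\<^bsub>N\<^esub> (s \<odot>\<^bsub>N\<^esub> x)"
  using assms left_module.smult_assoc[OF assms(1)] S_central S_carrier by metis

lemma phi_S_cancel:
  assumes "left_module B N" "s \<in> S" "x \<in> carrier N" "y \<in> carrier N"
    "\<phi> s \<odot>\<^bsub>N\<^esub> x = \<phi> s \<odot>\<^bsub>N\<^esub> y"
  shows "x = y"
proof -
  interpret N: left_module B N by fact
  obtain b where b: "b \<in> carrier B" "b \<otimes>\<^bsub>B\<^esub> \<phi> s = \<one>\<^bsub>B\<^esub>" using S_unit assms by blast
  have "b \<odot>\<^bsub>N\<^esub> (\<phi> s \<odot>\<^bsub>N\<^esub> w) = w" if "w \<in> carrier N" for w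
    using N.smult_assoc[of b "\<phi> s" w] b that phi_closed[OF S_carrier[OF assms(2)]]
    by (simp add: N.smult_one)
  then show ?thesis using assms(3-5) by metis
qed

lemma phi_S_solve:
  assumes "left_module B N" "s \<in> S" "x \<in> carrier N"
  obtains y where "y \<in> carrier N" "\<phi> s \<odot>\<^bsub>N\<^esub> y = x"
proof -
  interpret N: left_module B N by fact
  obtain b where b: "b \<in> carrier B" "\<phi> s \<otimes>\<^bsub>B\<^esub> b = \<one>\<^bsub>B\<^esub>" using S_unit assms by blast
  then have "\<phi> s \<odot>\<^bsub>N\<^esub> (b \<odot>\<^bsub>N\<^esub> x) = x"
    using assms phi_closed S_carrier by (simp add: N.smult_one flip: N.smult_assoc)
  then show thesis using that b(1) assms(3) N.smult_closed by blast
qed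

text \<open>Every \<open>b\<close> becomes the image of an element of \<open>A\<close> after
  multiplication by some \<open>\<phi> t\<close>, and there centrality of \<open>S\<close> in
  \<open>A\<close> applies; \<open>\<phi> t\<close> is then cancelled.\<close>

lemma phi_S_central:
  assumes s: "s \<in> S" and b: "b \<in> carrier B"
  shows "\<phi> s \<otimes>\<^bsub>B\<^esub> b = b \<otimes>\<^bsub>B\<^esub> \<phi> s"
proof -
  obtain t a where t: "t \<in> S" and a: "a \<in> carrier A" and eq: "\<phi> t \<otimes>\<^bsub>B\<^esub> b = \<phi> a"
    using fraction[OF b] by blast
  have c: "\<phi> s \<in> carrier B" "\<phi> t \<in> carrier B" using s t S_carrier phi_closed by auto
  have "\<phi> t \<otimes>\<^bsub>B\<^esub> (\<phi> s \<otimes>\<^bsub>B\<^esub> b) = \<phi> s \<otimes>\<^bsub>B\<^esub> (\<phi> t \<otimes>\<^bsub>B\<^esub> b)"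
    using phi_mult[of s t] phi_mult[of t s] S_central[OF s, of t] s t b c S_carrier
    by (simp flip: B.m_assoc)
  also have "\<dots> = \<phi> a \<otimes>\<^bsub>B\<^esub> \<phi> s"
    using phi_mult[of s a] phi_mult[of a s] S_central[OF s a] s a S_carrier by (simp add: eq)
  also have "\<dots> = \<phi> t \<otimes>\<^bsub>B\<^esub> (b \<otimes>\<^bsub>B\<^esub> \<phi> s)" using b c by (simp flip: eq add: B.m_assoc)
  finally show ?thesis
    using phi_S_cancel[OF left_module_regular[OF ring_B] t, of "\<phi> s \<otimes>\<^bsub>B\<^esub> b" "b \<otimes>\<^bsub>B\<^esub> \<phi> s"] b c
    by simp
qed

text \<open>\<open>N'\<close> is the module of fractions of \<open>N\<close> with structure map
  \<open>l\<close>: the kernel of \<open>l\<close> is killed by denominators, and every element of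
  \<open>N'\<close> has one.\<close>

definition loc_rel where
  "loc_rel N N' l \<longleftrightarrow> left_module A N \<and> left_module B N' \<and> mod_lin A N (restr \<phi> N') l \<and>
     (\<forall>x\<in>carrier N. l x = \<zero>\<^bsub>N'\<^esub> \<longrightarrow> (\<exists>s\<in>S. s \<odot>\<^bsub>N\<^esub> x = \<zero>\<^bsub>N\<^esub>)) \<and>
     (\<forall>y\<in>carrier N'. \<exists>s\<in>S. \<exists>x\<in>carrier N. \<phi> s \<odot>\<^bsub>N'\<^esub> y = l x)"

lemma loc_relD:
  assumes "loc_rel N N' l"
  shows "left_module A N" "left_module B N'" "mod_lin A N (restr \<phi> N') l"
    "\<lbrakk>x \<in> carrier N; l x = \<zero>\<^bsub>N'\<^esub>\<rbrakk> \<Longrightarrow> \<exists>s\<in>S. s \<odot>\<^bsub>N\<^esub> x = \<zero>\<^bsub>N\<^esub>"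
    "y \<in> carrier N' \<Longrightarrow> \<exists>s\<in>S. \<exists>x\<in>carrier N. \<phi> s \<odot>\<^bsub>N'\<^esub> y = l x"
    "x \<in> carrier N \<Longrightarrow> l x \<in> carrier N'"
    "\<lbrakk>x \<in> carrier N; x' \<in> carrier N\<rbrakk> \<Longrightarrow> l (x \<oplus>\<^bsub>N\<^esub> x') = l x \<oplus>\<^bsub>N'\<^esub> l x'"
    "\<lbrakk>a \<in> carrier A; x \<in> carrier N\<rbrakk> \<Longrightarrow> l (a \<odot>\<^bsub>N\<^esub> x) = \<phi> a \<odot>\<^bsub>N'\<^esub> l x"
  using assms by (auto simp: loc_rel_def mod_lin_def)

text \<open>On a \<open>B\<close>-module the denominators already act invertibly, so it is its own
  localization; this reaches every \<open>B\<close>-module.\<close>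

lemma loc_rel_refl:
  assumes "left_module B M"
  shows "loc_rel (restr \<phi> M) M (\<lambda>x. x)"
proof -
  interpret M: left_module B M by fact
  show ?thesis
    using assms left_module_restr[OF ring_A hom assms] S_one phi_one
    by (auto simp: loc_rel_def mod_lin_id M.smult_one intro!: bexI[of _ "\<one>\<^bsub>A\<^esub>"])
qed

text \<open>The universal property of fractions. The value at \<open>y\<close> is the element
  \<open>z\<close> with \<open>\<phi> s z = f x\<close> whenever
  \<open>\<phi> s y = l x\<close>.\<close>

lemma loc_rel_extend:
  assumes rel: "loc_rel N N' l" and V: "left_module B V" and f: "mod_lin A N (restr \<phi> V) f"
  obtains g where "mod_lin B N' V g" "\<And>x. x \<in> carrier N \<Longrightarrow> g (l x) = f x"
proof -
  note r = loc_relD[OF rel] and f' = mod_linD[OF f, simplified]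
  interpret N: left_module A N by (rule r(1))
  interpret N': left_module B N' by (rule r(2))
  interpret V: left_module B V by (rule V)
  \<comment> \<open>Two presentations of \<open>y\<close> give \<open>t x\<close> and
    \<open>s x'\<close> with the same image under \<open>l\<close>, so they agree after
    multiplication by some \<open>u\<close> in \<open>S\<close>; applying \<open>f\<close> and
    cancelling the denominators gives the claim.\<close>
  have wd: "f x = \<phi> s \<odot>\<^bsub>V\<^esub> z" if s: "s \<in> S" "t \<in> S" and x: "x \<in> carrier N" "x' \<in> carrier N"
    and y: "y \<in> carrier N'" "\<phi> s \<odot>\<^bsub>N'\<^esub> y = l x" "\<phi> t \<odot>\<^bsub>N'\<^esub> y = l x'"
    and z: "z \<in> carrier V" "\<phi> t \<odot>\<^bsub>V\<^esub> z = f x'" for s t x x' y z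
  proof -
    have c: "s \<in> carrier A" "t \<in> carrier A" "\<phi> s \<in> carrier B" "\<phi> t \<in> carrier B"
      using s S_carrier phi_closed by auto
    have ts: "\<phi> t \<otimes>\<^bsub>B\<^esub> \<phi> s = \<phi> s \<otimes>\<^bsub>B\<^esub> \<phi> t" by (rule phi_S_central[OF s(2) c(3)])
    have "l (t \<odot>\<^bsub>N\<^esub> x) = (\<phi> t \<otimes>\<^bsub>B\<^esub> \<phi> s) \<odot>\<^bsub>N'\<^esub> y" using x y c by (simp add: r(8) N'.smult_assoc)
    also have "\<dots> = l (s \<odot>\<^bsub>N\<^esub> x')" using x y c by (simp add: ts r(8) N'.smult_assoc)
    finally have "l (t \<odot>\<^bsub>N\<^esub> x \<ominus>\<^bsub>N\<^esub> s \<odot>\<^bsub>N\<^esub> x') = \<zero>\<^bsub>N'\<^esub>"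
      using mod_lin_diff[OF r(1) left_module_restr[OF ring_A hom r(2)] r(3)] x c
        mod_lin_zero[OF r(1) left_module_restr[OF ring_A hom r(2)] r(3)]
        N.smult_closed by (metis N.diff_zero_iff N.minus_closed restr_simps(2) left_module.diff_zero_iff
          left_module_restr[OF ring_A hom r(2)] restr_simps(1) r(6))
    then obtain u where u: "u \<in> S" "u \<odot>\<^bsub>N\<^esub> (t \<odot>\<^bsub>N\<^esub> x \<ominus>\<^bsub>N\<^esub> s \<odot>\<^bsub>N\<^esub> x') = \<zero>\<^bsub>N\<^esub>"
      using r(4) x c N.smult_closed N.minus_closed by metis
    have cu: "u \<in> carrier A" "\<phi> u \<in> carrier B" using u S_carrier phi_closed by auto
    have "u \<odot>\<^bsub>N\<^esub> (t \<odot>\<^bsub>N\<^esub> x) = u \<odot>\<^bsub>N\<^esub> (s \<odot>\<^bsub>N\<^esub> x')"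
      using u x c cu by (simp add: N.smult_diff N.diff_zero_iff N.smult_closed)
    then have "f (u \<odot>\<^bsub>N\<^esub> (t \<odot>\<^bsub>N\<^esub> x)) = f (u \<odot>\<^bsub>N\<^esub> (s \<odot>\<^bsub>N\<^esub> x'))" by simp
    then have "\<phi> u \<odot>\<^bsub>V\<^esub> (\<phi> t \<odot>\<^bsub>V\<^esub> f x) = \<phi> u \<odot>\<^bsub>V\<^esub> (\<phi> s \<odot>\<^bsub>V\<^esub> f x')"
      using x c cu by (simp add: f'(3) N.smult_closed)
    then have "\<phi> t \<odot>\<^bsub>V\<^esub> f x = \<phi> s \<odot>\<^bsub>V\<^esub> (\<phi> t \<odot>\<^bsub>V\<^esub> z)"
      using phi_S_cancel[OF V u(1)] x c f'(1) V.smult_closed z by metis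
    also have "\<dots> = \<phi> t \<odot>\<^bsub>V\<^esub> (\<phi> s \<odot>\<^bsub>V\<^esub> z)" by (metis V.smult_assoc c(3,4) ts z(1))
    finally show ?thesis using phi_S_cancel[OF V s(2)] x c f'(1) V.smult_closed z by metis
  qed
  have "\<exists>z\<in>carrier V. \<forall>s\<in>S. \<forall>x\<in>carrier N. \<phi> s \<odot>\<^bsub>N'\<^esub> y = l x \<longrightarrow> \<phi> s \<odot>\<^bsub>V\<^esub> z = f x"
    if y: "y \<in> carrier N'" for y
  proof -
    obtain t x' where t: "t \<in> S" "x' \<in> carrier N" "\<phi> t \<odot>\<^bsub>N'\<^esub> y = l x'" using r(5)[OF y] by blast
    obtain z where "z \<in> carrier V" "\<phi> t \<odot>\<^bsub>V\<^esub> z = f x'" using phi_S_solve[OF V t(1) f'(1)[OF t(2)]] by blast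
    then show ?thesis using wd[OF _ t(1) _ t(2) y _ t(3)] by metis
  qed
  then obtain g where g: "\<And>y. y \<in> carrier N' \<Longrightarrow> g y \<in> carrier V"
    "\<And>y s x. \<lbrakk>y \<in> carrier N'; s \<in> S; x \<in> carrier N; \<phi> s \<odot>\<^bsub>N'\<^esub> y = l x\<rbrakk> \<Longrightarrow> \<phi> s \<odot>\<^bsub>V\<^esub> g y = f x"
    by metis
  have lin: "mod_lin B N' V g"
  proof (rule mod_linI)
    fix y z assume y: "y \<in> carrier N'" and z: "z \<in> carrier N'"
    obtain s x where s: "s \<in> S" "x \<in> carrier N" "\<phi> s \<odot>\<^bsub>N'\<^esub> y = l x" using r(5)[OF y] by blast
    obtain t w where t: "t \<in> S" "w \<in> carrier N" "\<phi> t \<odot>\<^bsub>N'\<^esub> z = l w" using r(5)[OF z] by blast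
    have c: "s \<in> carrier A" "t \<in> carrier A" "\<phi> s \<in> carrier B" "\<phi> t \<in> carrier B"
      using s t S_carrier phi_closed by auto
    have ts: "\<phi> t \<otimes>\<^bsub>B\<^esub> \<phi> s = \<phi> s \<otimes>\<^bsub>B\<^esub> \<phi> t" by (rule phi_S_central[OF t(1) c(3)])
    have "\<phi> (s \<otimes>\<^bsub>A\<^esub> t) \<odot>\<^bsub>N'\<^esub> (y \<oplus>\<^bsub>N'\<^esub> z) = (\<phi> t \<otimes>\<^bsub>B\<^esub> \<phi> s) \<odot>\<^bsub>N'\<^esub> y \<oplus>\<^bsub>N'\<^esub> (\<phi> s \<otimes>\<^bsub>B\<^esub> \<phi> t) \<odot>\<^bsub>N'\<^esub> z"
      using y z c by (simp add: phi_mult N'.smult_r_distr ts)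
    also have "\<dots> = l (t \<odot>\<^bsub>N\<^esub> x \<oplus>\<^bsub>N\<^esub> s \<odot>\<^bsub>N\<^esub> w)"
      using y z c s t by (simp add: N'.smult_assoc r(7,8) N.smult_closed)
    finally have "\<phi> (s \<otimes>\<^bsub>A\<^esub> t) \<odot>\<^bsub>V\<^esub> g (y \<oplus>\<^bsub>N'\<^esub> z) = f (t \<odot>\<^bsub>N\<^esub> x \<oplus>\<^bsub>N\<^esub> s \<odot>\<^bsub>N\<^esub> w)"
      using y z c s t by (intro g(2)) (simp_all add: S_mult N.smult_closed)
    also have "\<dots> = \<phi> t \<odot>\<^bsub>V\<^esub> (\<phi> s \<odot>\<^bsub>V\<^esub> g y) \<oplus>\<^bsub>V\<^esub> \<phi> s \<odot>\<^bsub>V\<^esub> (\<phi> t \<odot>\<^bsub>V\<^esub> g z)"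
      using c s t g(2)[OF y s] g(2)[OF z t] by (simp add: f' N.smult_closed)
    also have "\<dots> = \<phi> (s \<otimes>\<^bsub>A\<^esub> t) \<odot>\<^bsub>V\<^esub> (g y \<oplus>\<^bsub>V\<^esub> g z)"
      using c g(1)[OF y] g(1)[OF z] ts by (simp add: phi_mult V.smult_r_distr flip: V.smult_assoc)
    finally show "g (y \<oplus>\<^bsub>N'\<^esub> z) = g y \<oplus>\<^bsub>V\<^esub> g z"
      using phi_S_cancel[OF V S_mult[OF s(1) t(1)]] g(1) y z by simp
  next
    fix b y assume b: "b \<in> carrier B" and y: "y \<in> carrier N'"
    obtain s x where s: "s \<in> S" "x \<in> carrier N" "\<phi> s \<odot>\<^bsub>N'\<^esub> y = l x" using r(5)[OF y] by blast
    obtain t a where t: "t \<in> S" "a \<in> carrier A" "\<phi> t \<otimes>\<^bsub>B\<^esub> b = \<phi> a" using fraction[OF b] by blast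
    have c: "s \<in> carrier A" "t \<in> carrier A" "\<phi> s \<in> carrier B" "\<phi> t \<in> carrier B" "\<phi> a \<in> carrier B"
      using s t S_carrier phi_closed by auto
    have tsb: "\<phi> (t \<otimes>\<^bsub>A\<^esub> s) \<otimes>\<^bsub>B\<^esub> b = \<phi> a \<otimes>\<^bsub>B\<^esub> \<phi> s"
      using c b phi_S_central[OF s(1) b] by (simp add: phi_mult B.m_assoc flip: t(3))
    have "\<phi> (t \<otimes>\<^bsub>A\<^esub> s) \<odot>\<^bsub>N'\<^esub> (b \<odot>\<^bsub>N'\<^esub> y) = l (a \<odot>\<^bsub>N\<^esub> x)"
      using y c s t b tsb by (simp add: r(8) phi_closed N'.smult_assoc flip: N'.smult_assoc[of "\<phi> (t \<otimes>\<^bsub>A\<^esub> s)"])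
    then have "\<phi> (t \<otimes>\<^bsub>A\<^esub> s) \<odot>\<^bsub>V\<^esub> g (b \<odot>\<^bsub>N'\<^esub> y) = f (a \<odot>\<^bsub>N\<^esub> x)"
      using y c s t b by (intro g(2)) (simp_all add: S_mult N.smult_closed N'.smult_closed)
    also have "\<dots> = \<phi> a \<odot>\<^bsub>V\<^esub> (\<phi> s \<odot>\<^bsub>V\<^esub> g y)" using s t g(2)[OF y s] by (simp add: f')
    also have "\<dots> = \<phi> (t \<otimes>\<^bsub>A\<^esub> s) \<odot>\<^bsub>V\<^esub> (b \<odot>\<^bsub>V\<^esub> g y)"
      using c b g(1)[OF y] tsb by (simp add: phi_closed flip: V.smult_assoc)
    finally show "g (b \<odot>\<^bsub>N'\<^esub> y) = b \<odot>\<^bsub>V\<^esub> g y"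
      using phi_S_cancel[OF V S_mult[OF t(1) s(1)]] g(1) y b N'.smult_closed V.smult_closed by simp
  qed (rule g(1))
  have "g (l x) = f x" if x: "x \<in> carrier N" for x
    using g(2)[OF r(6)[OF x] S_one x] x r(6)[OF x] g(1) by (simp add: phi_one N'.smult_one V.smult_one)
  with lin that show thesis by blast
qed

text \<open>Localization is left adjoint to restriction: the problem is solved over
  \<open>A\<close>, and the solution is extended to fractions.\<close>

lemma loc_rel_projective:
  fixes P :: "('a, 'm) module" and P' :: "('b, 'm) module"
  assumes rel: "loc_rel P P' l" and proj: "projective_module TYPE('m) A P"
  shows "projective_module TYPE('m) B P'"
proof (rule projectiveI)
  note r = loc_relD[OF rel]
  show "left_module B P'" by (rule r(2))
  fix U V :: "('b, 'm) module" and g f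
  assume U: "left_module B U" and V: "left_module B V" and g: "mod_lin B U V g"
    and gs: "g ` carrier U = carrier V" and f: "mod_lin B P' V f"
  have fl: "mod_lin A P (restr \<phi> V) (\<lambda>x. f (l x))"
    by (rule mod_lin_comp[OF r(3) mod_lin_restr[OF hom f]])
  obtain h where h: "mod_lin A P (restr \<phi> U) h" "\<And>x. x \<in> carrier P \<Longrightarrow> g (h x) = f (l x)"
    using projective_lift_same[OF proj left_module_restr[OF ring_A hom U]
        left_module_restr[OF ring_A hom V] mod_lin_restr[OF hom g] _ fl] gs by auto
  obtain h' where h': "mod_lin B P' U h'" "\<And>x. x \<in> carrier P \<Longrightarrow> h' (l x) = h x"
    using loc_rel_extend[OF rel U h(1)] by blast
  have "g (h' y) = f y" if y: "y \<in> carrier P'" for y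
  proof -
    obtain s x where s: "s \<in> S" "x \<in> carrier P" "\<phi> s \<odot>\<^bsub>P'\<^esub> y = l x" using r(5)[OF y] by blast
    have c: "\<phi> s \<in> carrier B" using s S_carrier phi_closed by auto
    have "\<phi> s \<odot>\<^bsub>V\<^esub> g (h' y) = g (h' (\<phi> s \<odot>\<^bsub>P'\<^esub> y))"
      using c y mod_linD(3)[OF h'(1)] mod_linD(3)[OF g] mod_linD(1)[OF h'(1)] by simp
    also have "\<dots> = f (\<phi> s \<odot>\<^bsub>P'\<^esub> y)" using s by (simp add: h h')
    also have "\<dots> = \<phi> s \<odot>\<^bsub>V\<^esub> f y" using c y mod_linD(3)[OF f] by simp
    finally show ?thesis
      using phi_S_cancel[OF V s(1)] mod_linD(1)[OF g] mod_linD(1)[OF h'(1)] mod_linD(1)[OF f] y by simp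
  qed
  with h'(1) show "\<exists>h. mod_lin B P' U h \<and> (\<forall>x\<in>carrier P'. g (h x) = f x)" by blast
qed

text \<open>Fractions are classes of pairs \<open>(x, s)\<close>. They live on sets of pairs, but
  there are no more of them than pairs, so the module can be copied into \<open>'m\<close>.\<close>

lemma ex_loc:
  fixes N :: "('a, 'm) module"
  assumes large: "large_universe TYPE('m) A" and N: "left_module A N"
  obtains N' :: "('b, 'm) module" and l where "loc_rel N N' l"
proof -
  interpret N: left_module A N by fact
  define eqv where "eqv p q \<longleftrightarrow> (\<exists>u\<in>S. u \<odot>\<^bsub>N\<^esub> (snd q \<odot>\<^bsub>N\<^esub> fst p) = u \<odot>\<^bsub>N\<^esub> (snd p \<odot>\<^bsub>N\<^esub> fst q))" for p q
  define T where "T = carrier N \<times> S"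
  note sc = S_carrier N.smult_closed S_mult
  note lc = S_smult_commute[OF N] S_smult_commute[OF N, symmetric]
  have eqvI: "eqv (x, s) (y, t)" if "t \<odot>\<^bsub>N\<^esub> x = s \<odot>\<^bsub>N\<^esub> y" for x y s t
    using that S_one by (auto simp: eqv_def)
  have sym: "eqv q p" if "eqv p q" for p q using that unfolding eqv_def by metis
  have trans: "eqv p w" if pT: "p \<in> T" "q \<in> T" "w \<in> T" and pq: "eqv p q" and qw: "eqv q w" for p q w
  proof -
    obtain x s y t z r where p: "p = (x, s)" "q = (y, t)" "w = (z, r)" by (metis surj_pair)
    have T: "x \<in> carrier N" "y \<in> carrier N" "z \<in> carrier N" "s \<in> S" "t \<in> S" "r \<in> S"
      using pT p by (auto simp: T_def)
    obtain u where u: "u \<in> S" "u \<odot>\<^bsub>N\<^esub> (t \<odot>\<^bsub>N\<^esub> x) = u \<odot>\<^bsub>N\<^esub> (s \<odot>\<^bsub>N\<^esub> y)" using pq p by (auto simp: eqv_def)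
    obtain v where v: "v \<in> S" "v \<odot>\<^bsub>N\<^esub> (r \<odot>\<^bsub>N\<^esub> y) = v \<odot>\<^bsub>N\<^esub> (t \<odot>\<^bsub>N\<^esub> z)" using qw p by (auto simp: eqv_def)
    have "v \<odot>\<^bsub>N\<^esub> (r \<odot>\<^bsub>N\<^esub> (u \<odot>\<^bsub>N\<^esub> (t \<odot>\<^bsub>N\<^esub> x))) = u \<odot>\<^bsub>N\<^esub> (s \<odot>\<^bsub>N\<^esub> (v \<odot>\<^bsub>N\<^esub> (r \<odot>\<^bsub>N\<^esub> y)))"
      unfolding u(2) using T u(1) v(1) by (simp add: sc lc)
    also have "\<dots> = u \<odot>\<^bsub>N\<^esub> (s \<odot>\<^bsub>N\<^esub> (v \<odot>\<^bsub>N\<^esub> (t \<odot>\<^bsub>N\<^esub> z)))" by (simp only: v(2))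
    finally have "(u \<otimes>\<^bsub>A\<^esub> v \<otimes>\<^bsub>A\<^esub> t) \<odot>\<^bsub>N\<^esub> (r \<odot>\<^bsub>N\<^esub> x) = (u \<otimes>\<^bsub>A\<^esub> v \<otimes>\<^bsub>A\<^esub> t) \<odot>\<^bsub>N\<^esub> (s \<odot>\<^bsub>N\<^esub> z)"
      using T u(1) v(1) by (simp add: sc lc N.smult_assoc)
    then show ?thesis unfolding eqv_def p using S_mult u(1) v(1) T by auto
  qed
  have refl: "eqv p p" if "p \<in> T" for p using that S_one by (auto simp: eqv_def)
  define cls where "cls x s = {q \<in> T. eqv (x, s) q}" for x s
  have cls_eq: "cls x s = cls y t \<longleftrightarrow> eqv (x, s) (y, t)"
    if "x \<in> carrier N" "s \<in> S" "y \<in> carrier N" "t \<in> S" for x s y t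
  proof
    have T: "(x, s) \<in> T" "(y, t) \<in> T" using that by (auto simp: T_def)
    { assume "cls x s = cls y t"
      then show "eqv (x, s) (y, t)" using refl[OF T(2)] T(2) by (auto simp: cls_def) }
    { assume "eqv (x, s) (y, t)"
      then show "cls x s = cls y t"
        unfolding cls_def using trans[OF T] trans[OF T(2,1)] sym by blast }
  qed
  define rep where "rep D = (SOME p. p \<in> T \<and> (\<lambda>(x, s). cls x s) p = D)" for D
  have rep: "\<exists>x' s'. rep (cls x s) = (x', s') \<and> x' \<in> carrier N \<and> s' \<in> S \<and> cls x' s' = cls x s"
    if "x \<in> carrier N" "s \<in> S" for x s
  proof -
    have "rep (cls x s) \<in> T \<and> (\<lambda>(x, s). cls x s) (rep (cls x s)) = cls x s"
      unfolding rep_def by (rule someI[of _ "(x, s)"]) (use that in \<open>auto simp: T_def\<close>)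
    then show ?thesis by (cases "rep (cls x s)") (auto simp: T_def)
  qed
  \<comment> \<open>An element of \<open>B\<close> is not a fraction by definition, so a
    presentation of \<open>b\<close> with denominator \<open>fst (num b)\<close> and numerator
    \<open>snd (num b)\<close> is chosen to define its action.\<close>
  define num where "num b = (SOME p. fst p \<in> S \<and> snd p \<in> carrier A \<and> \<phi> (fst p) \<otimes>\<^bsub>B\<^esub> b = \<phi> (snd p))" for b
  have num: "fst (num b) \<in> S" "snd (num b) \<in> carrier A" "\<phi> (fst (num b)) \<otimes>\<^bsub>B\<^esub> b = \<phi> (snd (num b))"
    if "b \<in> carrier B" for b
  proof -
    have "\<exists>p. fst p \<in> S \<and> snd p \<in> carrier A \<and> \<phi> (fst p) \<otimes>\<^bsub>B\<^esub> b = \<phi> (snd p)"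
      using fraction[OF that] by (metis fst_conv snd_conv)
    from someI_ex[OF this] show "fst (num b) \<in> S" "snd (num b) \<in> carrier A"
      "\<phi> (fst (num b)) \<otimes>\<^bsub>B\<^esub> b = \<phi> (snd (num b))" by (auto simp: num_def)
  qed
  define L :: "('b, ('m \<times> 'a) set) module" where
    "L = mk_module ((\<lambda>(x, s). cls x s) ` T) (cls \<zero>\<^bsub>N\<^esub> \<one>\<^bsub>A\<^esub>)
      (\<lambda>C D. cls (snd (rep D) \<odot>\<^bsub>N\<^esub> fst (rep C) \<oplus>\<^bsub>N\<^esub> snd (rep C) \<odot>\<^bsub>N\<^esub> fst (rep D)) (snd (rep C) \<otimes>\<^bsub>A\<^esub> snd (rep D)))
      (\<lambda>b C. cls (snd (num b) \<odot>\<^bsub>N\<^esub> fst (rep C)) (fst (num b) \<otimes>\<^bsub>A\<^esub> snd (rep C)))"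
  have Lc: "cls x s \<in> carrier L" if "x \<in> carrier N" "s \<in> S" for x s using that by (force simp: L_def T_def)
  have LE: "\<exists>x\<in>carrier N. \<exists>s\<in>S. C = cls x s" if "C \<in> carrier L" for C using that by (auto simp: L_def T_def)
  have add: "cls x s \<oplus>\<^bsub>L\<^esub> cls y t = cls (t \<odot>\<^bsub>N\<^esub> x \<oplus>\<^bsub>N\<^esub> s \<odot>\<^bsub>N\<^esub> y) (s \<otimes>\<^bsub>A\<^esub> t)"
    if T: "x \<in> carrier N" "s \<in> S" "y \<in> carrier N" "t \<in> S" for x s y t
  proof -
    obtain x' s' where p: "rep (cls x s) = (x', s')" "x' \<in> carrier N" "s' \<in> S" "cls x' s' = cls x s"
      using rep T by blast
    obtain y' t' where q: "rep (cls y t) = (y', t')" "y' \<in> carrier N" "t' \<in> S" "cls y' t' = cls y t"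
      using rep T by blast
    obtain u where u: "u \<in> S" "u \<odot>\<^bsub>N\<^esub> (s \<odot>\<^bsub>N\<^esub> x') = u \<odot>\<^bsub>N\<^esub> (s' \<odot>\<^bsub>N\<^esub> x)"
      using p T by (auto simp: cls_eq eqv_def)
    obtain v where v: "v \<in> S" "v \<odot>\<^bsub>N\<^esub> (t \<odot>\<^bsub>N\<^esub> y') = v \<odot>\<^bsub>N\<^esub> (t' \<odot>\<^bsub>N\<^esub> y)"
      using q T by (auto simp: cls_eq eqv_def)
    have 1: "u \<odot>\<^bsub>N\<^esub> (v \<odot>\<^bsub>N\<^esub> (s \<odot>\<^bsub>N\<^esub> (t \<odot>\<^bsub>N\<^esub> (t' \<odot>\<^bsub>N\<^esub> x')))) = u \<odot>\<^bsub>N\<^esub> (v \<odot>\<^bsub>N\<^esub> (s' \<odot>\<^bsub>N\<^esub> (t' \<odot>\<^bsub>N\<^esub> (t \<odot>\<^bsub>N\<^esub> x))))"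
    proof -
      have "u \<odot>\<^bsub>N\<^esub> (v \<odot>\<^bsub>N\<^esub> (s \<odot>\<^bsub>N\<^esub> (t \<odot>\<^bsub>N\<^esub> (t' \<odot>\<^bsub>N\<^esub> x')))) = v \<odot>\<^bsub>N\<^esub> (t \<odot>\<^bsub>N\<^esub> (t' \<odot>\<^bsub>N\<^esub> (u \<odot>\<^bsub>N\<^esub> (s \<odot>\<^bsub>N\<^esub> x'))))"
        using T p q u(1) v(1) by (simp add: sc lc)
      also have "\<dots> = v \<odot>\<^bsub>N\<^esub> (t \<odot>\<^bsub>N\<^esub> (t' \<odot>\<^bsub>N\<^esub> (u \<odot>\<^bsub>N\<^esub> (s' \<odot>\<^bsub>N\<^esub> x))))" by (simp only: u(2))
      also have "\<dots> = u \<odot>\<^bsub>N\<^esub> (v \<odot>\<^bsub>N\<^esub> (s' \<odot>\<^bsub>N\<^esub> (t' \<odot>\<^bsub>N\<^esub> (t \<odot>\<^bsub>N\<^esub> x))))"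
        using T p q u(1) v(1) by (simp add: sc lc)
      finally show ?thesis .
    qed
    have 2: "u \<odot>\<^bsub>N\<^esub> (v \<odot>\<^bsub>N\<^esub> (s \<odot>\<^bsub>N\<^esub> (t \<odot>\<^bsub>N\<^esub> (s' \<odot>\<^bsub>N\<^esub> y')))) = u \<odot>\<^bsub>N\<^esub> (v \<odot>\<^bsub>N\<^esub> (s' \<odot>\<^bsub>N\<^esub> (t' \<odot>\<^bsub>N\<^esub> (s \<odot>\<^bsub>N\<^esub> y))))"
    proof -
      have "u \<odot>\<^bsub>N\<^esub> (v \<odot>\<^bsub>N\<^esub> (s \<odot>\<^bsub>N\<^esub> (t \<odot>\<^bsub>N\<^esub> (s' \<odot>\<^bsub>N\<^esub> y')))) = u \<odot>\<^bsub>N\<^esub> (s \<odot>\<^bsub>N\<^esub> (s' \<odot>\<^bsub>N\<^esub> (v \<odot>\<^bsub>N\<^esub> (t \<odot>\<^bsub>N\<^esub> y'))))"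
        using T p q u(1) v(1) by (simp add: sc lc)
      also have "\<dots> = u \<odot>\<^bsub>N\<^esub> (s \<odot>\<^bsub>N\<^esub> (s' \<odot>\<^bsub>N\<^esub> (v \<odot>\<^bsub>N\<^esub> (t' \<odot>\<^bsub>N\<^esub> y))))" by (simp only: v(2))
      also have "\<dots> = u \<odot>\<^bsub>N\<^esub> (v \<odot>\<^bsub>N\<^esub> (s' \<odot>\<^bsub>N\<^esub> (t' \<odot>\<^bsub>N\<^esub> (s \<odot>\<^bsub>N\<^esub> y))))"
        using T p q u(1) v(1) by (simp add: sc lc)
      finally show ?thesis .
    qed
    have "eqv (t' \<odot>\<^bsub>N\<^esub> x' \<oplus>\<^bsub>N\<^esub> s' \<odot>\<^bsub>N\<^esub> y', s' \<otimes>\<^bsub>A\<^esub> t') (t \<odot>\<^bsub>N\<^esub> x \<oplus>\<^bsub>N\<^esub> s \<odot>\<^bsub>N\<^esub> y, s \<otimes>\<^bsub>A\<^esub> t)"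
      unfolding eqv_def using T p q u(1) v(1) 1 2
      by (intro bexI[of _ "u \<otimes>\<^bsub>A\<^esub> v"]) (simp_all add: sc N.smult_assoc N.smult_r_distr)
    then show ?thesis using T p q by (simp add: L_def cls_eq sc)
  qed
  have smult: "b \<odot>\<^bsub>L\<^esub> cls x s = cls (a \<odot>\<^bsub>N\<^esub> x) (t \<otimes>\<^bsub>A\<^esub> s)"
    if T: "x \<in> carrier N" "s \<in> S" and b: "b \<in> carrier B" "t \<in> S" "a \<in> carrier A" "\<phi> t \<otimes>\<^bsub>B\<^esub> b = \<phi> a"
    for b t a x s
  proof -
    obtain x' s' where p: "rep (cls x s) = (x', s')" "x' \<in> carrier N" "s' \<in> S" "cls x' s' = cls x s"
      using rep T by blast
    obtain u where u: "u \<in> S" "u \<odot>\<^bsub>N\<^esub> (s \<odot>\<^bsub>N\<^esub> x') = u \<odot>\<^bsub>N\<^esub> (s' \<odot>\<^bsub>N\<^esub> x)"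
      using p T by (auto simp: cls_eq eqv_def)
    obtain t' a' where n: "num b = (t', a')" by (metis surj_pair)
    have n': "t' \<in> S" "a' \<in> carrier A" "\<phi> t' \<otimes>\<^bsub>B\<^esub> b = \<phi> a'" using num[OF b(1)] n by auto
    have c: "t \<in> carrier A" "t' \<in> carrier A" "\<phi> t \<in> carrier B" "\<phi> t' \<in> carrier B"
      using b n' S_carrier phi_closed by auto
    \<comment> \<open>The chosen and the given presentation of \<open>b\<close> have cross products
      with the same image in \<open>B\<close>; by \<open>kernel\<close> these agree in
      \<open>A\<close> after multiplication by some \<open>v\<close> in \<open>S\<close>, so the
      action does not depend on the choice.\<close>
    have "\<phi> (t' \<otimes>\<^bsub>A\<^esub> a) = \<phi> (t \<otimes>\<^bsub>A\<^esub> a')"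
      using b n' c phi_S_central[OF b(2) c(4)] by (simp add: phi_mult flip: b(4) n'(3) B.m_assoc)
    then have d0: "\<phi> (t' \<otimes>\<^bsub>A\<^esub> a \<ominus>\<^bsub>A\<^esub> t \<otimes>\<^bsub>A\<^esub> a') = \<zero>\<^bsub>B\<^esub>"
      using b n' c phi_closed phi_neg by (simp add: A.minus_eq phi_add B.r_neg)
    have "t' \<otimes>\<^bsub>A\<^esub> a \<ominus>\<^bsub>A\<^esub> t \<otimes>\<^bsub>A\<^esub> a' \<in> carrier A" using b n' c by simp
    from kernel[OF this d0] obtain v where v: "v \<in> S" "v \<otimes>\<^bsub>A\<^esub> (t' \<otimes>\<^bsub>A\<^esub> a \<ominus>\<^bsub>A\<^esub> t \<otimes>\<^bsub>A\<^esub> a') = \<zero>\<^bsub>A\<^esub>" by blast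
    have "v \<odot>\<^bsub>N\<^esub> ((t' \<otimes>\<^bsub>A\<^esub> a \<ominus>\<^bsub>A\<^esub> t \<otimes>\<^bsub>A\<^esub> a') \<odot>\<^bsub>N\<^esub> z) = \<zero>\<^bsub>N\<^esub>" if "z \<in> carrier N" for z
      using N.smult_assoc[of v "t' \<otimes>\<^bsub>A\<^esub> a \<ominus>\<^bsub>A\<^esub> t \<otimes>\<^bsub>A\<^esub> a'" z] v b n' c that S_carrier
      by (simp add: N.smult_zero_left)
    then have va: "v \<odot>\<^bsub>N\<^esub> (t' \<odot>\<^bsub>N\<^esub> (a \<odot>\<^bsub>N\<^esub> z)) = v \<odot>\<^bsub>N\<^esub> (t \<odot>\<^bsub>N\<^esub> (a' \<odot>\<^bsub>N\<^esub> z))" if "z \<in> carrier N" for z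
      using that b n' c v(1) by (simp add: N.diff_smult N.smult_diff N.diff_zero_iff sc N.smult_assoc)
    have "v \<odot>\<^bsub>N\<^esub> (t \<odot>\<^bsub>N\<^esub> (a' \<odot>\<^bsub>N\<^esub> (u \<odot>\<^bsub>N\<^esub> (s \<odot>\<^bsub>N\<^esub> x')))) = v \<odot>\<^bsub>N\<^esub> (t' \<odot>\<^bsub>N\<^esub> (a \<odot>\<^bsub>N\<^esub> (u \<odot>\<^bsub>N\<^esub> (s' \<odot>\<^bsub>N\<^esub> x))))"
      unfolding u(2) using T p u(1) by (intro va[symmetric]) (simp add: sc)
    then have "eqv (a' \<odot>\<^bsub>N\<^esub> x', t' \<otimes>\<^bsub>A\<^esub> s') (a \<odot>\<^bsub>N\<^esub> x, t \<otimes>\<^bsub>A\<^esub> s)"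
      unfolding eqv_def using T p u(1) v(1) b n'
      by (intro bexI[of _ "u \<otimes>\<^bsub>A\<^esub> v"]) (simp_all add: sc N.smult_assoc lc)
    then show ?thesis using T p n n' b by (simp add: L_def cls_eq sc)
  qed
  have num': "\<exists>t\<in>S. \<exists>a\<in>carrier A. \<phi> t \<otimes>\<^bsub>B\<^esub> b = \<phi> a" if "b \<in> carrier B" for b by (rule fraction[OF that])
  have L: "left_module B L"
  proof (rule left_moduleI)
    show "ring B" by (rule ring_B)
    show "\<zero>\<^bsub>L\<^esub> \<in> carrier L" using Lc[of "\<zero>\<^bsub>N\<^esub>" "\<one>\<^bsub>A\<^esub>"] S_one by (simp add: L_def)
    have L0: "\<zero>\<^bsub>L\<^esub> = cls \<zero>\<^bsub>N\<^esub> \<one>\<^bsub>A\<^esub>" by (simp add: L_def)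
    fix C assume "C \<in> carrier L"
    then obtain x s where C: "C = cls x s" "x \<in> carrier N" "s \<in> S" using LE by blast
    show "\<zero>\<^bsub>L\<^esub> \<oplus>\<^bsub>L\<^esub> C = C"
      using C S_one by (simp add: L0 add sc N.smult_zero_right N.smult_one)
    show "\<one>\<^bsub>B\<^esub> \<odot>\<^bsub>L\<^esub> C = C"
      using C S_one by (simp add: smult[of _ _ _ "\<one>\<^bsub>A\<^esub>" "\<one>\<^bsub>A\<^esub>"] phi_one sc N.smult_one)
    have "(\<phi> (\<ominus>\<^bsub>A\<^esub> \<one>\<^bsub>A\<^esub>)) = \<ominus>\<^bsub>B\<^esub> \<one>\<^bsub>B\<^esub>"
      by (simp add: phi_neg phi_one)
    then have "(\<ominus>\<^bsub>B\<^esub> \<one>\<^bsub>B\<^esub>) \<odot>\<^bsub>L\<^esub> C = cls (\<ominus>\<^bsub>N\<^esub> x) s"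
      using C S_one by (simp add: smult[of _ _ _ "\<one>\<^bsub>A\<^esub>" "\<ominus>\<^bsub>A\<^esub> \<one>\<^bsub>A\<^esub>"] phi_one sc N.smult_minus_one)
    then show "(\<ominus>\<^bsub>B\<^esub> \<one>\<^bsub>B\<^esub>) \<odot>\<^bsub>L\<^esub> C \<oplus>\<^bsub>L\<^esub> C = \<zero>\<^bsub>L\<^esub>"
      using C S_one by (auto simp: L0 add cls_eq sc N.smult_minus N.l_neg N.smult_zero_right intro!: eqvI)
    fix D assume "D \<in> carrier L"
    then obtain y t where D: "D = cls y t" "y \<in> carrier N" "t \<in> S" using LE by blast
    show "C \<oplus>\<^bsub>L\<^esub> D \<in> carrier L" using C D Lc by (simp add: add sc)
    show "C \<oplus>\<^bsub>L\<^esub> D = D \<oplus>\<^bsub>L\<^esub> C"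
      using C D S_central by (simp add: add sc N.a_comm)
    fix E assume "E \<in> carrier L"
    then obtain z r where E: "E = cls z r" "z \<in> carrier N" "r \<in> S" using LE by blast
    show "C \<oplus>\<^bsub>L\<^esub> D \<oplus>\<^bsub>L\<^esub> E = C \<oplus>\<^bsub>L\<^esub> (D \<oplus>\<^bsub>L\<^esub> E)"
      using C D E by (simp add: add sc N.a_assoc N.smult_r_distr N.smult_assoc lc A.m_assoc)
  next
    fix b C assume b: "b \<in> carrier B" and "C \<in> carrier L"
    then obtain x s where C: "C = cls x s" "x \<in> carrier N" "s \<in> S" using LE by blast
    obtain t a where t: "t \<in> S" "a \<in> carrier A" "\<phi> t \<otimes>\<^bsub>B\<^esub> b = \<phi> a" using num'[OF b] by blast
    show "b \<odot>\<^bsub>L\<^esub> C \<in> carrier L" using C b t Lc by (simp add: smult[OF _ _ b t] sc)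
    { fix D assume "D \<in> carrier L"
      then obtain y r where D: "D = cls y r" "y \<in> carrier N" "r \<in> S" using LE by blast
      show "b \<odot>\<^bsub>L\<^esub> (C \<oplus>\<^bsub>L\<^esub> D) = b \<odot>\<^bsub>L\<^esub> C \<oplus>\<^bsub>L\<^esub> b \<odot>\<^bsub>L\<^esub> D"
        using C D t by (auto simp: add smult[OF _ _ b t] cls_eq sc N.smult_r_distr N.smult_assoc lc intro!: eqvI) }
    fix b' assume b': "b' \<in> carrier B"
    obtain t' a' where t': "t' \<in> S" "a' \<in> carrier A" "\<phi> t' \<otimes>\<^bsub>B\<^esub> b' = \<phi> a'" using num'[OF b'] by blast
    have c: "\<phi> t \<in> carrier B" "\<phi> t' \<in> carrier B" "t \<in> carrier A" "t' \<in> carrier A"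
      using t t' phi_closed S_carrier by auto
    have "\<phi> (t \<otimes>\<^bsub>A\<^esub> t') \<otimes>\<^bsub>B\<^esub> (b \<otimes>\<^bsub>B\<^esub> b') = \<phi> t \<otimes>\<^bsub>B\<^esub> (\<phi> t' \<otimes>\<^bsub>B\<^esub> b) \<otimes>\<^bsub>B\<^esub> b'"
      using b b' c by (simp add: phi_mult B.m_assoc)
    also have "\<dots> = \<phi> (a \<otimes>\<^bsub>A\<^esub> a')"
      using b b' c t t' phi_S_central[OF t'(1) b] by (simp add: phi_mult B.m_assoc flip: t(3) t'(3))
    finally have 1: "\<phi> (t \<otimes>\<^bsub>A\<^esub> t') \<otimes>\<^bsub>B\<^esub> (b \<otimes>\<^bsub>B\<^esub> b') = \<phi> (a \<otimes>\<^bsub>A\<^esub> a')" .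
    show "(b \<otimes>\<^bsub>B\<^esub> b') \<odot>\<^bsub>L\<^esub> C = b \<odot>\<^bsub>L\<^esub> (b' \<odot>\<^bsub>L\<^esub> C)"
      using C t t' by (simp add: smult[OF _ _ b t] smult[OF _ _ b' t'] smult[OF _ _ B.m_closed[OF b b'] _ _ 1]
          sc N.smult_assoc A.m_assoc)
    have "\<phi> (t \<otimes>\<^bsub>A\<^esub> t') \<otimes>\<^bsub>B\<^esub> (b \<oplus>\<^bsub>B\<^esub> b') = \<phi> t' \<otimes>\<^bsub>B\<^esub> (\<phi> t \<otimes>\<^bsub>B\<^esub> b) \<oplus>\<^bsub>B\<^esub> \<phi> t \<otimes>\<^bsub>B\<^esub> (\<phi> t' \<otimes>\<^bsub>B\<^esub> b')"
      using b b' c phi_S_central[OF t'(1) c(1)] by (simp add: phi_mult B.r_distr flip: B.m_assoc)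
    also have "\<dots> = \<phi> (t' \<otimes>\<^bsub>A\<^esub> a \<oplus>\<^bsub>A\<^esub> t \<otimes>\<^bsub>A\<^esub> a')"
      using c t t' by (simp add: phi_mult phi_add)
    finally have 2: "\<phi> (t \<otimes>\<^bsub>A\<^esub> t') \<otimes>\<^bsub>B\<^esub> (b \<oplus>\<^bsub>B\<^esub> b') = \<phi> (t' \<otimes>\<^bsub>A\<^esub> a \<oplus>\<^bsub>A\<^esub> t \<otimes>\<^bsub>A\<^esub> a')" .
    show "(b \<oplus>\<^bsub>B\<^esub> b') \<odot>\<^bsub>L\<^esub> C = b \<odot>\<^bsub>L\<^esub> C \<oplus>\<^bsub>L\<^esub> b' \<odot>\<^bsub>L\<^esub> C"
      using C t t' by (auto simp: add smult[OF _ _ b t] smult[OF _ _ b' t']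
          smult[OF _ _ B.a_closed[OF b b'] _ _ 2] cls_eq sc N.smult_r_distr N.smult_l_distr
          N.smult_assoc lc intro!: eqvI)
  qed
  let ?l = "\<lambda>x. cls x \<one>\<^bsub>A\<^esub>"
  have "loc_rel N L ?l"
    unfolding loc_rel_def
  proof (intro conjI N L ballI impI)
    show "mod_lin A N (restr \<phi> L) ?l"
    proof (rule mod_linI)
      fix x y assume "x \<in> carrier N" "y \<in> carrier N"
      then show "?l (x \<oplus>\<^bsub>N\<^esub> y) = ?l x \<oplus>\<^bsub>restr \<phi> L\<^esub> ?l y"
        using S_one by (simp add: add N.smult_one)
    next
      fix a x assume a: "a \<in> carrier A" and x: "x \<in> carrier N"
      have "\<phi> \<one>\<^bsub>A\<^esub> \<otimes>\<^bsub>B\<^esub> \<phi> a = \<phi> a" using a phi_closed by (simp add: phi_one)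
      then show "?l (a \<odot>\<^bsub>N\<^esub> x) = a \<odot>\<^bsub>restr \<phi> L\<^esub> ?l x"
        using S_one a x phi_closed by (simp add: smult[of _ _ _ "\<one>\<^bsub>A\<^esub>" a])
    qed (use Lc S_one in simp)
  next
    fix x assume x: "x \<in> carrier N" "?l x = \<zero>\<^bsub>L\<^esub>"
    then have "eqv (x, \<one>\<^bsub>A\<^esub>) (\<zero>\<^bsub>N\<^esub>, \<one>\<^bsub>A\<^esub>)" using S_one by (simp add: L_def cls_eq)
    then show "\<exists>s\<in>S. s \<odot>\<^bsub>N\<^esub> x = \<zero>\<^bsub>N\<^esub>"
      using x(1) S_carrier by (auto simp: eqv_def N.smult_one N.smult_zero_right)
  next
    fix y assume "y \<in> carrier L"
    then obtain x s where y: "y = cls x s" "x \<in> carrier N" "s \<in> S" using LE by blast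
    have "\<phi> \<one>\<^bsub>A\<^esub> \<otimes>\<^bsub>B\<^esub> \<phi> s = \<phi> s" using y S_carrier phi_closed by (simp add: phi_one)
    then have "\<phi> s \<odot>\<^bsub>L\<^esub> y = ?l x"
      using y S_one S_carrier phi_closed
      by (auto simp: smult[of _ _ _ "\<one>\<^bsub>A\<^esub>" s] cls_eq sc N.smult_one intro!: eqvI)
    then show "\<exists>s\<in>S. \<exists>x\<in>carrier N. \<phi> s \<odot>\<^bsub>L\<^esub> y = ?l x" using y by blast
  qed
  have le: "lepoll (carrier L) (UNIV :: 'm set)"
  proof -
    have "lepoll S (UNIV :: 'm set)"
      using large S_carrier subset_imp_lepoll[of S "carrier A"] lepoll_trans
      by (auto simp: large_universe_def)
    then have "lepoll T (UNIV :: 'm set)"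
      using large unfolding T_def large_universe_def
      by (intro prod_lepoll_infinite subset_imp_lepoll) auto
    then show ?thesis
      using image_lepoll[of "\<lambda>(x, s). cls x s" T] lepoll_trans by (simp add: L_def) blast
  qed
  obtain N' :: "('b, 'm) module" and i i' where N': "left_module B N'" "lin_iso B L N' i i'"
    using ex_transport[OF L le] by blast
  note i = lin_isoD[OF N'(2)] and r = loc_relD[OF \<open>loc_rel N L ?l\<close>]
  have "loc_rel N N' (\<lambda>x. i (?l x))"
    unfolding loc_rel_def
  proof (intro conjI N N'(1) ballI impI)
    show "mod_lin A N (restr \<phi> N') (\<lambda>x. i (?l x))"
      by (rule mod_lin_comp[OF r(3) mod_lin_restr[OF hom i(1)]])
  next
    fix x assume x: "x \<in> carrier N" "i (?l x) = \<zero>\<^bsub>N'\<^esub>"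
    then have "?l x = \<zero>\<^bsub>L\<^esub>" using i(3)[OF r(6)[OF x(1)]] mod_lin_zero[OF N'(1) L i(2)] by simp
    then show "\<exists>s\<in>S. s \<odot>\<^bsub>N\<^esub> x = \<zero>\<^bsub>N\<^esub>" using r(4)[OF x(1)] by blast
  next
    fix y assume y: "y \<in> carrier N'"
    obtain s x where s: "s \<in> S" "x \<in> carrier N" "\<phi> s \<odot>\<^bsub>L\<^esub> i' y = ?l x" using r(5)[OF i(6)[OF y]] by blast
    then have "\<phi> s \<odot>\<^bsub>N'\<^esub> y = i (?l x)"
      using mod_linD(3)[OF i(1), of "\<phi> s" "i' y"] i(4)[OF y] i(6)[OF y] phi_closed S_carrier by simp
    then show "\<exists>s\<in>S. \<exists>x\<in>carrier N. \<phi> s \<odot>\<^bsub>N'\<^esub> y = i (?l x)" using s by blast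
  qed
  then show thesis by (rule that)
qed

text \<open>Exactness of localization; the kernel formed upstairs with its map \<open>k\<close> to
  the kernel downstairs is again a localization.\<close>

lemma loc_rel_kernel:
  fixes N P :: "('a, 'm) module" and N' :: "('b, 'm) module"
  assumes large: "large_universe TYPE('m) A" and rel: "loc_rel N N' l" and P: "left_module A P"
    and \<pi>: "mod_lin A P N \<pi>" and surj: "\<pi> ` carrier P = carrier N"
  shows "\<exists>(P' :: ('b, 'm) module) \<pi>'. (\<exists>l. loc_rel P P' l) \<and> mod_lin B P' N' \<pi>' \<and>
    \<pi>' ` carrier P' = carrier N' \<and> (\<exists>l. loc_rel (ker_mod P N \<pi>) (ker_mod P' N' \<pi>') l)"
proof -
  note r = loc_relD[OF rel]
  obtain P' :: "('b, 'm) module" and k where relP: "loc_rel P P' k" using ex_loc[OF large P] by blast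
  note rP = loc_relD[OF relP]
  interpret N: left_module A N by (rule r(1))
  interpret P: left_module A P by (rule P)
  interpret N': left_module B N' by (rule r(2))
  interpret P': left_module B P' by (rule rP(2))
  obtain \<pi>' where lin: "mod_lin B P' N' \<pi>'" and \<pi>': "\<And>x. x \<in> carrier P \<Longrightarrow> \<pi>' (k x) = l (\<pi> x)"
    using loc_rel_extend[OF relP r(2) mod_lin_comp[OF \<pi> r(3)]] by blast
  have "carrier N' \<subseteq> \<pi>' ` carrier P'"
  proof
    fix y assume y: "y \<in> carrier N'"
    obtain s x where s: "s \<in> S" "x \<in> carrier N" "\<phi> s \<odot>\<^bsub>N'\<^esub> y = l x" using r(5)[OF y] by blast
    obtain p where p: "p \<in> carrier P" "\<pi> p = x" using surj_onE[OF surj s(2)] by metis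
    obtain z where z: "z \<in> carrier P'" "\<phi> s \<odot>\<^bsub>P'\<^esub> z = k p" using phi_S_solve[OF rP(2) s(1) rP(6)[OF p(1)]] by blast
    have "\<phi> s \<odot>\<^bsub>N'\<^esub> \<pi>' z = \<phi> s \<odot>\<^bsub>N'\<^esub> y"
      using mod_linD(3)[OF lin, of "\<phi> s" z] z s \<pi>'[OF p(1)] p(2) phi_closed S_carrier by simp
    then have "\<pi>' z = y" using phi_S_cancel[OF r(2) s(1)] mod_linD(1)[OF lin z(1)] y by blast
    then show "y \<in> \<pi>' ` carrier P'" using z(1) by blast
  qed
  then have surj': "\<pi>' ` carrier P' = carrier N'" using mod_linD(1)[OF lin] by auto
  let ?K = "ker_mod P N \<pi>" and ?K' = "ker_mod P' N' \<pi>'"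
  have l0: "l \<zero>\<^bsub>N\<^esub> = \<zero>\<^bsub>N'\<^esub>"
    using mod_lin_zero[OF r(1) left_module_restr[OF ring_A hom r(2)] r(3)] by simp
  have "loc_rel ?K ?K' k"
    unfolding loc_rel_def
  proof (intro conjI ballI impI)
    show "left_module A ?K" by (rule left_module_ker[OF P P r(1) \<pi>])
    show "left_module B ?K'" by (rule left_module_ker[OF rP(2) rP(2) r(2) lin])
    show "mod_lin A ?K (restr \<phi> ?K') k"
      using rP(6,7,8) \<pi>' l0 by (intro mod_linI) (auto simp: ker_set_def)
  next
    fix x assume "x \<in> carrier ?K" "k x = \<zero>\<^bsub>?K'\<^esub>"
    then show "\<exists>s\<in>S. s \<odot>\<^bsub>?K\<^esub> x = \<zero>\<^bsub>?K\<^esub>" using rP(4)[of x] by (simp add: ker_set_def)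
  next
    fix y assume "y \<in> carrier ?K'"
    then have y: "y \<in> carrier P'" "\<pi>' y = \<zero>\<^bsub>N'\<^esub>" by (auto simp: ker_set_def)
    obtain s p where s: "s \<in> S" "p \<in> carrier P" "\<phi> s \<odot>\<^bsub>P'\<^esub> y = k p" using rP(5)[OF y(1)] by blast
    have c: "\<phi> s \<in> carrier B" "s \<in> carrier A" using s phi_closed S_carrier by auto
    \<comment> \<open>The numerator \<open>p\<close> need not lie in the kernel of
      \<open>\<pi>\<close>. However, \<open>\<pi> p\<close> vanishes in \<open>N'\<close>, hence is
      killed by some \<open>t\<close> in \<open>S\<close>, and \<open>t p\<close> is a numerator in
      the kernel.\<close>
    have "l (\<pi> p) = \<zero>\<^bsub>N'\<^esub>"
      using mod_linD(3)[OF lin c(1) y(1)] s y(2) \<pi>' N'.smult_zero_right[OF c(1)] by simp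
    then obtain t where t: "t \<in> S" "t \<odot>\<^bsub>N\<^esub> \<pi> p = \<zero>\<^bsub>N\<^esub>" using r(4) mod_linD(1)[OF \<pi> s(2)] by blast
    have ct: "\<phi> t \<in> carrier B" "t \<in> carrier A" using t phi_closed S_carrier by auto
    have "t \<odot>\<^bsub>P\<^esub> p \<in> carrier ?K"
      using t s ct mod_linD(3)[OF \<pi>] by (simp add: ker_set_def P.smult_closed)
    moreover have "\<phi> (t \<otimes>\<^bsub>A\<^esub> s) \<odot>\<^bsub>P'\<^esub> y = k (t \<odot>\<^bsub>P\<^esub> p)"
      using y s c ct by (simp add: phi_mult P'.smult_assoc rP(8))
    ultimately show "\<exists>s\<in>S. \<exists>x\<in>carrier ?K. \<phi> s \<odot>\<^bsub>?K'\<^esub> y = k x"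
      using S_mult[OF t(1) s(1)] by auto
  qed
  then show ?thesis using relP lin surj' by blast
qed

lemma gldim_finite_loc:
  assumes "large_universe TYPE('m) A" and "gldim TYPE('m) A < \<infinity>"
  shows "gldim TYPE('m) B < \<infinity>"
proof -
  obtain n where n: "\<And>M :: ('a, 'm) module. left_module A M \<Longrightarrow> pd_le {\<one>\<^bsub>A\<^esub>} A n M"
    using assms(2) gldim_finite_iff by metis
  have "pd_le {\<one>\<^bsub>B\<^esub>} B n M" if M: "left_module B M" for M :: "('b, 'm) module"
  proof (rule pd_le_transfer[where Rel = "\<lambda>N N'. \<exists>l. loc_rel N N' l"])
    show "\<exists>l. loc_rel (restr \<phi> M) M l" using loc_rel_refl[OF M] by blast
    show "pd_le {\<one>\<^bsub>A\<^esub>} A n (restr \<phi> M)" by (rule n[OF left_module_restr[OF ring_A hom M]])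
  next
    fix P N :: "('a, 'm) module" and N' :: "('b, 'm) module" and \<pi>
    assume *: "\<exists>l. loc_rel N N' l" "projective_module TYPE('m) A P"
      "mod_lin A P N \<pi>" "\<pi> ` carrier P = carrier N"
    then show "\<exists>(P' :: ('b, 'm) module) \<pi>'. (\<exists>l. loc_rel P P' l) \<and> mod_lin B P' N' \<pi>' \<and>
      \<pi>' ` carrier P' = carrier N' \<and> (\<exists>l. loc_rel (ker_mod P N \<pi>) (ker_mod P' N' \<pi>') l)"
      using loc_rel_kernel[OF assms(1) _ projective_imp_left_module[OF *(2)] *(3,4)] by blast
  qed (use loc_relD(2) loc_rel_projective in blast)+
  then show ?thesis using gldim_finite_iff by blast
qed

end

lemma ring_loc_iso:
  assumes "ring A" "ring B" "\<phi> \<in> ring_hom A B" "bij_betw \<phi> (carrier A) (carrier B)"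
  shows "ring_loc A B \<phi> {\<one>\<^bsub>A\<^esub>}"
proof -
  interpret A: ring A by fact
  interpret B: ring B by fact
  interpret h: ring_hom_ring A B \<phi> by (rule ring_hom_ringI2[OF assms(1-3)])
  have inj: "a = \<zero>\<^bsub>A\<^esub>" if "a \<in> carrier A" "\<phi> a = \<zero>\<^bsub>B\<^esub>" for a
    using that assms(4) h.hom_zero inj_onD[of \<phi> "carrier A" a "\<zero>\<^bsub>A\<^esub>"] by (simp add: bij_betw_def)
  have surj: "\<exists>a\<in>carrier A. b = \<phi> a" if "b \<in> carrier B" for b
    using that assms(4) unfolding bij_betw_def by blast
  show ?thesis
    using assms(1-3) inj surj by unfold_locales (auto intro!: bexI[of _ "\<one>\<^bsub>B\<^esub>"])
qed

section \<open>The ring of fractions at a prime ideal\<close>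

locale prime_loc =
  fixes R :: "('r, 'x) ring_scheme" and P :: "'r set"
  assumes prime: "primeideal P R"
begin

interpretation primeideal P R by (rule prime)

definition S where "S = carrier R - P"

definition fr where "fr a s = frac_rel R P `` {(a, s)}"

lemma S_carrier: "s \<in> S \<Longrightarrow> s \<in> carrier R"
  by (simp add: S_def)

lemma S_mult: "s \<in> S \<Longrightarrow> t \<in> S \<Longrightarrow> s \<otimes>\<^bsub>R\<^esub> t \<in> S"
  using I_prime by (auto simp: S_def)

lemma S_one: "\<one>\<^bsub>R\<^esub> \<in> S"
  using I_notcarr one_imp_carrier by (auto simp: S_def)

lemma fr_mem: "p \<in> fr a s \<longleftrightarrow> a \<in> carrier R \<and> s \<in> S \<and> fst p \<in> carrier R \<and> snd p \<in> S \<and>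
    (\<exists>u\<in>S. u \<otimes>\<^bsub>R\<^esub> (a \<otimes>\<^bsub>R\<^esub> snd p) = u \<otimes>\<^bsub>R\<^esub> (fst p \<otimes>\<^bsub>R\<^esub> s))"
  by (cases p) (auto simp: fr_def frac_rel_def S_def)

text \<open>Classes are compared as sets. If \<open>u\<close> equates the two given fractions and
  \<open>v\<close> a third with the first, the product of \<open>u\<close>, \<open>v\<close> and
  \<open>s\<close> equates the third with the second.\<close>

lemma fr_eqI:
  assumes c: "a \<in> carrier R" "s \<in> S" "b \<in> carrier R" "t \<in> S" "u \<in> S"
    and u: "u \<otimes>\<^bsub>R\<^esub> (a \<otimes>\<^bsub>R\<^esub> t) = u \<otimes>\<^bsub>R\<^esub> (b \<otimes>\<^bsub>R\<^esub> s)"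
  shows "fr a s = fr b t"
proof -
  have *: "fr a s \<subseteq> fr b t"
    if c: "a \<in> carrier R" "s \<in> S" "b \<in> carrier R" "t \<in> S" "u \<in> S"
      and u: "u \<otimes>\<^bsub>R\<^esub> (a \<otimes>\<^bsub>R\<^esub> t) = u \<otimes>\<^bsub>R\<^esub> (b \<otimes>\<^bsub>R\<^esub> s)" for a s b t u
  proof
    fix p assume "p \<in> fr a s"
    then obtain v where p: "fst p \<in> carrier R" "snd p \<in> S" and v: "v \<in> S"
      "v \<otimes>\<^bsub>R\<^esub> (a \<otimes>\<^bsub>R\<^esub> snd p) = v \<otimes>\<^bsub>R\<^esub> (fst p \<otimes>\<^bsub>R\<^esub> s)" by (auto simp: fr_mem)
    have "(u \<otimes>\<^bsub>R\<^esub> v \<otimes>\<^bsub>R\<^esub> s) \<otimes>\<^bsub>R\<^esub> (b \<otimes>\<^bsub>R\<^esub> snd p) = v \<otimes>\<^bsub>R\<^esub> snd p \<otimes>\<^bsub>R\<^esub> (u \<otimes>\<^bsub>R\<^esub> (b \<otimes>\<^bsub>R\<^esub> s))"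
      using c p v(1) S_carrier by (simp add: m_ac)
    also have "\<dots> = v \<otimes>\<^bsub>R\<^esub> snd p \<otimes>\<^bsub>R\<^esub> (u \<otimes>\<^bsub>R\<^esub> (a \<otimes>\<^bsub>R\<^esub> t))" by (simp only: u)
    also have "\<dots> = u \<otimes>\<^bsub>R\<^esub> t \<otimes>\<^bsub>R\<^esub> (v \<otimes>\<^bsub>R\<^esub> (a \<otimes>\<^bsub>R\<^esub> snd p))"
      using c p v(1) S_carrier by (simp add: m_ac)
    also have "\<dots> = u \<otimes>\<^bsub>R\<^esub> t \<otimes>\<^bsub>R\<^esub> (v \<otimes>\<^bsub>R\<^esub> (fst p \<otimes>\<^bsub>R\<^esub> s))" by (simp only: v(2))
    also have "\<dots> = (u \<otimes>\<^bsub>R\<^esub> v \<otimes>\<^bsub>R\<^esub> s) \<otimes>\<^bsub>R\<^esub> (fst p \<otimes>\<^bsub>R\<^esub> t)"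
      using c p v(1) S_carrier by (simp add: m_ac)
    finally show "p \<in> fr b t"
      unfolding fr_mem using c p v(1) S_mult by (intro conjI bexI[of _ "u \<otimes>\<^bsub>R\<^esub> v \<otimes>\<^bsub>R\<^esub> s"]) simp_all
  qed
  show ?thesis using *[OF c u] *[OF c(3,4,1,2,5) u[symmetric]] by blast
qed

lemma fr_self: "a \<in> carrier R \<Longrightarrow> s \<in> S \<Longrightarrow> (a, s) \<in> fr a s"
  using S_one by (auto simp: fr_mem)

lemma fr_eq_iff:
  assumes "a \<in> carrier R" "s \<in> S" "b \<in> carrier R" "t \<in> S"
  shows "fr a s = fr b t \<longleftrightarrow> (\<exists>u\<in>S. u \<otimes>\<^bsub>R\<^esub> (a \<otimes>\<^bsub>R\<^esub> t) = u \<otimes>\<^bsub>R\<^esub> (b \<otimes>\<^bsub>R\<^esub> s))"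
proof
  assume "fr a s = fr b t"
  then have "(b, t) \<in> fr a s" using fr_self assms by simp
  then show "\<exists>u\<in>S. u \<otimes>\<^bsub>R\<^esub> (a \<otimes>\<^bsub>R\<^esub> t) = u \<otimes>\<^bsub>R\<^esub> (b \<otimes>\<^bsub>R\<^esub> s)" by (simp add: fr_mem)
next
  assume "\<exists>u\<in>S. u \<otimes>\<^bsub>R\<^esub> (a \<otimes>\<^bsub>R\<^esub> t) = u \<otimes>\<^bsub>R\<^esub> (b \<otimes>\<^bsub>R\<^esub> s)"
  then show "fr a s = fr b t" using fr_eqI[OF assms] by blast
qed

lemma fr_eq_simple:
  assumes "a \<in> carrier R" "s \<in> S" "b \<in> carrier R" "t \<in> S" "a \<otimes>\<^bsub>R\<^esub> t = b \<otimes>\<^bsub>R\<^esub> s"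
  shows "fr a s = fr b t"
  using fr_eqI[OF assms(1-4) S_one] assms(5) by simp

abbreviation Q where "Q \<equiv> localization R P"

lemma Q_carrier: "carrier Q = (\<lambda>(a, s). fr a s) ` (carrier R \<times> S)"
  by (auto simp: localization_def quotient_def fr_def S_def)

lemma Q_carrierE:
  assumes "y \<in> carrier Q"
  obtains a s where "y = fr a s" "a \<in> carrier R" "s \<in> S"
  using assms by (auto simp: Q_carrier)

lemma fr_closed: "a \<in> carrier R \<Longrightarrow> s \<in> S \<Longrightarrow> fr a s \<in> carrier Q"
  by (force simp: Q_carrier)

text \<open>Operations on fractions are unions over all representatives. Since every pair of
  representatives gives the same class and there is at least one pair, the union is that
  class.\<close>

lemma fr_op:
  assumes "a \<in> carrier R" "s \<in> S" "b \<in> carrier R" "t \<in> S"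
    and "\<And>p q. \<lbrakk>p \<in> fr a s; q \<in> fr b t\<rbrakk> \<Longrightarrow> h p q = K"
  shows "(\<Union>p\<in>fr a s. \<Union>q\<in>fr b t. h p q) = K"
proof (intro equalityI subsetI)
  fix x assume "x \<in> K"
  then have "x \<in> h (a, s) (b, t)" using assms fr_self by simp
  then show "x \<in> (\<Union>p\<in>fr a s. \<Union>q\<in>fr b t. h p q)" using fr_self assms by blast
qed (use assms(5) in blast)

lemma Q_mult:
  assumes c: "a \<in> carrier R" "s \<in> S" "b \<in> carrier R" "t \<in> S"
  shows "fr a s \<otimes>\<^bsub>Q\<^esub> fr b t = fr (a \<otimes>\<^bsub>R\<^esub> b) (s \<otimes>\<^bsub>R\<^esub> t)"
proof -
  have "(case p of (a', s') \<Rightarrow> case q of (b', t') \<Rightarrow> fr (a' \<otimes>\<^bsub>R\<^esub> b') (s' \<otimes>\<^bsub>R\<^esub> t')) =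
      fr (a \<otimes>\<^bsub>R\<^esub> b) (s \<otimes>\<^bsub>R\<^esub> t)" if p: "p \<in> fr a s" and q: "q \<in> fr b t" for p q
  proof -
    obtain a' s' where p': "p = (a', s')" by (cases p)
    obtain b' t' where q': "q = (b', t')" by (cases q)
    obtain u where u: "u \<in> S" "u \<otimes>\<^bsub>R\<^esub> (a \<otimes>\<^bsub>R\<^esub> s') = u \<otimes>\<^bsub>R\<^esub> (a' \<otimes>\<^bsub>R\<^esub> s)" and c1: "a' \<in> carrier R" "s' \<in> S"
      using p by (auto simp: fr_mem p')
    obtain v where v: "v \<in> S" "v \<otimes>\<^bsub>R\<^esub> (b \<otimes>\<^bsub>R\<^esub> t') = v \<otimes>\<^bsub>R\<^esub> (b' \<otimes>\<^bsub>R\<^esub> t)" and c2: "b' \<in> carrier R" "t' \<in> S"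
      using q by (auto simp: fr_mem q')
    have "u \<otimes>\<^bsub>R\<^esub> v \<otimes>\<^bsub>R\<^esub> (a' \<otimes>\<^bsub>R\<^esub> b' \<otimes>\<^bsub>R\<^esub> (s \<otimes>\<^bsub>R\<^esub> t)) =
        u \<otimes>\<^bsub>R\<^esub> (a' \<otimes>\<^bsub>R\<^esub> s) \<otimes>\<^bsub>R\<^esub> (v \<otimes>\<^bsub>R\<^esub> (b' \<otimes>\<^bsub>R\<^esub> t))"
      using c c1 c2 u(1) v(1) S_carrier by (simp add: m_ac)
    also have "\<dots> = u \<otimes>\<^bsub>R\<^esub> (a \<otimes>\<^bsub>R\<^esub> s') \<otimes>\<^bsub>R\<^esub> (v \<otimes>\<^bsub>R\<^esub> (b \<otimes>\<^bsub>R\<^esub> t'))" by (simp only: u(2) v(2))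
    also have "\<dots> = u \<otimes>\<^bsub>R\<^esub> v \<otimes>\<^bsub>R\<^esub> (a \<otimes>\<^bsub>R\<^esub> b \<otimes>\<^bsub>R\<^esub> (s' \<otimes>\<^bsub>R\<^esub> t'))"
      using c c1 c2 u(1) v(1) S_carrier by (simp add: m_ac)
    finally show ?thesis
      unfolding p' q' prod.case using c c1 c2 S_mult u(1) v(1)
      by (intro fr_eqI[of _ _ _ _ "u \<otimes>\<^bsub>R\<^esub> v"]) simp_all
  qed
  from fr_op[OF c this] show ?thesis
    by (simp add: localization_def case_prod_unfold flip: fr_def)
qed

lemma Q_add:
  assumes c: "a \<in> carrier R" "s \<in> S" "b \<in> carrier R" "t \<in> S"
  shows "fr a s \<oplus>\<^bsub>Q\<^esub> fr b t = fr (a \<otimes>\<^bsub>R\<^esub> t \<oplus>\<^bsub>R\<^esub> b \<otimes>\<^bsub>R\<^esub> s) (s \<otimes>\<^bsub>R\<^esub> t)"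
proof -
  have "(case p of (a', s') \<Rightarrow> case q of (b', t') \<Rightarrow> fr (a' \<otimes>\<^bsub>R\<^esub> t' \<oplus>\<^bsub>R\<^esub> b' \<otimes>\<^bsub>R\<^esub> s') (s' \<otimes>\<^bsub>R\<^esub> t')) =
      fr (a \<otimes>\<^bsub>R\<^esub> t \<oplus>\<^bsub>R\<^esub> b \<otimes>\<^bsub>R\<^esub> s) (s \<otimes>\<^bsub>R\<^esub> t)" if p: "p \<in> fr a s" and q: "q \<in> fr b t" for p q
  proof -
    obtain a' s' where p': "p = (a', s')" by (cases p)
    obtain b' t' where q': "q = (b', t')" by (cases q)
    obtain u where u: "u \<in> S" "u \<otimes>\<^bsub>R\<^esub> (a \<otimes>\<^bsub>R\<^esub> s') = u \<otimes>\<^bsub>R\<^esub> (a' \<otimes>\<^bsub>R\<^esub> s)" and c1: "a' \<in> carrier R" "s' \<in> S"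
      using p by (auto simp: fr_mem p')
    obtain v where v: "v \<in> S" "v \<otimes>\<^bsub>R\<^esub> (b \<otimes>\<^bsub>R\<^esub> t') = v \<otimes>\<^bsub>R\<^esub> (b' \<otimes>\<^bsub>R\<^esub> t)" and c2: "b' \<in> carrier R" "t' \<in> S"
      using q by (auto simp: fr_mem q')
    have "u \<otimes>\<^bsub>R\<^esub> v \<otimes>\<^bsub>R\<^esub> ((a' \<otimes>\<^bsub>R\<^esub> t' \<oplus>\<^bsub>R\<^esub> b' \<otimes>\<^bsub>R\<^esub> s') \<otimes>\<^bsub>R\<^esub> (s \<otimes>\<^bsub>R\<^esub> t)) =
        v \<otimes>\<^bsub>R\<^esub> t \<otimes>\<^bsub>R\<^esub> t' \<otimes>\<^bsub>R\<^esub> (u \<otimes>\<^bsub>R\<^esub> (a' \<otimes>\<^bsub>R\<^esub> s)) \<oplus>\<^bsub>R\<^esub> u \<otimes>\<^bsub>R\<^esub> s \<otimes>\<^bsub>R\<^esub> s' \<otimes>\<^bsub>R\<^esub> (v \<otimes>\<^bsub>R\<^esub> (b' \<otimes>\<^bsub>R\<^esub> t))"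
      using c c1 c2 u(1) v(1) S_carrier by (simp add: m_ac l_distr r_distr)
    also have "\<dots> = v \<otimes>\<^bsub>R\<^esub> t \<otimes>\<^bsub>R\<^esub> t' \<otimes>\<^bsub>R\<^esub> (u \<otimes>\<^bsub>R\<^esub> (a \<otimes>\<^bsub>R\<^esub> s')) \<oplus>\<^bsub>R\<^esub> u \<otimes>\<^bsub>R\<^esub> s \<otimes>\<^bsub>R\<^esub> s' \<otimes>\<^bsub>R\<^esub> (v \<otimes>\<^bsub>R\<^esub> (b \<otimes>\<^bsub>R\<^esub> t'))"
      by (simp only: u(2) v(2))
    also have "\<dots> = u \<otimes>\<^bsub>R\<^esub> v \<otimes>\<^bsub>R\<^esub> ((a \<otimes>\<^bsub>R\<^esub> t \<oplus>\<^bsub>R\<^esub> b \<otimes>\<^bsub>R\<^esub> s) \<otimes>\<^bsub>R\<^esub> (s' \<otimes>\<^bsub>R\<^esub> t'))"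
      using c c1 c2 u(1) v(1) S_carrier by (simp add: m_ac l_distr r_distr)
    finally show ?thesis
      unfolding p' q' prod.case using c c1 c2 S_mult u(1) v(1) S_carrier
      by (intro fr_eqI[of _ _ _ _ "u \<otimes>\<^bsub>R\<^esub> v"]) simp_all
  qed
  from fr_op[OF c this] show ?thesis
    by (simp add: localization_def case_prod_unfold flip: fr_def)
qed

lemma Q_zero: "\<zero>\<^bsub>Q\<^esub> = fr \<zero>\<^bsub>R\<^esub> \<one>\<^bsub>R\<^esub>" and Q_one: "\<one>\<^bsub>Q\<^esub> = fr \<one>\<^bsub>R\<^esub> \<one>\<^bsub>R\<^esub>"
  by (simp_all add: localization_def fr_def)

lemma cring_Q: "cring Q"
proof (rule cringI)
  show "abelian_group Q"
  proof (rule abelian_groupI)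
    show "\<zero>\<^bsub>Q\<^esub> \<in> carrier Q" using S_one by (simp add: Q_zero fr_closed)
    fix x assume "x \<in> carrier Q"
    then obtain a s where x: "x = fr a s" "a \<in> carrier R" "s \<in> S" by (rule Q_carrierE)
    show "\<zero>\<^bsub>Q\<^esub> \<oplus>\<^bsub>Q\<^esub> x = x" using x S_one S_carrier by (simp add: Q_zero Q_add)
    have "fr (\<ominus>\<^bsub>R\<^esub> a) s \<oplus>\<^bsub>Q\<^esub> x = \<zero>\<^bsub>Q\<^esub>"
      using x S_one S_carrier S_mult by (simp add: Q_add Q_zero l_minus l_neg) (intro fr_eq_simple; simp)
    then show "\<exists>y\<in>carrier Q. y \<oplus>\<^bsub>Q\<^esub> x = \<zero>\<^bsub>Q\<^esub>"
      by (rule bexI) (use x in \<open>simp add: fr_closed\<close>)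
    fix y assume "y \<in> carrier Q"
    then obtain b t where y: "y = fr b t" "b \<in> carrier R" "t \<in> S" by (rule Q_carrierE)
    show "x \<oplus>\<^bsub>Q\<^esub> y \<in> carrier Q" using x y S_carrier S_mult by (simp add: Q_add fr_closed)
    show "x \<oplus>\<^bsub>Q\<^esub> y = y \<oplus>\<^bsub>Q\<^esub> x" using x y S_carrier S_mult by (simp add: Q_add m_comm a_comm)
    fix z assume "z \<in> carrier Q"
    then obtain c r where z: "z = fr c r" "c \<in> carrier R" "r \<in> S" by (rule Q_carrierE)
    show "x \<oplus>\<^bsub>Q\<^esub> y \<oplus>\<^bsub>Q\<^esub> z = x \<oplus>\<^bsub>Q\<^esub> (y \<oplus>\<^bsub>Q\<^esub> z)"
      using x y z S_carrier S_mult by (simp add: Q_add l_distr r_distr m_ac a_ac)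
  qed
  show "comm_monoid Q"
  proof (rule comm_monoidI)
    show "\<one>\<^bsub>Q\<^esub> \<in> carrier Q" using S_one by (simp add: Q_one fr_closed)
    fix x assume "x \<in> carrier Q"
    then obtain a s where x: "x = fr a s" "a \<in> carrier R" "s \<in> S" by (rule Q_carrierE)
    show "\<one>\<^bsub>Q\<^esub> \<otimes>\<^bsub>Q\<^esub> x = x" using x S_one S_carrier by (simp add: Q_one Q_mult)
    fix y assume "y \<in> carrier Q"
    then obtain b t where y: "y = fr b t" "b \<in> carrier R" "t \<in> S" by (rule Q_carrierE)
    show "x \<otimes>\<^bsub>Q\<^esub> y \<in> carrier Q" using x y S_mult by (simp add: Q_mult fr_closed)
    show "x \<otimes>\<^bsub>Q\<^esub> y = y \<otimes>\<^bsub>Q\<^esub> x" using x y S_carrier by (simp add: Q_mult m_comm)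
    fix z assume "z \<in> carrier Q"
    then obtain c r where z: "z = fr c r" "c \<in> carrier R" "r \<in> S" by (rule Q_carrierE)
    show "x \<otimes>\<^bsub>Q\<^esub> y \<otimes>\<^bsub>Q\<^esub> z = x \<otimes>\<^bsub>Q\<^esub> (y \<otimes>\<^bsub>Q\<^esub> z)"
      using x y z S_carrier S_mult by (simp add: Q_mult m_assoc)
  qed
  fix x y z assume "x \<in> carrier Q" "y \<in> carrier Q" "z \<in> carrier Q"
  then obtain a s b t c r where "x = fr a s" "a \<in> carrier R" "s \<in> S" "y = fr b t" "b \<in> carrier R" "t \<in> S"
    "z = fr c r" "c \<in> carrier R" "r \<in> S" by (metis Q_carrierE)
  then show "(x \<oplus>\<^bsub>Q\<^esub> y) \<otimes>\<^bsub>Q\<^esub> z = x \<otimes>\<^bsub>Q\<^esub> z \<oplus>\<^bsub>Q\<^esub> y \<otimes>\<^bsub>Q\<^esub> z"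
    using S_carrier S_mult
    by (simp add: Q_mult Q_add) (intro fr_eq_simple; simp add: l_distr r_distr m_ac)
qed

abbreviation \<iota> where "\<iota> a \<equiv> fr a \<one>\<^bsub>R\<^esub>"

lemma ring_loc_Q: "ring_loc R Q \<iota> S"
proof (rule ring_loc.intro)
  interpret Q: cring Q by (rule cring_Q)
  show "ring R" "ring Q" by (rule ring_axioms Q.ring_axioms)+
  show "\<iota> \<in> ring_hom R Q"
    using S_one by (intro ring_hom_memI) (simp_all add: fr_closed Q_mult Q_add Q_one)
  show "\<And>s. s \<in> S \<Longrightarrow> s \<in> carrier R" by (rule S_carrier)
  show "\<one>\<^bsub>R\<^esub> \<in> S" by (rule S_one)
  show "\<And>s t. s \<in> S \<Longrightarrow> t \<in> S \<Longrightarrow> s \<otimes>\<^bsub>R\<^esub> t \<in> S" by (rule S_mult)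
  show "\<And>s a. s \<in> S \<Longrightarrow> a \<in> carrier R \<Longrightarrow> s \<otimes>\<^bsub>R\<^esub> a = a \<otimes>\<^bsub>R\<^esub> s" using S_carrier m_comm by blast
  show "\<exists>b\<in>carrier Q. b \<otimes>\<^bsub>Q\<^esub> \<iota> s = \<one>\<^bsub>Q\<^esub> \<and> \<iota> s \<otimes>\<^bsub>Q\<^esub> b = \<one>\<^bsub>Q\<^esub>" if s: "s \<in> S" for s
  proof (intro bexI[of _ "fr \<one>\<^bsub>R\<^esub> s"] conjI)
    show "fr \<one>\<^bsub>R\<^esub> s \<otimes>\<^bsub>Q\<^esub> \<iota> s = \<one>\<^bsub>Q\<^esub>" "\<iota> s \<otimes>\<^bsub>Q\<^esub> fr \<one>\<^bsub>R\<^esub> s = \<one>\<^bsub>Q\<^esub>"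
      using s S_one S_carrier fr_eq_simple[of s s "\<one>\<^bsub>R\<^esub>" "\<one>\<^bsub>R\<^esub>"] by (simp_all add: Q_mult Q_one)
  qed (use s in \<open>simp add: fr_closed\<close>)
  show "\<exists>s\<in>S. \<exists>a\<in>carrier R. \<iota> s \<otimes>\<^bsub>Q\<^esub> b = \<iota> a" if "b \<in> carrier Q" for b
  proof -
    obtain a s where b: "b = fr a s" "a \<in> carrier R" "s \<in> S" using \<open>b \<in> carrier Q\<close> by (rule Q_carrierE)
    then have "\<iota> s \<otimes>\<^bsub>Q\<^esub> b = \<iota> a"
      using S_one S_carrier fr_eq_simple[of "a \<otimes>\<^bsub>R\<^esub> s" s a "\<one>\<^bsub>R\<^esub>"] by (simp add: Q_mult m_comm)
    then show ?thesis using b by blast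
  qed
  show "\<exists>s\<in>S. s \<otimes>\<^bsub>R\<^esub> a = \<zero>\<^bsub>R\<^esub>" if "a \<in> carrier R" "\<iota> a = \<zero>\<^bsub>Q\<^esub>" for a
    using that S_one S_carrier by (auto simp: Q_zero fr_eq_iff)
qed

text \<open>An ideal of the localization is generated by the images of generators of its contraction
  to \<open>R\<close>, since every element is a unit times the image of an element of the
  contraction.\<close>

lemma noetherian_Q:
  assumes "noetherian_ring R"
  shows "noetherian_ring Q"
proof -
  interpret R: noetherian_ring R by fact
  interpret Q: cring Q by (rule cring_Q)
  interpret L: ring_loc R Q \<iota> S by (rule ring_loc_Q)
  interpret h: ring_hom_ring R Q \<iota> by (rule ring_hom_ringI2[OF L.ring_A L.ring_B L.hom])
  show ?thesis
  proof (intro noetherian_ring.intro noetherian_ring_axioms.intro Q.ring_axioms)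
    fix I assume I: "ideal I Q"
    have vim: "ideal {a \<in> carrier R. \<iota> a \<in> K} R" if K: "ideal K Q" for K
      by (rule h.ideal_vimage[OF K])
    obtain T where T: "T \<subseteq> carrier R" "finite T" "{a \<in> carrier R. \<iota> a \<in> I} = Idl\<^bsub>R\<^esub> T"
      using R.finetely_gen[OF vim[OF I]] by blast
    have TI: "\<iota> ` T \<subseteq> I" using genideal_self[OF T(1)] T(3) by auto
    have TQ: "\<iota> ` T \<subseteq> carrier Q" using T(1) by auto
    let ?K = "Idl\<^bsub>Q\<^esub> (\<iota> ` T)"
    have K: "ideal ?K Q" by (rule Q.genideal_ideal[OF TQ])
    have "Idl\<^bsub>R\<^esub> T \<subseteq> {a \<in> carrier R. \<iota> a \<in> ?K}"
      using genideal_minimal[OF vim[OF K], of T] Q.genideal_self[OF TQ] T(1) by blast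
    then have sub: "\<iota> a \<in> ?K" if "a \<in> carrier R" "\<iota> a \<in> I" for a using that T(3) by blast
    have "I \<subseteq> ?K"
    proof
      fix y assume y: "y \<in> I"
      have yc: "y \<in> carrier Q" using ideal.Icarr[OF I y] .
      obtain s a where s: "s \<in> S" "a \<in> carrier R" "\<iota> s \<otimes>\<^bsub>Q\<^esub> y = \<iota> a" using L.fraction[OF yc] by blast
      have "\<iota> s \<otimes>\<^bsub>Q\<^esub> y \<in> I" using ideal.I_l_closed[OF I y] s(1) S_carrier L.phi_closed by blast
      then have a: "\<iota> a \<in> ?K" using sub[OF s(2)] s(3) by simp
      obtain b where b: "b \<in> carrier Q" "b \<otimes>\<^bsub>Q\<^esub> \<iota> s = \<one>\<^bsub>Q\<^esub>" using L.S_unit[OF s(1)] by blast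
      have "y = b \<otimes>\<^bsub>Q\<^esub> (\<iota> s \<otimes>\<^bsub>Q\<^esub> y)"
        using b yc s(1) S_carrier L.phi_closed by (simp flip: Q.m_assoc)
      also have "\<dots> \<in> ?K" using ideal.I_l_closed[OF K a b(1)] s(3) by simp
      finally show "y \<in> ?K" .
    qed
    moreover have "?K \<subseteq> I" by (rule Q.genideal_minimal[OF I TI])
    ultimately have "I = ?K" by blast
    with TQ T(2) show "\<exists>A\<subseteq>carrier Q. finite A \<and> I = Idl\<^bsub>Q\<^esub> A" by (intro exI[of _ "\<iota> ` T"]) auto
  qed
qed

text \<open>The fractions with numerator in \<open>P\<close> form a proper ideal, and every other
  fraction is a unit because its numerator may serve as a denominator.\<close>

lemma ex1_maximalideal_Q: "\<exists>!M. maximalideal M Q"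
proof -
  interpret Q: cring Q by (rule cring_Q)
  define M where "M = {y. \<exists>a\<in>P. \<exists>s\<in>S. y = fr a s}"
  have Pc: "a \<in> carrier R" if "a \<in> P" for a using a_subset that by auto
  have M: "ideal M Q"
  proof (rule idealI[OF Q.ring_axioms])
    have neg: "\<ominus>\<^bsub>Q\<^esub> fr a s = fr (\<ominus>\<^bsub>R\<^esub> a) s" if "a \<in> P" "s \<in> S" for a s
    proof (rule Q.minus_equality)
      show "fr (\<ominus>\<^bsub>R\<^esub> a) s \<oplus>\<^bsub>Q\<^esub> fr a s = \<zero>\<^bsub>Q\<^esub>"
        using that Pc S_one S_carrier S_mult
        by (simp add: Q_add Q_zero l_minus l_neg) (intro fr_eq_simple; simp)
    qed (use that Pc in \<open>simp_all add: fr_closed\<close>)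
    show "subgroup M (add_monoid Q)"
    proof (rule subgroup.intro)
      show "M \<subseteq> carrier (add_monoid Q)" using Pc fr_closed by (auto simp: M_def)
      show "\<one>\<^bsub>add_monoid Q\<^esub> \<in> M" 
        using S_one additive_subgroup.zero_closed[OF is_additive_subgroup] by (auto simp: M_def Q_zero)
      fix x assume "x \<in> M"
      then obtain a s where x: "x = fr a s" "a \<in> P" "s \<in> S" by (auto simp: M_def)
      have "fr (\<ominus>\<^bsub>R\<^esub> a) s \<in> M" using x unfolding M_def by blast
      then show "inv\<^bsub>add_monoid Q\<^esub> x \<in> M" using neg x by (simp add: a_inv_def)
      fix y assume "y \<in> M"
      then obtain b t where y: "y = fr b t" "b \<in> P" "t \<in> S" by (auto simp: M_def)
      have "a \<otimes>\<^bsub>R\<^esub> t \<oplus>\<^bsub>R\<^esub> b \<otimes>\<^bsub>R\<^esub> s \<in> P" using x y S_carrier by (simp add: I_r_closed)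
      then have "fr (a \<otimes>\<^bsub>R\<^esub> t \<oplus>\<^bsub>R\<^esub> b \<otimes>\<^bsub>R\<^esub> s) (s \<otimes>\<^bsub>R\<^esub> t) \<in> M" using x y S_mult unfolding M_def by blast
      then show "x \<otimes>\<^bsub>add_monoid Q\<^esub> y \<in> M" using x y Pc by (simp add: Q_add)
    qed
    have l: "z \<otimes>\<^bsub>Q\<^esub> x \<in> M" if xM: "x \<in> M" and zQ: "z \<in> carrier Q" for x z
    proof -
      obtain a s where x: "x = fr a s" "a \<in> P" "s \<in> S" using xM by (auto simp: M_def)
      obtain b t where z: "z = fr b t" "b \<in> carrier R" "t \<in> S" using zQ by (rule Q_carrierE)
      have "fr (b \<otimes>\<^bsub>R\<^esub> a) (t \<otimes>\<^bsub>R\<^esub> s) \<in> M" using x z S_mult I_l_closed unfolding M_def by blast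
      then show ?thesis using x z Pc by (simp add: Q_mult)
    qed
    show "\<And>x z. x \<in> M \<Longrightarrow> z \<in> carrier Q \<Longrightarrow> z \<otimes>\<^bsub>Q\<^esub> x \<in> M" by (rule l)
    show "\<And>x z. x \<in> M \<Longrightarrow> z \<in> carrier Q \<Longrightarrow> x \<otimes>\<^bsub>Q\<^esub> z \<in> M"
    proof -
      fix x z assume x: "x \<in> M" and z: "z \<in> carrier Q"
      have "x \<in> carrier Q" using x Pc fr_closed by (auto simp: M_def)
      then show "x \<otimes>\<^bsub>Q\<^esub> z \<in> M" using l[OF x z] z by (simp add: Q.m_comm)
    qed
  qed
  have notone: "\<one>\<^bsub>Q\<^esub> \<notin> M"
  proof
    assume "\<one>\<^bsub>Q\<^esub> \<in> M"
    then obtain a s where a: "a \<in> P" "s \<in> S" "fr \<one>\<^bsub>R\<^esub> \<one>\<^bsub>R\<^esub> = fr a s" by (auto simp: M_def Q_one)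
    then obtain u where u: "u \<in> S" "u \<otimes>\<^bsub>R\<^esub> s = u \<otimes>\<^bsub>R\<^esub> a" using S_one S_carrier Pc by (auto simp: fr_eq_iff)
    have "u \<otimes>\<^bsub>R\<^esub> s \<in> P" using u a I_l_closed S_carrier by simp
    then show False using S_mult[OF u(1) a(2)] by (simp add: S_def)
  qed
  have sub: "K \<subseteq> M" if K: "ideal K Q" and ne: "K \<noteq> carrier Q" for K
  proof
    fix y assume y: "y \<in> K"
    then have "y \<in> carrier Q" using ideal.Icarr[OF K] by blast
    then obtain a s where as: "y = fr a s" "a \<in> carrier R" "s \<in> S" by (rule Q_carrierE)
    show "y \<in> M"
    proof (rule ccontr)
      assume "y \<notin> M"
      then have aS: "a \<in> S" using as by (auto simp: M_def S_def)
      have "fr s a \<otimes>\<^bsub>Q\<^esub> y = \<one>\<^bsub>Q\<^esub>"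
        using as aS S_one S_carrier S_mult by (simp add: Q_mult Q_one) (intro fr_eq_simple; simp add: m_comm)
      moreover have "fr s a \<otimes>\<^bsub>Q\<^esub> y \<in> K"
        using ideal.I_l_closed[OF K y] fr_closed[of s a] as aS S_carrier by simp
      ultimately show False using ideal.one_imp_carrier[OF K] ne by simp
    qed
  qed
  have Mc: "M \<noteq> carrier Q" using notone by auto
  have "maximalideal M Q"
    by (rule maximalidealI[OF M]) (use sub Mc in blast)+
  moreover have "M' = M" if "maximalideal M' Q" for M'
  proof -
    interpret M': maximalideal M' Q by fact
    have "M' \<subseteq> M" using sub[OF M'.is_ideal] M'.I_notcarr by blast
    then show ?thesis using M'.I_maximal[OF M] ideal.Icarr[OF M] Mc by blast
  qed
  ultimately show ?thesis by blast
qed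

end

lemma regular_ring_of_gldim:
  assumes "cring R" "noetherian_ring R" "large_universe TYPE('m) R" "gldim TYPE('m) R < \<infinity>"
  shows "regular_ring TYPE('m) R"
  unfolding regular_ring_def
proof (intro conjI allI impI assms(1,2))
  fix P assume "primeideal P R"
  then interpret prime_loc R P by (rule prime_loc.intro)
  show "regular_local_ring TYPE('m) (localization R P)"
    unfolding regular_local_ring_def
    using cring_Q noetherian_Q[OF assms(2)] ex1_maximalideal_Q
      ring_loc.gldim_finite_loc[OF ring_loc_Q assms(3,4)] by simp
qed

section \<open>Krull dimension\<close>

lemma sproj_mono: "sproj U S R M \<Longrightarrow> S \<subseteq> T \<Longrightarrow> sproj U T R M"
  unfolding sproj_def by (elim conjE, intro conjI, assumption) (meson subsetD)

lemma pd_le_mono: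
  fixes M :: "('a, 'm) module"
  assumes "pd_le S R n M" "S \<subseteq> T"
  shows "pd_le T R n M"
  using assms(1)
proof (induction n arbitrary: M)
  case 0
  then show ?case using sproj_mono[OF _ assms(2)] by simp
next
  case (Suc n)
  then show ?case unfolding pd_le.simps by blast
qed

text \<open>\<open>M\<close> is a retract of \<open>M'\<close>, up to \<open>S\<close> and up to maps that factor through a projective module.\<close>

definition sret :: "('a, 'x) ring_scheme \<Rightarrow> 'a set \<Rightarrow> ('a, 'm) module \<Rightarrow> ('a, 'm) module \<Rightarrow> bool" where
  "sret R S M M' \<longleftrightarrow> (\<exists>u v (P :: ('a, 'm) module) a b. \<exists>s\<in>S. projective_module TYPE('m) R P \<and>
     mod_lin R M M' u \<and> mod_lin R M' M v \<and> mod_lin R M P a \<and> mod_lin R P M b \<and>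
     (\<forall>x\<in>carrier M. v (u x) \<oplus>\<^bsub>M\<^esub> b (a x) = s \<odot>\<^bsub>M\<^esub> x))"

lemma sretI:
  assumes "left_module R M" "mod_lin R M M' u" "mod_lin R M' M v" "s \<in> S"
    and "\<And>x. x \<in> carrier M \<Longrightarrow> v (u x) = s \<odot>\<^bsub>M\<^esub> x"
  shows "sret R S M (M' :: ('a, 'm) module)"
proof -
  interpret M: left_module R M by fact
  let ?Z = "M\<lparr>carrier := {\<zero>\<^bsub>M\<^esub>}\<rparr>"
  note sz = submod_zero[OF assms(1)]
  have Z: "left_module R ?Z" by (rule submod_left_module[OF assms(1) sz])
  have pZ: "projective_module TYPE('m) R ?Z" by (rule projective_zero[OF Z]) simp
  have a: "mod_lin R M ?Z (\<lambda>x. \<zero>\<^bsub>M\<^esub>)" using mod_lin_zero_map[OF Z, of M] by simp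
  have "v (u x) \<oplus>\<^bsub>M\<^esub> \<zero>\<^bsub>M\<^esub> = s \<odot>\<^bsub>M\<^esub> x" if "x \<in> carrier M" for x
    using assms(5)[OF that] mod_linD(1)[OF assms(3)] mod_linD(1)[OF assms(2)] that by (metis M.r_zero)
  then show ?thesis
    unfolding sret_def using assms(2-4) pZ a mod_lin_incl[OF sz] by blast
qed

lemma sret_refl: "left_module R M \<Longrightarrow> \<one>\<^bsub>R\<^esub> \<in> S \<Longrightarrow> sret R S M M"
  using sretI[OF _ mod_lin_id mod_lin_id, of R M "\<one>\<^bsub>R\<^esub>" S] left_module.smult_one[of R M] by simp

text \<open>The given map is lifted on \<open>M'\<close> with denominator \<open>t\<close> and on
  the projective module exactly. Scaling the second lift by \<open>t\<close> and adding gives a lift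
  with denominator \<open>t\<close> times \<open>s\<close>.\<close>

lemma sproj_sret:
  fixes M M' :: "('a, 'm) module"
  assumes R: "cring R" and S: "S \<subseteq> carrier R" "\<And>s t. \<lbrakk>s \<in> S; t \<in> S\<rbrakk> \<Longrightarrow> s \<otimes>\<^bsub>R\<^esub> t \<in> S"
    and M: "left_module R M" and ret: "sret R S M M'" and M': "sproj TYPE('m) S R M'"
  shows "sproj TYPE('m) S R M"
  unfolding sproj_def
proof (intro conjI M allI impI)
  fix V W :: "('a, 'm) module" and g f
  assume V: "left_module R V" and W: "left_module R W" and g: "mod_lin R V W g"
    and gs: "g ` carrier V = carrier W" and f: "mod_lin R M W f"
  interpret R: cring R by fact
  interpret V: left_module R V by fact
  interpret W: left_module R W by fact
  interpret M: left_module R M by fact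
  obtain u v and P :: "('a, 'm) module" and a b s where s: "s \<in> S"
    and P: "projective_module TYPE('m) R P" and u: "mod_lin R M M' u" and v: "mod_lin R M' M v"
    and a: "mod_lin R M P a" and b: "mod_lin R P M b"
    and eq: "\<forall>x\<in>carrier M. v (u x) \<oplus>\<^bsub>M\<^esub> b (a x) = s \<odot>\<^bsub>M\<^esub> x"
    using ret unfolding sret_def by blast
  obtain t h where t: "t \<in> S" and h: "mod_lin R M' V h"
    and gh: "\<forall>x\<in>carrier M'. g (h x) = t \<odot>\<^bsub>W\<^esub> f (v x)"
    using M' V W g gs mod_lin_comp[OF v f] unfolding sproj_def by metis
  obtain k where k: "mod_lin R P V k" "\<And>x. x \<in> carrier P \<Longrightarrow> g (k x) = f (b x)"
    using projective_lift_same[OF P V W g gs mod_lin_comp[OF b f]] by blast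
  have tR: "t \<in> carrier R" "s \<in> carrier R" using t s S by auto
  let ?h = "\<lambda>x. h (u x) \<oplus>\<^bsub>V\<^esub> t \<odot>\<^bsub>V\<^esub> k (a x)"
  have lin: "mod_lin R M V ?h"
    by (rule mod_lin_add[OF M V mod_lin_comp[OF u h] mod_lin_smult[OF R M V mod_lin_comp[OF a k(1)] tR(1)]])
  have "g (?h x) = (t \<otimes>\<^bsub>R\<^esub> s) \<odot>\<^bsub>W\<^esub> f x" if x: "x \<in> carrier M" for x
  proof -
    note c = mod_linD(1)[OF u x] mod_linD(1)[OF a x]
    note c' = mod_linD(1)[OF h c(1)] mod_linD(1)[OF k(1) c(2)] mod_linD(1)[OF v c(1)] mod_linD(1)[OF b c(2)]
    have "g (?h x) = t \<odot>\<^bsub>W\<^esub> f (v (u x)) \<oplus>\<^bsub>W\<^esub> t \<odot>\<^bsub>W\<^esub> f (b (a x))"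
      using c c' gh k(2) tR by (simp add: mod_linD[OF g] V.smult_closed)
    also have "\<dots> = t \<odot>\<^bsub>W\<^esub> f (v (u x) \<oplus>\<^bsub>M\<^esub> b (a x))"
      using c' tR by (simp add: mod_linD[OF f] W.smult_r_distr)
    also have "\<dots> = (t \<otimes>\<^bsub>R\<^esub> s) \<odot>\<^bsub>W\<^esub> f x"
      using x tR eq by (simp add: mod_linD[OF f] W.smult_assoc)
    finally show ?thesis .
  qed
  then show "\<exists>s\<in>S. \<exists>h. mod_lin R M V h \<and> (\<forall>x\<in>carrier M. g (h x) = s \<odot>\<^bsub>W\<^esub> f x)"
    using lin S(2)[OF t s] by blast
qed

text \<open>The substitute for Schanuel's lemma: being a retract up to projectives passes to first
  syzygies, whatever covers are used. The maps are lifted to the covers, and the failure of the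
  lifts to compose to \<open>s\<close> factors through the projective module
  \<open>F\<close>.\<close>

lemma sret_kernel:
  fixes M M' F F' :: "('a, 'm) module"
  assumes R: "cring R" and S: "S \<subseteq> carrier R"
    and M: "left_module R M" and M': "left_module R M'" and ret: "sret R S M M'"
    and F: "projective_module TYPE('m) R F" "mod_lin R F M \<pi>" "\<pi> ` carrier F = carrier M"
    and F': "projective_module TYPE('m) R F'" "mod_lin R F' M' \<pi>'" "\<pi>' ` carrier F' = carrier M'"
  shows "sret R S (ker_mod F M \<pi>) (ker_mod F' M' \<pi>')"
proof -
  interpret R: cring R by fact
  have lF: "left_module R F" and lF': "left_module R F'"
    using projective_imp_left_module[OF F(1)] projective_imp_left_module[OF F'(1)] by auto
  interpret M: left_module R M by fact
  interpret M': left_module R M' by fact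
  interpret F: left_module R F by fact
  obtain u v and P :: "('a, 'm) module" and a b s where s: "s \<in> S"
    and P: "projective_module TYPE('m) R P" and u: "mod_lin R M M' u" and v: "mod_lin R M' M v"
    and a: "mod_lin R M P a" and b: "mod_lin R P M b"
    and eq: "\<And>x. x \<in> carrier M \<Longrightarrow> v (u x) \<oplus>\<^bsub>M\<^esub> b (a x) = s \<odot>\<^bsub>M\<^esub> x"
    using ret unfolding sret_def by blast
  have sR: "s \<in> carrier R" using s S by auto
  have lP: "left_module R P" by (rule projective_imp_left_module[OF P])
  obtain u' where u': "mod_lin R F F' u'" "\<And>x. x \<in> carrier F \<Longrightarrow> \<pi>' (u' x) = u (\<pi> x)"
    using projective_lift_same[OF F(1) lF' M' F'(2,3) mod_lin_comp[OF F(2) u]] by blast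
  obtain v' where v': "mod_lin R F' F v'" "\<And>x. x \<in> carrier F' \<Longrightarrow> \<pi> (v' x) = v (\<pi>' x)"
    using projective_lift_same[OF F'(1) lF M F(2,3) mod_lin_comp[OF F'(2) v]] by blast
  obtain b' where b': "mod_lin R P F b'" "\<And>x. x \<in> carrier P \<Longrightarrow> \<pi> (b' x) = b x"
    using projective_lift_same[OF P lF M F(2,3) b] by blast
  note \<pi> = mod_linD[OF F(2)]
  let ?K = "ker_mod F M \<pi>" and ?K' = "ker_mod F' M' \<pi>'"
  note sK = submod_ker[OF lF M F(2)] and sK' = submod_ker[OF lF' M' F'(2)]
  \<comment> \<open>The lifted composite agrees with \<open>s\<close> after applying
    \<open>\<pi>\<close>, so \<open>w\<close> has values in the kernel. On the kernel of
    \<open>\<pi>\<close> the last term vanishes, and \<open>w\<close> is the required correction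
    through \<open>F\<close>.\<close>
  define w where "w x = s \<odot>\<^bsub>F\<^esub> x \<ominus>\<^bsub>F\<^esub> (v' (u' x) \<oplus>\<^bsub>F\<^esub> b' (a (\<pi> x)))" for x
  have w: "mod_lin R F F w"
    unfolding w_def
    by (intro mod_lin_diff_map[OF lF lF] mod_lin_smult[OF R lF lF mod_lin_id sR]
        mod_lin_add[OF lF lF] mod_lin_comp[OF u'(1) v'(1)] mod_lin_comp[OF mod_lin_comp[OF F(2) a] b'(1)])
  have "w ` carrier F \<subseteq> ker_set F M \<pi>"
  proof
    fix y assume "y \<in> w ` carrier F"
    then obtain x where x: "x \<in> carrier F" "y = w x" by blast
    note c = \<pi>(1)[OF x(1)] mod_linD(1)[OF u'(1) x(1)]
    note c' = mod_linD(1)[OF v'(1) c(2)] mod_linD(1)[OF a c(1)]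
    note c'' = mod_linD(1)[OF b'(1) c'(2)]
    have "\<pi> (v' (u' x) \<oplus>\<^bsub>F\<^esub> b' (a (\<pi> x))) = s \<odot>\<^bsub>M\<^esub> \<pi> x"
      using c c' c'' x(1) eq[OF c(1)] by (simp add: \<pi>(2) u'(2) v'(2) b'(2))
    then have "\<pi> (w x) = \<zero>\<^bsub>M\<^esub>"
      using mod_lin_diff[OF lF M F(2), of "s \<odot>\<^bsub>F\<^esub> x" "v' (u' x) \<oplus>\<^bsub>F\<^esub> b' (a (\<pi> x))"] c c' c'' x(1) sR
      by (simp add: w_def F.smult_closed \<pi>(3) M.smult_closed M.diff_zero_iff)
    then show "y \<in> ker_set F M \<pi>" using x mod_linD(1)[OF w] by (simp add: ker_set_def)
  qed
  then have w': "mod_lin R F ?K w" using mod_lin_restrict_cod[OF w] by blast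
  have "u' ` carrier ?K \<subseteq> ker_set F' M' \<pi>'"
    using u'(2) mod_linD(1)[OF u'(1)] mod_lin_zero[OF M M' u] by (auto simp: ker_set_def)
  then have uK: "mod_lin R ?K ?K' u'"
    by (rule mod_lin_restrict_cod[OF mod_lin_restrict_dom[OF sK u'(1)]])
  have "v' ` carrier ?K' \<subseteq> ker_set F M \<pi>"
    using v'(2) mod_linD(1)[OF v'(1)] mod_lin_zero[OF M' M v] by (auto simp: ker_set_def)
  then have vK: "mod_lin R ?K' ?K v'"
    by (rule mod_lin_restrict_cod[OF mod_lin_restrict_dom[OF sK' v'(1)]])
  have "v' (u' x) \<oplus>\<^bsub>F\<^esub> w x = s \<odot>\<^bsub>F\<^esub> x" if x: "x \<in> carrier ?K" for x
  proof -
    have xF: "x \<in> carrier F" "\<pi> x = \<zero>\<^bsub>M\<^esub>" using x by (auto simp: ker_set_def)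
    note c = mod_linD(1)[OF v'(1) mod_linD(1)[OF u'(1) xF(1)]]
    have "b' (a (\<pi> x)) = \<zero>\<^bsub>F\<^esub>"
      using mod_lin_zero[OF M lP a] mod_lin_zero[OF lP lF b'(1)] by (simp add: xF(2))
    then show ?thesis
      using c xF sR by (simp add: w_def F.minus_eq F.smult_closed) (metis F.a_assoc F.a_comm
          F.a_inv_closed F.r_neg F.r_zero F.smult_closed)
  qed
  then show ?thesis
    unfolding sret_def using s F(1) uK vK w' mod_lin_incl[OF sK]
    by (intro exI[of _ u'] exI[of _ v'] exI[of _ F] exI[of _ "\<lambda>x. x"] exI[of _ w] bexI[of _ s]) auto
qed

text \<open>The bound for \<open>M'\<close> comes with an unknown cover, while \<open>M\<close> gets
  a Noetherian one; \<open>sret_kernel\<close> relates their kernels and the induction continues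
  there.\<close>

lemma pd_le_sret:
  fixes M M' :: "('a, 'm) module"
  assumes R: "cring R" and N: "noetherian_ring R" and large: "large_universe TYPE('m) R"
    and S: "S \<subseteq> carrier R" "\<And>s t. \<lbrakk>s \<in> S; t \<in> S\<rbrakk> \<Longrightarrow> s \<otimes>\<^bsub>R\<^esub> t \<in> S"
    and "noeth R M" "sret R S M M'" "pd_le S R n M'"
  shows "pd_le S R n M"
  using assms(6-8)
proof (induction n arbitrary: M M')
  case 0
  then show ?case using sproj_sret[OF R S noeth_left_module] by simp
next
  case (Suc n)
  have M: "left_module R M" by (rule noeth_left_module[OF Suc(2)])
  obtain F :: "('a, 'm) module" and \<pi> where F: "projective_module TYPE('m) R F" "noeth R F"
    "mod_lin R F M \<pi>" "\<pi> ` carrier F = carrier M"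
    using ex_noeth_cover[OF R N large Suc(2)] by blast
  obtain F' :: "('a, 'm) module" and \<pi>' where F': "projective_module TYPE('m) R F'" "mod_lin R F' M' \<pi>'"
    "\<pi>' ` carrier F' = carrier M'" "pd_le S R n (ker_mod F' M' \<pi>')" and M': "left_module R M'"
    using Suc(4) unfolding pd_le.simps by blast
  have "noeth R (ker_mod F M \<pi>)"
    by (rule noeth_sub[OF F(2) submod_ker[OF noeth_left_module[OF F(2)] M F(3)]])
  then have "pd_le S R n (ker_mod F M \<pi>)"
    using Suc(1) sret_kernel[OF R S(1) M M' Suc(3) F(1,3,4) F'(1-3)] F'(4) by blast
  then show ?case unfolding pd_le.simps using M F by blast
qed

text \<open>\<open>pd_le\<close> only asserts that some cover has a good kernel. As \<open>M\<close>
  is a retract of itself, every Noetherian projective cover has one.\<close>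

lemma pd_le_kernel:
  fixes M F :: "('a, 'm) module"
  assumes R: "cring R" and N: "noetherian_ring R" and large: "large_universe TYPE('m) R"
    and S: "S \<subseteq> carrier R" "\<And>s t. \<lbrakk>s \<in> S; t \<in> S\<rbrakk> \<Longrightarrow> s \<otimes>\<^bsub>R\<^esub> t \<in> S" "\<one>\<^bsub>R\<^esub> \<in> S"
    and pd: "pd_le S R (Suc n) M"
    and F: "projective_module TYPE('m) R F" "noeth R F" "mod_lin R F M \<pi>" "\<pi> ` carrier F = carrier M"
  shows "pd_le S R n (ker_mod F M \<pi>)"
proof -
  obtain F' :: "('a, 'm) module" and \<pi>' where F': "projective_module TYPE('m) R F'" "mod_lin R F' M \<pi>'"
    "\<pi>' ` carrier F' = carrier M" "pd_le S R n (ker_mod F' M \<pi>')" and M: "left_module R M"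
    using pd unfolding pd_le.simps by blast
  have "noeth R (ker_mod F M \<pi>)"
    by (rule noeth_sub[OF F(2) submod_ker[OF noeth_left_module[OF F(2)] M F(3)]])
  then show ?thesis
    using pd_le_sret[OF R N large S(1,2)]
      sret_kernel[OF R S(1) M M sret_refl[OF M S(3)] F(1,3,4) F'(1-3)] F'(4) by blast
qed

subsection \<open>A local form of Nakayama's lemma\<close>

text \<open>After localization at \<open>q\<close> the hypothesis reads \<open>Z = B + x Z\<close>,
  with \<open>Z / B\<close> generated by \<open>T\<close>. Instead of a determinant, one generator
  \<open>t\<close> at a time is moved into the submodule, and each generator yields one more
  denominator.\<close>

lemma nakayama_prime:
  assumes q: "primeideal q R" and Z: "left_module R Z" and x: "x \<in> q" and "finite T"
    and "submod R Z B" "T \<subseteq> carrier Z" "gen R Z (B \<union> T) = carrier Z"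
    and "\<And>z. z \<in> carrier Z \<Longrightarrow> \<exists>s\<in>carrier R - q. \<exists>b\<in>B. \<exists>z'\<in>carrier Z. s \<odot>\<^bsub>Z\<^esub> z = b \<oplus>\<^bsub>Z\<^esub> x \<odot>\<^bsub>Z\<^esub> z'"
    and "z \<in> carrier Z"
  shows "\<exists>s\<in>carrier R - q. s \<odot>\<^bsub>Z\<^esub> z \<in> B"
  using assms(4-9)
proof (induction T arbitrary: B z)
  case (empty B z)
  interpret primeideal q R by fact
  interpret Z: left_module R Z by fact
  have "B = carrier Z" using empty gen_self[of R Z B] by simp
  moreover have "\<one>\<^bsub>R\<^esub> \<notin> q" using I_notcarr one_imp_carrier by blast
  ultimately show ?case using empty(5) by (intro bexI[of _ "\<one>\<^bsub>R\<^esub>"]) (simp_all add: Z.smult_one)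
next
  case (insert t T B z)
  interpret primeideal q R by fact
  interpret Z: left_module R Z by fact
  have xR: "x \<in> carrier R" using x a_subset by auto
  have t: "t \<in> carrier Z" using insert by auto
  note B = submodD[OF insert.prems(1)]
  define B' where "B' = {b \<oplus>\<^bsub>Z\<^esub> r \<odot>\<^bsub>Z\<^esub> t | b r. b \<in> B \<and> r \<in> carrier R}"
  have B'I: "b \<oplus>\<^bsub>Z\<^esub> r \<odot>\<^bsub>Z\<^esub> t \<in> B'" if "b \<in> B" "r \<in> carrier R" for b r using that B'_def by blast
  have BB': "B \<subseteq> B'"
  proof
    fix b assume "b \<in> B"
    then show "b \<in> B'" using B'I[of b "\<zero>\<^bsub>R\<^esub>"] B(1) t by (simp add: Z.smult_zero_left)
  qed
  have tB': "t \<in> B'" using B'I[OF B(2), of "\<one>\<^bsub>R\<^esub>"] t by (simp add: Z.smult_one)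
  have B'sub: "submod R Z B'"
    unfolding submod_def
  proof (intro conjI ballI)
    show "B' \<subseteq> carrier Z" using B(1) t by (auto simp: B'_def Z.smult_closed)
    show "\<zero>\<^bsub>Z\<^esub> \<in> B'" using BB' B(2) by blast
    fix y assume "y \<in> B'"
    then obtain b r where y: "y = b \<oplus>\<^bsub>Z\<^esub> r \<odot>\<^bsub>Z\<^esub> t" "b \<in> B" "r \<in> carrier R" by (auto simp: B'_def)
    { fix y' assume "y' \<in> B'"
      then obtain b' r' where y': "y' = b' \<oplus>\<^bsub>Z\<^esub> r' \<odot>\<^bsub>Z\<^esub> t" "b' \<in> B" "r' \<in> carrier R" by (auto simp: B'_def)
      have "y \<oplus>\<^bsub>Z\<^esub> y' = (b \<oplus>\<^bsub>Z\<^esub> b') \<oplus>\<^bsub>Z\<^esub> (r \<oplus>\<^bsub>R\<^esub> r') \<odot>\<^bsub>Z\<^esub> t"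
        using y y' B(1) t by (simp add: Z.smult_l_distr Z.smult_closed Z.a_ac)
      then show "y \<oplus>\<^bsub>Z\<^esub> y' \<in> B'" using B'I[of "b \<oplus>\<^bsub>Z\<^esub> b'" "r \<oplus>\<^bsub>R\<^esub> r'"] B(3) y y' by simp }
    fix a assume a: "a \<in> carrier R"
    have "a \<odot>\<^bsub>Z\<^esub> y = a \<odot>\<^bsub>Z\<^esub> b \<oplus>\<^bsub>Z\<^esub> (a \<otimes>\<^bsub>R\<^esub> r) \<odot>\<^bsub>Z\<^esub> t"
      using y a B(1) t by (simp add: Z.smult_r_distr Z.smult_assoc Z.smult_closed)
    then show "a \<odot>\<^bsub>Z\<^esub> y \<in> B'" using B'I[of "a \<odot>\<^bsub>Z\<^esub> b" "a \<otimes>\<^bsub>R\<^esub> r"] B(4) y a by simp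
  qed
  have step: "\<exists>s\<in>carrier R - q. s \<odot>\<^bsub>Z\<^esub> z \<in> B'" if z: "z \<in> carrier Z" for z
  proof (rule insert.IH[OF B'sub _ _ _ z])
    have BT: "B' \<union> T \<subseteq> carrier Z" using B'sub insert.prems(2) by (auto simp: submod_def)
    have "gen R Z (B \<union> insert t T) \<subseteq> gen R Z (B' \<union> T)"
      by (rule gen_least[OF gen_submod[OF Z BT]])
        (use BB' tB' gen_incl[of "B' \<union> T" R Z] in blast)
    then show "gen R Z (B' \<union> T) = carrier Z"
      using insert.prems(3) gen_submod[OF Z BT] by (auto simp: submod_def)
  qed (use insert BB' in \<open>blast+\<close>)
  obtain s b y where s: "s \<in> carrier R - q" "b \<in> B" "y \<in> carrier Z" "s \<odot>\<^bsub>Z\<^esub> t = b \<oplus>\<^bsub>Z\<^esub> x \<odot>\<^bsub>Z\<^esub> y"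
    using insert.prems(4)[OF t] by blast
  obtain s' where s': "s' \<in> carrier R - q" "s' \<odot>\<^bsub>Z\<^esub> y \<in> B'" using step[OF s(3)] by blast
  obtain b' r where b': "s' \<odot>\<^bsub>Z\<^esub> y = b' \<oplus>\<^bsub>Z\<^esub> r \<odot>\<^bsub>Z\<^esub> t" "b' \<in> B" "r \<in> carrier R"
    using s'(2) by (auto simp: B'_def)
  have c: "s \<in> carrier R" "s' \<in> carrier R" "b \<in> carrier Z" "b' \<in> carrier Z" using s s' b' B(1) by auto
  \<comment> \<open>From \<open>s t = b + x y\<close> and \<open>s' y = b' + r t\<close> follows
    that \<open>s' s - x r\<close> maps \<open>t\<close> into \<open>B\<close>. It lies outside
    \<open>q\<close>, because \<open>s' s\<close> does while \<open>x r\<close> is in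
    \<open>q\<close>.\<close>
  define e where "e = s' \<otimes>\<^bsub>R\<^esub> s \<ominus>\<^bsub>R\<^esub> x \<otimes>\<^bsub>R\<^esub> r"
  have "s' \<otimes>\<^bsub>R\<^esub> s \<notin> q" using I_prime c s s' by blast
  moreover have "x \<otimes>\<^bsub>R\<^esub> r \<in> q" using x b' I_r_closed by blast
  ultimately have "e \<notin> q"
  proof -
    have "s' \<otimes>\<^bsub>R\<^esub> s = e \<oplus>\<^bsub>R\<^esub> x \<otimes>\<^bsub>R\<^esub> r"
      using c xR b' by (simp add: e_def minus_eq a_assoc l_neg)
    then show ?thesis using \<open>s' \<otimes>\<^bsub>R\<^esub> s \<notin> q\<close> \<open>x \<otimes>\<^bsub>R\<^esub> r \<in> q\<close>
        additive_subgroup.a_closed[OF is_additive_subgroup, of e] by auto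
  qed
  then have e: "e \<in> carrier R - q" using c xR b' by (simp add: e_def)
  have "(s' \<otimes>\<^bsub>R\<^esub> s) \<odot>\<^bsub>Z\<^esub> t = s' \<odot>\<^bsub>Z\<^esub> b \<oplus>\<^bsub>Z\<^esub> x \<odot>\<^bsub>Z\<^esub> (s' \<odot>\<^bsub>Z\<^esub> y)"
    using c xR s t by (simp add: Z.smult_assoc Z.smult_r_distr Z.smult_closed)
      (simp add: m_comm flip: Z.smult_assoc)
  also have "\<dots> = (s' \<odot>\<^bsub>Z\<^esub> b \<oplus>\<^bsub>Z\<^esub> x \<odot>\<^bsub>Z\<^esub> b') \<oplus>\<^bsub>Z\<^esub> (x \<otimes>\<^bsub>R\<^esub> r) \<odot>\<^bsub>Z\<^esub> t"
    unfolding b'(1) using c xR b' t by (simp add: Z.smult_assoc Z.smult_r_distr Z.smult_closed Z.a_assoc)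
  finally have "e \<odot>\<^bsub>Z\<^esub> t = s' \<odot>\<^bsub>Z\<^esub> b \<oplus>\<^bsub>Z\<^esub> x \<odot>\<^bsub>Z\<^esub> b'"
    using c xR b' t by (simp add: e_def Z.diff_smult Z.minus_eq Z.a_assoc Z.r_neg Z.smult_closed)
  then have et: "e \<odot>\<^bsub>Z\<^esub> t \<in> B" using B(3,4) s(2) b'(2) c xR by simp
  obtain s1 where s1: "s1 \<in> carrier R - q" "s1 \<odot>\<^bsub>Z\<^esub> z \<in> B'" using step[OF insert.prems(5)] by blast
  obtain b1 r1 where b1: "s1 \<odot>\<^bsub>Z\<^esub> z = b1 \<oplus>\<^bsub>Z\<^esub> r1 \<odot>\<^bsub>Z\<^esub> t" "b1 \<in> B" "r1 \<in> carrier R"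
    using s1(2) by (auto simp: B'_def)
  have c1: "s1 \<in> carrier R" "e \<in> carrier R" "b1 \<in> carrier Z" using s1 e b1 B(1) by auto
  have "(e \<otimes>\<^bsub>R\<^esub> s1) \<odot>\<^bsub>Z\<^esub> z = e \<odot>\<^bsub>Z\<^esub> b1 \<oplus>\<^bsub>Z\<^esub> r1 \<odot>\<^bsub>Z\<^esub> (e \<odot>\<^bsub>Z\<^esub> t)"
    using c1 b1 insert.prems(5) t by (simp add: Z.smult_assoc Z.smult_r_distr Z.smult_closed)
      (simp add: m_comm flip: Z.smult_assoc)
  then have "(e \<otimes>\<^bsub>R\<^esub> s1) \<odot>\<^bsub>Z\<^esub> z \<in> B" using B(3,4) et b1 c1 by simp
  moreover have "e \<otimes>\<^bsub>R\<^esub> s1 \<notin> q" using I_prime e s1 by blast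
  ultimately show ?case using c1 by blast
qed

section \<open>The module of linear maps over a commutative ring\<close>

definition lin_module :: "('a, 'x) ring_scheme \<Rightarrow> ('a, 'm) module \<Rightarrow> ('a, 'n) module \<Rightarrow> ('a, 'm \<Rightarrow> 'n) module" where
  "lin_module R K N = mk_module (mod_hom R K N) (\<lambda>x\<in>carrier K. \<zero>\<^bsub>N\<^esub>)
     (\<lambda>f g. \<lambda>x\<in>carrier K. f x \<oplus>\<^bsub>N\<^esub> g x) (\<lambda>r f. \<lambda>x\<in>carrier K. r \<odot>\<^bsub>N\<^esub> f x)"

lemma lin_module_simps [simp]:
  "carrier (lin_module R K N) = mod_hom R K N"
  "\<zero>\<^bsub>lin_module R K N\<^esub> = (\<lambda>x\<in>carrier K. \<zero>\<^bsub>N\<^esub>)"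
  "f \<oplus>\<^bsub>lin_module R K N\<^esub> g = (\<lambda>x\<in>carrier K. f x \<oplus>\<^bsub>N\<^esub> g x)"
  "r \<odot>\<^bsub>lin_module R K N\<^esub> f = (\<lambda>x\<in>carrier K. r \<odot>\<^bsub>N\<^esub> f x)"
  by (simp_all add: lin_module_def)

lemma left_module_lin_module:
  assumes R: "cring R" and K: "left_module R K" and N: "left_module R N"
  shows "left_module R (lin_module R K N)"
proof -
  interpret R: cring R by fact
  interpret N: left_module R N by fact
  have c: "f x \<in> carrier N" if "f \<in> mod_hom R K N" "x \<in> carrier K" for f x
    using mod_linD(1)[OF mod_hom_lin[OF that(1)] that(2)] .
  have e: "restrict f (carrier K) = f" if "f \<in> mod_hom R K N" for f
    using that by (simp add: mod_hom_iff extensional_restrict)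
  show ?thesis
  proof (rule left_moduleI)
    show "ring R" by (rule R.ring_axioms)
    show "\<zero>\<^bsub>lin_module R K N\<^esub> \<in> carrier (lin_module R K N)"
      using mod_hom_restrict[OF K mod_lin_zero_map[OF N]] by simp
    fix f assume f: "f \<in> carrier (lin_module R K N)"
    then have f': "f \<in> mod_hom R K N" by simp
    show "\<zero>\<^bsub>lin_module R K N\<^esub> \<oplus>\<^bsub>lin_module R K N\<^esub> f = f"
      using c[OF f'] e[OF f'] by (simp cong: restrict_cong)
    show "\<one>\<^bsub>R\<^esub> \<odot>\<^bsub>lin_module R K N\<^esub> f = f"
      using c[OF f'] e[OF f'] by (simp add: N.smult_one cong: restrict_cong)
    show "(\<ominus>\<^bsub>R\<^esub> \<one>\<^bsub>R\<^esub>) \<odot>\<^bsub>lin_module R K N\<^esub> f \<oplus>\<^bsub>lin_module R K N\<^esub> f = \<zero>\<^bsub>lin_module R K N\<^esub>"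
      using c[OF f'] by (simp add: N.smult_minus_one N.l_neg cong: restrict_cong)
    { fix r assume r: "r \<in> carrier R"
      show "r \<odot>\<^bsub>lin_module R K N\<^esub> f \<in> carrier (lin_module R K N)"
        using mod_hom_restrict[OF K mod_lin_smult[OF R K N mod_hom_lin[OF f'] r]] by simp
      { fix s assume "s \<in> carrier R"
        then show "(r \<oplus>\<^bsub>R\<^esub> s) \<odot>\<^bsub>lin_module R K N\<^esub> f = r \<odot>\<^bsub>lin_module R K N\<^esub> f \<oplus>\<^bsub>lin_module R K N\<^esub> s \<odot>\<^bsub>lin_module R K N\<^esub> f"
          "(r \<otimes>\<^bsub>R\<^esub> s) \<odot>\<^bsub>lin_module R K N\<^esub> f = r \<odot>\<^bsub>lin_module R K N\<^esub> (s \<odot>\<^bsub>lin_module R K N\<^esub> f)"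
          using r c[OF f'] by (simp_all add: N.smult_l_distr N.smult_assoc cong: restrict_cong) } }
    fix g assume g: "g \<in> carrier (lin_module R K N)"
    then have g': "g \<in> mod_hom R K N" by simp
    show "f \<oplus>\<^bsub>lin_module R K N\<^esub> g \<in> carrier (lin_module R K N)"
      using mod_hom_restrict[OF K mod_lin_add[OF K N mod_hom_lin[OF f'] mod_hom_lin[OF g']]] by simp
    show "f \<oplus>\<^bsub>lin_module R K N\<^esub> g = g \<oplus>\<^bsub>lin_module R K N\<^esub> f"
      using c[OF f'] c[OF g'] by (simp add: N.a_comm cong: restrict_cong)
    { fix r assume r: "r \<in> carrier R"
      show "r \<odot>\<^bsub>lin_module R K N\<^esub> (f \<oplus>\<^bsub>lin_module R K N\<^esub> g) =
          r \<odot>\<^bsub>lin_module R K N\<^esub> f \<oplus>\<^bsub>lin_module R K N\<^esub> r \<odot>\<^bsub>lin_module R K N\<^esub> g"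
        using r c[OF f'] c[OF g'] by (simp add: N.smult_r_distr cong: restrict_cong) }
    fix h assume "h \<in> carrier (lin_module R K N)"
    then have h': "h \<in> mod_hom R K N" by simp
    show "f \<oplus>\<^bsub>lin_module R K N\<^esub> g \<oplus>\<^bsub>lin_module R K N\<^esub> h = f \<oplus>\<^bsub>lin_module R K N\<^esub> (g \<oplus>\<^bsub>lin_module R K N\<^esub> h)"
      using c[OF f'] c[OF g'] c[OF h'] by (simp add: N.a_assoc cong: restrict_cong)
  qed
qed

lemma noeth_lin_module:
  assumes R: "cring R" and K: "left_module R K" and fg: "fgen R K (carrier K)" and N: "noeth R N"
  shows "noeth R (lin_module R K N)"
proof -
  have lN: "left_module R N" by (rule noeth_left_module[OF N])
  interpret R: cring R by fact
  interpret N: left_module R N by fact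
  interpret K: left_module R K by fact
  let ?H = "lin_module R K N"
  have H: "left_module R ?H" by (rule left_module_lin_module[OF R K lN])
  obtain S where S: "finite S" "S \<subseteq> carrier K" "gen R K S = carrier K" using fg by (auto simp: fgen_def)
  \<comment> \<open>Induction on the set \<open>T\<close> of generators at which members of
    \<open>V\<close> may be nonzero. Evaluation at one of them has an image in \<open>N\<close>, and
    its kernel belongs to a smaller set.\<close>
  have "fgen R ?H V" if "finite T" "T \<subseteq> S" "submod R ?H V" "\<forall>f\<in>V. \<forall>s\<in>S - T. f s = \<zero>\<^bsub>N\<^esub>" for T V
    using that
  proof (induction T arbitrary: V)
    case (empty V)
    have "V \<subseteq> {\<zero>\<^bsub>?H\<^esub>}"
    proof
      fix f assume f: "f \<in> V"
      then have fh: "f \<in> mod_hom R K N" using submodD(1)[OF empty(2)] by simp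
      have "S \<subseteq> ker_set K N f" using empty(3) f S(2) by (auto simp: ker_set_def)
      then have "carrier K \<subseteq> ker_set K N f"
        using gen_least[OF submod_ker[OF K lN mod_hom_lin[OF fh]], of S] S(3) by simp
      then have "f x = \<zero>\<^bsub>?H\<^esub> x" if "x \<in> carrier K" for x using that by (auto simp: ker_set_def)
      moreover have "\<zero>\<^bsub>?H\<^esub> \<in> mod_hom R K N" using mod_hom_restrict[OF K mod_lin_zero_map[OF lN]] by simp
      ultimately show "f \<in> {\<zero>\<^bsub>?H\<^esub>}" using mod_hom_eqI[OF fh] by blast
    qed
    then have V: "V = {\<zero>\<^bsub>?H\<^esub>}" using submodD(2)[OF empty(2)] by blast
    have "gen R ?H {} = V"
      using gen_least[OF empty(2), of "{}"] submodD(2)[OF gen_submod[OF H, of "{}"]] unfolding V by auto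
    then show ?case unfolding fgen_def by blast
  next
    case (insert t T V)
    have t: "t \<in> carrier K" using insert S by auto
    have ev: "mod_lin R ?H N (\<lambda>f. f t)"
      using t by (intro mod_linI) (auto simp: mod_linD(1)[OF mod_hom_lin])
    show ?case
    proof (rule fgen_extension[OF H lN ev insert.prems(2)])
      show "fgen R N ((\<lambda>f. f t) ` V)"
        using N submod_image[OF H lN ev insert.prems(2)] by (simp add: noeth_def)
      have "submod R ?H {f \<in> V. f t = \<zero>\<^bsub>N\<^esub>}"
        using insert.prems(2) t unfolding submod_def by (auto simp: N.smult_zero_right)
      then show "fgen R ?H {f \<in> V. f t = \<zero>\<^bsub>N\<^esub>}"
        using insert.prems by (intro insert.IH) auto
    qed
  qed
  from this[OF S(1) subset_refl] show ?thesis unfolding noeth_def using H by auto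
qed

subsection \<open>Lowering the projective dimension along a chain of primes\<close>

text \<open>
  \<open>L\<close> is the pullback of \<open>\<pi>\<close> along multiplication by \<open>x\<close> on \<open>M\<close>; if \<open>x\<close> is regular on \<open>M\<close>, it is
  the kernel of \<open>F \<rightarrow> M / x M\<close>. Its first syzygy is again a pullback of this kind, with
  \<open>M\<close> replaced by the kernel of \<open>\<pi>\<close>, so no long exact sequence is needed.
\<close>

definition mult_pullback where
  "mult_pullback R x F M \<pi> L a l \<longleftrightarrow> left_module R L \<and> mod_lin R L F a \<and> mod_lin R L M l \<and>
     (\<forall>d\<in>carrier L. \<pi> (a d) = x \<odot>\<^bsub>M\<^esub> l d) \<and>
     (\<forall>f\<in>carrier F. \<forall>m\<in>carrier M. \<pi> f = x \<odot>\<^bsub>M\<^esub> m \<longrightarrow> (\<exists>d\<in>carrier L. a d = f \<and> l d = m)) \<and>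
     (\<forall>d\<in>carrier L. \<forall>d'\<in>carrier L. a d = a d' \<and> l d = l d' \<longrightarrow> d = d')"

lemma mult_pullbackD:
  assumes "mult_pullback R x F M \<pi> L a l"
  shows "left_module R L" "mod_lin R L F a" "mod_lin R L M l"
    "d \<in> carrier L \<Longrightarrow> \<pi> (a d) = x \<odot>\<^bsub>M\<^esub> l d"
    "\<lbrakk>f \<in> carrier F; m \<in> carrier M; \<pi> f = x \<odot>\<^bsub>M\<^esub> m\<rbrakk> \<Longrightarrow> \<exists>d\<in>carrier L. a d = f \<and> l d = m"
    "\<lbrakk>d \<in> carrier L; d' \<in> carrier L; a d = a d'; l d = l d'\<rbrakk> \<Longrightarrow> d = d'"
  using assms unfolding mult_pullback_def by simp_all

text \<open>The universal property of the pullback; joint injectivity of \<open>a\<close> and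
  \<open>l\<close> makes the chosen preimages linear.\<close>

lemma mult_pullback_factor:
  assumes pb: "mult_pullback R x F M \<pi> L a l" and V: "left_module R V"
    and f: "mod_lin R V F f" and g: "mod_lin R V M g"
    and eq: "\<And>v. v \<in> carrier V \<Longrightarrow> \<pi> (f v) = x \<odot>\<^bsub>M\<^esub> g v"
  obtains h where "mod_lin R V L h" "\<And>v. v \<in> carrier V \<Longrightarrow> a (h v) = f v"
    "\<And>v. v \<in> carrier V \<Longrightarrow> l (h v) = g v"
proof -
  note p = mult_pullbackD[OF pb]
  interpret V: left_module R V by fact
  interpret L: left_module R L by (rule p(1))
  have "\<exists>d\<in>carrier L. a d = f v \<and> l d = g v" if "v \<in> carrier V" for v
    using p(5)[OF mod_linD(1)[OF f that] mod_linD(1)[OF g that] eq[OF that]] .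
  then obtain h where h: "\<And>v. v \<in> carrier V \<Longrightarrow> h v \<in> carrier L"
    "\<And>v. v \<in> carrier V \<Longrightarrow> a (h v) = f v" "\<And>v. v \<in> carrier V \<Longrightarrow> l (h v) = g v" by metis
  have "mod_lin R V L h"
  proof (rule mod_linI)
    fix v w assume vw: "v \<in> carrier V" "w \<in> carrier V"
    show "h (v \<oplus>\<^bsub>V\<^esub> w) = h v \<oplus>\<^bsub>L\<^esub> h w"
      by (rule p(6)) (simp_all add: vw h mod_linD(2)[OF p(2)] mod_linD(2)[OF p(3)] mod_linD(2)[OF f]
          mod_linD(2)[OF g])
  next
    fix r v assume rv: "r \<in> carrier R" "v \<in> carrier V"
    show "h (r \<odot>\<^bsub>V\<^esub> v) = r \<odot>\<^bsub>L\<^esub> h v"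
      by (rule p(6)) (simp_all add: rv h V.smult_closed L.smult_closed mod_linD(3)[OF p(2)]
          mod_linD(3)[OF p(3)] mod_linD(3)[OF f] mod_linD(3)[OF g])
  qed (rule h(1))
  with h that show thesis by blast
qed

text \<open>A cover of the kernel of \<open>\<pi>\<close> and \<open>F\<close> itself together cover
  the pullback: for \<open>y\<close> in \<open>L\<close> choose \<open>z\<close> in \<open>F\<close>
  over \<open>l y\<close>; then \<open>a y - x z\<close> lies in the kernel.\<close>

lemma mult_pullback_cover:
  assumes R: "cring R" and x: "x \<in> carrier R" and F: "left_module R F" and M: "left_module R M"
    and \<pi>: "mod_lin R F M \<pi>" and surj: "\<pi> ` carrier F = carrier M"
    and pb: "mult_pullback R x F M \<pi> L a l"
    and G: "left_module R G" and k: "mod_lin R G F k" "k ` carrier G = ker_set F M \<pi>"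
    and D: "left_module R D" "mod_lin R D G p" "mod_lin R D F q"
    and j: "\<And>y z. \<lbrakk>y \<in> carrier G; z \<in> carrier F\<rbrakk> \<Longrightarrow> j y z \<in> carrier D \<and> p (j y z) = y \<and> q (j y z) = z"
  obtains h where "mod_lin R D L h" "h ` carrier D = carrier L"
    "\<And>d. d \<in> carrier D \<Longrightarrow> a (h d) = k (p d) \<oplus>\<^bsub>F\<^esub> x \<odot>\<^bsub>F\<^esub> q d"
    "\<And>d. d \<in> carrier D \<Longrightarrow> l (h d) = \<pi> (q d)"
proof -
  note P = mult_pullbackD[OF pb]
  interpret R: cring R by fact
  interpret F: left_module R F by fact
  interpret M: left_module R M by fact
  have kk: "k y \<in> carrier F" "\<pi> (k y) = \<zero>\<^bsub>M\<^esub>" if "y \<in> carrier G" for y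
    using k(2) that by (auto simp: ker_set_def)
  let ?f = "\<lambda>d. k (p d) \<oplus>\<^bsub>F\<^esub> x \<odot>\<^bsub>F\<^esub> q d"
  have f: "mod_lin R D F ?f"
    by (rule mod_lin_add[OF D(1) F mod_lin_comp[OF D(2) k(1)] mod_lin_smult[OF R D(1) F D(3) x]])
  have g: "mod_lin R D M (\<lambda>d. \<pi> (q d))" by (rule mod_lin_comp[OF D(3) \<pi>])
  have eq: "\<pi> (?f d) = x \<odot>\<^bsub>M\<^esub> \<pi> (q d)" if d: "d \<in> carrier D" for d
    using kk[OF mod_linD(1)[OF D(2) d]] mod_linD(1)[OF D(3) d] x mod_linD(1)[OF g d]
    by (simp add: mod_linD[OF \<pi>] F.smult_closed M.smult_closed)
  obtain h where h: "mod_lin R D L h" "\<And>d. d \<in> carrier D \<Longrightarrow> a (h d) = ?f d"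
    "\<And>d. d \<in> carrier D \<Longrightarrow> l (h d) = \<pi> (q d)"
    using mult_pullback_factor[OF pb D(1) f g eq] by blast
  have "carrier L \<subseteq> h ` carrier D"
  proof
    fix y assume y: "y \<in> carrier L"
    obtain z where z: "z \<in> carrier F" "\<pi> z = l y" using surj_onE[OF surj mod_linD(1)[OF P(3) y]] by metis
    have ay: "a y \<in> carrier F" by (rule mod_linD(1)[OF P(2) y])
    have "\<pi> (a y \<ominus>\<^bsub>F\<^esub> x \<odot>\<^bsub>F\<^esub> z) = \<zero>\<^bsub>M\<^esub>"
      using mod_lin_diff[OF F M \<pi> ay, of "x \<odot>\<^bsub>F\<^esub> z"] z x P(4)[OF y] mod_linD(1)[OF P(3) y]
      by (simp add: F.smult_closed mod_linD(3)[OF \<pi>] M.diff_zero_iff M.smult_closed)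
    then have "a y \<ominus>\<^bsub>F\<^esub> x \<odot>\<^bsub>F\<^esub> z \<in> k ` carrier G"
      using ay z x F.smult_closed unfolding k(2) by (simp add: ker_set_def)
    then obtain w where w: "w \<in> carrier G" "k w = a y \<ominus>\<^bsub>F\<^esub> x \<odot>\<^bsub>F\<^esub> z" by (metis imageE)
    note jj = j[OF w(1) z(1)]
    have jc: "j w z \<in> carrier D" using jj by simp
    have "h (j w z) = y"
      by (rule P(6)[OF mod_linD(1)[OF h(1) jc] y])
        (use jj ay z x in \<open>simp_all add: h w F.minus_eq F.a_assoc F.l_neg F.smult_closed\<close>)
    then show "y \<in> h ` carrier D" using jc by blast
  qed
  then have "h ` carrier D = carrier L" using mod_linD(1)[OF h(1)] by auto
  with h that show thesis by blast
qed

lemma factor_surj: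
  assumes L: "left_module R L" and M: "left_module R M" and F: "left_module R F"
    and l: "mod_lin R L M l" and surj: "l ` carrier L = carrier M" and f: "mod_lin R L F f"
    and ker: "\<And>d. \<lbrakk>d \<in> carrier L; l d = \<zero>\<^bsub>M\<^esub>\<rbrakk> \<Longrightarrow> f d = \<zero>\<^bsub>F\<^esub>"
  obtains h where "mod_lin R M F h" "\<And>d. d \<in> carrier L \<Longrightarrow> h (l d) = f d"
proof -
  interpret L: left_module R L by fact
  interpret M: left_module R M by fact
  interpret F: left_module R F by fact
  define r where "r = inv_into (carrier L) l"
  have r: "r m \<in> carrier L" "l (r m) = m" if "m \<in> carrier M" for m
    using that surj by (auto simp: r_def inv_into_into f_inv_into_f)
  have wd: "f d = f d'" if "d \<in> carrier L" "d' \<in> carrier L" "l d = l d'" for d d'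
  proof -
    have "l (d \<ominus>\<^bsub>L\<^esub> d') = \<zero>\<^bsub>M\<^esub>"
      using mod_lin_diff[OF L M l that(1,2)] that mod_linD(1)[OF l] by (simp add: M.diff_zero_iff)
    then have "f (d \<ominus>\<^bsub>L\<^esub> d') = \<zero>\<^bsub>F\<^esub>" using ker that by simp
    then show ?thesis
      using mod_lin_diff[OF L F f that(1,2)] that mod_linD(1)[OF f] F.diff_zero_iff by simp
  qed
  have "mod_lin R M F (\<lambda>m. f (r m))"
  proof (rule mod_linI)
    fix m n assume mn: "m \<in> carrier M" "n \<in> carrier M"
    have "f (r (m \<oplus>\<^bsub>M\<^esub> n)) = f (r m \<oplus>\<^bsub>L\<^esub> r n)"
      by (rule wd) (simp_all add: mn r mod_linD(2)[OF l])
    then show "f (r (m \<oplus>\<^bsub>M\<^esub> n)) = f (r m) \<oplus>\<^bsub>F\<^esub> f (r n)" by (simp add: mn r mod_linD(2)[OF f])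
  next
    fix a m assume am: "a \<in> carrier R" "m \<in> carrier M"
    have "f (r (a \<odot>\<^bsub>M\<^esub> m)) = f (a \<odot>\<^bsub>L\<^esub> r m)"
      by (rule wd) (simp_all add: am r mod_linD(3)[OF l] M.smult_closed L.smult_closed)
    then show "f (r (a \<odot>\<^bsub>M\<^esub> m)) = a \<odot>\<^bsub>F\<^esub> f (r m)" by (simp add: am r mod_linD(3)[OF f])
  qed (simp add: r mod_linD(1)[OF f])
  moreover have "f (r (l d)) = f d" if "d \<in> carrier L" for d
    using that by (intro wd) (simp_all add: r mod_linD(1)[OF l])
  ultimately show thesis using that by blast
qed

lemma sproj_of_section:
  fixes M F :: "('a, 'm) module"
  assumes F: "projective_module TYPE('m) R F" and M: "left_module R M" and \<pi>: "mod_lin R F M \<pi>"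
    and h: "mod_lin R M F h" and s: "s \<in> S" "s \<in> carrier R"
    and eq: "\<And>m. m \<in> carrier M \<Longrightarrow> \<pi> (h m) = s \<odot>\<^bsub>M\<^esub> m"
  shows "sproj TYPE('m) S R M"
  unfolding sproj_def
proof (intro conjI M allI impI)
  fix V W :: "('a, 'm) module" and g f
  assume *: "left_module R V" "left_module R W" "mod_lin R V W g" "g ` carrier V = carrier W"
    and f: "mod_lin R M W f"
  obtain e where e: "mod_lin R F V e" "\<And>y. y \<in> carrier F \<Longrightarrow> g (e y) = f (\<pi> y)"
    using projective_lift_same[OF F * mod_lin_comp[OF \<pi> f]] by blast
  have "g (e (h m)) = s \<odot>\<^bsub>W\<^esub> f m" if "m \<in> carrier M" for m
    using that s(2) by (simp add: e(2) mod_linD(1)[OF h] eq mod_linD(3)[OF f])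
  then show "\<exists>s\<in>S. \<exists>h. mod_lin R M V h \<and> (\<forall>m\<in>carrier M. g (h m) = s \<odot>\<^bsub>W\<^esub> f m)"
    using s(1) mod_lin_comp[OF h e(1)] by blast
qed

text \<open>\<open>M\<close> is \<open>L\<close> modulo a copy of the kernel \<open>K\<close> of
  \<open>\<pi>\<close>, so a section of \<open>\<pi>\<close> up to a denominator may be sought as a
  map from \<open>L\<close> to \<open>F\<close> vanishing on \<open>K\<close>. Splitting the cover
  of \<open>L\<close> by the sum of \<open>K\<close> and \<open>F\<close> gives a map of the right
  kind that need not vanish on \<open>K\<close>. Nakayama's lemma for the endomorphisms of
  \<open>K\<close> extends its restriction, up to a denominator, to a map from \<open>L\<close> to
  \<open>K\<close>; subtracting this does not change the image under \<open>\<pi>\<close>.\<close>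

lemma sproj_of_mult_pullback:
  fixes F M L :: "('a, 'm) module"
  assumes R: "cring R" and large: "large_universe TYPE('m) R" and q: "primeideal q R" and x: "x \<in> q"
    and F: "projective_module TYPE('m) R F" "noeth R F" and M: "left_module R M"
    and \<pi>: "mod_lin R F M \<pi>" and surj: "\<pi> ` carrier F = carrier M"
    and pb: "mult_pullback R x F M \<pi> L a l"
    and L: "sproj TYPE('m) (carrier R - q) R L"
  shows "sproj TYPE('m) (carrier R - q) R M"
proof -
  interpret primeideal q R by fact
  note P = mult_pullbackD[OF pb]
  have lF: "left_module R F" by (rule noeth_left_module[OF F(2)])
  have xR: "x \<in> carrier R" using x a_subset by auto
  interpret F: left_module R F by fact
  interpret M: left_module R M by fact
  interpret L: left_module R L by (rule P(1))
  let ?K = "ker_mod F M \<pi>"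
  note sK = submod_ker[OF lF M \<pi>]
  have K: "left_module R ?K" by (rule submod_left_module[OF lF sK])
  have nK: "noeth R ?K" by (rule noeth_sub[OF F(2) sK])
  have inf: "infinite (UNIV :: 'm set)" using large by (simp add: large_universe_def)
  obtain D :: "('a, 'm) module" and p r j where D: "left_module R D" "mod_lin R D ?K p" "mod_lin R D F r"
    "\<And>y z. \<lbrakk>y \<in> carrier ?K; z \<in> carrier F\<rbrakk> \<Longrightarrow> j y z \<in> carrier D \<and> p (j y z) = y \<and> r (j y z) = z"
    using ex_direct_sum[OF K lF inf subset_imp_lepoll[OF subset_UNIV] subset_imp_lepoll[OF subset_UNIV]]
    by metis
  obtain \<theta> where \<theta>: "mod_lin R D L \<theta>" "\<theta> ` carrier D = carrier L"
    "\<And>d. d \<in> carrier D \<Longrightarrow> a (\<theta> d) = p d \<oplus>\<^bsub>F\<^esub> x \<odot>\<^bsub>F\<^esub> r d"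
    "\<And>d. d \<in> carrier D \<Longrightarrow> l (\<theta> d) = \<pi> (r d)"
    using mult_pullback_cover[OF R xR lF M \<pi> surj pb K mod_lin_incl[OF sK] _ D] by auto
  obtain s h where s: "s \<in> carrier R - q" and h: "mod_lin R L D h"
    "\<And>y. y \<in> carrier L \<Longrightarrow> \<theta> (h y) = s \<odot>\<^bsub>L\<^esub> y"
    using L D(1) P(1) \<theta>(1,2) mod_lin_id unfolding sproj_def by metis
  have sR: "s \<in> carrier R" using s by simp
  \<comment> \<open>The two components of the section satisfy
    \<open>\<sigma> y + x \<rho> y = s a y\<close> and \<open>\<pi> (\<rho> y) = s l y\<close>; so
    \<open>\<rho>\<close> is the first candidate, up to its values on \<open>K\<close>.\<close>
  define \<sigma> where "\<sigma> y = p (h y)" for y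
  define \<rho> where "\<rho> y = r (h y)" for y
  have \<sigma>: "mod_lin R L ?K \<sigma>" unfolding \<sigma>_def by (rule mod_lin_comp[OF h(1) D(2)])
  have \<rho>: "mod_lin R L F \<rho>" unfolding \<rho>_def by (rule mod_lin_comp[OF h(1) D(3)])
  have e1: "\<sigma> y \<oplus>\<^bsub>F\<^esub> x \<odot>\<^bsub>F\<^esub> \<rho> y = s \<odot>\<^bsub>F\<^esub> a y" and e2: "\<pi> (\<rho> y) = s \<odot>\<^bsub>M\<^esub> l y" if y: "y \<in> carrier L" for y
    using \<theta>(3,4)[OF mod_linD(1)[OF h(1) y]] h(2)[OF y] y sR
    by (simp_all add: \<sigma>_def \<rho>_def mod_linD(3)[OF P(2)] mod_linD(3)[OF P(3)])
  \<comment> \<open>\<open>K\<close> sits in the pullback as the pairs with second entry zero, that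
    is, as the kernel of \<open>l\<close>.\<close>
  obtain i where i: "mod_lin R ?K L i" "\<And>k. k \<in> carrier ?K \<Longrightarrow> a (i k) = k"
    "\<And>k. k \<in> carrier ?K \<Longrightarrow> l (i k) = \<zero>\<^bsub>M\<^esub>"
    using mult_pullback_factor[OF pb K mod_lin_incl[OF sK] mod_lin_zero_map[OF M]]
      M.smult_zero_right[OF xR] by (auto simp: ker_set_def)
  let ?Z = "lin_module R ?K ?K"
  have Z: "left_module R ?Z" by (rule left_module_lin_module[OF R K K])
  have "noeth R ?Z" by (rule noeth_lin_module[OF R K noeth_carrier[OF nK] nK])
  then obtain T where T: "finite T" "T \<subseteq> carrier ?Z" "gen R ?Z T = carrier ?Z"
    using noeth_carrier[of R ?Z] by (auto simp: fgen_def)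
  have Zlin: "mod_lin R ?K ?K f" if "f \<in> carrier ?Z" for f using that by (simp add: mod_hom_lin)
  \<comment> \<open>The endomorphisms of \<open>K\<close> that extend to \<open>L\<close>.\<close>
  let ?B = "(\<lambda>f. \<lambda>k\<in>carrier ?K. f (i k)) ` mod_hom R L ?K"
  have B: "submod R ?Z ?B"
  proof -
    have rl: "mod_lin R (lin_module R L ?K) ?Z (\<lambda>f. \<lambda>k\<in>carrier ?K. f (i k))"
    proof (rule mod_linI)
      fix f assume "f \<in> carrier (lin_module R L ?K)"
      then have f: "mod_lin R L ?K f" by (simp add: mod_hom_lin)
      from mod_hom_restrict[OF K mod_lin_comp[OF i(1) f]]
      show "(\<lambda>k\<in>carrier ?K. f (i k)) \<in> carrier ?Z" by simp
    qed (auto simp: mod_linD(1)[OF i(1)] intro!: restrict_ext)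
    show ?thesis
      using image_carrier_submod[OF left_module_lin_module[OF R P(1) K] Z rl] by simp
  qed
  define \<tau> where "\<tau> = (\<lambda>k\<in>carrier ?K. \<rho> (i k))"
  have rK: "\<rho> (i k) \<in> carrier ?K" if k: "k \<in> carrier ?K" for k
    using e2[OF mod_linD(1)[OF i(1) k]] i(3)[OF k] M.smult_zero_right[OF sR]
      mod_linD(1)[OF \<rho> mod_linD(1)[OF i(1) k]] by (simp add: ker_set_def)
  have "mod_lin R ?K ?K (\<lambda>k. \<rho> (i k))"
    using mod_lin_restrict_cod[OF mod_lin_comp[OF i(1) \<rho>], of "carrier ?K"] rK by auto
  then have \<tau>: "\<tau> \<in> carrier ?Z" unfolding \<tau>_def using mod_hom_restrict[OF K] by simp
  \<comment> \<open>On \<open>K\<close> the first equation reads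
    \<open>s k = \<sigma> (i k) + x \<tau> k\<close>. Applying \<open>\<nu>\<close> writes
    \<open>s \<nu>\<close> as an endomorphism that extends to \<open>L\<close> plus \<open>x\<close>
    times another, which is the hypothesis of Nakayama's lemma.\<close>
  have "\<exists>s\<in>carrier R - q. \<exists>b\<in>?B. \<exists>z'\<in>carrier ?Z. s \<odot>\<^bsub>?Z\<^esub> \<nu> = b \<oplus>\<^bsub>?Z\<^esub> x \<odot>\<^bsub>?Z\<^esub> z'"
    if \<nu>: "\<nu> \<in> carrier ?Z" for \<nu>
  proof -
    let ?f = "\<lambda>y\<in>carrier L. \<nu> (\<sigma> y)"
    have "?f \<in> mod_hom R L ?K" by (rule mod_hom_restrict[OF P(1) mod_lin_comp[OF \<sigma> Zlin[OF \<nu>]]])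
    then have fB: "(\<lambda>k\<in>carrier ?K. ?f (i k)) \<in> ?B" by (rule imageI)
    have \<nu>\<tau>: "(\<lambda>k\<in>carrier ?K. \<nu> (\<tau> k)) \<in> carrier ?Z"
      using mod_hom_restrict[OF K mod_lin_comp[OF Zlin[OF \<tau>] Zlin[OF \<nu>]]] by simp
    have "s \<odot>\<^bsub>?Z\<^esub> \<nu> = (\<lambda>k\<in>carrier ?K. ?f (i k)) \<oplus>\<^bsub>?Z\<^esub> x \<odot>\<^bsub>?Z\<^esub> (\<lambda>k\<in>carrier ?K. \<nu> (\<tau> k))"
    proof -
      have "s \<odot>\<^bsub>?K\<^esub> \<nu> k = ?f (i k) \<oplus>\<^bsub>?K\<^esub> x \<odot>\<^bsub>?K\<^esub> \<nu> (\<tau> k)" if k: "k \<in> carrier ?K" for k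
      proof -
        note ik = mod_linD(1)[OF i(1) k]
        have c: "\<sigma> (i k) \<in> carrier ?K" "\<tau> k \<in> carrier ?K"
          using mod_linD(1)[OF \<sigma> ik] mod_linD(1)[OF Zlin[OF \<tau>] k] by auto
        have "s \<odot>\<^bsub>?K\<^esub> \<nu> k = \<nu> (\<sigma> (i k) \<oplus>\<^bsub>?K\<^esub> x \<odot>\<^bsub>?K\<^esub> \<tau> k)"
          using mod_linD(3)[OF Zlin[OF \<nu>] sR k] e1[OF ik] i(2)[OF k] k by (simp add: \<tau>_def)
        also have "\<dots> = \<nu> (\<sigma> (i k)) \<oplus>\<^bsub>?K\<^esub> x \<odot>\<^bsub>?K\<^esub> \<nu> (\<tau> k)"
          using mod_linD(2)[OF Zlin[OF \<nu>] c(1), of "x \<odot>\<^bsub>?K\<^esub> \<tau> k"] mod_linD(3)[OF Zlin[OF \<nu>] xR c(2)]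
            left_module.smult_closed[OF K xR c(2)] by simp
        finally show ?thesis using ik by simp
      qed
      then show ?thesis by (intro ext) (simp add: restrict_def)
    qed
    then show ?thesis by (rule bexI[OF bexI[OF bexI[OF _ \<nu>\<tau>] fB] s])
  qed
  note hyp = this
  have "gen R ?Z (?B \<union> T) = carrier ?Z"
  proof -
    have "?B \<union> T \<subseteq> carrier ?Z" using T(2) B by (auto simp: submod_def)
    note G = gen_submod[OF Z this]
    have "gen R ?Z T \<subseteq> gen R ?Z (?B \<union> T)"
      using gen_incl[of "?B \<union> T" R ?Z] by (intro gen_least[OF G]) blast
    then show ?thesis using T(3) G by (auto simp: submod_def)
  qed
  from nakayama_prime[OF q Z x T(1) B T(2) this hyp \<tau>]
  have "\<exists>s\<in>carrier R - q. s \<odot>\<^bsub>?Z\<^esub> \<tau> \<in> ?B" .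
  then obtain s' \<omega> where s': "s' \<in> carrier R - q" and \<omega>h: "\<omega> \<in> mod_hom R L ?K"
    and \<omega>eq: "s' \<odot>\<^bsub>?Z\<^esub> \<tau> = (\<lambda>k\<in>carrier ?K. \<omega> (i k))" by blast
  have s'R: "s' \<in> carrier R" using s' by simp
  have \<omega>: "mod_lin R L F \<omega>" by (rule mod_lin_extend_cod[OF sK mod_hom_lin[OF \<omega>h]])
  have \<omega>i: "\<omega> (i k) = s' \<odot>\<^bsub>F\<^esub> \<rho> (i k)" if "k \<in> carrier ?K" for k
    using fun_cong[OF \<omega>eq, of k] that by (simp add: \<tau>_def)
  \<comment> \<open>On \<open>K\<close> both terms agree, so the difference descends along
    \<open>l\<close> to \<open>M\<close>. Since \<open>\<omega>\<close> has values in
    \<open>K\<close>, its image under \<open>\<pi>\<close> is still \<open>s' s\<close> times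
    \<open>l\<close>.\<close>
  let ?g = "\<lambda>y. s' \<odot>\<^bsub>F\<^esub> \<rho> y \<ominus>\<^bsub>F\<^esub> \<omega> y"
  have g: "mod_lin R L F ?g"
    by (rule mod_lin_diff_map[OF P(1) lF mod_lin_smult[OF R P(1) lF \<rho> s'R] \<omega>])
  have "?g y = \<zero>\<^bsub>F\<^esub>" if y: "y \<in> carrier L" "l y = \<zero>\<^bsub>M\<^esub>" for y
  proof -
    have k: "a y \<in> carrier ?K"
      using P(4)[OF y(1)] y M.smult_zero_right[OF xR] mod_linD(1)[OF P(2) y(1)] by (simp add: ker_set_def)
    have "i (a y) = y"
      by (rule P(6)[OF mod_linD(1)[OF i(1) k] y(1)]) (simp_all add: i(2,3)[OF k] y(2))
    then show ?thesis
      using \<omega>i[OF k] mod_linD(1)[OF \<rho> y(1)] s'R by (simp add: F.diff_zero_iff F.smult_closed)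
  qed
  moreover have "l ` carrier L = carrier M"
  proof (intro equalityI subsetI)
    fix m assume m: "m \<in> carrier M"
    then obtain f where f: "f \<in> carrier F" "\<pi> f = x \<odot>\<^bsub>M\<^esub> m"
      using surj_onE[OF surj M.smult_closed[OF xR m]] by metis
    show "m \<in> l ` carrier L" using P(5)[OF f(1) m f(2)] by blast
  qed (use mod_linD(1)[OF P(3)] in auto)
  ultimately obtain e where e: "mod_lin R M F e" "\<And>y. y \<in> carrier L \<Longrightarrow> e (l y) = ?g y"
    using factor_surj[OF P(1) M lF P(3) _ g] by blast
  have surl: "l ` carrier L = carrier M" by fact
  show ?thesis
  proof (rule sproj_of_section[OF F(1) M \<pi> e(1)])
    show "s' \<otimes>\<^bsub>R\<^esub> s \<in> carrier R - q" using I_prime s s' by blast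
    show "s' \<otimes>\<^bsub>R\<^esub> s \<in> carrier R" using sR s'R by simp
    fix m assume "m \<in> carrier M"
    then obtain y where y: "y \<in> carrier L" "l y = m" using surj_onE[OF surl] by metis
    have "\<omega> y \<in> carrier ?K" using mod_linD(1)[OF mod_hom_lin[OF \<omega>h] y(1)] .
    then have "\<omega> y \<in> carrier F" "\<pi> (\<omega> y) = \<zero>\<^bsub>M\<^esub>" by (simp_all add: ker_set_def)
    moreover have "m \<in> carrier M" by fact
    ultimately have "\<pi> (?g y) = s' \<odot>\<^bsub>M\<^esub> (s \<odot>\<^bsub>M\<^esub> m)"
      using mod_lin_diff[OF lF M \<pi>, of "s' \<odot>\<^bsub>F\<^esub> \<rho> y" "\<omega> y"] mod_linD(1)[OF \<rho> y(1)] s'R sR e2[OF y(1)] y(2)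
        M.minus_equality[of "\<zero>\<^bsub>M\<^esub>" "\<zero>\<^bsub>M\<^esub>"]
      by (simp add: F.smult_closed mod_linD(3)[OF \<pi>] M.minus_eq M.smult_closed)
    then show "\<pi> (e m) = (s' \<otimes>\<^bsub>R\<^esub> s) \<odot>\<^bsub>M\<^esub> m"
      using e(2)[OF y(1)] y s'R sR \<open>m \<in> carrier M\<close> by (simp add: M.smult_assoc)
  qed
qed

lemma prime_complement:
  assumes "primeideal q R"
  shows "carrier R - q \<subseteq> carrier R" "\<And>s t. \<lbrakk>s \<in> carrier R - q; t \<in> carrier R - q\<rbrakk> \<Longrightarrow> s \<otimes>\<^bsub>R\<^esub> t \<in> carrier R - q"
    "\<one>\<^bsub>R\<^esub> \<in> carrier R - q"
proof -
  interpret primeideal q R by fact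
  show "\<And>s t. \<lbrakk>s \<in> carrier R - q; t \<in> carrier R - q\<rbrakk> \<Longrightarrow> s \<otimes>\<^bsub>R\<^esub> t \<in> carrier R - q"
    using I_prime by blast
  show "\<one>\<^bsub>R\<^esub> \<in> carrier R - q" using I_notcarr one_imp_carrier by blast
qed auto

lemma pd_le_of_mult_pullback:
  fixes F M L :: "('a, 'm) module"
  assumes R: "cring R" and N: "noetherian_ring R" and large: "large_universe TYPE('m) R"
    and q: "primeideal q R" and x: "x \<in> q"
    and "projective_module TYPE('m) R F" "noeth R F" "left_module R M"
    and "mod_lin R F M \<pi>" "\<pi> ` carrier F = carrier M"
    and "mult_pullback R x F M \<pi> L a l"
    and "pd_le (carrier R - q) R n L"
  shows "pd_le (carrier R - q) R n M"
  using assms(6-12)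
proof (induction n arbitrary: F M L \<pi> a l)
  case 0
  then show ?case using sproj_of_mult_pullback[OF R large q x] by simp
next
  case (Suc n F M L \<pi> a l)
  note F = Suc.prems(1,2) and M = Suc.prems(3) and \<pi> = Suc.prems(4) and surj = Suc.prems(5)
    and pb = Suc.prems(6) and pdL = Suc.prems(7)
  interpret primeideal q R by fact
  note P = mult_pullbackD[OF pb] and S = prime_complement[OF q]
  have lF: "left_module R F" by (rule noeth_left_module[OF F(2)])
  have xR: "x \<in> carrier R" using x a_subset by auto
  interpret F: left_module R F by fact
  interpret M: left_module R M by fact
  interpret L: left_module R L by (rule P(1))
  let ?K = "ker_mod F M \<pi>"
  note sK = submod_ker[OF lF M \<pi>]
  have K: "left_module R ?K" by (rule submod_left_module[OF lF sK])
  have nK: "noeth R ?K" by (rule noeth_sub[OF F(2) sK])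
  interpret K: left_module R ?K by fact
  obtain G :: "('a, 'm) module" and k where G: "projective_module TYPE('m) R G" "noeth R G"
    "mod_lin R G ?K k" "k ` carrier G = carrier ?K"
    using ex_noeth_cover[OF R N large nK] by blast
  have lG: "left_module R G" by (rule noeth_left_module[OF G(2)])
  have inf: "infinite (UNIV :: 'm set)" using large by (simp add: large_universe_def)
  obtain D :: "('a, 'm) module" and p r j where D: "left_module R D" "mod_lin R D G p" "mod_lin R D F r"
    "\<And>y z. \<lbrakk>y \<in> carrier G; z \<in> carrier F\<rbrakk> \<Longrightarrow> j y z \<in> carrier D \<and> p (j y z) = y \<and> r (j y z) = z"
    "\<And>d. d \<in> carrier D \<Longrightarrow> j (p d) (r d) = d"
    using ex_direct_sum[OF lG lF inf subset_imp_lepoll[OF subset_UNIV] subset_imp_lepoll[OF subset_UNIV]]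
    by metis
  have pD: "projective_module TYPE('m) R D" by (rule projective_direct_sum[OF G(1) F(1) D])
  have nD: "noeth R D" by (rule noeth_direct_sum[OF G(2) F(2) D])
  have kF: "mod_lin R G F k" by (rule mod_lin_extend_cod[OF sK G(3)])
  have kim: "k ` carrier G = ker_set F M \<pi>" using G(4) by simp
  obtain \<theta> where \<theta>: "mod_lin R D L \<theta>" "\<theta> ` carrier D = carrier L"
    "\<And>d. d \<in> carrier D \<Longrightarrow> a (\<theta> d) = k (p d) \<oplus>\<^bsub>F\<^esub> x \<odot>\<^bsub>F\<^esub> r d"
    "\<And>d. d \<in> carrier D \<Longrightarrow> l (\<theta> d) = \<pi> (r d)"
    using mult_pullback_cover[OF R xR lF M \<pi> surj pb lG kF kim D(1-4)] by blast
  let ?L' = "ker_mod D L \<theta>"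
  note sL' = submod_ker[OF D(1) P(1) \<theta>(1)]
  have L': "left_module R ?L'" by (rule submod_left_module[OF D(1) sL'])
  \<comment> \<open>The cover of \<open>L\<close> implicit in the bound is unknown; it is exchanged
    for the explicit cover \<open>D\<close>, whose kernel can be computed.\<close>
  have pdL': "pd_le (carrier R - q) R n ?L'"
    by (rule pd_le_kernel[OF R N large S pdL pD nD \<theta>(1,2)])
  have a0: "a \<zero>\<^bsub>L\<^esub> = \<zero>\<^bsub>F\<^esub>" and l0: "l \<zero>\<^bsub>L\<^esub> = \<zero>\<^bsub>M\<^esub>"
    using mod_lin_zero[OF P(1) lF P(2)] mod_lin_zero[OF P(1) M P(3)] by auto
  have kc: "k y \<in> carrier F" "\<pi> (k y) = \<zero>\<^bsub>M\<^esub>" if "y \<in> carrier G" for y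
    using kim that by (auto simp: ker_set_def)
  have L'iff: "d \<in> carrier ?L' \<longleftrightarrow> d \<in> carrier D \<and> k (p d) \<oplus>\<^bsub>F\<^esub> x \<odot>\<^bsub>F\<^esub> r d = \<zero>\<^bsub>F\<^esub> \<and> \<pi> (r d) = \<zero>\<^bsub>M\<^esub>" for d
  proof
    assume "d \<in> carrier ?L'"
    then have "d \<in> carrier D" "\<theta> d = \<zero>\<^bsub>L\<^esub>" by (auto simp: ker_set_def)
    then show "d \<in> carrier D \<and> k (p d) \<oplus>\<^bsub>F\<^esub> x \<odot>\<^bsub>F\<^esub> r d = \<zero>\<^bsub>F\<^esub> \<and> \<pi> (r d) = \<zero>\<^bsub>M\<^esub>"
      using \<theta>(3,4) a0 l0 by metis
  next
    assume d: "d \<in> carrier D \<and> k (p d) \<oplus>\<^bsub>F\<^esub> x \<odot>\<^bsub>F\<^esub> r d = \<zero>\<^bsub>F\<^esub> \<and> \<pi> (r d) = \<zero>\<^bsub>M\<^esub>"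
    then have "\<theta> d = \<zero>\<^bsub>L\<^esub>"
      using P(6)[of "\<theta> d" "\<zero>\<^bsub>L\<^esub>"] mod_linD(1)[OF \<theta>(1)] \<theta>(3,4) a0 l0 by simp
    then show "d \<in> carrier ?L'" using d by (simp add: ker_set_def)
  qed
  \<comment> \<open>An element of the kernel satisfies \<open>k (p d) + x (r d) = 0\<close> with
    \<open>r d\<close> in \<open>K\<close>; hence the minus sign in the second projection.\<close>
  have "mult_pullback R x G ?K k ?L' p (\<lambda>d. \<ominus>\<^bsub>F\<^esub> r d)"
    unfolding mult_pullback_def
  proof (intro conjI ballI impI L')
    show "mod_lin R ?L' G p" by (rule mod_lin_restrict_dom[OF sL' D(2)])
    have "mod_lin R D F (\<lambda>d. \<zero>\<^bsub>F\<^esub> \<ominus>\<^bsub>F\<^esub> r d)"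
      by (rule mod_lin_diff_map[OF D(1) lF mod_lin_zero_map[OF lF] D(3)])
    then have m: "mod_lin R D F (\<lambda>d. \<ominus>\<^bsub>F\<^esub> r d)"
      by (rule mod_lin_cong[OF _ D(1)]) (simp add: F.minus_eq mod_linD(1)[OF D(3)])
    have neg: "\<pi> (\<ominus>\<^bsub>F\<^esub> y) = \<zero>\<^bsub>M\<^esub>" if "y \<in> carrier F" "\<pi> y = \<zero>\<^bsub>M\<^esub>" for y
      using mod_linD(3)[OF \<pi>, of "\<ominus>\<^bsub>R\<^esub> \<one>\<^bsub>R\<^esub>" y] that by (simp add: F.smult_minus_one M.smult_zero_right)
    have "(\<lambda>d. \<ominus>\<^bsub>F\<^esub> r d) ` carrier ?L' \<subseteq> ker_set F M \<pi>"
      using L'iff neg mod_linD(1)[OF D(3)] by (auto simp del: partial_object.simps) (simp add: ker_set_def)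
    then show "mod_lin R ?L' ?K (\<lambda>d. \<ominus>\<^bsub>F\<^esub> r d)"
      by (rule mod_lin_restrict_cod[OF mod_lin_restrict_dom[OF sL' m]])
  next
    fix d assume "d \<in> carrier ?L'"
    then have d: "d \<in> carrier D" "k (p d) \<oplus>\<^bsub>F\<^esub> x \<odot>\<^bsub>F\<^esub> r d = \<zero>\<^bsub>F\<^esub>" unfolding L'iff by auto
    have "k (p d) = \<ominus>\<^bsub>F\<^esub> (x \<odot>\<^bsub>F\<^esub> r d)"
      using F.minus_equality[OF d(2)] kc mod_linD(1)[OF D(2)] mod_linD(1)[OF D(3)] d(1) xR
      by (simp add: F.smult_closed)
    then show "k (p d) = x \<odot>\<^bsub>?K\<^esub> (\<ominus>\<^bsub>F\<^esub> r d)"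
      using F.smult_minus[OF xR mod_linD(1)[OF D(3) d(1)]] by simp
  next
    fix y m assume y: "y \<in> carrier G" and "m \<in> carrier ?K" and eq: "k y = x \<odot>\<^bsub>?K\<^esub> m"
    then have m: "m \<in> carrier F" "\<pi> m = \<zero>\<^bsub>M\<^esub>" by (auto simp: ker_set_def)
    note jj = D(4)[OF y F.a_inv_closed[OF m(1)]]
    have "\<pi> (\<ominus>\<^bsub>F\<^esub> m) = \<zero>\<^bsub>M\<^esub>"
      using mod_linD(3)[OF \<pi>, of "\<ominus>\<^bsub>R\<^esub> \<one>\<^bsub>R\<^esub>" m] m by (simp add: F.smult_minus_one M.smult_zero_right)
    then have "j y (\<ominus>\<^bsub>F\<^esub> m) \<in> carrier ?L'"
      unfolding L'iff using jj eq m xR by (simp add: F.smult_minus F.r_neg F.smult_closed)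
    then show "\<exists>d\<in>carrier ?L'. p d = y \<and> \<ominus>\<^bsub>F\<^esub> r d = m" using jj m by (intro bexI) auto
  next
    fix d d' assume "d \<in> carrier ?L'" "d' \<in> carrier ?L'" and eq: "p d = p d' \<and> \<ominus>\<^bsub>F\<^esub> r d = \<ominus>\<^bsub>F\<^esub> r d'"
    then have d: "d \<in> carrier D" "d' \<in> carrier D" unfolding L'iff by auto
    have "r d = r d'" using eq F.minus_minus[OF mod_linD(1)[OF D(3) d(1)]]
        F.minus_minus[OF mod_linD(1)[OF D(3) d(2)]] by metis
    then show "d = d'" using D(5)[OF d(1)] D(5)[OF d(2)] eq by metis
  qed
  from Suc.IH[OF G(1,2) K G(3,4) this pdL']
  show ?case unfolding pd_le.simps using M F(1) \<pi> surj by blast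
qed

section \<open>Passing to a smaller prime, and the end of a chain of primes\<close>

lemma ex_power_torsion:
  assumes R: "cring R" and M: "noeth R M" and x: "x \<in> carrier R"
  obtains n :: nat where "\<And>m k. \<lbrakk>m \<in> carrier M; (x [^]\<^bsub>R\<^esub> (k::nat)) \<odot>\<^bsub>M\<^esub> m = \<zero>\<^bsub>M\<^esub>\<rbrakk> \<Longrightarrow>
    (x [^]\<^bsub>R\<^esub> n) \<odot>\<^bsub>M\<^esub> m = \<zero>\<^bsub>M\<^esub>"
proof -
  interpret R: cring R by fact
  have lM: "left_module R M" by (rule noeth_left_module[OF M])
  interpret M: left_module R M by fact
  let ?t = "\<lambda>k::nat. ker_set M M (\<lambda>m. (x [^]\<^bsub>R\<^esub> k) \<odot>\<^bsub>M\<^esub> m)"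
  have sub: "submod R M (?t k)" for k
    by (rule submod_ker[OF lM lM mod_lin_smult[OF R lM lM mod_lin_id]]) (use x in simp)
  have mono: "?t k \<subseteq> ?t n" if "k \<le> n" for k n
  proof
    fix m assume "m \<in> ?t k"
    then have m: "m \<in> carrier M" "(x [^]\<^bsub>R\<^esub> k) \<odot>\<^bsub>M\<^esub> m = \<zero>\<^bsub>M\<^esub>" by (auto simp: ker_set_def)
    have "x [^]\<^bsub>R\<^esub> n = x [^]\<^bsub>R\<^esub> (n - k) \<otimes>\<^bsub>R\<^esub> x [^]\<^bsub>R\<^esub> k"
      using that x by (simp add: R.nat_pow_mult)
    then show "m \<in> ?t n" using m x by (simp add: ker_set_def M.smult_assoc M.smult_zero_right)
  qed
  \<comment> \<open>The annihilators of the powers of \<open>x\<close> increase, so their union is a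
    submodule. Its finitely many generators already lie in one of them.\<close>
  have U: "submod R M (\<Union>k. ?t k)"
    unfolding submod_def
  proof (intro conjI ballI)
    fix y z assume "y \<in> (\<Union>k. ?t k)" "z \<in> (\<Union>k. ?t k)"
    then obtain k n where "y \<in> ?t k" "z \<in> ?t n" by blast
    then have "y \<in> ?t (max k n)" "z \<in> ?t (max k n)" using mono[of k "max k n"] mono[of n "max k n"] by auto
    from submodD(3)[OF sub this] show "y \<oplus>\<^bsub>M\<^esub> z \<in> (\<Union>k. ?t k)" by blast
  next
    fix r y assume r: "r \<in> carrier R" and "y \<in> (\<Union>k. ?t k)"
    then obtain k where "y \<in> ?t k" by blast
    from submodD(4)[OF sub r this] show "r \<odot>\<^bsub>M\<^esub> y \<in> (\<Union>k. ?t k)" by blast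
  next
    show "\<zero>\<^bsub>M\<^esub> \<in> (\<Union>k. ?t k)" using submodD(2)[OF sub[of 0]] by blast
  qed (auto simp: ker_set_def)
  then obtain T where T: "finite T" "gen R M T = (\<Union>k. ?t k)" using M by (auto simp: noeth_def fgen_def)
  have "\<exists>n. T' \<subseteq> ?t n" if "finite T'" "T' \<subseteq> (\<Union>k. ?t k)" for T'
    using that
  proof (induction T')
    case (insert y T')
    then obtain k n where "y \<in> ?t k" "T' \<subseteq> ?t n" by blast
    then have "insert y T' \<subseteq> ?t (max k n)" using mono[of k "max k n"] mono[of n "max k n"] by auto
    then show ?case by blast
  qed blast
  then obtain n where "T \<subseteq> ?t n" using T gen_incl[of T R M] by metis
  then have "(\<Union>k. ?t k) \<subseteq> ?t n" using gen_least[OF sub] T(2) by metis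
  then show thesis using that[of n] by (auto simp: ker_set_def)
qed

lemma power_notin_prime:
  assumes "primeideal p R" "x \<in> carrier R" "x \<notin> p"
  shows "x [^]\<^bsub>R\<^esub> (n::nat) \<notin> p"
proof -
  interpret primeideal p R by fact
  show ?thesis
  proof (induction n)
    case 0
    show ?case using I_notcarr one_imp_carrier by auto
  next
    case (Suc n)
    then show ?case using I_prime[of "x [^]\<^bsub>R\<^esub> n" x] assms(2,3) by auto
  qed
qed

text \<open>With \<open>y\<close> a power of \<open>x\<close> that kills all \<open>x\<close>-power
  torsion, \<open>x\<close> is regular on \<open>M1 = y M\<close>, so the bound \<open>n + 1\<close>
  for \<open>M1 / x M1\<close> at \<open>q\<close> becomes \<open>n\<close> for \<open>M1\<close>.
  As \<open>y\<close> lies outside \<open>p\<close>, the modules \<open>M\<close> and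
  \<open>M1\<close> cannot be distinguished at \<open>p\<close>.\<close>

lemma pd_le_smaller_prime:
  fixes M :: "('a, 'm) module"
  assumes R: "cring R" and N: "noetherian_ring R" and large: "large_universe TYPE('m) R"
    and p: "primeideal p R" and q: "primeideal q R" and pq: "p \<subset> q"
    and G: "\<And>M :: ('a, 'm) module. noeth R M \<Longrightarrow> pd_le (carrier R - q) R (Suc n) M"
    and M: "noeth R M"
  shows "pd_le (carrier R - p) R n M"
proof -
  interpret q: primeideal q R by fact
  obtain x where x: "x \<in> q" "x \<notin> p" using pq by blast
  have xR: "x \<in> carrier R" using x q.a_subset by auto
  have lM: "left_module R M" by (rule noeth_left_module[OF M])
  interpret M: left_module R M by fact
  obtain N0 :: nat where N0: "\<And>m k. \<lbrakk>m \<in> carrier M; (x [^]\<^bsub>R\<^esub> (k::nat)) \<odot>\<^bsub>M\<^esub> m = \<zero>\<^bsub>M\<^esub>\<rbrakk> \<Longrightarrow>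
    (x [^]\<^bsub>R\<^esub> N0) \<odot>\<^bsub>M\<^esub> m = \<zero>\<^bsub>M\<^esub>" using ex_power_torsion[OF R M xR] by blast
  define y where "y = x [^]\<^bsub>R\<^esub> N0"
  have y: "y \<in> carrier R" "y \<in> carrier R - p"
    using xR power_notin_prime[OF p xR x(2)] by (simp_all add: y_def)
  have ml: "mod_lin R M M (\<lambda>m. y \<odot>\<^bsub>M\<^esub> m)" by (rule mod_lin_smult[OF R lM lM mod_lin_id y(1)])
  define M1 where "M1 = M\<lparr>carrier := (\<lambda>m. y \<odot>\<^bsub>M\<^esub> m) ` carrier M\<rparr>"
  note s1 = image_carrier_submod[OF lM lM ml]
  have M1: "left_module R M1" "noeth R M1"
    unfolding M1_def by (rule submod_left_module[OF lM s1], rule noeth_sub[OF M s1])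
  interpret M1: left_module R M1 by fact
  \<comment> \<open>If \<open>x\<close> kills \<open>y m'\<close>, then \<open>m'\<close> is killed
    by the next power of \<open>x\<close>, hence already by \<open>y\<close>.\<close>
  have reg: "m = \<zero>\<^bsub>M1\<^esub>" if m: "m \<in> carrier M1" "x \<odot>\<^bsub>M1\<^esub> m = \<zero>\<^bsub>M1\<^esub>" for m
  proof -
    obtain m' where m': "m' \<in> carrier M" "m = y \<odot>\<^bsub>M\<^esub> m'" using m(1) by (auto simp: M1_def)
    have "(x [^]\<^bsub>R\<^esub> Suc N0) \<odot>\<^bsub>M\<^esub> m' = x \<odot>\<^bsub>M\<^esub> m"
      using m' xR by (simp add: y_def q.m_comm flip: M.smult_assoc)
    also have "\<dots> = \<zero>\<^bsub>M\<^esub>" using m(2) by (simp add: M1_def)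
    finally show ?thesis using N0[OF m'(1), of "Suc N0"] m'(2) by (simp only: y_def) (simp add: M1_def)
  qed
  have xl: "mod_lin R M1 M1 (\<lambda>m. x \<odot>\<^bsub>M1\<^esub> m)" by (rule mod_lin_smult[OF R M1(1) M1(1) mod_lin_id xR])
  have inj: "inj_on (\<lambda>m. x \<odot>\<^bsub>M1\<^esub> m) (carrier M1)"
    unfolding mod_lin_inj_iff[OF M1(1) M1(1) xl] using reg by blast
  obtain F :: "('a, 'm) module" and \<pi> where F: "projective_module TYPE('m) R F" "noeth R F"
    "mod_lin R F M1 \<pi>" "\<pi> ` carrier F = carrier M1" using ex_noeth_cover[OF R N large M1(2)] by blast
  have lF: "left_module R F" by (rule noeth_left_module[OF F(2)])
  let ?H = "(\<lambda>m. x \<odot>\<^bsub>M1\<^esub> m) ` carrier M1"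
  note sH = image_carrier_submod[OF M1(1) M1(1) xl]
  obtain V :: "('a, 'm) module" and g where V: "left_module R V" "mod_lin R M1 V g"
    "g ` carrier M1 = carrier V" "\<And>m. m \<in> carrier M1 \<Longrightarrow> g m = \<zero>\<^bsub>V\<^esub> \<longleftrightarrow> m \<in> ?H"
    using ex_kernel_quotient[OF M1(1), of ?H] sH unfolding submod_def by metis
  have nV: "noeth R V" by (rule noeth_surj_image[OF M1(2) V(1-3)])
  let ?g = "\<lambda>f. g (\<pi> f)"
  have gl: "mod_lin R F V ?g" by (rule mod_lin_comp[OF F(3) V(2)])
  have gs: "?g ` carrier F = carrier V" using F(4) V(3) by (metis image_image)
  let ?L = "ker_mod F V ?g"
  note sL = submod_ker[OF lF V(1) gl]
  have L: "left_module R ?L" by (rule submod_left_module[OF lF sL])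
  \<comment> \<open>\<open>?L\<close> is the kernel of the map from \<open>F\<close> onto
    \<open>M1 / x M1\<close>, so it inherits the bound for that quotient lowered by one.\<close>
  have pdL: "pd_le (carrier R - q) R n ?L"
    by (rule pd_le_kernel[OF R N large prime_complement[OF q] G[OF nV] F(1,2) gl gs])
  have Lx: "\<exists>m\<in>carrier M1. \<pi> d = x \<odot>\<^bsub>M1\<^esub> m" if "d \<in> carrier ?L" for d
    using that V(4)[OF mod_linD(1)[OF F(3)]] by (auto simp: ker_set_def)
  then obtain l where l: "\<And>d. d \<in> carrier ?L \<Longrightarrow> l d \<in> carrier M1"
    "\<And>d. d \<in> carrier ?L \<Longrightarrow> \<pi> d = x \<odot>\<^bsub>M1\<^esub> l d" by metis
  have L_F: "d \<in> carrier F" if "d \<in> carrier ?L" for d using that by (simp add: ker_set_def)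
  interpret L: left_module R ?L by fact
  have ll: "mod_lin R ?L M1 l"
  proof (rule mod_linI)
    fix c d assume cd: "c \<in> carrier ?L" "d \<in> carrier ?L"
    have "x \<odot>\<^bsub>M1\<^esub> l (c \<oplus>\<^bsub>?L\<^esub> d) = x \<odot>\<^bsub>M1\<^esub> (l c \<oplus>\<^bsub>M1\<^esub> l d)"
      using l(2)[OF L.a_closed[OF cd]] cd L_F mod_linD(2)[OF F(3), of c d] l xR
      by (simp add: M1.smult_r_distr)
    then show "l (c \<oplus>\<^bsub>?L\<^esub> d) = l c \<oplus>\<^bsub>M1\<^esub> l d"
      by (rule inj_onD[OF inj]) (use l(1)[OF L.a_closed[OF cd]] l(1) cd in auto)
  next
    fix r d assume rd: "r \<in> carrier R" "d \<in> carrier ?L"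
    have "x \<odot>\<^bsub>M1\<^esub> l (r \<odot>\<^bsub>?L\<^esub> d) = x \<odot>\<^bsub>M1\<^esub> (r \<odot>\<^bsub>M1\<^esub> l d)"
      using l(2)[OF L.smult_closed[OF rd]] rd L_F mod_linD(3)[OF F(3), of r d] l xR
      by (simp add: q.m_comm flip: M1.smult_assoc)
    then show "l (r \<odot>\<^bsub>?L\<^esub> d) = r \<odot>\<^bsub>M1\<^esub> l d"
      by (rule inj_onD[OF inj]) (use l(1)[OF L.smult_closed[OF rd]] l(1) rd M1.smult_closed in auto)
  qed (rule l(1))
  have "mult_pullback R x F M1 \<pi> ?L (\<lambda>d. d) l"
    unfolding mult_pullback_def
  proof (intro conjI ballI impI L ll mod_lin_incl[OF sL])
    fix f m assume f: "f \<in> carrier F" and m: "m \<in> carrier M1" and eq: "\<pi> f = x \<odot>\<^bsub>M1\<^esub> m"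
    have fL: "f \<in> carrier ?L" using f m eq V(4)[OF mod_linD(1)[OF F(3) f]] by (simp add: ker_set_def)
    have "l f = m" by (rule inj_onD[OF inj]) (use l[OF fL] eq m in auto)
    then show "\<exists>d\<in>carrier ?L. d = f \<and> l d = m" using fL by blast
  qed (use l(2) in auto)
  from pd_le_of_mult_pullback[OF R N large q x(1) F(1,2) M1(1) F(3,4) this pdL]
  \<comment> \<open>Denominators outside \<open>q\<close> are also outside the smaller prime
    \<open>p\<close>.\<close>
  have "pd_le (carrier R - p) R n M1" by (rule pd_le_mono) (use pq in auto)
  moreover have "sret R (carrier R - p) M M1"
  proof (rule sretI[OF lM _ _ y(2)])
    show "mod_lin R M M1 (\<lambda>m. y \<odot>\<^bsub>M\<^esub> m)" unfolding M1_def by (rule mod_lin_restrict_cod[OF ml]) simp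
    show "mod_lin R M1 M (\<lambda>m. m)" unfolding M1_def by (rule mod_lin_incl[OF s1])
  qed simp
  ultimately show ?thesis by (intro pd_le_sret[OF R N large prime_complement(1,2)[OF p] M])
qed

text \<open>Take \<open>M\<close> to be a copy of the ideal \<open>y R\<close>, on which
  \<open>x\<close> is regular. A section of \<open>M \<rightarrow> M / x M\<close> up to
  \<open>s\<close> has values killed by \<open>x\<close>, hence is zero, so \<open>s\<close> kills
  the quotient. This is incompatible with \<open>y\<close> not in \<open>p\<close> and
  \<open>s\<close> not in \<open>q\<close>.\<close>

lemma not_all_sproj:
  assumes R: "cring R" and N: "noetherian_ring R" and large: "large_universe TYPE('m) R"
    and p: "primeideal p R" and q: "primeideal q R" and pq: "p \<subset> q"
    and G: "\<And>M :: ('a, 'm) module. noeth R M \<Longrightarrow> sproj TYPE('m) (carrier R - q) R M"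
  shows False
proof -
  interpret q: primeideal q R by fact
  interpret p: primeideal p R by fact
  obtain x where x: "x \<in> q" "x \<notin> p" using pq by blast
  have xR: "x \<in> carrier R" using x q.a_subset by auto
  let ?R = "ideal_module R (carrier R)"
  have lR: "left_module R ?R" by (rule left_module_regular[OF q.ring_axioms])
  have nR: "noeth R ?R" by (rule noeth_regular[OF R N])
  obtain n :: nat where n: "\<And>m k. \<lbrakk>m \<in> carrier ?R; (x [^]\<^bsub>R\<^esub> (k::nat)) \<odot>\<^bsub>?R\<^esub> m = \<zero>\<^bsub>?R\<^esub>\<rbrakk> \<Longrightarrow>
    (x [^]\<^bsub>R\<^esub> n) \<odot>\<^bsub>?R\<^esub> m = \<zero>\<^bsub>?R\<^esub>" using ex_power_torsion[OF R nR xR] by blast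
  define y where "y = x [^]\<^bsub>R\<^esub> n"
  have y: "y \<in> carrier R" "y \<notin> p" using xR power_notin_prime[OF p xR x(2)] by (simp_all add: y_def)
  have ml: "mod_lin R ?R ?R (\<lambda>m. y \<otimes>\<^bsub>R\<^esub> m)"
    using mod_lin_smult[OF R lR lR mod_lin_id y(1)] by simp
  let ?I = "(\<lambda>m. y \<otimes>\<^bsub>R\<^esub> m) ` carrier R"
  have s1: "submod R ?R ?I" using image_carrier_submod[OF lR lR ml] by simp
  let ?M0 = "?R\<lparr>carrier := ?I\<rparr>"
  have M0: "left_module R ?M0" "noeth R ?M0" by (rule submod_left_module[OF lR s1], rule noeth_sub[OF nR s1])
  have "lepoll (carrier ?M0) (UNIV :: 'm set)"
    using large lepoll_trans[OF subset_imp_lepoll[of "carrier ?M0" "carrier R"]] submodD(1)[OF s1]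
    by (auto simp: large_universe_def)
  then obtain M :: "('a, 'm) module" and i i' where M: "left_module R M" and iso: "lin_iso R ?M0 M i i'"
    using ex_transport[OF M0(1)] by blast
  note i = lin_isoD[OF iso]
  interpret M: left_module R M by fact
  have nM: "noeth R M"
    using noeth_surj_image[OF M0(2) M i(1)] lin_iso_bij[OF iso] by (simp add: bij_betw_def)
  have reg: "m = \<zero>\<^bsub>M\<^esub>" if m: "m \<in> carrier M" "x \<odot>\<^bsub>M\<^esub> m = \<zero>\<^bsub>M\<^esub>" for m
  proof -
    obtain r where r: "r \<in> carrier R" "i' m = y \<otimes>\<^bsub>R\<^esub> r" using i(6)[OF m(1)] by auto
    have z: "i' \<zero>\<^bsub>M\<^esub> = \<zero>\<^bsub>R\<^esub>" using mod_lin_zero[OF M M0(1) i(2)] by simp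
    have "x \<otimes>\<^bsub>R\<^esub> i' m = \<zero>\<^bsub>R\<^esub>" using mod_linD(3)[OF i(2) xR m(1)] m(2) z by simp
    then have "(x [^]\<^bsub>R\<^esub> Suc n) \<otimes>\<^bsub>R\<^esub> r = \<zero>\<^bsub>R\<^esub>" using r xR by (simp add: y_def q.m_ac)
    then have "i' m = \<zero>\<^bsub>R\<^esub>" using n[of r "Suc n"] r by (simp add: y_def)
    then show ?thesis using i(4)[OF m(1)] i(4)[of "\<zero>\<^bsub>M\<^esub>"] z by simp
  qed
  have xl: "mod_lin R M M (\<lambda>m. x \<odot>\<^bsub>M\<^esub> m)" by (rule mod_lin_smult[OF R M M mod_lin_id xR])
  let ?H = "(\<lambda>m. x \<odot>\<^bsub>M\<^esub> m) ` carrier M"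
  obtain V :: "('a, 'm) module" and g where V: "left_module R V" "mod_lin R M V g"
    "g ` carrier M = carrier V" "\<And>m. m \<in> carrier M \<Longrightarrow> g m = \<zero>\<^bsub>V\<^esub> \<longleftrightarrow> m \<in> ?H"
    using ex_kernel_quotient[OF M, of ?H] image_carrier_submod[OF M M xl] unfolding submod_def by metis
  interpret V: left_module R V by (rule V(1))
  have nV: "noeth R V" by (rule noeth_surj_image[OF nM V(1-3)])
  obtain s h where s: "s \<in> carrier R - q" and h: "mod_lin R V M h"
    "\<And>v. v \<in> carrier V \<Longrightarrow> g (h v) = s \<odot>\<^bsub>V\<^esub> v"
    using G[OF nV] M V(1-3) mod_lin_id unfolding sproj_def by metis
  have yI: "y \<in> carrier ?M0" using y by (auto intro!: image_eqI[of _ _ "\<one>\<^bsub>R\<^esub>"])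
  have iy: "i y \<in> carrier M" by (rule i(5)[OF yI])
  have gv: "g (i y) \<in> carrier V" by (rule mod_linD(1)[OF V(2) iy])
  have "x \<odot>\<^bsub>V\<^esub> g (i y) = \<zero>\<^bsub>V\<^esub>"
    using V(4)[OF M.smult_closed[OF xR iy]] mod_linD(3)[OF V(2) xR iy] iy by auto
  then have "x \<odot>\<^bsub>M\<^esub> h (g (i y)) = \<zero>\<^bsub>M\<^esub>"
    using mod_linD(3)[OF h(1) xR gv] mod_lin_zero[OF V(1) M h(1)] by simp
  then have "h (g (i y)) = \<zero>\<^bsub>M\<^esub>" using reg mod_linD(1)[OF h(1) gv] by blast
  then have "s \<odot>\<^bsub>V\<^esub> g (i y) = \<zero>\<^bsub>V\<^esub>" using h(2)[OF gv] mod_lin_zero[OF M V(1,2)] by simp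
  then have "s \<odot>\<^bsub>M\<^esub> i y \<in> ?H"
    using V(4)[OF M.smult_closed[OF _ iy], of s] mod_linD(3)[OF V(2) _ iy, of s] s by simp
  then obtain m where m: "m \<in> carrier M" "s \<odot>\<^bsub>M\<^esub> i y = x \<odot>\<^bsub>M\<^esub> m" by blast
  obtain r where r: "r \<in> carrier R" "i' m = y \<otimes>\<^bsub>R\<^esub> r" using i(6)[OF m(1)] by auto
  have "s \<otimes>\<^bsub>R\<^esub> y = x \<otimes>\<^bsub>R\<^esub> (y \<otimes>\<^bsub>R\<^esub> r)"
    using arg_cong[OF m(2), of i'] mod_linD(3)[OF i(2) _ iy, of s] mod_linD(3)[OF i(2) xR m(1)] s i(3)[OF yI] r
    by simp
  \<comment> \<open>From \<open>s y = x y r\<close> one gets \<open>y (s - x r) = 0\<close>, and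
    since \<open>y\<close> is not in the prime \<open>p\<close>, the other factor is; it then lies
    in \<open>q\<close>, and so does \<open>s\<close>.\<close>
  then have "y \<otimes>\<^bsub>R\<^esub> (s \<ominus>\<^bsub>R\<^esub> x \<otimes>\<^bsub>R\<^esub> r) = \<zero>\<^bsub>R\<^esub>"
    using s y r xR by (simp add: q.minus_eq q.r_distr q.r_minus q.m_ac) (simp add: q.r_neg)
  then have "y \<otimes>\<^bsub>R\<^esub> (s \<ominus>\<^bsub>R\<^esub> x \<otimes>\<^bsub>R\<^esub> r) \<in> p"
    using additive_subgroup.zero_closed[OF p.is_additive_subgroup] by simp
  then have "s \<ominus>\<^bsub>R\<^esub> x \<otimes>\<^bsub>R\<^esub> r \<in> p" using p.I_prime[of y "s \<ominus>\<^bsub>R\<^esub> x \<otimes>\<^bsub>R\<^esub> r"] y s r xR by auto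
  then have "s \<ominus>\<^bsub>R\<^esub> x \<otimes>\<^bsub>R\<^esub> r \<in> q" using pq by blast
  then have "(s \<ominus>\<^bsub>R\<^esub> x \<otimes>\<^bsub>R\<^esub> r) \<oplus>\<^bsub>R\<^esub> x \<otimes>\<^bsub>R\<^esub> r \<in> q"
    using additive_subgroup.a_closed[OF q.is_additive_subgroup] q.I_r_closed[OF x(1) r(1)] by blast
  moreover have "(s \<ominus>\<^bsub>R\<^esub> x \<otimes>\<^bsub>R\<^esub> r) \<oplus>\<^bsub>R\<^esub> x \<otimes>\<^bsub>R\<^esub> r = s"
    using s xR r by (simp add: q.minus_eq q.a_assoc q.l_neg)
  ultimately show False using s by simp
qed

text \<open>Each step down the chain lowers the bound by one, and a step down from bound 0 is
  impossible by \<open>not_all_sproj\<close>.\<close>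

lemma prime_chain_le:
  assumes R: "cring R" and N: "noetherian_ring R" and large: "large_universe TYPE('m) R"
    and "\<And>i. i \<le> n \<Longrightarrow> primeideal (P i) R" "\<And>i. i < n \<Longrightarrow> P i \<subset> P (Suc i)"
    and "\<And>M :: ('a, 'm) module. noeth R M \<Longrightarrow> pd_le (carrier R - P n) R k M"
  shows "n \<le> k"
  using assms(4-6)
proof (induction n arbitrary: k)
  case (Suc n)
  have pr: "primeideal (P n) R" "primeideal (P (Suc n)) R" "P n \<subset> P (Suc n)" using Suc by auto
  show ?case
  proof (cases k)
    case 0
    then show ?thesis using not_all_sproj[OF R N large pr] Suc(4) by auto
  next
    case (Suc j)
    then have "n \<le> j"
      using pd_le_smaller_prime[OF R N large pr] Suc.prems by (intro Suc.IH) auto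
    then show ?thesis using Suc by simp
  qed
qed simp

lemma krull_dim_finite:
  assumes R: "cring R" and N: "noetherian_ring R" and large: "large_universe TYPE('m) R"
    and "gldim TYPE('m) R < \<infinity>"
  shows "krull_dim R < \<infinity>"
proof -
  obtain k where k: "\<And>M :: ('a, 'm) module. left_module R M \<Longrightarrow> pd_le {\<one>\<^bsub>R\<^esub>} R k M"
    using assms(4) gldim_finite_iff by metis
  have le: "n \<le> k" if "\<And>i. i \<le> n \<Longrightarrow> primeideal (P i) R" "\<And>i. i < n \<Longrightarrow> P i \<subset> P (Suc i)"
    for n and P :: "nat \<Rightarrow> 'a set"
  proof (rule prime_chain_le[where n = n and P = P, OF R N large that])
    fix M :: "('a, 'm) module" assume "noeth R M"
    from k[OF noeth_left_module[OF this]] show "pd_le (carrier R - P n) R k M"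
      by (rule pd_le_mono) (use prime_complement(3)[OF that(1)[of n]] in auto)
  qed
  have "krull_dim R \<le> enat k"
    unfolding krull_dim_def
  proof (rule Sup_least)
    fix z assume "z \<in> {enat n |n. \<exists>P. (\<forall>i\<le>n. primeideal (P i) R) \<and> (\<forall>i<n. P i \<subset> P (Suc i))}"
    then obtain n P where "z = enat n" "\<forall>i\<le>n. primeideal (P i) R" "\<forall>i<n. P i \<subset> P (Suc i)" by blast
    with le[of n P] show "z \<le> enat k" by simp
  qed
  also have "enat k < \<infinity>" by simp
  finally show ?thesis .
qed

section \<open>Split quasi-hereditary algebras\<close>

text \<open>The dual basis lemma: a section of a finite free cover has functionals as
  coordinates.\<close>

lemma dual_sums_identity:
  fixes J :: "('a, 'b) module"
  assumes large: "large_universe TYPE('m) A" and proj: "projective_module TYPE('m) A J"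
    and fg: "fgen A J (carrier J)"
  shows "(\<lambda>x\<in>carrier J. x) \<in> dual_sums A J J"
proof -
  have J: "left_module A J" by (rule projective_imp_left_module[OF proj])
  obtain S where S: "finite S" "S \<subseteq> carrier J" "gen A J S = carrier J" using fg by (auto simp: fgen_def)
  obtain F :: "('a, 'm) module" and \<pi> where F: "projective_module TYPE('m) A F" "mod_lin A F J \<pi>"
    "S \<subseteq> \<pi> ` carrier F" "\<And>\<sigma>. mod_lin A J F \<sigma> \<Longrightarrow> (\<lambda>x\<in>carrier J. \<pi> (\<sigma> x)) \<in> dual_sums A J J"
    using ex_finite_free_cover[OF large J S(1,2) J] by blast
  have lF: "left_module A F" by (rule projective_imp_left_module[OF F(1)])
  obtain \<sigma> where \<sigma>: "mod_lin A J F \<sigma>" "\<And>x. x \<in> carrier J \<Longrightarrow> \<pi> (\<sigma> x) = x"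
    using projective_lift_same[OF proj lF J F(2) gen_subset_image[OF lF J F(2) S(3) F(3)] mod_lin_id] by blast
  show ?thesis using F(4)[OF \<sigma>(1)] \<sigma>(2) by (simp cong: restrict_cong)
qed

lemma split_heredity_ideal_gldim:
  fixes R :: "('r, 'x) ring_scheme" and A :: "('r, 'a) module"
  assumes R: "cring R" and N: "noetherian_ring R" and largeR: "large_universe TYPE('m) R"
    and large: "large_universe TYPE('m) A"
    and J: "split_heredity_ideal TYPE('m) R A J" and gl: "gldim TYPE('m) A < \<infinity>"
  shows "gldim TYPE('m) R < \<infinity>"
proof -
  interpret R: cring R by fact
  have alg: "assoc_algebra R A" and fg: "finitely_generated R A" and id: "ideal J A"
    and pJ: "projective_module TYPE('m) A (ideal_module A J)" and idem: "J \<cdot>\<^bsub>A\<^esub> J = J"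
    and mor: "morita_equivalent TYPE('m) R (End_op A (ideal_module A J)) (self_algebra R)"
    using J by (simp_all add: split_heredity_ideal_def fg_projective_algebra_def)
  interpret A: assoc_algebra R A by fact
  interpret J: ideal J A by fact
  let ?J = "ideal_module A J" and ?E = "End_op A (ideal_module A J)" and ?C = "self_algebra R"
  have lA: "left_module R A" using fg by (simp add: finitely_generated_def)
  interpret lA: left_module R A by fact
  have lJ: "left_module A ?J" by (rule projective_imp_left_module[OF pJ])
  have ringA: "ring A" by (rule A.ring_axioms)
  have oneA: "\<one>\<^bsub>A\<^esub> \<in> carrier A" by (rule ring.ring_simprules(6)[OF ringA])
  \<comment> \<open>The scalar \<open>r\<close> acts on \<open>J\<close> as the element
    \<open>r 1\<close> of \<open>A\<close>. Thus \<open>A\<close>-submodules of \<open>J\<close> are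
    \<open>R\<close>-submodules of \<open>A\<close>, and finite generation of \<open>J\<close> over
    \<open>A\<close> follows from finiteness of \<open>A\<close> over the Noetherian ring
    \<open>R\<close>.\<close>
  have sub: "submod R A H" if H: "submod A ?J H" for H
  proof -
    have HJ: "H \<subseteq> J" using H by (auto simp: submod_def)
    have "r \<odot>\<^bsub>A\<^esub> h \<in> H" if "r \<in> carrier R" "h \<in> H" for r h
    proof -
      have c: "h \<in> carrier A" using HJ that(2) J.a_subset by auto
      have "r \<odot>\<^bsub>A\<^esub> h = (r \<odot>\<^bsub>A\<^esub> \<one>\<^bsub>A\<^esub>) \<otimes>\<^bsub>A\<^esub> h"
        using A.smult_mult_left[OF that(1) oneA c] c by simp
      then show ?thesis
        using submodD(4)[OF H, of "r \<odot>\<^bsub>A\<^esub> \<one>\<^bsub>A\<^esub>" h] lA.smult_closed[OF that(1) oneA] that by simp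
    qed
    then show ?thesis using H HJ J.a_subset by (auto simp: submod_def)
  qed
  have nA: "noeth R A"
  proof -
    obtain S where S: "finite S" "S \<subseteq> carrier A" "gen R A S = carrier A"
      using finitely_generated_fgen[OF fg] by (auto simp: fgen_def)
    obtain F :: "('r, 'm) module" and \<pi> where F: "projective_module TYPE('m) R F" "mod_lin R F A \<pi>"
      "S \<subseteq> \<pi> ` carrier F" "noeth R F"
      using ex_finite_free_cover[OF largeR lA S(1,2) lA] noeth_regular[OF R N] by blast
    show ?thesis
      by (rule noeth_surj_image[OF F(4) lA F(2) gen_subset_image[OF noeth_left_module[OF F(4)] lA F(2) S(3) F(3)]])
  qed
  have "submod A ?J J" using submod_carrier[OF lJ] by simp
  then have "fgen R A J" using nA sub by (simp add: noeth_def)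
  then obtain S where S: "finite S" "S \<subseteq> carrier A" "gen R A S = J" by (auto simp: fgen_def)
  have SJ: "S \<subseteq> J" using S(3) gen_incl[of S R A] by simp
  have G: "submod A ?J (gen A ?J S)" using gen_submod[OF lJ] SJ by simp
  have "gen R A S \<subseteq> gen A ?J S" by (rule gen_least[OF sub[OF G] gen_incl])
  then have "gen A ?J S = J" using G S(3) by (auto simp: submod_def)
  then have fgJ: "fgen A ?J J" using S(1) SJ by (auto simp: fgen_def)
  have inf: "infinite (UNIV :: 'm set)" and lepR: "lepoll (carrier R) (UNIV :: 'm set)"
    using largeR by (auto simp: large_universe_def)
  have glE: "gldim TYPE('m) ?E < \<infinity>"
  \<comment> \<open>If the endomorphism structure were not a ring, it would have no left modules and
    the bound would hold vacuously; this replaces a verification of the ring axioms.\<close>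
  proof (cases "ring ?E")
    case True
    have dual: "(\<lambda>x\<in>J. x) \<in> dual_sums A ?J ?J" using dual_sums_identity[OF large pJ] fgJ by simp
    interpret heredity A J ?E
      by (rule heredity.intro[OF ringA id idem refl True dual])
    show ?thesis by (rule gldim_finite_End[OF inf fgJ pJ gl])
  next
    case False
    then have "\<not> left_module ?E M" for M :: "('a \<Rightarrow> 'a, 'm) module" by (simp add: left_module_def)
    then show ?thesis using gldim_finite_iff by blast
  qed
  \<comment> \<open>The Morita equivalence speaks of the regular algebra, a different record from
    \<open>R\<close>; the identity map, as a ring isomorphism, carries the bound over.\<close>
  have idC: "(\<lambda>x. x) \<in> ring_hom ?C R" by (rule ring_hom_memI) simp_all
  have "cring ?C"
    by (rule cringI) (use R.abelian_group_axioms R.comm_monoid_axioms R.l_distr in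
      \<open>auto intro!: abelian_groupI comm_monoidI simp: R.a_ac R.m_ac R.l_neg intro: R.l_neg\<close>)
  then have ringC: "ring ?C" by (rule cring.axioms(1))
  have "gldim TYPE('m) ?C < \<infinity>"
    by (rule gldim_finite_morita[OF mor ringC _ glE]) (simp add: lepR)
  moreover have "large_universe TYPE('m) ?C" using largeR by (simp add: large_universe_def)
  moreover have "ring_loc ?C R (\<lambda>x. x) {\<one>\<^bsub>?C\<^esub>}"
    by (rule ring_loc_iso[OF ringC R.ring_axioms idC]) (simp add: bij_betw_def)
  ultimately show ?thesis by (metis ring_loc.gldim_finite_loc)
qed

text \<open>The last member of the chain is a heredity ideal of the quotient by zero, whose elements
  are singletons. This isomorphism connects that quotient with \<open>A\<close> itself.\<close>

lemma quotient_algebra_zero_hom: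
  assumes "ring A"
  shows "(\<lambda>x. {\<zero>\<^bsub>A\<^esub>} +>\<^bsub>A\<^esub> x) \<in> ring_hom A (quotient_algebra A {\<zero>\<^bsub>A\<^esub>})"
    and "bij_betw (\<lambda>x. {\<zero>\<^bsub>A\<^esub>} +>\<^bsub>A\<^esub> x) (carrier A) (carrier (quotient_algebra A {\<zero>\<^bsub>A\<^esub>}))"
proof -
  interpret ring A by fact
  interpret Z: ideal "{\<zero>\<^bsub>A\<^esub>}" A by (rule zeroideal)
  have "(+>\<^bsub>A\<^esub>) {\<zero>\<^bsub>A\<^esub>} \<in> ring_hom A (A Quot {\<zero>\<^bsub>A\<^esub>})" by (rule Z.rcos_ring_hom)
  then show "(\<lambda>x. {\<zero>\<^bsub>A\<^esub>} +>\<^bsub>A\<^esub> x) \<in> ring_hom A (quotient_algebra A {\<zero>\<^bsub>A\<^esub>})"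
    by (simp add: ring_hom_def quotient_algebra_def)
  have coset: "{\<zero>\<^bsub>A\<^esub>} +>\<^bsub>A\<^esub> x = {x}" if "x \<in> carrier A" for x
    using that by (simp add: a_r_coset_def')
  show "bij_betw (\<lambda>x. {\<zero>\<^bsub>A\<^esub>} +>\<^bsub>A\<^esub> x) (carrier A) (carrier (quotient_algebra A {\<zero>\<^bsub>A\<^esub>}))"
    by (auto simp: bij_betw_def inj_on_def coset quotient_algebra_def FactRing_def A_RCOSETS_def')
qed

theorem proposition3p5p5:
  fixes R :: "('r, 'x) ring_scheme" and A :: "('r, 'a) module"
    and J :: "nat \<Rightarrow> 'a set" and t :: nat
  assumes "cring R" and "noetherian_ring R"
    and "large_universe TYPE('m) R" and "large_universe TYPE('m) A"
    and "split_heredity_chain TYPE('m) R A t J"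
    and "gldim TYPE('m) A < \<infinity>"
  shows "gldim TYPE('m) R < \<infinity> \<and> regular_ring TYPE('m) R \<and> krull_dim R < \<infinity>"
proof -
  let ?B = "quotient_algebra A {\<zero>\<^bsub>A\<^esub>}" and ?f = "\<lambda>x. {\<zero>\<^bsub>A\<^esub>} +>\<^bsub>A\<^esub> x"
  have alg: "assoc_algebra R A" and t: "1 \<le> t" and Jt: "J (t + 1) = {\<zero>\<^bsub>A\<^esub>}"
    and hered: "\<forall>i\<in>{1..t}. split_heredity_ideal TYPE('m) R (quotient_algebra A (J (i + 1)))
        ((\<lambda>x. J (i + 1) +>\<^bsub>A\<^esub> x) ` J i)"
    using assms(5) by (simp_all add: split_heredity_chain_def fg_projective_algebra_def)
  \<comment> \<open>The instance \<open>i = t\<close>, available because \<open>t\<close> is at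
    least 1; there \<open>J (i + 1)\<close> is zero.\<close>
  have J: "split_heredity_ideal TYPE('m) R ?B (?f ` J t)"
    using bspec[OF hered, of t] t Jt by simp
  have ringA: "ring A" using alg by (simp add: assoc_algebra_def)
  have ringB: "ring ?B"
    using J by (simp add: split_heredity_ideal_def fg_projective_algebra_def assoc_algebra_def)
  note f = quotient_algebra_zero_hom[OF ringA]
  have "lepoll (?f ` carrier A) (carrier A)" by (rule image_lepoll)
  moreover have "?f ` carrier A = carrier ?B" using f(2) by (simp only: bij_betw_def)
  ultimately have "lepoll (carrier ?B) (UNIV :: 'm set)"
    using assms(4) unfolding large_universe_def by (metis lepoll_trans)
  then have largeB: "large_universe TYPE('m) ?B" using assms(4) by (simp add: large_universe_def)
  have "gldim TYPE('m) ?B < \<infinity>"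
    by (rule ring_loc.gldim_finite_loc[OF ring_loc_iso[OF ringA ringB f] assms(4,6)])
  then have "gldim TYPE('m) R < \<infinity>"
    by (rule split_heredity_ideal_gldim[OF assms(1-3) largeB J])
  then show ?thesis
    using regular_ring_of_gldim[OF assms(1-3)] krull_dim_finite[OF assms(1-3)] by blast
qed

end
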